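(* Let $1\le p<\infty$ and let $\mathcal Z$ be a sequence of distinct points in $\mathbb D$. Then $\mathcal Z$ is an interpolating sequence for $A^p$ if and only if $\mathcal Z$ is separated in the pseudo-hyperbolic metric and there is a constant $C$ such that for every $f\in L^p_{\mathcal Z}$ there is a solution $u\in L^p_{\mathcal Z}$ of $(1-|z|^2)\,\frac{\partial u}{\partial\bar z}=f$ (in the sense of distributions on $\mathbb D$) satisfying $\|u\|_{p,\mathcal Z}\le C\|f\|_{p,\mathcal Z}$.
   Context: $\mathbb D$ is the open unit disk, $dA$ is Lebesgue area measure. For $0<p<\infty$, $A^p$ is the space of analytic $f$ on $\mathbb D$ with $\|f\|_p^p=\int_{\mathbb D}|f|^p\,dA<\infty$. The pseudo-hyperbolic metric is $\psi(z,w)=\left|\frac{z-w}{1-\bar wz}\right|$; $\mathcal Z$ is separated if $\inf\{\psi(a,b):a\ne b\in\mathcal Z\}>0$. For a sequence $\mathcal Z$ in $\mathbb D$, $\ell^p(\mathcal Z)$ is the space of sequences $(c_a)_{a\in\mathcal Z}$ with $\|c\|_{p,\mathcal Z}^p=\sum_{a\in\mathcal Z}|c_a|^p(1-|a|^2)^2<\infty$; $\mathcal Z$ is an interpolating sequence for $A^p$ if the map $f\mapsto(f(a))_{a\in\mathcal Z}$ maps $A^p$ into and onto $\ell^p(\mathcal Z)$. When $\sum_{a\in\mathcal Z}(1-|a|^2)^2<\infty$ (which holds in all cases considered), $k_{\mathcal Z}(z)=\frac{|z|^2}{2}\sum_{a\in\mathcal Z}\frac{(1-|a|^2)^2}{|1-\bar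 az|^2}$, $L^p_{\mathcal Z}$ is the space of measurable $f$ on $\mathbb D$ with $\|f\|_{p,\mathcal Z}^p=\int_{\mathbb D}|f e^{k_{\mathcal Z}}|^p\,dA<\infty$. Here $\frac{\partial}{\partial\bar z}=\frac12\left(\frac{\partial}{\partial x}+i\frac{\partial}{\partial y}\right)$. *)

theory Defs
  imports "HOL-Analysis.Analysis"
begin

abbreviation unit_disk :: "complex set" where
  "unit_disk \<equiv> ball 0 1"

definition pseudo_hyp :: "complex \<Rightarrow> complex \<Rightarrow> real" where
  "pseudo_hyp z w = cmod ((z - w) / (1 - cnj w * z))"

definition separated :: "complex set \<Rightarrow> bool" where
  "separated Z \<longleftrightarrow> (\<exists>\<delta>>0. \<forall>a\<in>Z. \<forall>b\<in>Z. a \<noteq> b \<longrightarrow> \<delta> \<le> pseudo_hyp a b)"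

definition bergman :: "real \<Rightarrow> (complex \<Rightarrow> complex) set" where
  "bergman p = {f. f holomorphic_on unit_disk \<and>
      (\<integral>\<^sup>+ z\<in>unit_disk. ennreal (cmod (f z) powr p) \<partial>lebesgue) < \<infinity>}"

definition lpZ :: "real \<Rightarrow> complex set \<Rightarrow> (complex \<Rightarrow> complex) set" where
  "lpZ p Z = {c. (\<lambda>a. cmod (c a) powr p * (1 - (cmod a)\<^sup>2)\<^sup>2) summable_on Z}"

definition interpolating :: "real \<Rightarrow> complex set \<Rightarrow> bool" where
  "interpolating p Z \<longleftrightarrow>
     (\<forall>f\<in>bergman p. f \<in> lpZ p Z) \<and>
     (\<forall>c\<in>lpZ p Z. \<exists>f\<in>bergman p. \<forall>a\<in>Z. f a = c a)"

definition kZ :: "complex set \<Rightarrow> complex \<Rightarrow> real" where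
  "kZ Z z = (cmod z)\<^sup>2 / 2 *
      (\<Sum>\<^sub>\<infinity>a\<in>Z. (1 - (cmod a)\<^sup>2)\<^sup>2 / (cmod (1 - cnj a * z))\<^sup>2)"

definition LpZ_int :: "real \<Rightarrow> complex set \<Rightarrow> (complex \<Rightarrow> complex) \<Rightarrow> ennreal" where
  "LpZ_int p Z f = (\<integral>\<^sup>+ z\<in>unit_disk. ennreal ((cmod (f z) * exp (kZ Z z)) powr p) \<partial>lebesgue)"

definition LpZ :: "real \<Rightarrow> complex set \<Rightarrow> (complex \<Rightarrow> complex) set" where
  "LpZ p Z = {f. set_borel_measurable lebesgue unit_disk f \<and> LpZ_int p Z f < \<infinity>}"

definition LpZ_norm :: "real \<Rightarrow> complex set \<Rightarrow> (complex \<Rightarrow> complex) \<Rightarrow> real" where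
  "LpZ_norm p Z f = enn2real (LpZ_int p Z f) powr (1 / p)"

definition dbar :: "(complex \<Rightarrow> complex) \<Rightarrow> complex \<Rightarrow> complex" where
  "dbar \<phi> z = (frechet_derivative \<phi> (at z) 1 + \<i> * frechet_derivative \<phi> (at z) \<i>) / 2"

coinductive smooth_fun :: "(complex \<Rightarrow> complex) \<Rightarrow> bool" where
  "(\<forall>z. \<phi> differentiable (at z)) \<Longrightarrow>
   smooth_fun (\<lambda>z. frechet_derivative \<phi> (at z) 1) \<Longrightarrow>
   smooth_fun (\<lambda>z. frechet_derivative \<phi> (at z) \<i>) \<Longrightarrow> smooth_fun \<phi>"

definition test_fun :: "(complex \<Rightarrow> complex) \<Rightarrow> bool" where
  "test_fun \<phi> \<longleftrightarrow> smooth_fun \<phi> \<and> compact (closure {z. \<phi> z \<noteq> 0})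
      \<and> closure {z. \<phi> z \<noteq> 0} \<subseteq> unit_disk"

text \<open>(1-|z|^2) du/dzbar = f in the sense of distributions on the disk:
  for every test function phi, <(1-|z|^2) dbar u, phi> = <dbar u, (1-|z|^2) phi>
  = - int u dbar((1-|z|^2) phi) = int f phi.\<close>
definition dbar_weighted_solves :: "(complex \<Rightarrow> complex) \<Rightarrow> (complex \<Rightarrow> complex) \<Rightarrow> bool" where
  "dbar_weighted_solves u f \<longleftrightarrow>
     (\<forall>\<phi>. test_fun \<phi> \<longrightarrow>
        - (\<integral>z\<in>unit_disk. u z * dbar (\<lambda>w. complex_of_real (1 - (cmod w)\<^sup>2) * \<phi> w) z \<partial>lebesgue)
        = (\<integral>z\<in>unit_disk. f z * \<phi> z \<partial>lebesgue))"

end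

theory Submission
  imports Defs "HOL-Complex_Analysis.Complex_Analysis"
begin

text \<open>
  The bridge between the two sides is a holomorphic function \<open>\<Psi>\<close> with simple zeros exactly at \<open>Z\<close> and with
  \<open>\<bar>\<Psi>\<bar>\<close> comparable to \<open>\<psi>(z, Z) exp (k z)\<close>.

  If the weighted equation is solvable, interpolate \<open>c\<close> first by a smooth function \<open>G\<close>, constant near each
  point of \<open>Z\<close>, and solve with right-hand side \<open>(1 - \<bar>z\<bar>\<^sup>2) dbar G / \<Psi>\<close>: the function \<open>G - u \<Psi>\<close> is
  holomorphic by Weyl's lemma and takes the values \<open>c\<close> on \<open>Z\<close>.

  Conversely, an interpolating sequence interpolates with a uniform bound, which forces separation. A kernel
  bounded by Schur's test gives \<open>v\<close> with \<open>(1 - \<bar>z\<bar>\<^sup>2) dbar v = \<Psi> f\<close>, and the values of \<open>v\<close> on \<open>Z\<close> make sense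
  because \<open>\<Psi> f\<close> is small near \<open>Z\<close>. Subtracting from \<open>v\<close> a function \<open>h\<close> in \<open>A\<^sup>p\<close> with these values,
  \<open>u = (v - h) / \<Psi>\<close> solves the equation with the required bound.
\<close>

text \<open>The exponential factors in \<Psi> answer a divergence. For a separated sequence the sum
  of \<open>1 - \<psi>(z,a)^2\<close> over \<open>Z\<close> may diverge, which rules out a Blaschke
  product; only the sum of the squares is bounded, uniformly in z, by comparison with an area
  integral. The factor exp((1 - \<psi>^2)/2) cancels the first-order term of log \<psi>, and the
  weight \<open>kZ\<close> collects what makes the exponents harmonic.

  The other obstacle is that f is merely an L^p function, so the potential v has no pointwise
  regularity although h must match it on \<open>Z\<close>. All pointwise control comes from a
  positive potential t, finite almost everywhere: for z near a with finite potential, v(a) is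
  O(t(z)) and v(z) - v(a) is O(\<psi>(z,a) t(z)). This puts the values of v in l^p, bounds (v -
  h)/\<Psi>, and shows that the points of \<open>Z\<close> carry no point masses: the error of
  cutting out shrinking discs tends to 0.

  In the other direction u is again only an L^p function, so the values of the holomorphic function
  on \<open>Z\<close> are read off from averages against mollifiers.\<close>

section \<open>Partial derivatives in the plane and the operator \<open>dbar\<close>\<close>

definition partials :: "(complex \<Rightarrow> complex) \<Rightarrow> complex \<Rightarrow> complex \<Rightarrow> complex \<Rightarrow> bool" where
  "partials f f1 f2 z \<longleftrightarrow>
     (f has_derivative (\<lambda>h. of_real (Re h) * f1 + of_real (Im h) * f2)) (at z)"

lemma partials_frechet:
  assumes "partials f f1 f2 z"
  shows "f differentiable (at z)" "frechet_derivative f (at z) 1 = f1"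
    "frechet_derivative f (at z) \<i> = f2"
proof -
  have d: "(f has_derivative (\<lambda>h. of_real (Re h) * f1 + of_real (Im h) * f2)) (at z)"
    using assms by (simp add: partials_def)
  show "f differentiable (at z)" by (rule differentiableI[OF d])
  have e: "frechet_derivative f (at z) = (\<lambda>h. of_real (Re h) * f1 + of_real (Im h) * f2)"
    by (rule frechet_derivative_at[OF d, symmetric])
  show "frechet_derivative f (at z) 1 = f1" "frechet_derivative f (at z) \<i> = f2"
    unfolding e by auto
qed

text \<open>Real-linear maps of the plane are determined by their values at 1 and
  \<open>\<i>\<close>, which are the two values that \<open>smooth_fun\<close> and
  \<open>dbar\<close> read off.\<close>

lemma differentiable_partials:
  assumes "f differentiable (at z)"
  shows "partials f (frechet_derivative f (at z) 1) (frechet_derivative f (at z) \<i>) z"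
proof -
  let ?D = "frechet_derivative f (at z)"
  have d: "(f has_derivative ?D) (at z)" using assms frechet_derivative_works by blast
  then have l: "linear ?D" by (rule has_derivative_linear)
  have "?D = (\<lambda>h. of_real (Re h) * ?D 1 + of_real (Im h) * ?D \<i>)"
  proof (rule ext)
    fix h
    have e: "Re h *\<^sub>R 1 + Im h *\<^sub>R \<i> = h" by (simp add: complex_eq_iff)
    have "?D (Re h *\<^sub>R 1 + Im h *\<^sub>R \<i>) = Re h *\<^sub>R ?D 1 + Im h *\<^sub>R ?D \<i>"
      by (simp only: linear_add[OF l] linear_scale[OF l])
    then show "?D h = of_real (Re h) * ?D 1 + of_real (Im h) * ?D \<i>"
      unfolding e by (simp only: scaleR_conv_of_real)
  qed
  then show ?thesis unfolding partials_def by (rule has_derivative_eq_rhs[OF d])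
qed

lemma dbar_partials: "partials f f1 f2 z \<Longrightarrow> dbar f z = (f1 + \<i> * f2) / 2"
  by (simp add: dbar_def partials_frechet)

lemma partials_const: "partials (\<lambda>_. c) 0 0 z"
  by (simp add: partials_def)

lemma partials_add:
  "partials f f1 f2 z \<Longrightarrow> partials g g1 g2 z \<Longrightarrow> partials (\<lambda>z. f z + g z) (f1 + g1) (f2 + g2) z"
  unfolding partials_def
  by (drule (1) has_derivative_add, erule has_derivative_eq_rhs, intro ext) (simp add: ring_distribs)

lemma partials_mult:
  "partials f f1 f2 z \<Longrightarrow> partials g g1 g2 z \<Longrightarrow>
   partials (\<lambda>z. f z * g z) (f1 * g z + f z * g1) (f2 * g z + f z * g2) z"
  unfolding partials_def
  by (drule (1) has_derivative_mult, erule has_derivative_eq_rhs, intro ext) (simp add: ring_distribs mult_ac)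

lemma partials_inverse:
  assumes "partials f f1 f2 z" "f z \<noteq> 0"
  shows "partials (\<lambda>z. inverse (f z)) (- f1 * inverse (f z) * inverse (f z))
     (- f2 * inverse (f z) * inverse (f z)) z"
  unfolding partials_def
proof (rule has_derivative_eq_rhs)
  show "((\<lambda>z. inverse (f z)) has_derivative (\<lambda>h. - (inverse (f z) *
     (of_real (Re h) * f1 + of_real (Im h) * f2) * inverse (f z)))) (at z)"
    using Deriv.has_derivative_inverse[OF assms(2) assms(1)[unfolded partials_def]] .
  have "- (i * (a * f1 + b * f2) * i) = a * (- f1 * i * i) + b * (- f2 * i * i)"
    for a b i :: complex
    by (simp add: algebra_simps)
  then show "(\<lambda>h. - (inverse (f z) *
     (of_real (Re h) * f1 + of_real (Im h) * f2) * inverse (f z))) =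
     (\<lambda>h. of_real (Re h) * (- f1 * inverse (f z) * inverse (f z)) +
       of_real (Im h) * (- f2 * inverse (f z) * inverse (f z)))"
    by (intro ext)
qed

lemma partials_holomorphic:
  assumes "(f has_field_derivative d) (at z)"
  shows "partials f d (\<i> * d) z"
  unfolding partials_def
proof (rule has_derivative_eq_rhs)
  show "(f has_derivative (*) d) (at z)" using assms by (simp only: has_field_derivative_def)
  show "(*) d = (\<lambda>h. of_real (Re h) * d + of_real (Im h) * (\<i> * d))"
    by (intro ext complex_eqI) (simp_all add: mult.commute)
qed

lemma partials_real_compose:
  assumes "(Q has_derivative (\<lambda>h. Re h * q1 + Im h * q2)) (at z)"
    and "(g has_field_derivative g') (at (Q z))"
  shows "partials (\<lambda>z. of_real (g (Q z))) (of_real (g' * q1)) (of_real (g' * q2)) z"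
  unfolding partials_def
proof (rule has_derivative_eq_rhs)
  have "((\<lambda>z. g (Q z)) has_derivative (\<lambda>h. g' * (Re h * q1 + Im h * q2))) (at z)"
    using assms(2) unfolding has_field_derivative_def
    by (rule has_derivative_compose[OF assms(1)])
  then show "((\<lambda>z. complex_of_real (g (Q z))) has_derivative
      (\<lambda>h. of_real (g' * (Re h * q1 + Im h * q2)))) (at z)"
    by (rule has_derivative_of_real)
  show "(\<lambda>h. of_real (g' * (Re h * q1 + Im h * q2))) =
    (\<lambda>h. of_real (Re h) * complex_of_real (g' * q1) + of_real (Im h) * of_real (g' * q2))"
    by (intro ext) (simp add: ring_distribs mult_ac)
qed

lemma partials_transform_open:
  assumes "partials f f1 f2 z" "open U" "z \<in> U" "\<And>w. w \<in> U \<Longrightarrow> f w = g w"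
  shows "partials g f1 f2 z"
  using assms(1) unfolding partials_def
  by (rule has_derivative_transform_within_open[OF _ assms(2-4)])

lemma dbar_cong_open:
  assumes "open U" "z \<in> U" "\<And>w. w \<in> U \<Longrightarrow> f w = g w"
  shows "dbar f z = dbar g z"
proof -
  \<comment> \<open>\<open>frechet_derivative\<close> is a choice, so it suffices that both
    functions have the same set of derivatives at z. This covers points without differentiability as
    well.\<close>
  have "frechet_derivative f (at z) = frechet_derivative g (at z)"
    unfolding frechet_derivative_def
    using has_derivative_transform_within_open[of f _ z UNIV U g]
      has_derivative_transform_within_open[of g _ z UNIV U f] assms
    by (intro arg_cong[where f=Eps] ext iffI) auto
  then show ?thesis by (simp add: dbar_def)
qed

section \<open>Smooth functions on open subsets of the plane\<close>

text \<open>\<open>smooth_fun\<close> with the differentiability clause restricted to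
  \<open>U\<close>, since functions such as \<open>1 / \<Psi>\<close> are smooth only on a part of
  the plane.\<close>

coinductive smooth_on :: "complex set \<Rightarrow> (complex \<Rightarrow> complex) \<Rightarrow> bool" for U where
  "\<forall>z\<in>U. f differentiable (at z) \<Longrightarrow>
   smooth_on U (\<lambda>z. frechet_derivative f (at z) 1) \<Longrightarrow>
   smooth_on U (\<lambda>z. frechet_derivative f (at z) \<i>) \<Longrightarrow> smooth_on U f"

lemma smooth_on_UNIV:
  assumes "smooth_on UNIV f"
  shows "smooth_fun f"
  using assms
proof (coinduction arbitrary: f rule: smooth_fun.coinduct)
  case smooth_fun
  then show ?case by (rule smooth_on.cases) auto
qed

lemma smooth_on_differentiable: "smooth_on U f \<Longrightarrow> z \<in> U \<Longrightarrow> f differentiable (at z)"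
  by (erule smooth_on.cases) auto

text \<open>Each clause is a condition at single points with full neighbourhoods, so smoothness can
  be checked piece by piece. Removed poles and extensions by 0 are treated in this way
  below.\<close>

lemma smooth_on_Un: "smooth_on U f \<Longrightarrow> smooth_on V f \<Longrightarrow> smooth_on (U \<union> V) f"
proof (coinduction arbitrary: f rule: smooth_on.coinduct)
  case smooth_on
  then show ?case by (auto elim: smooth_on.cases)
qed

lemma smooth_fun_smooth_on: "smooth_fun f \<Longrightarrow> smooth_on UNIV f"
proof (coinduction arbitrary: f rule: smooth_on.coinduct)
  case smooth_on
  then show ?case by (auto elim: smooth_fun.cases)
qed

lemma smooth_on_subset: "smooth_on U f \<Longrightarrow> V \<subseteq> U \<Longrightarrow> smooth_on V f"
proof (coinduction arbitrary: f rule: smooth_on.coinduct)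
  case smooth_on
  then show ?case by (auto elim: smooth_on.cases)
qed

text \<open>Smoothness is proved by coinduction up to the algebra generated by a set of functions
  whose first partial derivatives lie again in that algebra.\<close>

inductive smooth_alg :: "complex set \<Rightarrow> (complex \<Rightarrow> complex) set \<Rightarrow> (complex \<Rightarrow> complex) \<Rightarrow> bool"
  for U G where
  gen: "g \<in> G \<Longrightarrow> smooth_alg U G g"
| smooth: "smooth_on U g \<Longrightarrow> smooth_alg U G g"
| add: "smooth_alg U G f \<Longrightarrow> smooth_alg U G g \<Longrightarrow> smooth_alg U G (\<lambda>z. f z + g z)"
| mult: "smooth_alg U G f \<Longrightarrow> smooth_alg U G g \<Longrightarrow> smooth_alg U G (\<lambda>z. f z * g z)"

lemma smooth_alg_partials:
  assumes G: "\<And>g. g \<in> G \<Longrightarrow>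
      \<exists>g1 g2. smooth_alg U G g1 \<and> smooth_alg U G g2 \<and> (\<forall>z\<in>U. partials g (g1 z) (g2 z) z)"
    and f: "smooth_alg U G f"
  shows "\<exists>f1 f2. smooth_alg U G f1 \<and> smooth_alg U G f2 \<and> (\<forall>z\<in>U. partials f (f1 z) (f2 z) z)"
  using f
proof induction
  case (gen g) then show ?case using G by blast
next
  case (smooth g)
  let ?g1 = "\<lambda>z. frechet_derivative g (at z) 1"
  let ?g2 = "\<lambda>z. frechet_derivative g (at z) \<i>"
  have "smooth_on U ?g1" "smooth_on U ?g2" "\<forall>z\<in>U. g differentiable (at z)"
    using smooth by (auto elim: smooth_on.cases)
  then show ?case
    by (intro exI[of _ ?g1] exI[of _ ?g2]) (auto intro: smooth_alg.smooth differentiable_partials)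
next
  case (add f g)
  then obtain f1 f2 g1 g2 where *:
    "smooth_alg U G f1" "smooth_alg U G f2" "\<forall>z\<in>U. partials f (f1 z) (f2 z) z"
    "smooth_alg U G g1" "smooth_alg U G g2" "\<forall>z\<in>U. partials g (g1 z) (g2 z) z" by blast
  show ?case
    by (intro exI[of _ "\<lambda>z. f1 z + g1 z"] exI[of _ "\<lambda>z. f2 z + g2 z"])
       (use * in \<open>auto intro!: smooth_alg.add partials_add\<close>)
next
  case (mult f g)
  then obtain f1 f2 g1 g2 where *:
    "smooth_alg U G f1" "smooth_alg U G f2" "\<forall>z\<in>U. partials f (f1 z) (f2 z) z"
    "smooth_alg U G g1" "smooth_alg U G g2" "\<forall>z\<in>U. partials g (g1 z) (g2 z) z" by blast
  show ?case
    by (intro exI[of _ "\<lambda>z. f1 z * g z + f z * g1 z"] exI[of _ "\<lambda>z. f2 z * g z + f z * g2 z"])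
       (use * mult.hyps in \<open>auto intro!: smooth_alg.add smooth_alg.mult partials_mult\<close>)
qed

text \<open>Agreement with an element of the algebra is demanded on \<open>U\<close> only:
  \<open>frechet_derivative\<close> is a total function and equals the algebraic formula just at
  points of \<open>U\<close>. Openness of \<open>U\<close> lets the agreement pass to
  derivatives.\<close>

lemma smooth_alg_imp_smooth_on:
  assumes U: "open U" and G: "\<And>g. g \<in> G \<Longrightarrow>
      \<exists>g1 g2. smooth_alg U G g1 \<and> smooth_alg U G g2 \<and> (\<forall>z\<in>U. partials g (g1 z) (g2 z) z)"
    and f: "smooth_alg U G f" "\<And>z. z \<in> U \<Longrightarrow> f' z = f z"
  shows "smooth_on U f'"
proof -
  have "\<exists>f. smooth_alg U G f \<and> (\<forall>z\<in>U. f' z = f z)" using f by blast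
  then show ?thesis
  proof (coinduction arbitrary: f' rule: smooth_on.coinduct)
    case (smooth_on f')
    then obtain f where f: "smooth_alg U G f" "\<And>z. z \<in> U \<Longrightarrow> f' z = f z" by blast
    obtain f1 f2 where p: "smooth_alg U G f1" "smooth_alg U G f2"
      "\<forall>z\<in>U. partials f (f1 z) (f2 z) z"
      using smooth_alg_partials[OF G f(1)] by blast
    have "partials f' (f1 z) (f2 z) z" if "z \<in> U" for z
      using p(3) partials_transform_open[OF _ U that] f(2) that by metis
    from partials_frechet[OF this] p show ?case by auto
  qed
qed

lemma smooth_on_add:
  "open U \<Longrightarrow> smooth_on U f \<Longrightarrow> smooth_on U g \<Longrightarrow> smooth_on U (\<lambda>z. f z + g z)"
  by (rule smooth_alg_imp_smooth_on[where G="{}"]) (auto intro: smooth_alg.intros)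

lemma smooth_on_mult:
  "open U \<Longrightarrow> smooth_on U f \<Longrightarrow> smooth_on U g \<Longrightarrow> smooth_on U (\<lambda>z. f z * g z)"
  by (rule smooth_alg_imp_smooth_on[where G="{}"]) (auto intro: smooth_alg.intros)

lemma smooth_on_cong:
  "open U \<Longrightarrow> smooth_on U f \<Longrightarrow> (\<And>z. z \<in> U \<Longrightarrow> f' z = f z) \<Longrightarrow> smooth_on U f'"
  by (rule smooth_alg_imp_smooth_on[where G="{}" and f=f]) (auto intro: smooth_alg.intros)

lemma smooth_on_const: "open U \<Longrightarrow> smooth_on U (\<lambda>_. c)"
proof (rule smooth_alg_imp_smooth_on[where G="range (\<lambda>c _. c)" and f="\<lambda>_. c"])
  fix g :: "complex \<Rightarrow> complex" assume "g \<in> range (\<lambda>c _. c)"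
  then show "\<exists>g1 g2. smooth_alg U (range (\<lambda>c _. c)) g1 \<and> smooth_alg U (range (\<lambda>c _. c)) g2 \<and>
      (\<forall>z\<in>U. partials g (g1 z) (g2 z) z)"
    using partials_const smooth_alg.gen[OF rangeI[of "\<lambda>c _. c" 0]]
    by (intro exI[of _ "\<lambda>_. 0"] conjI ballI) blast+
qed (simp_all add: smooth_alg.gen rangeI)

lemma smooth_on_holomorphic:
  assumes U: "open U" and f: "f holomorphic_on U"
  shows "smooth_on U f"
proof (rule smooth_alg_imp_smooth_on[where G="{f. f holomorphic_on U}" and f=f])
  fix g assume g: "g \<in> {f. f holomorphic_on U}"
  have "deriv g holomorphic_on U" "(\<lambda>z. \<i> * deriv g z) holomorphic_on U"
    using g U by (auto intro!: holomorphic_intros)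
  moreover have "partials g (deriv g z) (\<i> * deriv g z) z" if "z \<in> U" for z
    using g U that by (intro partials_holomorphic) (auto intro: holomorphic_derivI)
  ultimately show "\<exists>g1 g2. smooth_alg U {f. f holomorphic_on U} g1 \<and>
      smooth_alg U {f. f holomorphic_on U} g2 \<and> (\<forall>z\<in>U. partials g (g1 z) (g2 z) z)"
    by (intro exI[of _ "deriv g"] exI[of _ "\<lambda>z. \<i> * deriv g z"]) (auto intro!: smooth_alg.gen)
qed (use assms in \<open>auto intro: smooth_alg.gen\<close>)

lemma smooth_on_partialsE:
  assumes "smooth_on U f"
  obtains f1 f2 where "smooth_on U f1" "smooth_on U f2" "\<forall>z\<in>U. partials f (f1 z) (f2 z) z"
proof -
  have d: "\<forall>z\<in>U. f differentiable (at z)"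
    and s: "smooth_on U (\<lambda>z. frechet_derivative f (at z) 1)"
      "smooth_on U (\<lambda>z. frechet_derivative f (at z) \<i>)"
    using assms by (rule smooth_on.cases, simp)+
  show ?thesis by (rule that[OF s]) (use d in \<open>simp add: differentiable_partials\<close>)
qed

text \<open>One generator is enough: the partial derivatives of \<open>1 / f\<close> are smooth
  functions times the square of \<open>1 / f\<close>.\<close>

lemma smooth_on_inverse:
  assumes U: "open U" and f: "smooth_on U f" "\<And>z. z \<in> U \<Longrightarrow> f z \<noteq> 0"
  shows "smooth_on U (\<lambda>z. inverse (f z))"
proof (rule smooth_alg_imp_smooth_on[where G="{\<lambda>z. inverse (f z)}" and f="\<lambda>z. inverse (f z)"])
  let ?i = "\<lambda>z. inverse (f z)"
  fix g assume g: "g \<in> {?i}"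
  obtain f1 f2 where p: "smooth_on U f1" "smooth_on U f2" "\<forall>z\<in>U. partials f (f1 z) (f2 z) z"
    using f(1) by (rule smooth_on_partialsE)
  have a: "smooth_alg U {?i} (\<lambda>z. - q z * ?i z * ?i z)" if "smooth_on U q" for q
  proof -
    have "smooth_on U (\<lambda>z. -1 * q z)" by (intro smooth_on_mult smooth_on_const U that)
    then have "smooth_on U (\<lambda>z. - q z)" by simp
    then show ?thesis
      by (intro smooth_alg.mult smooth_alg.gen[OF singletonI]) (rule smooth_alg.smooth)
  qed
  have "\<forall>z\<in>U. partials g (- f1 z * ?i z * ?i z) (- f2 z * ?i z * ?i z) z"
    using partials_inverse p(3) f(2) g by blast
  then show "\<exists>g1 g2. smooth_alg U {?i} g1 \<and> smooth_alg U {?i} g2 \<and>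
      (\<forall>z\<in>U. partials g (g1 z) (g2 z) z)"
    using a[OF p(1)] a[OF p(2)] by blast
qed (use U in \<open>simp_all add: smooth_alg.gen\<close>)

section \<open>A smooth step function\<close>

text \<open>The flat function exp(-1/t) together with all its quotients by powers of t: the
  derivative of member n combines members n+1 and n+2, so the family generates an algebra closed
  under differentiation.\<close>

definition expinv :: "nat \<Rightarrow> real \<Rightarrow> real" where
  "expinv n t = (if t > 0 then exp (- (1 / t)) / t ^ n else 0)"

lemma expinv_tendsto_0: "((\<lambda>t. exp (- (1 / t)) / t ^ n) \<longlongrightarrow> (0::real)) (at_right 0)"
proof -
  have "((\<lambda>x. x ^ n / exp x) \<longlongrightarrow> (0::real)) at_top" by (rule tendsto_power_div_exp_0)
  from filterlim_compose[OF this filterlim_inverse_at_top_right]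
  show ?thesis by (simp add: divide_inverse exp_minus power_inverse mult.commute)
qed

lemma expinv_deriv: "(expinv n has_field_derivative (expinv (n+2) t - n * expinv (n+1) t)) (at t)"
proof -
  consider "t > 0" | "t < 0" | "t = 0" by linarith
  then show ?thesis
  proof cases
    case 1
    have p: "((\<lambda>t. inverse (t ^ n)) has_field_derivative - (real n / t ^ (n+1))) (at t)"
      by (rule DERIV_cong[OF DERIV_inverse_fun[OF DERIV_pow]]) (use 1 in \<open>cases n; simp add: field_simps\<close>)+
    have e: "((\<lambda>t. exp (- (1 / t))) has_field_derivative exp (- (1 / t)) / t\<^sup>2) (at t)"
      using 1 by (auto intro!: derivative_eq_intros simp: power2_eq_square)
    have "((\<lambda>t. exp (- (1 / t)) * inverse (t ^ n)) has_field_derivative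
        (expinv (n+2) t - n * expinv (n+1) t)) (at t)"
      by (rule DERIV_cong[OF DERIV_mult[OF e p]])
         (use 1 in \<open>simp add: expinv_def divide_inverse power_add power2_eq_square algebra_simps\<close>)
    then have "((\<lambda>t. exp (- (1 / t)) / t ^ n) has_field_derivative
        (expinv (n+2) t - n * expinv (n+1) t)) (at t)"
      by (simp only: divide_inverse)
    then show ?thesis
      by (rule has_field_derivative_transform_within_open[where S="{0<..}"])
         (use 1 in \<open>auto simp: expinv_def\<close>)
  next
    case 2
    have "((\<lambda>t. 0) has_field_derivative (expinv (n+2) t - n * expinv (n+1) t)) (at t)"
      using 2 by (simp add: expinv_def)
    then show ?thesis
      by (rule has_field_derivative_transform_within_open[where S="{..<0}"])
         (use 2 in \<open>auto simp: expinv_def\<close>)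
  next
    case 3
    \<comment> \<open>At 0 the difference quotient of member n is, from the right, member n+1, which
      tends to 0; from the left it is constantly 0.\<close>
    have "((\<lambda>h. (expinv n (0 + h) - expinv n 0) / h) \<longlongrightarrow> 0) (at_right 0)"
      using expinv_tendsto_0[of "n+1"]
      by (rule Lim_transform_eventually)
         (auto simp: eventually_at_right_field expinv_def intro!: exI[of _ 1])
    moreover have "((\<lambda>h. (expinv n (0 + h) - expinv n 0) / h) \<longlongrightarrow> 0) (at_left 0)"
      by (rule tendsto_eventually)
         (auto simp: eventually_at_left_field expinv_def intro!: exI[of _ "-1"])
    ultimately have "(\<lambda>h. (expinv n (0 + h) - expinv n 0) / h) \<midarrow>0\<rightarrow> 0"
      by (simp add: filterlim_split_at)
    then show ?thesis using 3 by (simp add: DERIV_def expinv_def)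
  qed
qed

lemma smooth_on_expinv:
  assumes U: "open U"
    and Q: "\<And>z. z \<in> U \<Longrightarrow> (Q has_derivative (\<lambda>h. Re h * q1 z + Im h * q2 z)) (at z)"
    and q: "smooth_on U (\<lambda>z. of_real (q1 z))" "smooth_on U (\<lambda>z. of_real (q2 z))"
  shows "smooth_on U (\<lambda>z. of_real (expinv n (Q z)))"
proof (rule smooth_alg_imp_smooth_on[where G="range (\<lambda>n z. of_real (expinv n (Q z)))"
        and f="\<lambda>z. of_real (expinv n (Q z))"])
  let ?e = "\<lambda>n z. complex_of_real (expinv n (Q z))"
  fix g assume "g \<in> range ?e"
  then obtain n where g: "g = ?e n" by auto
  have d: "smooth_alg U (range ?e) (\<lambda>z. (?e (n+2) z + of_real (- real n) * ?e (n+1) z) * q z)"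
    if "smooth_on U q" for q
  proof -
    have m: "smooth_alg U (range ?e) (?e m)" for m by (rule smooth_alg.gen, rule rangeI)
    show ?thesis
      by (intro smooth_alg.mult smooth_alg.add m smooth_alg.smooth[OF smooth_on_const[OF U]]
          smooth_alg.smooth[OF that])
  qed
  have "\<forall>z\<in>U. partials g ((?e (n+2) z + of_real (- real n) * ?e (n+1) z) * of_real (q1 z))
     ((?e (n+2) z + of_real (- real n) * ?e (n+1) z) * of_real (q2 z)) z"
  proof
    fix z assume "z \<in> U"
    from partials_real_compose[OF Q[OF this] expinv_deriv[of n]]
    show "partials g ((?e (n+2) z + of_real (- real n) * ?e (n+1) z) * of_real (q1 z))
      ((?e (n+2) z + of_real (- real n) * ?e (n+1) z) * of_real (q2 z)) z"
      by (simp add: g ring_distribs mult_ac)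
  qed
  then show "\<exists>g1 g2. smooth_alg U (range ?e) g1 \<and> smooth_alg U (range ?e) g2 \<and>
      (\<forall>z\<in>U. partials g (g1 z) (g2 z) z)"
    using d[OF q(1)] d[OF q(2)] by blast
qed (use U in \<open>auto intro: smooth_alg.gen\<close>)

text \<open>The thresholds 1/4 and 1 are meant for a squared distance divided by \<open>r^2\<close>:
  they correspond to the radii r/2 and r.\<close>

definition step :: "real \<Rightarrow> real" where
  "step t = expinv 0 (t - 1/4) * inverse (expinv 0 (t - 1/4) + expinv 0 (1 - t))"

definition step' :: "real \<Rightarrow> real" where
  "step' t = (expinv 2 (t - 1/4) * expinv 0 (1 - t) + expinv 0 (t - 1/4) * expinv 2 (1 - t))
     * (inverse (expinv 0 (t - 1/4) + expinv 0 (1 - t)))\<^sup>2"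

lemma expinv_nonneg: "expinv n t \<ge> 0"
  by (simp add: expinv_def)

lemma step_denom_pos: "expinv 0 (t - 1/4) + expinv 0 (1 - t) > 0"
  by (simp add: expinv_def add_pos_pos)

lemma step_deriv: "(step has_field_derivative step' t) (at t)"
proof -
  have e: "(expinv 0 has_field_derivative expinv 2 x) (at x)" for x
    using expinv_deriv[of 0 x] by (simp add: numeral_2_eq_2)
  have a: "((\<lambda>t. expinv 0 (t - 1/4)) has_field_derivative expinv 2 (t - 1/4)) (at t)"
    by (rule DERIV_cong[OF DERIV_chain2[OF e, of "\<lambda>t. t - 1/4" 1 t]])
       (auto intro!: derivative_eq_intros)
  have b: "((\<lambda>t. expinv 0 (1 - t)) has_field_derivative - expinv 2 (1 - t)) (at t)"
    by (rule DERIV_cong[OF DERIV_chain2[OF e, of "\<lambda>t. 1 - t" "-1" t]])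
       (auto intro!: derivative_eq_intros)
  have n: "expinv 0 (t - 1/4) + expinv 0 (1 - t) \<noteq> 0" using step_denom_pos[of t] by simp
  \<comment> \<open>The quotient rule rewritten so that every summand of the derivative is visibly
    nonnegative; \<open>i\<close> stands for the inverse of the denominator.\<close>
  have k: "a' * i - a * (i * (a' - b') * i) = (a' * b + a * b') * i\<^sup>2" if "(a + b) * i = 1"
    for a b a' b' i :: real
    using that by algebra
  have i: "(expinv 0 (t - 1/4) + expinv 0 (1 - t)) * inverse (expinv 0 (t - 1/4) + expinv 0 (1 - t)) = 1"
    by (rule right_inverse[OF n])
  show ?thesis unfolding step_def
    by (rule DERIV_cong[OF DERIV_mult[OF a DERIV_inverse_fun[OF DERIV_add[OF a b] n]]],
        unfold step'_def, subst k[OF i, symmetric]) (simp add: power2_eq_square mult_ac)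
qed

lemma step_0: "t \<le> 1/4 \<Longrightarrow> step t = 0" and step_1: "t \<ge> 1 \<Longrightarrow> step t = 1"
  and step_nonneg: "step t \<ge> 0" and step_le_1: "step t \<le> 1"
  and step'_nonneg: "step' t \<ge> 0" and step'_0: "t \<le> 1/4 \<or> t \<ge> 1 \<Longrightarrow> step' t = 0"
  using step_denom_pos[of t] expinv_nonneg[of 0 "1 - t"] expinv_nonneg[of 0 "t - 1/4"]
  by (auto simp: step_def step'_def expinv_def field_simps)

lemma continuous_on_expinv: "continuous_on S (expinv n)"
  using expinv_deriv by (meson DERIV_isCont continuous_at_imp_continuous_on)

lemma continuous_on_step': "continuous_on S step'"
proof -
  have c: "continuous_on S (\<lambda>x. expinv n (f x))" if "continuous_on S f" for n and f :: "real \<Rightarrow> real"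
    using continuous_on_compose2[OF continuous_on_expinv that] by auto
  show ?thesis unfolding step'_def
    using step_denom_pos by (intro continuous_intros c) (auto simp: less_le)
qed

lemma continuous_on_step: "continuous_on S step"
  using step_deriv by (meson DERIV_isCont continuous_at_imp_continuous_on)

lemma step'_bounded: "\<exists>B>0. \<forall>t. step' t \<le> B"
proof -
  have "bounded (step' ` {0..1})"
    by (intro compact_imp_bounded compact_continuous_image continuous_on_step') auto
  then obtain B where B: "B > 0" "\<forall>x\<in>{0..1}. norm (step' x) \<le> B"
    by (auto simp: bounded_pos)
  have "step' t \<le> B" for t
    using B(1) B(2)[rule_format, of t] step'_0[of t] by (cases "t \<in> {0..1}") auto
  then show ?thesis using B by blast
qed

text \<open>The radial cutoff \<open>rstep a r\<close> vanishes on the disc of radius \<open>r/2\<close> about \<open>a\<close> and equals 1 off the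
  disc of radius \<open>r\<close>.\<close>

definition rstep :: "complex \<Rightarrow> real \<Rightarrow> complex \<Rightarrow> real" where
  "rstep a r z = step ((cmod (z - a))\<^sup>2 / r\<^sup>2)"

lemma sqnorm_has_derivative:
  "((\<lambda>z. (cmod (z - a))\<^sup>2 * c + d) has_derivative
     (\<lambda>h. Re h * (2 * c * Re (z - a)) + Im h * (2 * c * Im (z - a)))) (at z)"
proof -
  have "((\<lambda>z. ((Re z - Re a)\<^sup>2 + (Im z - Im a)\<^sup>2) * c + d) has_derivative
     (\<lambda>h. Re h * (2 * c * Re (z - a)) + Im h * (2 * c * Im (z - a)))) (at z)"
    by (rule derivative_eq_intros refl | simp add: algebra_simps)+
  then show ?thesis by (simp add: cmod_power2)
qed

lemma smooth_on_Re_Im: "smooth_on UNIV (\<lambda>z. of_real (Re z))" "smooth_on UNIV (\<lambda>z. of_real (Im z))"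
proof -
  have p: "partials (\<lambda>z. of_real (Re z)) 1 0 z" "partials (\<lambda>z. of_real (Im z)) 0 1 z" for z
    unfolding partials_def by (rule derivative_eq_intros refl | simp)+
  have s: "\<exists>g1 g2. smooth_alg UNIV {g} g1 \<and> smooth_alg UNIV {g} g2 \<and>
      (\<forall>z\<in>UNIV. partials g (g1 z) (g2 z) z)" if "\<And>z. partials g c d z" for g c d
    using that by (intro exI[of _ "\<lambda>_. c"] exI[of _ "\<lambda>_. d"])
      (auto intro!: smooth_alg.smooth smooth_on_const)
  show "smooth_on UNIV (\<lambda>z. of_real (Re z))"
    by (rule smooth_alg_imp_smooth_on[where G="{\<lambda>z. of_real (Re z)}" and f="\<lambda>z. of_real (Re z)"])
       (use s[OF p(1)] in \<open>auto intro: smooth_alg.gen\<close>)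
  show "smooth_on UNIV (\<lambda>z. of_real (Im z))"
    by (rule smooth_alg_imp_smooth_on[where G="{\<lambda>z. of_real (Im z)}" and f="\<lambda>z. of_real (Im z)"])
       (use s[OF p(2)] in \<open>auto intro: smooth_alg.gen\<close>)
qed

lemma smooth_on_affine_Re_Im:
  "smooth_on UNIV (\<lambda>z. of_real (c * Re (z - a)))" "smooth_on UNIV (\<lambda>z. of_real (c * Im (z - a)))"
proof -
  have "smooth_on UNIV (\<lambda>z. of_real c * (of_real (Re z) + of_real (- Re a)))"
    "smooth_on UNIV (\<lambda>z. of_real c * (of_real (Im z) + of_real (- Im a)))"
    by (intro smooth_on_mult smooth_on_add smooth_on_const smooth_on_Re_Im open_UNIV)+
  then show "smooth_on UNIV (\<lambda>z. of_real (c * Re (z - a)))"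
    "smooth_on UNIV (\<lambda>z. of_real (c * Im (z - a)))" by simp_all
qed

lemma smooth_on_sqnorm: "smooth_on UNIV (\<lambda>z. of_real (1 - (cmod z)\<^sup>2))"
proof -
  have "smooth_on UNIV (\<lambda>z. 1 + (-1) * (of_real (Re z) * of_real (Re z) + of_real (Im z) * of_real (Im z)))"
    by (intro smooth_on_mult smooth_on_add smooth_on_const smooth_on_Re_Im open_UNIV)
  then show ?thesis by (rule smooth_on_cong[OF open_UNIV]) (unfold cmod_power2, simp add: power2_eq_square)
qed

lemma smooth_on_rstep: "r > 0 \<Longrightarrow> smooth_on UNIV (\<lambda>z. of_real (rstep a r z))"
proof -
  assume r: "r > 0"
  have e: "smooth_on UNIV (\<lambda>z. of_real (expinv 0 ((cmod (z - a))\<^sup>2 * c + d)))" for c d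
    by (rule smooth_on_expinv[OF open_UNIV sqnorm_has_derivative]) (rule smooth_on_affine_Re_Im)+
  have n: "complex_of_real (expinv 0 ((cmod (z - a))\<^sup>2 * (1 / r\<^sup>2) + (-1/4))) +
     of_real (expinv 0 ((cmod (z - a))\<^sup>2 * (-1 / r\<^sup>2) + 1)) \<noteq> 0" for z
    using step_denom_pos[of "(cmod (z - a))\<^sup>2 * (1 / r\<^sup>2)"]
    by (simp flip: of_real_add)
  have "smooth_on UNIV (\<lambda>z. of_real (expinv 0 ((cmod (z - a))\<^sup>2 * (1 / r\<^sup>2) + (-1/4))) *
      inverse (of_real (expinv 0 ((cmod (z - a))\<^sup>2 * (1 / r\<^sup>2) + (-1/4))) +
        of_real (expinv 0 ((cmod (z - a))\<^sup>2 * (-1 / r\<^sup>2) + 1))))"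
    by (intro smooth_on_mult smooth_on_inverse smooth_on_add e n open_UNIV)
  then show ?thesis unfolding rstep_def step_def by simp
qed

lemma partials_rstep:
  "partials (\<lambda>z. of_real (rstep a r z))
    (of_real (step' ((cmod (z - a))\<^sup>2 / r\<^sup>2) * (2 / r\<^sup>2 * Re (z - a))))
    (of_real (step' ((cmod (z - a))\<^sup>2 / r\<^sup>2) * (2 / r\<^sup>2 * Im (z - a)))) z"
  using partials_real_compose[OF sqnorm_has_derivative[of a "1 / r\<^sup>2" 0 z] step_deriv]
  unfolding rstep_def by (simp only: add_0_right times_divide_eq_right mult_1_right)

section \<open>Rules for \<open>dbar\<close>\<close>

text \<open>By the chain rule, because \<open>dbar\<close> of \<open>\<bar>z - a\<bar>^2\<close> is
  \<open>z - a\<close>.\<close>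

lemma dbar_rstep:
  "dbar (\<lambda>z. of_real (rstep a r z)) z = of_real (step' ((cmod (z - a))\<^sup>2 / r\<^sup>2) / r\<^sup>2) * (z - a)"
  unfolding dbar_partials[OF partials_rstep]
  by (cases "r = 0") (simp_all add: complex_eq_iff field_simps)

lemma dbar_mult:
  assumes "f differentiable (at z)" "g differentiable (at z)"
  shows "dbar (\<lambda>z. f z * g z) z = dbar f z * g z + f z * dbar g z"
  unfolding dbar_partials[OF partials_mult[OF differentiable_partials[OF assms(1)]
     differentiable_partials[OF assms(2)]]]
  by (simp add: dbar_def add_divide_distrib ring_distribs mult_ac)

lemma dbar_add:
  assumes "f differentiable (at z)" "g differentiable (at z)"
  shows "dbar (\<lambda>z. f z + g z) z = dbar f z + dbar g z"
  unfolding dbar_partials[OF partials_add[OF differentiable_partials[OF assms(1)]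
     differentiable_partials[OF assms(2)]]]
  by (simp add: dbar_def add_divide_distrib ring_distribs)

lemma dbar_holomorphic: "(f has_field_derivative d) (at z) \<Longrightarrow> dbar f z = 0"
  by (drule partials_holomorphic, drule dbar_partials) (simp add: algebra_simps)

lemma dbar_const: "dbar (\<lambda>_. c) z = 0"
  using dbar_partials[OF partials_const] by simp

lemma smooth_on_dbar: "open U \<Longrightarrow> smooth_on U f \<Longrightarrow> smooth_on U (dbar f)"
proof -
  assume U: "open U" and f: "smooth_on U f"
  from f have "smooth_on U (\<lambda>z. frechet_derivative f (at z) 1)"
    "smooth_on U (\<lambda>z. frechet_derivative f (at z) \<i>)" by (auto elim: smooth_on.cases)
  then have "smooth_on U (\<lambda>z. (1/2) * (frechet_derivative f (at z) 1 + \<i> * frechet_derivative f (at z) \<i>))"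
    by (intro smooth_on_mult smooth_on_add smooth_on_const U)
  then show ?thesis by (rule smooth_on_cong[OF U]) (simp add: dbar_def)
qed

lemma smooth_on_continuous: "smooth_on U f \<Longrightarrow> continuous_on U f"
  by (auto intro!: continuous_at_imp_continuous_on differentiable_imp_continuous_within
      dest: smooth_on_differentiable)

section \<open>Integration in the plane\<close>

lemma integrable_indicator_cball: "integrable lborel (\<lambda>z. b * indicator (cball c r) z :: real)"
  by (intro integrable_mult_right integrable_real_indicator)
     (use emeasure_bounded_finite[OF bounded_cball, of c r] in auto)

lemma integrable_bounded_cball:
  fixes f :: "'a::euclidean_space \<Rightarrow> 'b::{banach, second_countable_topology}"
  assumes [measurable]: "f \<in> borel_measurable borel"
    and B: "\<And>z. z \<in> cball c r \<Longrightarrow> norm (f z) \<le> B" and z: "\<And>z. z \<notin> cball c r \<Longrightarrow> f z = 0"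
  shows "integrable lborel f"
proof (rule Bochner_Integration.integrable_bound[OF integrable_indicator_cball[of B c r]])
  have "norm (f z) \<le> norm (B * indicator (cball c r) z :: real)" for z
    using B[of z] z[of z] norm_ge_zero[of "f z"] by (cases "z \<in> cball c r") auto
  then show "AE z in lborel. norm (f z) \<le> norm (B * indicator (cball c r) z :: real)" by simp
qed simp

lemma continuous_bounded_cball:
  fixes f :: "complex \<Rightarrow> 'b::real_normed_vector"
  assumes "continuous_on (cball c r) f"
  obtains B where "B > 0" "\<And>z. z \<in> cball c r \<Longrightarrow> norm (f z) \<le> B"
proof -
  have "bounded (f ` cball c r)"
    by (intro compact_imp_bounded compact_continuous_image assms compact_cball)
  then obtain B where "B > 0" "\<forall>x\<in>f ` cball c r. norm x \<le> B" unfolding bounded_pos by blast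
  then show ?thesis using that by blast
qed

text \<open>Translation invariance replaces integration by parts: every difference quotient of
  \<open>\<Phi>\<close> has integral 0, and since \<open>\<Phi>\<close> is Lipschitz, dominated
  convergence passes this on to the directional derivatives, of which \<open>dbar\<close> is a
  combination.\<close>

lemma integral_dbar_compact_support:
  assumes s: "smooth_on UNIV \<Phi>" and R: "\<And>z. R \<le> cmod z \<Longrightarrow> \<Phi> z = 0"
  shows "integrable lborel (dbar \<Phi>)" "(\<integral>z. dbar \<Phi> z \<partial>lborel) = 0"
proof -
  obtain f1 f2 where f: "smooth_on UNIV f1" "smooth_on UNIV f2"
    and p: "\<And>z. partials \<Phi> (f1 z) (f2 z) z"
    using s by (rule smooth_on_partialsE) simp
  have c: "continuous_on UNIV f1" "continuous_on UNIV f2" "continuous_on UNIV \<Phi>"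
    using f s by (auto intro: smooth_on_continuous)
  have m[measurable]: "f1 \<in> borel_measurable borel" "f2 \<in> borel_measurable borel"
    "\<Phi> \<in> borel_measurable borel"
    using c by (auto intro: borel_measurable_continuous_onI)
  have z: "f1 z = 0 \<and> f2 z = 0" if "R < cmod z" for z
  proof -
    have "partials \<Phi> 0 0 z"
    proof (rule partials_transform_open[OF partials_const[of 0]])
      show "open {z. R < cmod z}" by (intro open_Collect_less continuous_intros)
    qed (use that R in auto)
    from partials_frechet[OF this] partials_frechet[OF p[of z]] show ?thesis by simp
  qed
  have "continuous_on (cball 0 (\<bar>R\<bar> + 1)) (\<lambda>z. cmod (f1 z) + cmod (f2 z))"
    by (intro continuous_intros continuous_on_subset[OF c(1)] continuous_on_subset[OF c(2)]) auto
  then obtain B where B: "B > 0" "\<And>z. z \<in> cball 0 (\<bar>R\<bar> + 1) \<Longrightarrow> cmod (f1 z) + cmod (f2 z) \<le> B"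
    by (rule continuous_bounded_cball) fastforce
  have B': "cmod (f1 z) + cmod (f2 z) \<le> B" for z
    using B(1) B(2)[of z] z[of z] by (cases "z \<in> cball 0 (\<bar>R\<bar> + 1)") auto
  let ?D = "\<lambda>z h. of_real (Re h) * f1 z + of_real (Im h) * f2 z"
  have D: "(\<Phi> has_derivative ?D z) (at z)" for z using p[of z] by (simp add: partials_def)
  have Db: "cmod (?D z h) \<le> B * cmod h" for z h
  proof -
    have "cmod (?D z h) \<le> \<bar>Re h\<bar> * cmod (f1 z) + \<bar>Im h\<bar> * cmod (f2 z)"
      by (rule norm_triangle_le) (simp add: norm_mult)
    also have "\<dots> \<le> cmod h * cmod (f1 z) + cmod h * cmod (f2 z)"
      by (intro add_mono mult_right_mono abs_Re_le_cmod abs_Im_le_cmod) auto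
    also have "\<dots> \<le> B * cmod h" using mult_left_mono[OF B'[of z] norm_ge_zero[of h]] by (simp add: ring_distribs mult_ac)
    finally show ?thesis .
  qed
  have lip: "cmod (\<Phi> x - \<Phi> y) \<le> B * cmod (x - y)" for x y
    by (rule differentiable_bound[of UNIV \<Phi> ?D]) (use D Db in \<open>auto intro!: onorm_le\<close>)
  have key: "integrable lborel (\<lambda>z. ?D z v) \<and> (\<integral>z. ?D z v \<partial>lborel) = 0" if v: "cmod v \<le> 1" for v
  proof -
    let ?e = "\<lambda>n. inverse (real (Suc n))"
    let ?g = "\<lambda>n z. (\<Phi> (?e n *\<^sub>R v + z) - \<Phi> z) /\<^sub>R ?e n"
    \<comment> \<open>The increments \<open>?e n *\<^sub>R v\<close> have length at most 1, so all
      difference quotients vanish outside the support enlarged by 1.\<close>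
    let ?w = "\<lambda>z. B * indicator (cball 0 (\<bar>R\<bar> + 1)) z :: real"
    have w: "integrable lborel ?w"
      by (rule integrable_indicator_cball)
    have phi: "integrable lborel \<Phi>"
    proof (rule continuous_bounded_cball[OF continuous_on_subset[OF c(3) subset_UNIV]])
      fix B assume "\<And>z. z \<in> cball 0 R \<Longrightarrow> norm (\<Phi> z) \<le> B"
      then show "integrable lborel \<Phi>"
        by (rule integrable_bounded_cball[OF m(3), of 0 R B]) (auto intro!: R)
    qed
    have tr: "integrable lborel (\<lambda>z. \<Phi> (c + z))" "(\<integral>z. \<Phi> (c + z) \<partial>lborel) = (\<integral>z. \<Phi> z \<partial>lborel)" for c
    proof -
      have "integrable (distr lborel borel ((+) c)) \<Phi>" using phi by (simp add: lborel_distr_plus)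
      then show "integrable lborel (\<lambda>z. \<Phi> (c + z))" by (subst (asm) integrable_distr_eq) auto
      have "(\<integral>z. \<Phi> z \<partial>distr lborel borel ((+) c)) = (\<integral>z. \<Phi> (c + z) \<partial>lborel)"
        by (subst integral_distr) auto
      then show "(\<integral>z. \<Phi> (c + z) \<partial>lborel) = (\<integral>z. \<Phi> z \<partial>lborel)" by (simp add: lborel_distr_plus)
    qed
    have i0: "(\<integral>z. ?g n z \<partial>lborel) = 0" for n
      using tr[of "?e n *\<^sub>R v"] phi by (simp add: Bochner_Integration.integral_diff)
    have lim: "(\<lambda>n. ?g n z) \<longlonglongrightarrow> ?D z v" for z
    proof -
      have "((\<lambda>t. \<Phi> (t *\<^sub>R v + z)) has_derivative (\<lambda>t. ?D z (t *\<^sub>R v))) (at 0)"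
        by (rule has_derivative_compose[of "\<lambda>t. t *\<^sub>R v + z" "\<lambda>t. t *\<^sub>R v" 0 UNIV \<Phi> "?D z"])
           (use D[of z] in \<open>auto intro!: derivative_eq_intros\<close>)
      then have hv: "((\<lambda>t. \<Phi> (t *\<^sub>R v + z)) has_vector_derivative ?D z v) (at 0)"
        by (simp add: has_vector_derivative_def scaleR_conv_of_real algebra_simps)
      have f: "filterlim ?e (at 0) sequentially"
        using LIMSEQ_inverse_real_of_nat by (intro filterlim_atI) auto
      have "((\<lambda>t. Re (\<Phi> (t *\<^sub>R v + z))) has_field_derivative Re (?D z v)) (at 0)"
        "((\<lambda>t. Im (\<Phi> (t *\<^sub>R v + z))) has_field_derivative Im (?D z v)) (at 0)"
        using hv unfolding has_vector_derivative_complex_iff by blast+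
      note d = this[unfolded DERIV_def]
      have "(\<lambda>n. Re (?g n z)) \<longlonglongrightarrow> Re (?D z v)" "(\<lambda>n. Im (?g n z)) \<longlonglongrightarrow> Im (?D z v)"
        using filterlim_compose[OF d(1) f] filterlim_compose[OF d(2) f]
        by (simp_all only: scaleR_complex.simps minus_complex.simps divide_inverse mult.commute
            add_0_left scaleR_zero_left)
      then show ?thesis by (simp only: tendsto_complex_iff)
    qed
    have bd: "norm (?g n z) \<le> ?w z" for n z
    proof (cases "z \<in> cball 0 (\<bar>R\<bar> + 1)")
      case True
      have "norm (?g n z) \<le> (B * cmod (?e n *\<^sub>R v)) / ?e n"
        using lip[of "?e n *\<^sub>R v + z" z] by (simp add: divide_inverse mult.commute mult_left_mono)
      also have "\<dots> = B * cmod v" by (simp add: field_simps)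
      also have "\<dots> \<le> B" using v B(1) by (simp add: mult_left_le)
      finally show ?thesis using True by simp
    next
      case False
      then have "cmod z > \<bar>R\<bar> + 1" by simp
      moreover have "cmod (?e n *\<^sub>R v) \<le> 1"
        using v by (simp add: field_simps)
      ultimately have "R \<le> cmod (?e n *\<^sub>R v + z)"
        using norm_triangle_ineq4[of "?e n *\<^sub>R v + z" "?e n *\<^sub>R v"] by simp
      then show ?thesis using R[of z] R[of "?e n *\<^sub>R v + z"] \<open>cmod z > _\<close> by simp
    qed
    have mg: "?g n \<in> borel_measurable lborel" for n by measurable
    have mf: "(\<lambda>z. ?D z v) \<in> borel_measurable lborel" by measurable
    have "integrable lborel (\<lambda>z. ?D z v)" "(\<lambda>n. (\<integral>z. ?g n z \<partial>lborel)) \<longlonglongrightarrow> (\<integral>z. ?D z v \<partial>lborel)"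
      by (rule integrable_dominated_convergence[OF mf mg w AE_I2[OF lim] AE_I2[OF bd]]
          integral_dominated_convergence[OF mf mg w AE_I2[OF lim] AE_I2[OF bd]])+
    moreover from this(2) have "(\<integral>z. ?D z v \<partial>lborel) = 0"
      unfolding i0 by (rule LIMSEQ_unique[OF _ tendsto_const])
    ultimately show ?thesis by (rule_tac conjI)
  qed
  have e: "dbar \<Phi> = (\<lambda>z. (?D z 1 + \<i> * ?D z \<i>) / 2)"
    using dbar_partials[OF p] by auto
  show "integrable lborel (dbar \<Phi>)" "(\<integral>z. dbar \<Phi> z \<partial>lborel) = 0"
    unfolding e using key[of 1] key[of \<i>] by simp_all
qed

section \<open>Radial integration\<close>

text \<open>A disc of squared radius a has area pi * a, so the squared distance from w has constant
  density pi on the half line. This does the work of polar coordinates for radial functions.\<close>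

lemma distr_sqnorm:
  "distr lborel borel (\<lambda>z. (cmod (z - w))\<^sup>2) = density lborel (\<lambda>t. ennreal pi * indicator {0..} t)"
proof (rule measure_eqI_generator_eq[where E="range atMost" and \<Omega>=UNIV and A="\<lambda>i. {..real i}"])
  show "Int_stable (range atMost :: real set set)"
  proof (unfold Int_stable_def, safe)
    fix a b :: real show "{..a} \<inter> {..b} \<in> range atMost"
      by (rule range_eqI[of _ _ "min a b"]) auto
  qed
  fix X :: "real set" assume "X \<in> range atMost"
  then obtain a where X: "X = {..a}" by auto
  have "emeasure (distr lborel borel (\<lambda>z. (cmod (z - w))\<^sup>2)) X =
      emeasure lborel {z. (cmod (z - w))\<^sup>2 \<le> a}"
    unfolding X by (subst emeasure_distr) (auto simp: vimage_def)
  also have "\<dots> = ennreal (pi * max 0 a)"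
  proof (cases "a < 0")
    case True
    then have "{z. (cmod (z - w))\<^sup>2 \<le> a} = {}"
      by (smt (verit) empty_Collect_eq zero_le_power2)
    then show ?thesis using True by simp
  next
    case False
    then have "{z. (cmod (z - w))\<^sup>2 \<le> a} = cball w (sqrt a)"
      by (auto simp: dist_norm norm_minus_commute real_le_rsqrt sqrt_ge_absD)
    then show ?thesis using False
      by (simp add: emeasure_cball unit_ball_vol_2 ennreal_mult)
  qed
  also have "\<dots> = emeasure (density lborel (\<lambda>t. ennreal pi * indicator {0..} t)) X"
  proof -
    have "emeasure (density lborel (\<lambda>t. ennreal pi * indicator {0..} t)) X =
      (\<integral>\<^sup>+t\<in>{0..a}. ennreal pi \<partial>lborel)"
      unfolding X by (subst emeasure_density) (auto intro!: nn_integral_cong simp: indicator_def)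
    also have "\<dots> = ennreal pi * ennreal (max 0 a)"
      by (subst nn_integral_cmult_indicator) (auto simp: max_def emeasure_lborel_Icc_eq)
    finally show ?thesis by (simp add: ennreal_mult)
  qed
  finally show "emeasure (distr lborel borel (\<lambda>z. (cmod (z - w))\<^sup>2)) X =
     emeasure (density lborel (\<lambda>t. ennreal pi * indicator {0..} t)) X" .
next
  fix i
  have "emeasure (distr lborel borel (\<lambda>z. (cmod (z - w))\<^sup>2)) {..real i} =
      emeasure lborel {z. (cmod (z - w))\<^sup>2 \<le> real i}"
    by (subst emeasure_distr) (auto simp: vimage_def)
  also have "{z. (cmod (z - w))\<^sup>2 \<le> real i} = cball w (sqrt (real i))"
    by (auto simp: dist_norm norm_minus_commute real_le_rsqrt sqrt_ge_absD)
  finally show "emeasure (distr lborel borel (\<lambda>z. (cmod (z - w))\<^sup>2)) {..real i} \<noteq> \<infinity>"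
    using emeasure_bounded_finite[OF bounded_cball, of w "sqrt (real i)"] by simp
next
  show "(\<Union>i. {..real i}) = UNIV" by (auto intro: real_arch_simple)
qed (auto simp: borel_eq_atMost)

lemma nn_integral_radial:
  assumes [measurable]: "F \<in> borel_measurable borel"
  shows "(\<integral>\<^sup>+z. F ((cmod (z - w))\<^sup>2) \<partial>lborel) = ennreal pi * (\<integral>\<^sup>+t\<in>{0..}. F t \<partial>lborel)"
proof -
  have "(\<integral>\<^sup>+z. F ((cmod (z - w))\<^sup>2) \<partial>lborel) = (\<integral>\<^sup>+t. F t \<partial>distr lborel borel (\<lambda>z. (cmod (z - w))\<^sup>2))"
    by (subst nn_integral_distr) auto
  also have "\<dots> = (\<integral>\<^sup>+t. ennreal pi * (F t * indicator {0..} t) \<partial>lborel)"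
    unfolding distr_sqnorm by (subst nn_integral_density) (auto simp: mult_ac)
  finally show ?thesis by (subst (asm) nn_integral_cmult) auto
qed

section \<open>Radial mollifiers\<close>

text \<open>This is \<open>dbar\<close> of \<open>rstep w r z / (z - w)\<close>: the derivative of
  the cutoff supplies a factor \<open>z - w\<close> which cancels the pole. The result is a
  mollifier of mass pi living on the annulus between the radii r/2 and r, and it links cutoffs with
  averages everywhere below.\<close>

definition moll :: "complex \<Rightarrow> real \<Rightarrow> complex \<Rightarrow> real" where
  "moll w r z = step' ((cmod (z - w))\<^sup>2 / r\<^sup>2) / r\<^sup>2"

lemma moll_nonneg: "moll w r z \<ge> 0"
  by (simp add: moll_def step'_nonneg)

lemma moll_eq_0: "r > 0 \<Longrightarrow> cmod (z - w) \<ge> r \<Longrightarrow> moll w r z = 0"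
  and moll_eq_0': "r > 0 \<Longrightarrow> cmod (z - w) \<le> r / 2 \<Longrightarrow> moll w r z = 0"
proof -
  assume r: "r > 0"
  show "moll w r z = 0" if "cmod (z - w) \<ge> r"
    using power_mono[OF that, of 2] r by (simp add: moll_def step'_0)
  show "moll w r z = 0" if "cmod (z - w) \<le> r / 2"
    using power_mono[OF that, of 2] r by (simp add: moll_def step'_0 power_divide field_simps)
qed

lemma rstep_eq_1: "r > 0 \<Longrightarrow> cmod (z - w) \<ge> r \<Longrightarrow> rstep w r z = 1"
  and rstep_eq_0: "r > 0 \<Longrightarrow> cmod (z - w) \<le> r / 2 \<Longrightarrow> rstep w r z = 0"
proof -
  assume r: "r > 0"
  show "rstep w r z = 1" if "cmod (z - w) \<ge> r"
    using power_mono[OF that, of 2] r by (simp add: rstep_def step_1)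
  show "rstep w r z = 0" if "cmod (z - w) \<le> r / 2"
    using power_mono[OF that, of 2] r by (simp add: rstep_def step_0 power_divide field_simps)
qed

lemma rstep_bounds: "0 \<le> rstep w r z" "rstep w r z \<le> 1"
  by (simp_all add: rstep_def step_nonneg step_le_1)

lemma dbar_rstep_moll: "dbar (\<lambda>z. of_real (rstep w r z)) z = of_real (moll w r z) * (z - w)"
  by (simp add: dbar_rstep moll_def)

lemma moll_measurable[measurable]: "moll w r \<in> borel_measurable borel"
proof -
  have [measurable]: "step' \<in> borel_measurable borel"
    by (intro borel_measurable_continuous_onI continuous_on_step')
  show ?thesis unfolding moll_def[abs_def] by measurable
qed

lemma moll_bounded: "\<exists>B>0. \<forall>w r z. moll w r z \<le> B / r\<^sup>2"
  using step'_bounded unfolding moll_def by (auto intro!: divide_right_mono)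

lemma nn_integral_moll:
  assumes r: "r > 0"
  shows "(\<integral>\<^sup>+z. ennreal (moll w r z) \<partial>lborel) = ennreal pi"
proof -
  have [measurable]: "step' \<in> borel_measurable borel"
    by (intro borel_measurable_continuous_onI continuous_on_step')
  have "(\<integral>\<^sup>+z. ennreal (moll w r z) \<partial>lborel) =
      ennreal pi * (\<integral>\<^sup>+t\<in>{0..}. ennreal (step' (t / r\<^sup>2) / r\<^sup>2) \<partial>lborel)"
    unfolding moll_def by (rule nn_integral_radial) auto
  also have "(\<integral>\<^sup>+t\<in>{0..}. ennreal (step' (t / r\<^sup>2) / r\<^sup>2) \<partial>lborel) =
      (\<integral>\<^sup>+t\<in>{0..r\<^sup>2}. ennreal (step' (t / r\<^sup>2) / r\<^sup>2) \<partial>lborel)"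
    using r by (intro nn_integral_cong) (auto simp: indicator_def step'_0)
  also have "\<dots> = ennreal (step (r\<^sup>2 / r\<^sup>2) - step (0 / r\<^sup>2))"
  proof (rule nn_integral_FTC_Icc)
    fix x show "((\<lambda>x. step (x / r\<^sup>2)) has_real_derivative step' (x / r\<^sup>2) / r\<^sup>2) (at x)"
      by (rule DERIV_cong[OF DERIV_chain2[OF step_deriv DERIV_cdivide[OF DERIV_ident]]]) simp
  qed (use r in \<open>auto simp: step'_nonneg\<close>)
  also have "\<dots> = 1" using r by (simp add: step_0 step_1)
  finally show ?thesis by simp
qed

lemma integral_moll:
  assumes "r > 0"
  shows "integrable lborel (moll w r)" "(\<integral>z. moll w r z \<partial>lborel) = pi"
proof -
  show i: "integrable lborel (moll w r)"
    by (rule integrableI_nonneg) (use nn_integral_moll[OF assms, of w] in \<open>auto simp: moll_nonneg\<close>)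
  show "(\<integral>z. moll w r z \<partial>lborel) = pi"
    using nn_integral_moll[OF assms, of w] by (subst integral_eq_nn_integral) (auto simp: moll_nonneg)
qed

text \<open>The cutoff vanishes near the pole. The pole may lie off the centre of the cutoff, which
  Weyl's lemma uses to move \<zeta> while the outer cutoff stays fixed.\<close>

lemma smooth_on_rstep_pole:
  assumes r: "r > 0" and c: "cmod (\<zeta> - w) < r / 2"
  shows "smooth_on UNIV (\<lambda>z. of_real (rstep w r z) * inverse (z - \<zeta>))"
proof -
  have "smooth_on (- {\<zeta>}) (\<lambda>z. of_real (rstep w r z) * inverse (z - \<zeta>))"
    by (intro smooth_on_mult smooth_on_subset[OF smooth_on_rstep[OF r] subset_UNIV]
        smooth_on_holomorphic holomorphic_intros open_Compl finite_imp_closed) auto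
  moreover have "smooth_on (ball w (r / 2)) (\<lambda>z. of_real (rstep w r z) * inverse (z - \<zeta>))"
    by (rule smooth_on_cong[OF open_ball smooth_on_const[OF open_ball, of _ _ 0]])
       (use r in \<open>auto simp: rstep_eq_0 dist_norm norm_minus_commute\<close>)
  ultimately have "smooth_on (- {\<zeta>} \<union> ball w (r / 2)) (\<lambda>z. of_real (rstep w r z) * inverse (z - \<zeta>))"
    by (rule smooth_on_Un)
  moreover have "- {\<zeta>} \<union> ball w (r / 2) = UNIV" using c by (auto simp: dist_norm norm_minus_commute)
  ultimately show ?thesis by simp
qed

lemma dbar_rstep_pole:
  assumes r: "r > 0" and c: "cmod (\<zeta> - w) < r / 2"
  shows "dbar (\<lambda>z. of_real (rstep w r z) * inverse (z - \<zeta>)) z =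
    of_real (moll w r z) * (z - w) * inverse (z - \<zeta>)"
proof (cases "z = \<zeta>")
  case True
  have "dbar (\<lambda>z. of_real (rstep w r z) * inverse (z - \<zeta>)) z = dbar (\<lambda>_. 0) z"
    by (rule dbar_cong_open[OF open_ball[of w "r/2"]])
       (use c r True in \<open>auto simp: rstep_eq_0 dist_norm norm_minus_commute\<close>)
  then show ?thesis using True by (simp add: dbar_const)
next
  case False
  then have h: "((\<lambda>z. inverse (z - \<zeta>)) has_field_derivative - (inverse (z - \<zeta>) * 1 * inverse (z - \<zeta>))) (at z)"
    by (auto intro!: derivative_eq_intros)
  have "dbar (\<lambda>z. of_real (rstep w r z) * inverse (z - \<zeta>)) z =
    dbar (\<lambda>z. of_real (rstep w r z)) z * inverse (z - \<zeta>) + of_real (rstep w r z) * dbar (\<lambda>z. inverse (z - \<zeta>)) z"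
    by (rule dbar_mult[OF smooth_on_differentiable[OF smooth_on_rstep[OF r] UNIV_I]
          partials_frechet(1)[OF partials_holomorphic[OF h]]])
  then show ?thesis by (simp add: dbar_holomorphic[OF h] dbar_rstep_moll)
qed

lemma smooth_on_cutoff:
  assumes U: "open U" and f: "smooth_on U f" and r: "r > 0" "cball \<zeta> r \<subseteq> U"
  shows "smooth_on UNIV (\<lambda>z. f z * of_real (1 - rstep \<zeta> r z))"
proof -
  have "smooth_on U (\<lambda>z. f z * (1 + (-1) * of_real (rstep \<zeta> r z)))"
    by (intro smooth_on_mult smooth_on_add smooth_on_const f U
        smooth_on_subset[OF smooth_on_rstep[OF r(1)] subset_UNIV])
  then have "smooth_on U (\<lambda>z. f z * of_real (1 - rstep \<zeta> r z))" by simp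
  moreover have o: "open (- cball \<zeta> r)" by (intro open_Compl closed_cball)
  have "smooth_on (- cball \<zeta> r) (\<lambda>z. f z * of_real (1 - rstep \<zeta> r z))"
    by (rule smooth_on_cong[OF o smooth_on_const[OF o, of 0]])
       (use r in \<open>auto simp: rstep_eq_1 dist_norm norm_minus_commute\<close>)
  ultimately have "smooth_on (U \<union> - cball \<zeta> r) (\<lambda>z. f z * of_real (1 - rstep \<zeta> r z))"
    by (rule smooth_on_Un)
  moreover have "U \<union> - cball \<zeta> r = UNIV" using r by auto
  ultimately show ?thesis by simp
qed

section \<open>Singular integrals and the Cauchy-Pompeiu formula\<close>

lemma nn_integral_powr_from_0:
  assumes "\<alpha> > -1" "c \<ge> 0"
  shows "(\<integral>\<^sup>+t\<in>{0..c}. ennreal (t powr \<alpha>) \<partial>lborel) = ennreal (c powr (\<alpha> + 1) / (\<alpha> + 1))"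
proof -
  have "(\<integral>\<^sup>+t\<in>{0..c}. ennreal (t powr \<alpha>) \<partial>lborel) =
      (\<integral>\<^sup>+t. ennreal (indicator {0..c} t * t powr \<alpha>) \<partial>lborel)"
    by (intro nn_integral_cong) (auto simp: indicator_def)
  also have "\<dots> = ennreal (c powr (\<alpha> + 1) / (\<alpha> + 1))"
    by (rule nn_integral_has_integral_lebesgue[OF _ has_integral_powr_from_0[OF assms]]) simp
  finally show ?thesis .
qed

lemma nn_integral_inverse_dist:
  assumes r: "r \<ge> 0"
  shows "(\<integral>\<^sup>+z\<in>cball w r. ennreal (1 / cmod (z - w)) \<partial>lborel) = ennreal (2 * pi * r)"
proof -
  have "(\<integral>\<^sup>+z\<in>cball w r. ennreal (1 / cmod (z - w)) \<partial>lborel) =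
    (\<integral>\<^sup>+z. (\<lambda>t. ennreal (t powr (-1/2)) * indicator {0..r\<^sup>2} t) ((cmod (z - w))\<^sup>2) \<partial>lborel)"
  proof (intro nn_integral_cong)
    fix z
    have "((cmod (z - w))\<^sup>2) powr (-1/2) = 1 / cmod (z - w)"
    proof (cases "z = w")
      case False
      then have "((cmod (z - w))\<^sup>2) powr (-1/2) = (cmod (z - w) powr 2) powr (-1/2)" by simp
      also have "\<dots> = cmod (z - w) powr (-1)" by (subst powr_powr) simp
      finally show ?thesis using False by (simp add: powr_minus_divide)
    qed simp
    moreover have "(cmod (z - w))\<^sup>2 \<le> r\<^sup>2 \<longleftrightarrow> cmod (z - w) \<le> r"
      using r by (metis norm_ge_zero power_mono power2_le_imp_le)
    ultimately show "ennreal (1 / cmod (z - w)) * indicator (cball w r) z =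
       ennreal ((cmod (z - w))\<^sup>2 powr (-1/2)) * indicator {0..r\<^sup>2} ((cmod (z - w))\<^sup>2)"
      by (simp add: indicator_def dist_norm norm_minus_commute)
  qed
  also have "\<dots> = ennreal pi * (\<integral>\<^sup>+t\<in>{0..}. ennreal (t powr (-1/2)) * indicator {0..r\<^sup>2} t \<partial>lborel)"
    by (rule nn_integral_radial) simp
  also have "(\<integral>\<^sup>+t\<in>{0..}. ennreal (t powr (-1/2)) * indicator {0..r\<^sup>2} t \<partial>lborel) =
     (\<integral>\<^sup>+t\<in>{0..r\<^sup>2}. ennreal (t powr (-1/2)) \<partial>lborel)"
    by (intro nn_integral_cong) (auto simp: indicator_def)
  also have "\<dots> = ennreal ((r\<^sup>2) powr (-1/2 + 1) / (-1/2 + 1))"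
    by (rule nn_integral_powr_from_0) auto
  also have "(r\<^sup>2) powr (-1/2 + 1) / (-1/2 + 1) = 2 * r" using r by (simp add: powr_half_sqrt)
  finally show ?thesis using r by (simp add: ennreal_mult[symmetric] mult_ac)
qed

text \<open>The bound has to be uniform in the pole w: the disc of radius 1 about w contributes at
  most 2 * pi, and elsewhere the integrand is at most 1.\<close>

lemma nn_integral_inverse_dist_le:
  assumes r: "r \<ge> 0"
  shows "(\<integral>\<^sup>+z\<in>cball c r. ennreal (1 / cmod (z - w)) \<partial>lborel) \<le> ennreal (2 * pi + pi * r\<^sup>2)"
proof -
  have "(\<integral>\<^sup>+z\<in>cball c r. ennreal (1 / cmod (z - w)) \<partial>lborel) \<le>
    (\<integral>\<^sup>+z. ennreal (1 / cmod (z - w)) * indicator (cball w 1) z + indicator (cball c r) z \<partial>lborel)"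
  proof (intro nn_integral_mono)
    fix z
    show "ennreal (1 / cmod (z - w)) * indicator (cball c r) z \<le>
       ennreal (1 / cmod (z - w)) * indicator (cball w 1) z + indicator (cball c r) z"
    proof (cases "z \<in> cball w 1")
      case True then show ?thesis by (auto simp: indicator_def)
    next
      case False
      then have "1 < cmod (z - w)" by (simp add: dist_norm norm_minus_commute)
      then have "1 / cmod (z - w) \<le> 1" by (subst divide_le_eq_1_pos) linarith+
      then show ?thesis using False by (auto simp: indicator_def)
    qed
  qed
  also have "\<dots> = ennreal (2 * pi) + ennreal (pi * r\<^sup>2)"
  proof (subst nn_integral_add)
    have [measurable]: "cball w 1 \<in> sets borel" "cball c r \<in> sets borel" by auto
    show "(\<lambda>z. ennreal (1 / cmod (z - w)) * indicator (cball w 1) z) \<in> borel_measurable lborel"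
      "(\<lambda>z. indicator (cball c r) z) \<in> borel_measurable lborel" by measurable
  qed (use r in \<open>auto simp: nn_integral_inverse_dist emeasure_cball unit_ball_vol_2\<close>)
  finally show ?thesis by (simp add: ennreal_plus)
qed

lemma inverse_dist_measurable[measurable]: "(\<lambda>z::complex. inverse (z - w)) \<in> borel_measurable borel"
  by (intro borel_measurable_inverse) auto

lemma integrable_inverse_dist:
  "integrable lborel (\<lambda>z. B * (indicator (cball c r) z * (1 / cmod (z - w))))"
proof (intro integrable_mult_right integrableI_nonneg)
  have "(\<integral>\<^sup>+z. ennreal (indicator (cball c r) z * (1 / cmod (z - w))) \<partial>lborel) \<le>
     (\<integral>\<^sup>+z\<in>cball c \<bar>r\<bar>. ennreal (1 / cmod (z - w)) \<partial>lborel)"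
    by (intro nn_integral_mono) (auto simp: indicator_def)
  also have "\<dots> \<le> ennreal (2 * pi + pi * \<bar>r\<bar>\<^sup>2)" by (rule nn_integral_inverse_dist_le) simp
  finally show "(\<integral>\<^sup>+z. ennreal (indicator (cball c r) z * (1 / cmod (z - w))) \<partial>lborel) < \<infinity>"
    by (simp add: le_less_trans)
  have [measurable]: "cball c r \<in> sets borel" by auto
  show "(\<lambda>z. indicator (cball c r) z * (1 / cmod (z - w))) \<in> borel_measurable lborel" by measurable
qed auto

lemma integral_moll_tendsto:
  fixes \<Phi> :: "complex \<Rightarrow> complex"
  assumes c: "continuous_on UNIV \<Phi>" and r: "r \<longlonglongrightarrow> 0" "\<And>n. r n > 0"
  shows "\<And>n. integrable lborel (\<lambda>z. \<Phi> z * of_real (moll w (r n) z))"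
    "(\<lambda>n. \<integral>z. \<Phi> z * of_real (moll w (r n) z) \<partial>lborel) \<longlonglongrightarrow> pi * \<Phi> w"
proof -
  have [measurable]: "\<Phi> \<in> borel_measurable borel" using c by (rule borel_measurable_continuous_onI)
  obtain B where B: "B > 0" "\<And>w r z. moll w r z \<le> B / r\<^sup>2" using moll_bounded by blast
  have i: "integrable lborel (\<lambda>z. f z * of_real (moll w r z))"
    if r: "r > 0" and c: "continuous_on UNIV f" for r and f :: "complex \<Rightarrow> complex"
  proof (rule continuous_bounded_cball[OF continuous_on_subset[OF c subset_UNIV]])
    have [measurable]: "f \<in> borel_measurable borel" using c by (rule borel_measurable_continuous_onI)
    fix A assume A: "A > 0" "\<And>z. z \<in> cball w r \<Longrightarrow> norm (f z) \<le> A"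
    show "integrable lborel (\<lambda>z. f z * of_real (moll w r z))"
    proof (rule integrable_bounded_cball[where c=w and r=r and B="A * (B / r\<^sup>2)"])
      fix z assume "z \<in> cball w r"
      then show "norm (f z * of_real (moll w r z)) \<le> A * (B / r\<^sup>2)"
        using mult_mono[OF A(2)[of z] B(2)[of w r z]] A(1) moll_nonneg[of w r z] by (simp add: norm_mult)
    next
      fix z assume "z \<notin> cball w r"
      then show "f z * of_real (moll w r z) = 0"
        using moll_eq_0[OF r, of z w] by (simp add: dist_norm norm_minus_commute)
    qed measurable
  qed
  show ii: "integrable lborel (\<lambda>z. \<Phi> z * of_real (moll w (r n) z))" for n
    using i[OF r(2) c] .
  show "(\<lambda>n. \<integral>z. \<Phi> z * of_real (moll w (r n) z) \<partial>lborel) \<longlonglongrightarrow> pi * \<Phi> w"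
  proof (rule LIMSEQ_I)
    fix e :: real assume e: "e > 0"
    have "isCont \<Phi> w" using c continuous_on_eq_continuous_at[of UNIV] by auto
    then obtain d where d: "d > 0" "\<And>z. dist z w < d \<Longrightarrow> dist (\<Phi> z) (\<Phi> w) < e / (2 * pi)"
      unfolding continuous_at_eps_delta using e by (metis divide_pos_pos mult_pos_pos pi_gt_zero zero_less_numeral)
    obtain N where N: "\<And>n. n \<ge> N \<Longrightarrow> r n < d" using LIMSEQ_D[OF r(1) d(1)] by fastforce
    show "\<exists>no. \<forall>n\<ge>no. norm ((\<integral>z. \<Phi> z * of_real (moll w (r n) z) \<partial>lborel) - pi * \<Phi> w) < e"
    proof (intro exI[of _ N] allI impI)
      fix n assume n: "n \<ge> N"
      have p: "pi * \<Phi> w = (\<integral>z. \<Phi> w * of_real (moll w (r n) z) \<partial>lborel)"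
        using integral_moll(2)[OF r(2), of w n] by simp
      have "(\<integral>z. \<Phi> z * of_real (moll w (r n) z) \<partial>lborel) - pi * \<Phi> w =
        (\<integral>z. (\<Phi> z - \<Phi> w) * of_real (moll w (r n) z) \<partial>lborel)"
        unfolding p using ii[of n] i[OF r(2) continuous_on_const]
        by (subst Bochner_Integration.integral_diff[symmetric]) (auto simp: algebra_simps)
      also have "norm \<dots> \<le> (\<integral>z. e / (2 * pi) * moll w (r n) z \<partial>lborel)"
      proof (rule Bochner_Integration.integral_norm_bound_integral)
        show "integrable lborel (\<lambda>z. (\<Phi> z - \<Phi> w) * of_real (moll w (r n) z))"
          by (intro i[OF r(2), of "\<lambda>z. \<Phi> z - \<Phi> w"] continuous_intros c)
        show "integrable lborel (\<lambda>z. e / (2 * pi) * moll w (r n) z)"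
          using integral_moll(1)[OF r(2)] by (rule integrable_mult_right)
        fix z
        show "norm ((\<Phi> z - \<Phi> w) * of_real (moll w (r n) z)) \<le> e / (2 * pi) * moll w (r n) z"
        proof (cases "cmod (z - w) < r n")
          case True
          then have "cmod (\<Phi> z - \<Phi> w) \<le> e / (2 * pi)"
            using d(2)[of z] N[OF n] by (simp add: dist_norm less_imp_le)
          from mult_right_mono[OF this moll_nonneg[of w "r n" z]] show ?thesis
            using moll_nonneg[of w "r n" z] by (simp add: norm_mult)
        next
          case False then show ?thesis using moll_eq_0[OF r(2), of n z w] by simp
        qed
      qed
      also have "\<dots> = e / 2" using integral_moll(2)[OF r(2), of w n] by simp
      also have "\<dots> < e" using e by simp
      finally show "norm ((\<integral>z. \<Phi> z * of_real (moll w (r n) z) \<partial>lborel) - pi * \<Phi> w) < e" .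
    qed
  qed
qed

lemma rstep_measurable[measurable]: "rstep w r \<in> borel_measurable borel"
proof -
  have [measurable]: "step \<in> borel_measurable borel"
    by (intro borel_measurable_continuous_onI continuous_on_step)
  show ?thesis unfolding rstep_def[abs_def] by measurable
qed

text \<open>The Cauchy kernel is regularized by the cutoff. The integral of \<open>dbar\<close> of
  \<open>\<Phi> z * rstep w r z / (z - w)\<close> vanishes, and the product rule splits it into the
  regularized Cauchy integral and the average of \<open>\<Phi>\<close> against
  \<open>moll w r\<close>. As r tends to 0, the mass pi of the mollifier gives the right-hand
  side.\<close>

theorem cauchy_pompeiu:
  fixes \<Phi> :: "complex \<Rightarrow> complex"
  assumes s: "smooth_on UNIV \<Phi>" and R: "\<And>z. R \<le> cmod z \<Longrightarrow> \<Phi> z = 0"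
  shows "integrable lborel (\<lambda>z. dbar \<Phi> z * inverse (z - w))"
    "(\<integral>z. dbar \<Phi> z * inverse (z - w) \<partial>lborel) = - (pi * \<Phi> w)"
proof -
  let ?r = "\<lambda>n. inverse (real (Suc n))"
  let ?s = "\<lambda>n z. dbar \<Phi> z * (of_real (rstep w (?r n) z) * inverse (z - w))"
  have r: "?r \<longlonglongrightarrow> 0" "\<And>n. ?r n > 0" using LIMSEQ_inverse_real_of_nat by auto
  have c: "continuous_on UNIV \<Phi>" "continuous_on UNIV (dbar \<Phi>)"
    using s smooth_on_dbar[OF open_UNIV s] by (auto intro: smooth_on_continuous)
  have [measurable]: "\<Phi> \<in> borel_measurable borel" "dbar \<Phi> \<in> borel_measurable borel"
    using c by (auto intro!: borel_measurable_continuous_onI)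
  have D0: "dbar \<Phi> z = 0" if "R < cmod z" for z
  proof -
    have "dbar \<Phi> z = dbar (\<lambda>_. 0) z"
    proof (rule dbar_cong_open)
      show "open {z. R < cmod z}" by (intro open_Collect_less continuous_intros)
    qed (use that R in auto)
    then show ?thesis by (simp add: dbar_const)
  qed
  obtain B where B: "B > 0" "\<And>z. z \<in> cball 0 R \<Longrightarrow> norm (dbar \<Phi> z) \<le> B"
    using continuous_bounded_cball[OF continuous_on_subset[OF c(2) subset_UNIV], of 0 R] by auto
  let ?W = "\<lambda>z. B * (indicator (cball 0 R) z * (1 / cmod (z - w)))"
  have bd: "norm (dbar \<Phi> z * (of_real x * inverse (z - w))) \<le> ?W z" if "0 \<le> x" "x \<le> 1" for z x
  proof (cases "z \<in> cball 0 R")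
    case True
    have "norm (dbar \<Phi> z * (of_real x * inverse (z - w))) =
      cmod (dbar \<Phi> z) * (x * (1 / cmod (z - w)))"
      using that by (simp add: norm_mult norm_inverse divide_inverse)
    also have "\<dots> \<le> B * (1 * (1 / cmod (z - w)))"
      using that B(2)[OF True] B(1) by (intro mult_mono) auto
    finally show ?thesis using True by simp
  next
    case False then show ?thesis using D0[of z] by simp
  qed
  have lim: "(\<lambda>n. ?s n z) \<longlonglongrightarrow> dbar \<Phi> z * inverse (z - w)" for z
  proof (cases "z = w")
    case False
    then have "eventually (\<lambda>n. ?r n < cmod (z - w)) sequentially"
      using order_tendstoD(2)[OF r(1), of "cmod (z - w)"] by simp
    then have "eventually (\<lambda>n. ?s n z = dbar \<Phi> z * inverse (z - w)) sequentially"
      by eventually_elim (use r(2) in \<open>simp add: rstep_eq_1\<close>)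
    then show ?thesis by (rule tendsto_eventually)
  qed simp
  have i: "(\<integral>z. ?s n z \<partial>lborel) = - (\<integral>z. \<Phi> z * of_real (moll w (?r n) z) \<partial>lborel)" for n
  proof -
    let ?g = "\<lambda>z. of_real (rstep w (?r n) z) * inverse (z - w)"
    have g: "smooth_on UNIV ?g" by (rule smooth_on_rstep_pole) (use r in auto)
    have e: "dbar (\<lambda>z. \<Phi> z * ?g z) z = ?s n z + \<Phi> z * of_real (moll w (?r n) z)" for z
    proof -
      have "dbar (\<lambda>z. \<Phi> z * ?g z) z = dbar \<Phi> z * ?g z + \<Phi> z * dbar ?g z"
        by (rule dbar_mult) (use s g in \<open>auto intro: smooth_on_differentiable\<close>)
      also have "dbar ?g z = of_real (moll w (?r n) z)"
        using r(2)[of n] moll_eq_0'[OF r(2)[of n], of w w]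
        by (subst dbar_rstep_pole) (simp_all add: mult.assoc, cases "z = w", simp_all)
      finally show ?thesis .
    qed
    have "smooth_on UNIV (\<lambda>z. \<Phi> z * ?g z)" by (intro smooth_on_mult s g open_UNIV)
    note * = integral_dbar_compact_support[OF this, of R]
    have "integrable lborel (?s n)"
      by (rule Bochner_Integration.integrable_bound[OF integrable_inverse_dist[of B 0 R w]])
         (measurable, intro AE_I2 order_trans[OF bd[OF rstep_bounds]], simp add: divide_right_mono)
    then have "(\<integral>z. ?s n z \<partial>lborel) + (\<integral>z. \<Phi> z * of_real (moll w (?r n) z) \<partial>lborel) =
       (\<integral>z. dbar (\<lambda>z. \<Phi> z * ?g z) z \<partial>lborel)"
      unfolding e using integral_moll_tendsto(1)[OF c(1) r]
      by (subst Bochner_Integration.integral_add) auto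
    also have "\<dots> = 0" using * R by simp
    finally show ?thesis by (simp add: add_eq_0_iff2)
  qed
  have ms: "?s n \<in> borel_measurable lborel" for n by measurable
  have mf: "(\<lambda>z. dbar \<Phi> z * inverse (z - w)) \<in> borel_measurable lborel" by measurable
  show "integrable lborel (\<lambda>z. dbar \<Phi> z * inverse (z - w))"
    by (rule integrable_dominated_convergence[OF mf ms integrable_inverse_dist[of B 0 R w]
        AE_I2[OF lim] AE_I2[OF bd[OF rstep_bounds]]])
  have "(\<lambda>n. \<integral>z. ?s n z \<partial>lborel) \<longlonglongrightarrow> (\<integral>z. dbar \<Phi> z * inverse (z - w) \<partial>lborel)"
    by (rule integral_dominated_convergence[OF mf ms integrable_inverse_dist[of B 0 R w]
        AE_I2[OF lim] AE_I2[OF bd[OF rstep_bounds]]])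
  moreover have "(\<lambda>n. \<integral>z. ?s n z \<partial>lborel) \<longlonglongrightarrow> - (pi * \<Phi> w)"
    unfolding i by (intro tendsto_minus integral_moll_tendsto(2)[OF c(1) r])
  ultimately show "(\<integral>z. dbar \<Phi> z * inverse (z - w) \<partial>lborel) = - (pi * \<Phi> w)"
    by (rule LIMSEQ_unique)
qed

text \<open>Cauchy-Pompeiu for \<open>h z * (1 - rstep \<zeta> r z)\<close>, which equals h near
  \<zeta>: since h is holomorphic, \<open>dbar\<close> falls on the cutoff alone and turns the
  Cauchy kernel into the mollifier.\<close>

lemma holomorphic_mean_value_moll:
  fixes h :: "complex \<Rightarrow> complex"
  assumes U: "open U" and h: "h holomorphic_on U" and r: "r > 0" "cball \<zeta> r \<subseteq> U"
  shows "integrable lborel (\<lambda>z. h z * of_real (moll \<zeta> r z))"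
    "(\<integral>z. h z * of_real (moll \<zeta> r z) \<partial>lborel) = pi * h \<zeta>"
proof -
  let ?\<Phi> = "\<lambda>z. h z * of_real (1 - rstep \<zeta> r z)"
  have s: "smooth_on UNIV ?\<Phi>"
    by (rule smooth_on_cutoff[OF U smooth_on_holomorphic[OF U h] r])
  have z: "?\<Phi> z = 0" if "cmod \<zeta> + r \<le> cmod z" for z
  proof -
    have "r \<le> cmod (z - \<zeta>)" using that norm_triangle_ineq2[of z \<zeta>] by simp
    then show ?thesis using rstep_eq_1[OF r(1)] by simp
  qed
  have e: "dbar ?\<Phi> z * inverse (z - \<zeta>) = - (h z * of_real (moll \<zeta> r z))" for z
  proof (cases "z \<in> U")
    case True
    then have "(h has_field_derivative deriv h z) (at z)" using h U holomorphic_derivI by blast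
    note h' = dbar_holomorphic[OF this] partials_frechet(1)[OF partials_holomorphic[OF this]]
    have s1: "(\<lambda>z. complex_of_real (1 - rstep \<zeta> r z)) differentiable (at z)"
      using smooth_on_differentiable[OF smooth_on_rstep[OF r(1)] UNIV_I]
      unfolding of_real_diff by (intro differentiable_diff differentiable_const)
    have "dbar ?\<Phi> z = dbar h z * of_real (1 - rstep \<zeta> r z) + h z * dbar (\<lambda>z. of_real (1 - rstep \<zeta> r z)) z"
      by (rule dbar_mult[OF h'(2) s1])
    also have "dbar (\<lambda>z. of_real (1 - rstep \<zeta> r z)) z = - (of_real (moll \<zeta> r z) * (z - \<zeta>))"
    proof -
      have "dbar (\<lambda>z. 1 + (-1) * complex_of_real (rstep \<zeta> r z)) z =
        dbar (\<lambda>_. 1) z + (dbar (\<lambda>_. -1) z * of_real (rstep \<zeta> r z) + (-1) * dbar (\<lambda>z. of_real (rstep \<zeta> r z)) z)"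
        using smooth_on_differentiable[OF smooth_on_rstep[OF r(1)] UNIV_I]
        by (subst dbar_add, simp, simp, subst dbar_mult) auto
      then show ?thesis by (simp add: dbar_const dbar_rstep_moll)
    qed
    finally show ?thesis using h'(1) moll_eq_0'[OF r(1), of z \<zeta>] r by (cases "z = \<zeta>") (auto simp: mult_ac)
  next
    case False
    have "dbar ?\<Phi> z = dbar (\<lambda>_. 0) z"
    proof (rule dbar_cong_open)
      show "open (- cball \<zeta> r)" by (intro open_Compl closed_cball)
    qed (use False r in \<open>auto simp: rstep_eq_1 dist_norm norm_minus_commute\<close>)
    moreover have "moll \<zeta> r z = 0"
      using False r by (intro moll_eq_0) (force simp: dist_norm norm_minus_commute subset_iff)+
    ultimately show ?thesis by (simp add: dbar_const)
  qed
  have z0: "rstep \<zeta> r \<zeta> = 0" using r(1) by (intro rstep_eq_0) auto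
  show "integrable lborel (\<lambda>z. h z * of_real (moll \<zeta> r z))"
    "(\<integral>z. h z * of_real (moll \<zeta> r z) \<partial>lborel) = pi * h \<zeta>"
    using cauchy_pompeiu[OF s z, where w=\<zeta>] z0 unfolding e by simp_all
qed

section \<open>Convexity estimates\<close>

text \<open>Young's inequality with the coefficients replaced by 1: either x is at most l, or
  \<open>x powr (1 - p)\<close> is at most \<open>l powr (1 - p)\<close>. The free scale l is
  optimized later.\<close>

lemma le_Young:
  fixes x l p :: real
  assumes "x \<ge> 0" "l > 0" "p \<ge> 1"
  shows "x \<le> l + l powr (1 - p) * x powr p"
proof (cases "x \<le> l")
  case True
  then show ?thesis by (simp add: add_increasing2)
next
  case False
  then have x: "x > l" "x > 0" using assms by auto
  have "x = x powr (1 - p) * x powr p" using x by (simp flip: powr_add)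
  also have "\<dots> \<le> l powr (1 - p) * x powr p"
    using x assms by (intro mult_right_mono powr_mono2') auto
  finally show ?thesis using assms by linarith
qed

lemma nn_integral_Young:
  assumes [measurable]: "k \<in> borel_measurable M" "f \<in> borel_measurable M"
    and nn: "\<And>x. k x \<ge> 0" "\<And>x. f x \<ge> (0::real)" and l: "l > 0" "p \<ge> 1"
  shows "(\<integral>\<^sup>+x. ennreal (k x * f x) \<partial>M) \<le>
    ennreal l * (\<integral>\<^sup>+x. ennreal (k x) \<partial>M) + ennreal (l powr (1 - p)) * (\<integral>\<^sup>+x. ennreal (k x * f x powr p) \<partial>M)"
proof -
  have "(\<integral>\<^sup>+x. ennreal (k x * f x) \<partial>M) \<le>
    (\<integral>\<^sup>+x. ennreal l * ennreal (k x) + ennreal (l powr (1 - p)) * ennreal (k x * f x powr p) \<partial>M)"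
  proof (intro nn_integral_mono)
    fix x
    have "k x * f x \<le> k x * (l + l powr (1 - p) * f x powr p)"
      by (intro mult_left_mono le_Young nn l)
    also have "\<dots> = l * k x + l powr (1 - p) * (k x * f x powr p)" by (simp add: algebra_simps)
    finally have "ennreal (k x * f x) \<le> ennreal (l * k x + l powr (1 - p) * (k x * f x powr p))"
      by (rule ennreal_leI)
    then show "ennreal (k x * f x) \<le> ennreal l * ennreal (k x) + ennreal (l powr (1 - p)) * ennreal (k x * f x powr p)"
      using l nn by (simp add: ennreal_mult ennreal_plus)
  qed
  also have "\<dots> = ennreal l * (\<integral>\<^sup>+x. ennreal (k x) \<partial>M) +
      ennreal (l powr (1 - p)) * (\<integral>\<^sup>+x. ennreal (k x * f x powr p) \<partial>M)"
    by (subst nn_integral_add) (auto simp: nn_integral_cmult)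
  finally show ?thesis .
qed

lemma jensen_finite:
  assumes m[measurable]: "k \<in> borel_measurable M" "f \<in> borel_measurable M"
    and nn: "\<And>x. k x \<ge> 0" "\<And>x. f x \<ge> (0::real)" and p: "p \<ge> 1"
    and A: "A > 0" "(\<integral>\<^sup>+x. ennreal (k x) \<partial>M) \<le> ennreal A"
    and fin: "(\<integral>\<^sup>+x. ennreal (k x * f x powr p) \<partial>M) < \<infinity>"
  shows "(\<integral>\<^sup>+x. ennreal (k x * f x) \<partial>M) < \<infinity>"
proof -
  have "(\<integral>\<^sup>+x. ennreal (k x * f x) \<partial>M) \<le> ennreal 1 * (\<integral>\<^sup>+x. ennreal (k x) \<partial>M) +
      ennreal (1 powr (1 - p)) * (\<integral>\<^sup>+x. ennreal (k x * f x powr p) \<partial>M)"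
    by (rule nn_integral_Young[OF m nn _ p]) auto
  also have "\<dots> < \<infinity>"
    using le_less_trans[OF A(2) ennreal_less_top] fin by (simp add: ennreal_mult_less_top less_top)
  finally show ?thesis .
qed

text \<open>Jensen's inequality for the measure with density k, of mass at most A, up to the factor
  \<open>2 powr p\<close> lost by the crude form of Young's inequality. The left side goes through
  \<open>enn2real\<close>; the inner integral can be infinite only when the right side is.\<close>

lemma jensen_nn_integral:
  assumes m[measurable]: "k \<in> borel_measurable M" "f \<in> borel_measurable M"
    and nn: "\<And>x. k x \<ge> 0" "\<And>x. f x \<ge> (0::real)" and p: "p \<ge> 1"
    and A: "A > 0" "(\<integral>\<^sup>+x. ennreal (k x) \<partial>M) \<le> ennreal A"
  shows "ennreal (enn2real (\<integral>\<^sup>+x. ennreal (k x * f x) \<partial>M) powr p) \<le>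
     ennreal (2 powr p * A powr (p - 1)) * (\<integral>\<^sup>+x. ennreal (k x * f x powr p) \<partial>M)"
proof (cases "(\<integral>\<^sup>+x. ennreal (k x * f x powr p) \<partial>M) = \<infinity>")
  case True
  then show ?thesis using A by (simp add: ennreal_mult_top)
next
  case False
  then have "(\<integral>\<^sup>+x. ennreal (k x * f x powr p) \<partial>M) < \<infinity>" by (simp add: less_top)
  note T = jensen_finite[OF m nn p A this]
  from False obtain B where B: "(\<integral>\<^sup>+x. ennreal (k x * f x powr p) \<partial>M) = ennreal B" "B \<ge> 0"
    by (cases "\<integral>\<^sup>+x. ennreal (k x * f x powr p) \<partial>M") auto
  from T obtain t where t: "(\<integral>\<^sup>+x. ennreal (k x * f x) \<partial>M) = ennreal t" "t \<ge> 0"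
    by (cases "\<integral>\<^sup>+x. ennreal (k x * f x) \<partial>M") auto
  have le: "t \<le> l * A + l powr (1 - p) * B" if l: "l > 0" for l
  proof -
    have "ennreal t \<le> ennreal l * (\<integral>\<^sup>+x. ennreal (k x) \<partial>M) + ennreal (l powr (1 - p)) * ennreal B"
      using nn_integral_Young[OF m nn l p] by (simp add: t B)
    also have "\<dots> \<le> ennreal l * ennreal A + ennreal (l powr (1 - p)) * ennreal B"
      by (intro add_mono mult_left_mono A) auto
    also have "\<dots> = ennreal (l * A + l powr (1 - p) * B)"
      using l A B by (simp add: ennreal_mult ennreal_plus)
    finally show ?thesis using l A B by (subst (asm) ennreal_le_iff) auto
  qed
  have "t powr p \<le> 2 powr p * A powr (p - 1) * B"
  proof (cases "B = 0")
    case True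
    have "t \<le> 0"
    proof (rule field_le_epsilon)
      fix e :: real assume "e > 0"
      then show "t \<le> 0 + e" using le[of "e / A"] A True by simp
    qed
    then show ?thesis using t True by simp
  next
    case False
    then have B0: "B > 0" using B by simp
    \<comment> \<open>The scale at which the two terms of Young's inequality are equal. If B is 0
      there is no such scale, and letting l tend to 0 shows that t is 0.\<close>
    define l where "l = (B / A) powr (1 / p)"
    have l: "l > 0" using B0 A by (simp add: l_def)
    have lp: "l powr p = B / A" using p B0 A by (simp add: l_def powr_powr)
    have "l powr (1 - p) * B = l * A"
      using l lp A B0 by (simp add: powr_diff field_simps)
    then have "t \<le> 2 * (l * A)" using le[OF l] by (simp add: mult.commute)
    then have "t powr p \<le> (2 * (l * A)) powr p" using t p by (intro powr_mono2) auto
    also have "\<dots> = 2 powr p * ((B / A) * A powr p)"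
      using l A lp by (simp add: powr_mult)
    also have "\<dots> = 2 powr p * A powr (p - 1) * B"
      using A by (simp add: powr_diff)
    finally show ?thesis .
  qed
  then show ?thesis unfolding t B using t A B
    by (subst ennreal_mult[symmetric]) (auto intro!: ennreal_leI)
qed

lemma powr_add_le:
  fixes x y p :: real
  assumes "x \<ge> 0" "y \<ge> 0" "p \<ge> 1"
  shows "(x + y) powr p \<le> 2 powr p * (x powr p + y powr p)"
proof -
  have "(x + y) powr p \<le> (2 * max x y) powr p" using assms by (intro powr_mono2) auto
  also have "\<dots> = 2 powr p * (max x y) powr p" using assms by (simp add: powr_mult)
  also have "\<dots> \<le> 2 powr p * (x powr p + y powr p)" by (intro mult_left_mono) (auto simp: max_def)
  finally show ?thesis .
qed

text \<open>Holds without integrability of f, because the Bochner integral is then 0 by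
  convention.\<close>

lemma norm_integral_le_enn2real:
  fixes f :: "'a \<Rightarrow> 'b::{banach, second_countable_topology}"
  assumes "(\<integral>\<^sup>+x. ennreal (norm (f x)) \<partial>M) < \<infinity>"
  shows "norm (integral\<^sup>L M f) \<le> enn2real (\<integral>\<^sup>+x. ennreal (norm (f x)) \<partial>M)"
proof (cases "integrable M f")
  case True
  from integral_norm_bound_ennreal[OF this] assms show ?thesis
    by (metis enn2real_ennreal enn2real_mono infinity_ennreal_def norm_ge_zero)
next
  case False
  then show ?thesis by (simp add: not_integrable_integral_eq)
qed

lemma holomorphic_indicator_measurable:
  assumes "h holomorphic_on U" "open U"
  shows "(\<lambda>z. indicator U z *\<^sub>R h z) \<in> borel_measurable borel"
    "(\<lambda>z. indicator U z * cmod (h z)) \<in> borel_measurable borel"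
proof -
  have c: "continuous_on U h" using assms holomorphic_on_imp_continuous_on by blast
  then show "(\<lambda>z. indicator U z *\<^sub>R h z) \<in> borel_measurable borel"
    by (intro borel_measurable_continuous_on_indicator) (use assms in auto)
  have "(\<lambda>z. indicator U z *\<^sub>R cmod (h z)) \<in> borel_measurable borel"
    by (intro borel_measurable_continuous_on_indicator continuous_intros c) (use assms in auto)
  then show "(\<lambda>z. indicator U z * cmod (h z)) \<in> borel_measurable borel" by simp
qed

text \<open>Subharmonicity of \<open>\<bar>h\<bar> powr p\<close> in the form of a mean value
  inequality: Jensen applied to the smooth mean value formula. The mollifier has radius r/2 so that
  its closed support lies in the open disc.\<close>

lemma holomorphic_norm_powr_le:
  assumes p: "p \<ge> 1"
  obtains C where "C > 0" "\<And>h \<zeta> r. h holomorphic_on ball \<zeta> r \<Longrightarrow> r > 0 \<Longrightarrow>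
    ennreal (cmod (h \<zeta>) powr p) \<le>
      ennreal (C / r\<^sup>2) * (\<integral>\<^sup>+z\<in>ball \<zeta> r. ennreal (cmod (h z) powr p) \<partial>lborel)"
proof -
  obtain B where B: "B > 0" "\<And>w r z. moll w r z \<le> B / r\<^sup>2" using moll_bounded by blast
  \<comment> \<open>The first two factors are the Jensen constant for a kernel of mass pi,
    \<open>4 * B\<close> comes from the bound on the mollifier of radius r/2, and
    \<open>pi powr (- p)\<close> removes the factor pi of the mean value formula.\<close>
  define C where "C = 2 powr p * pi powr (p - 1) * (4 * B) * pi powr (- p)"
  have C: "C > 0" using B by (simp add: C_def)
  show thesis
  proof (rule that[OF C])
    fix h :: "complex \<Rightarrow> complex" and \<zeta> :: complex and r :: real
    assume h: "h holomorphic_on ball \<zeta> r" and r: "r > 0"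
    let ?f = "\<lambda>z. indicator (ball \<zeta> r) z * cmod (h z)"
    have m[measurable]: "?f \<in> borel_measurable borel"
      by (rule holomorphic_indicator_measurable[OF h open_ball])
    have mv: "integrable lborel (\<lambda>z. h z * of_real (moll \<zeta> (r/2) z))"
      "(\<integral>z. h z * of_real (moll \<zeta> (r/2) z) \<partial>lborel) = pi * h \<zeta>"
      by (rule holomorphic_mean_value_moll[OF open_ball h]; use r in \<open>auto simp: dist_norm\<close>)+
    have e: "norm (h z * of_real (moll \<zeta> (r/2) z)) = moll \<zeta> (r/2) z * ?f z" for z
    proof (cases "z \<in> ball \<zeta> r")
      case True then show ?thesis by (simp add: norm_mult moll_nonneg mult.commute)
    next
      case False then show ?thesis
        using moll_eq_0[of "r/2" z \<zeta>] r by (simp add: dist_norm norm_minus_commute)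
    qed
    have fin: "(\<integral>\<^sup>+z. ennreal (moll \<zeta> (r/2) z * ?f z) \<partial>lborel) < \<infinity>"
      using mv(1) unfolding integrable_iff_bounded e by simp
    have "pi * cmod (h \<zeta>) = norm (\<integral>z. h z * of_real (moll \<zeta> (r/2) z) \<partial>lborel)"
      by (simp add: mv(2) norm_mult)
    also have "\<dots> \<le> enn2real (\<integral>\<^sup>+z. ennreal (norm (h z * of_real (moll \<zeta> (r/2) z))) \<partial>lborel)"
      by (rule norm_integral_le_enn2real) (use fin in \<open>simp only: e\<close>)
    finally have le: "pi * cmod (h \<zeta>) \<le> enn2real (\<integral>\<^sup>+z. ennreal (moll \<zeta> (r/2) z * ?f z) \<partial>lborel)"
      by (simp only: e)
    have "ennreal ((pi * cmod (h \<zeta>)) powr p) \<le>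
        ennreal (enn2real (\<integral>\<^sup>+z. ennreal (moll \<zeta> (r/2) z * ?f z) \<partial>lborel) powr p)"
      using le p by (intro ennreal_leI powr_mono2) auto
    also have "\<dots> \<le> ennreal (2 powr p * pi powr (p - 1)) * (\<integral>\<^sup>+z. ennreal (moll \<zeta> (r/2) z * ?f z powr p) \<partial>lborel)"
      by (rule jensen_nn_integral) (use r p in \<open>auto simp: nn_integral_moll moll_nonneg\<close>)
    also have "(\<integral>\<^sup>+z. ennreal (moll \<zeta> (r/2) z * ?f z powr p) \<partial>lborel) \<le>
        (\<integral>\<^sup>+z. ennreal (4 * B / r\<^sup>2) * (ennreal (?f z powr p)) \<partial>lborel)"
    proof (intro nn_integral_mono)
      fix z
      have "moll \<zeta> (r/2) z * ?f z powr p \<le> (4 * B / r\<^sup>2) * ?f z powr p"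
        using B(2)[of \<zeta> "r/2" z] by (intro mult_right_mono) (auto simp: power_divide mult.commute)
      then show "ennreal (moll \<zeta> (r/2) z * ?f z powr p) \<le> ennreal (4 * B / r\<^sup>2) * ennreal (?f z powr p)"
        using B by (subst ennreal_mult[symmetric]) (auto intro!: ennreal_leI)
    qed
    also have "\<dots> = ennreal (4 * B / r\<^sup>2) * (\<integral>\<^sup>+z. ennreal (?f z powr p) \<partial>lborel)"
      by (rule nn_integral_cmult) measurable
    also have "(\<integral>\<^sup>+z. ennreal (?f z powr p) \<partial>lborel) =
       (\<integral>\<^sup>+z\<in>ball \<zeta> r. ennreal (cmod (h z) powr p) \<partial>lborel)"
      by (intro nn_integral_cong) (auto simp: indicator_def)
    finally have "ennreal ((pi * cmod (h \<zeta>)) powr p) \<le> ennreal (2 powr p * pi powr (p - 1)) *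
       (ennreal (4 * B / r\<^sup>2) * (\<integral>\<^sup>+z\<in>ball \<zeta> r. ennreal (cmod (h z) powr p) \<partial>lborel))"
      by (simp add: mult_left_mono)
    then have "ennreal (pi powr (- p)) * ennreal ((pi * cmod (h \<zeta>)) powr p) \<le>
      ennreal (pi powr (- p)) * (ennreal (2 powr p * pi powr (p - 1)) *
       (ennreal (4 * B / r\<^sup>2) * (\<integral>\<^sup>+z\<in>ball \<zeta> r. ennreal (cmod (h z) powr p) \<partial>lborel)))"
      by (rule mult_left_mono) simp
    moreover have "ennreal (pi powr (- p)) * ennreal ((pi * cmod (h \<zeta>)) powr p) = ennreal (cmod (h \<zeta>) powr p)"
      by (subst ennreal_mult[symmetric]) (auto simp: powr_mult powr_minus)
    moreover have "ennreal (pi powr (- p)) * (ennreal (2 powr p * pi powr (p - 1)) *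
       (ennreal (4 * B / r\<^sup>2) * x)) = ennreal (C / r\<^sup>2) * x" for x
    proof -
      have "ennreal a * (ennreal b * (ennreal c * x)) = ennreal (a * b * c) * x"
        if "a \<ge> 0" "b \<ge> 0" "c \<ge> 0" for a b c
        using that by (simp add: ennreal_mult mult.assoc)
      moreover have "pi powr (- p) * (2 powr p * pi powr (p - 1)) * (4 * B / r\<^sup>2) = C / r\<^sup>2"
        by (simp add: C_def mult_ac)
      ultimately show ?thesis using B by (metis divide_nonneg_nonneg mult_nonneg_nonneg
          powr_ge_zero zero_le_numeral zero_le_power2 less_imp_le)
    qed
    ultimately show "ennreal (cmod (h \<zeta>) powr p) \<le>
      ennreal (C / r\<^sup>2) * (\<integral>\<^sup>+z\<in>ball \<zeta> r. ennreal (cmod (h z) powr p) \<partial>lborel)"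
      by simp
  qed
qed

section \<open>Geometry of the disk\<close>

lemma cmod_one_minus_sq:
  "(cmod (1 - cnj w * z))\<^sup>2 = (cmod (z - w))\<^sup>2 + (1 - (cmod z)\<^sup>2) * (1 - (cmod w)\<^sup>2)"
  unfolding cmod_power2 by (simp add: algebra_simps power2_eq_square)

lemma cmod_one_minus_commute: "cmod (1 - cnj w * z) = cmod (1 - cnj z * w)"
proof -
  have "cnj (1 - cnj w * z) = 1 - cnj z * w" by (simp add: mult.commute)
  then show ?thesis by (metis complex_mod_cnj)
qed

lemma one_minus_sq_pos: "cmod z < 1 \<Longrightarrow> 0 < 1 - (cmod z)\<^sup>2"
  by (simp add: abs_square_less_1)

lemma one_minus_sq_le: "1 - (cmod z)\<^sup>2 \<le> 2 - 2 * cmod z"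
  using zero_le_power2[of "1 - cmod z"] unfolding power2_diff by simp

lemma cmod_one_minus_ge:
  assumes "cmod z < 1" "cmod w < 1"
  shows "1 - cmod z \<le> cmod (1 - cnj w * z)" "1 - cmod w \<le> cmod (1 - cnj w * z)"
    "1 - (cmod z)\<^sup>2 \<le> 2 * cmod (1 - cnj w * z)" "1 - (cmod w)\<^sup>2 \<le> 2 * cmod (1 - cnj w * z)"
    "cmod (z - w) \<le> cmod (1 - cnj w * z)" "0 < cmod (1 - cnj w * z)" "1 - cnj w * z \<noteq> 0"
    "cmod (1 - cnj w * z) \<le> 2"
proof -
  have a: "1 - cmod w * cmod z \<le> cmod (1 - cnj w * z)"
    using norm_triangle_ineq2[of 1 "cnj w * z"] by (simp add: norm_mult)
  have b: "cmod w * cmod z \<le> cmod z" "cmod w * cmod z \<le> cmod w"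
    using assms by (auto simp: mult_left_le mult_left_le_one_le)
  show c: "1 - cmod z \<le> cmod (1 - cnj w * z)" "1 - cmod w \<le> cmod (1 - cnj w * z)"
    using a b by auto
  show "1 - (cmod z)\<^sup>2 \<le> 2 * cmod (1 - cnj w * z)" "1 - (cmod w)\<^sup>2 \<le> 2 * cmod (1 - cnj w * z)"
    using c one_minus_sq_le[of z] one_minus_sq_le[of w] by (smt (verit))+
  show "0 < cmod (1 - cnj w * z)" using c(1) assms by linarith
  then show "1 - cnj w * z \<noteq> 0" by auto
  have "0 \<le> (1 - (cmod z)\<^sup>2) * (1 - (cmod w)\<^sup>2)"
    using one_minus_sq_pos assms by (intro mult_nonneg_nonneg) (auto intro: less_imp_le)
  then have "(cmod (z - w))\<^sup>2 \<le> (cmod (1 - cnj w * z))\<^sup>2" unfolding cmod_one_minus_sq by simp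
  then show "cmod (z - w) \<le> cmod (1 - cnj w * z)" by (rule power2_le_imp_le) simp
  have "cmod w * cmod z \<le> 1" using b assms by linarith
  then show "cmod (1 - cnj w * z) \<le> 2"
    using norm_triangle_ineq4[of 1 "cnj w * z"] by (simp add: norm_mult)
qed

lemma pseudo_hyp_eq: "pseudo_hyp z w = cmod (z - w) / cmod (1 - cnj w * z)"
  by (simp add: pseudo_hyp_def norm_divide)

lemma pseudo_hyp_commute: "pseudo_hyp z w = pseudo_hyp w z"
  unfolding pseudo_hyp_eq using cmod_one_minus_commute[of w z] by (simp add: norm_minus_commute)

lemma pseudo_hyp_bounds:
  assumes "cmod z < 1" "cmod w < 1"
  shows "0 \<le> pseudo_hyp z w" "pseudo_hyp z w \<le> 1"
  using cmod_one_minus_ge[OF assms] by (auto simp: pseudo_hyp_eq)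

lemma one_minus_pseudo_hyp_sq:
  assumes "cmod z < 1" "cmod w < 1"
  shows "1 - (pseudo_hyp z w)\<^sup>2 = (1 - (cmod z)\<^sup>2) * (1 - (cmod w)\<^sup>2) / (cmod (1 - cnj w * z))\<^sup>2"
proof -
  have "(cmod (1 - cnj w * z))\<^sup>2 \<noteq> 0" using cmod_one_minus_ge(7)[OF assms] by simp
  then show ?thesis using cmod_one_minus_sq[of w z]
    by (simp add: pseudo_hyp_eq power_divide field_simps)
qed

section \<open>Hyperbolic discs and separated sequences\<close>

text \<open>Comparable to a pseudo-hyperbolic disc, but Euclidean with centre a, so that its area is
  explicit and the radial cutoffs fit into it.\<close>

definition hball :: "real \<Rightarrow> complex \<Rightarrow> complex set" where
  "hball \<kappa> a = ball a (\<kappa> * (1 - (cmod a)\<^sup>2))"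

text \<open>Everything follows from one perturbation estimate: moving a to z changes
  \<open>1 - cnj w * a\<close> by at most \<open>(1 - \<bar>a\<bar>^2) / 8\<close>, hence by at most
  a quarter of its modulus, because \<open>1 - \<bar>a\<bar>^2\<close> is at most
  \<open>2 * \<bar>1 - cnj w * a\<bar>\<close>. The case w = a compares Euclidean and
  pseudo-hyperbolic distance.\<close>

lemma hball_props:
  assumes k: "0 < \<kappa>" "\<kappa> \<le> 1/8" and a: "cmod a < 1" and z: "z \<in> hball \<kappa> a"
  shows "cmod z < 1" "cmod (z - a) < \<kappa> * (1 - (cmod a)\<^sup>2)"
    "\<And>w. cmod w < 1 \<Longrightarrow> 3/4 * cmod (1 - cnj w * a) \<le> cmod (1 - cnj w * z)"
    "\<And>w. cmod w < 1 \<Longrightarrow> cmod (1 - cnj w * z) \<le> 5/4 * cmod (1 - cnj w * a)"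
    "cmod (z - a) \<le> 5/4 * (1 - (cmod a)\<^sup>2) * pseudo_hyp z a"
    "3/4 * (1 - (cmod a)\<^sup>2) * pseudo_hyp z a \<le> cmod (z - a)"
proof -
  define N where "N = 1 - (cmod a)\<^sup>2"
  have za: "cmod (z - a) < \<kappa> * N"
    using z by (simp add: hball_def dist_norm norm_minus_commute N_def)
  then show "cmod (z - a) < \<kappa> * (1 - (cmod a)\<^sup>2)" by (simp add: N_def)
  have n: "0 < N" using one_minus_sq_pos[OF a] by (simp add: N_def)
  have N2: "N \<le> 2 - 2 * cmod a" using one_minus_sq_le[of a] by (simp add: N_def)
  have "\<kappa> * N \<le> 1/8 * N" using k n by (intro mult_right_mono) auto
  then have za8: "cmod (z - a) \<le> N / 8" using za by linarith
  have "cmod z \<le> cmod a + cmod (z - a)" by (metis norm_triangle_sub)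
  then show z1: "cmod z < 1" using za8 N2 a by linarith
  have d: "\<bar>cmod (1 - cnj w * z) - cmod (1 - cnj w * a)\<bar> \<le> cmod (1 - cnj w * a) / 4"
    if w: "cmod w < 1" for w
  proof -
    have "\<bar>cmod (1 - cnj w * z) - cmod (1 - cnj w * a)\<bar> \<le> cmod ((1 - cnj w * z) - (1 - cnj w * a))"
      by (rule norm_triangle_ineq3)
    also have "(1 - cnj w * z) - (1 - cnj w * a) = - (cnj w * (z - a))" by (simp add: algebra_simps)
    also have "cmod (- (cnj w * (z - a))) = cmod w * cmod (z - a)" by (simp add: norm_mult)
    also have "\<dots> \<le> cmod (z - a)" using w by (simp add: mult_left_le_one_le)
    also have "\<dots> \<le> N / 8" by (rule za8)
    also have "N \<le> 2 * cmod (1 - cnj w * a)" using cmod_one_minus_ge(3)[OF a w] by (simp add: N_def)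
    finally show ?thesis by simp
  qed
  show "3/4 * cmod (1 - cnj w * a) \<le> cmod (1 - cnj w * z)"
    "cmod (1 - cnj w * z) \<le> 5/4 * cmod (1 - cnj w * a)" if "cmod w < 1" for w
    using d[OF that] by linarith+
  have aa: "cmod (1 - cnj a * a) = N"
  proof -
    have "1 - cnj a * a = of_real N"
      unfolding N_def by (metis complex_norm_square mult.commute of_real_1 of_real_diff)
    then show ?thesis using n by (simp only: norm_of_real)
  qed
  have D: "3/4 * N \<le> cmod (1 - cnj a * z)" "cmod (1 - cnj a * z) \<le> 5/4 * N"
    using d[OF a] unfolding aa by linarith+
  have e: "cmod (z - a) = cmod (1 - cnj a * z) * pseudo_hyp z a"
    using cmod_one_minus_ge(7)[OF z1 a] by (simp add: pseudo_hyp_eq)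
  show "cmod (z - a) \<le> 5/4 * (1 - (cmod a)\<^sup>2) * pseudo_hyp z a"
    "3/4 * (1 - (cmod a)\<^sup>2) * pseudo_hyp z a \<le> cmod (z - a)"
    unfolding e N_def[symmetric]
    by (rule mult_right_mono[OF D(2) pseudo_hyp_bounds(1)[OF z1 a]]
        mult_right_mono[OF D(1) pseudo_hyp_bounds(1)[OF z1 a]])+
qed

text \<open>Outside the disc, \<open>1 - \<bar>a\<bar>^2\<close> is at most
  \<open>\<bar>z - a\<bar> / \<kappa>\<close>, so the denominator of the pseudo-hyperbolic distance
  is at most \<open>(1 / \<kappa> + 1) * \<bar>z - a\<bar>\<close>.\<close>

lemma pseudo_hyp_ge_off_hball:
  assumes k: "0 < \<kappa>" "\<kappa> \<le> 1/8" and a: "cmod a < 1" and z: "cmod z < 1" "z \<notin> hball \<kappa> a"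
  shows "\<kappa> / 2 \<le> pseudo_hyp z a"
proof -
  have za: "\<kappa> * (1 - (cmod a)\<^sup>2) \<le> cmod (z - a)"
    using z by (simp add: hball_def dist_norm norm_minus_commute)
  have n: "0 < 1 - (cmod a)\<^sup>2" using a by (rule one_minus_sq_pos)
  have "1 - cnj a * z = of_real (1 - (cmod a)\<^sup>2) - cnj a * (z - a)"
  proof -
    have "complex_of_real ((cmod a)\<^sup>2) = cnj a * a" by (metis complex_norm_square mult.commute)
    then show ?thesis by (simp add: algebra_simps)
  qed
  then have "cmod (1 - cnj a * z) \<le> (1 - (cmod a)\<^sup>2) + cmod a * cmod (z - a)"
    using norm_triangle_ineq4[of "of_real (1 - (cmod a)\<^sup>2)" "cnj a * (z - a)"] n
    by (simp only: norm_mult norm_of_real complex_mod_cnj abs_of_pos)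
  also have "\<dots> \<le> cmod (z - a) / \<kappa> + cmod (z - a)"
    using za k a by (intro add_mono) (auto simp: field_simps mult_left_le_one_le)
  finally have "cmod (1 - cnj a * z) * \<kappa> \<le> (cmod (z - a) / \<kappa> + cmod (z - a)) * \<kappa>"
    using k by (intro mult_right_mono) auto
  also have "\<dots> = cmod (z - a) * (1 + \<kappa>)" using k by (simp add: field_simps)
  also have "\<dots> \<le> cmod (z - a) * 2" using k by (intro mult_left_mono) auto
  finally show ?thesis using cmod_one_minus_ge(6)[OF z(1) a] by (simp add: pseudo_hyp_eq field_simps)
qed

lemma separated_hball_disjoint:
  assumes s: "separated Z" and Z: "Z \<subseteq> unit_disk"
  obtains \<kappa> where "0 < \<kappa>" "\<kappa> \<le> 1/8"
    "\<And>a b. a \<in> Z \<Longrightarrow> b \<in> Z \<Longrightarrow> a \<noteq> b \<Longrightarrow> hball \<kappa> a \<inter> hball \<kappa> b = {}"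
proof -
  obtain d where d: "d > 0" "\<And>a b. a \<in> Z \<Longrightarrow> b \<in> Z \<Longrightarrow> a \<noteq> b \<Longrightarrow> d \<le> pseudo_hyp a b"
    using s by (auto simp: separated_def)
  \<comment> \<open>A common point of two discs forces \<open>pseudo_hyp a b < 4 * \<kappa>\<close>,
    which is at most d/2; the minimum with 1 keeps \<kappa> within the range of
    \<open>hball_props\<close>.\<close>
  define \<kappa> where "\<kappa> = min d 1 / 8"
  show thesis
  proof (rule that[of \<kappa>])
    show "0 < \<kappa>" "\<kappa> \<le> 1/8" using d by (auto simp: \<kappa>_def)
    fix a b assume ab: "a \<in> Z" "b \<in> Z" "a \<noteq> b"
    then have 1: "cmod a < 1" "cmod b < 1" using Z by (auto simp: subset_iff)
    show "hball \<kappa> a \<inter> hball \<kappa> b = {}"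
    proof (rule ccontr)
      assume "hball \<kappa> a \<inter> hball \<kappa> b \<noteq> {}"
      then obtain z where z: "cmod (a - z) < \<kappa> * (1 - (cmod a)\<^sup>2)" "cmod (b - z) < \<kappa> * (1 - (cmod b)\<^sup>2)"
        by (auto simp: hball_def dist_norm)
      have "cmod (a - b) \<le> cmod (a - z) + cmod (b - z)"
        using norm_triangle_ineq4[of "a - z" "b - z"] by simp
      also have "\<dots> < \<kappa> * (1 - (cmod a)\<^sup>2) + \<kappa> * (1 - (cmod b)\<^sup>2)" using z by linarith
      also have "\<dots> \<le> \<kappa> * (2 * cmod (1 - cnj b * a)) + \<kappa> * (2 * cmod (1 - cnj b * a))"
        using cmod_one_minus_ge[OF 1] \<open>0 < \<kappa>\<close> by (intro add_mono mult_left_mono) auto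
      also have "\<dots> = (4 * \<kappa>) * cmod (1 - cnj b * a)" by simp
      finally have "pseudo_hyp a b < 4 * \<kappa>"
        using cmod_one_minus_ge(6)[OF 1] by (simp add: pseudo_hyp_eq field_simps)
      moreover have "4 * \<kappa> < d" using d by (auto simp: \<kappa>_def)
      ultimately show False using d(2)[OF ab] by linarith
    qed
  qed
qed

text \<open>Separation in its working form: disjoint discs whose areas are proportional to the
  weights \<open>(1 - \<bar>a\<bar>^2)^2\<close>, so that weighted sums over \<open>Z\<close> can be
  compared with area integrals.\<close>

locale separated_seq =
  fixes Z :: "complex set" and \<kappa> :: real
  assumes Z_disk: "Z \<subseteq> unit_disk" and kappa: "0 < \<kappa>" "\<kappa> \<le> 1/8"
    and disjoint: "\<And>a b. a \<in> Z \<Longrightarrow> b \<in> Z \<Longrightarrow> a \<noteq> b \<Longrightarrow> hball \<kappa> a \<inter> hball \<kappa> b = {}"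
    and Z_countable: "countable Z"
begin

lemma Z_cmod: "a \<in> Z \<Longrightarrow> cmod a < 1"
  using Z_disk by (auto simp: subset_iff)

lemma sum_nn_integral_hball_le:
  assumes S: "finite S" "S \<subseteq> Z" and [measurable]: "F \<in> borel_measurable borel"
  shows "(\<Sum>a\<in>S. (\<integral>\<^sup>+z\<in>hball \<kappa> a. F z \<partial>lborel)) \<le>
     (\<integral>\<^sup>+z\<in>unit_disk. F z \<partial>lborel)"
proof -
  have [measurable]: "hball \<kappa> a \<in> sets borel" for a by (simp add: hball_def)
  have "(\<Sum>a\<in>S. (\<integral>\<^sup>+z\<in>hball \<kappa> a. F z \<partial>lborel)) =
     (\<integral>\<^sup>+z. (\<Sum>a\<in>S. F z * indicator (hball \<kappa> a) z) \<partial>lborel)"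
    by (rule nn_integral_sum[symmetric]) measurable
  also have "\<dots> \<le> (\<integral>\<^sup>+z\<in>unit_disk. F z \<partial>lborel)"
  proof (intro nn_integral_mono)
    fix z
    show "(\<Sum>a\<in>S. F z * indicator (hball \<kappa> a) z) \<le> F z * indicator unit_disk z"
    proof (cases "\<exists>a\<in>S. z \<in> hball \<kappa> a")
      case True
      then obtain a where a: "a \<in> S" "z \<in> hball \<kappa> a" by blast
      have "(\<Sum>b\<in>S. F z * indicator (hball \<kappa> b) z) = (\<Sum>b\<in>S. if b = a then F z else 0)"
        using disjoint[of a] a S by (intro sum.cong) (auto simp: indicator_def)
      also have "\<dots> = F z" using a S by simp
      finally show ?thesis using hball_props(1)[OF kappa Z_cmod a(2)] a S by auto
    next
      case False
      then have "(\<Sum>a\<in>S. F z * indicator (hball \<kappa> a) z) = 0" by (intro sum.neutral) auto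
      then show ?thesis by simp
    qed
  qed
  finally show ?thesis .
qed

lemma emeasure_hball:
  assumes "a \<in> Z"
  shows "emeasure lborel (hball \<kappa> a) = ennreal (pi * \<kappa>\<^sup>2 * (1 - (cmod a)\<^sup>2)\<^sup>2)"
  using kappa one_minus_sq_pos[OF Z_cmod[OF assms]]
  by (simp add: hball_def emeasure_ball unit_ball_vol_2 power_mult_distrib mult_ac)

text \<open>Up to the factor \<open>pi * \<kappa>^2\<close> the weight of a is the area of its disc,
  so a weighted value is the integral of a constant over that disc, and the discs are
  disjoint.\<close>

lemma sum_le_nn_integral:
  assumes S: "finite S" "S \<subseteq> Z" and [measurable]: "F \<in> borel_measurable borel"
    and f: "\<And>a z. a \<in> S \<Longrightarrow> z \<in> hball \<kappa> a \<Longrightarrow> f a \<le> F z" "\<And>a. a \<in> S \<Longrightarrow> 0 \<le> f a"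
  shows "ennreal (\<Sum>a\<in>S. f a * (1 - (cmod a)\<^sup>2)\<^sup>2) \<le>
     ennreal (1 / (pi * \<kappa>\<^sup>2)) * (\<integral>\<^sup>+z\<in>unit_disk. ennreal (F z) \<partial>lborel)"
proof -
  have [measurable]: "hball \<kappa> a \<in> sets borel" for a by (simp add: hball_def)
  have "ennreal (f a * (1 - (cmod a)\<^sup>2)\<^sup>2) \<le>
     ennreal (1 / (pi * \<kappa>\<^sup>2)) * (\<integral>\<^sup>+z\<in>hball \<kappa> a. ennreal (F z) \<partial>lborel)" if a: "a \<in> S" for a
  proof -
    have "ennreal (f a * (1 - (cmod a)\<^sup>2)\<^sup>2) =
       ennreal (1 / (pi * \<kappa>\<^sup>2)) * (ennreal (f a) * ennreal (pi * \<kappa>\<^sup>2 * (1 - (cmod a)\<^sup>2)\<^sup>2))"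
      using kappa f(2)[OF a] by (simp add: ennreal_mult[symmetric])
    also have "ennreal (f a) * ennreal (pi * \<kappa>\<^sup>2 * (1 - (cmod a)\<^sup>2)\<^sup>2) =
       (\<integral>\<^sup>+z\<in>hball \<kappa> a. ennreal (f a) \<partial>lborel)"
      using a S by (subst nn_integral_cmult_indicator) (auto simp: emeasure_hball)
    also have "\<dots> \<le> (\<integral>\<^sup>+z\<in>hball \<kappa> a. ennreal (F z) \<partial>lborel)"
      using f(1)[OF a] by (intro nn_integral_mono) (auto simp: indicator_def intro: ennreal_leI)
    finally show ?thesis by (simp add: mult_left_mono)
  qed
  then have "(\<Sum>a\<in>S. ennreal (f a * (1 - (cmod a)\<^sup>2)\<^sup>2)) \<le>
     (\<Sum>a\<in>S. ennreal (1 / (pi * \<kappa>\<^sup>2)) * (\<integral>\<^sup>+z\<in>hball \<kappa> a. ennreal (F z) \<partial>lborel))"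
    by (rule sum_mono)
  also have "\<dots> \<le> ennreal (1 / (pi * \<kappa>\<^sup>2)) * (\<integral>\<^sup>+z\<in>unit_disk. ennreal (F z) \<partial>lborel)"
    unfolding sum_distrib_left[symmetric] by (intro mult_left_mono sum_nn_integral_hball_le S) auto
  finally show ?thesis using f(2) by (subst sum_ennreal[symmetric]) auto
qed

lemma sum_weights_le:
  assumes S: "finite S" "S \<subseteq> Z"
  shows "(\<Sum>a\<in>S. (1 - (cmod a)\<^sup>2)\<^sup>2) \<le> 1 / \<kappa>\<^sup>2"
proof -
  have "ennreal (\<Sum>a\<in>S. 1 * (1 - (cmod a)\<^sup>2)\<^sup>2) \<le>
     ennreal (1 / (pi * \<kappa>\<^sup>2)) * (\<integral>\<^sup>+z\<in>unit_disk. ennreal 1 \<partial>lborel)"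
    by (rule sum_le_nn_integral[OF S]) auto
  also have "\<dots> = ennreal (1 / \<kappa>\<^sup>2)"
    using kappa by (simp add: emeasure_ball unit_ball_vol_2 ennreal_mult[symmetric])
  finally show ?thesis using kappa by (subst (asm) ennreal_le_iff) auto
qed

text \<open>The uniform second-order bound on which the product \<Psi> rests. Each term is a weight
  times a function that varies little over the disc of a, so the sum is dominated by an area
  integral which, in scale-invariant form, does not depend on z.\<close>

lemma sum_pseudo_hyp_le:
  assumes S: "finite S" "S \<subseteq> Z" and z: "cmod z < 1"
  shows "(\<Sum>a\<in>S. (1 - (pseudo_hyp z a)\<^sup>2)\<^sup>2) \<le> 256 / \<kappa>\<^sup>2"
proof -
  let ?n = "1 - (cmod z)\<^sup>2"
  have n: "?n > 0" "?n \<le> 1" using z one_minus_sq_pos by auto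
  \<comment> \<open>A Euclidean majorant with an explicit radial antiderivative. The number 256 is
    the square of 16, which comes from bounding \<open>?n^2 + \<bar>w - z\<bar>^2\<close> by
    \<open>16 * \<bar>1 - cnj a * z\<bar>^2\<close> for w in the disc of a.\<close>
  let ?G = "\<lambda>t. 256 * ?n\<^sup>2 / (?n\<^sup>2 + t)\<^sup>2"
  have "ennreal (\<Sum>a\<in>S. ((?n / (cmod (1 - cnj a * z))\<^sup>2)\<^sup>2) * (1 - (cmod a)\<^sup>2)\<^sup>2) \<le>
     ennreal (1 / (pi * \<kappa>\<^sup>2)) * (\<integral>\<^sup>+w\<in>unit_disk. ennreal (?G ((cmod (w - z))\<^sup>2)) \<partial>lborel)"
  proof (rule sum_le_nn_integral[OF S])
    fix a w assume a: "a \<in> S" and w: "w \<in> hball \<kappa> a"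
    have a1: "cmod a < 1" using a S Z_cmod by auto
    note h = hball_props[OF kappa a1 w]
    have "3/4 * cmod (1 - cnj z * a) \<le> cmod (1 - cnj z * w)" "cmod (1 - cnj z * w) \<le> 5/4 * cmod (1 - cnj z * a)"
      using h(3,4)[OF z] .
    then have D: "cmod (1 - cnj z * w) \<le> 5/4 * cmod (1 - cnj a * z)"
      using cmod_one_minus_commute[of a z] by simp
    have c: "?n \<le> 2 * cmod (1 - cnj z * w)" "cmod (w - z) \<le> cmod (1 - cnj z * w)"
      "0 < cmod (1 - cnj z * w)"
      using cmod_one_minus_ge[OF h(1) z] by auto
    have "?n\<^sup>2 + (cmod (w - z))\<^sup>2 \<le> (2 * cmod (1 - cnj z * w))\<^sup>2 + (cmod (1 - cnj z * w))\<^sup>2"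
      using c n by (intro add_mono power_mono) auto
    also have "\<dots> = 5 * (cmod (1 - cnj z * w))\<^sup>2" by (simp add: power_mult_distrib)
    also have "\<dots> \<le> 5 * (5/4 * cmod (1 - cnj a * z))\<^sup>2" using D by (intro mult_left_mono power_mono) auto
    also have "\<dots> \<le> 16 * (cmod (1 - cnj a * z))\<^sup>2" by (simp add: power_mult_distrib power_divide)
    finally have e: "?n\<^sup>2 + (cmod (w - z))\<^sup>2 \<le> 16 * (cmod (1 - cnj a * z))\<^sup>2" .
    have pos: "0 < ?n\<^sup>2 + (cmod (w - z))\<^sup>2" using n by (simp add: add_pos_nonneg)
    have "?n / (cmod (1 - cnj a * z))\<^sup>2 \<le> 16 * ?n / (?n\<^sup>2 + (cmod (w - z))\<^sup>2)"
    proof -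
      have "16 * ?n / (16 * (cmod (1 - cnj a * z))\<^sup>2) \<le> 16 * ?n / (?n\<^sup>2 + (cmod (w - z))\<^sup>2)"
        by (rule divide_left_mono[OF e]) (use n pos cmod_one_minus_ge(6)[OF z a1] in auto)
      moreover have "16 * ?n / (16 * (cmod (1 - cnj a * z))\<^sup>2) = ?n / (cmod (1 - cnj a * z))\<^sup>2"
        by (rule mult_divide_mult_cancel_left) simp
      ultimately show ?thesis by (simp only:)
    qed
    then have "(?n / (cmod (1 - cnj a * z))\<^sup>2)\<^sup>2 \<le> (16 * ?n / (?n\<^sup>2 + (cmod (w - z))\<^sup>2))\<^sup>2"
      using n by (intro power_mono) auto
    then show "(?n / (cmod (1 - cnj a * z))\<^sup>2)\<^sup>2 \<le> ?G ((cmod (w - z))\<^sup>2)"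
      by (simp only: power_divide power_mult_distrib[of 16]) simp
  qed auto
  also have "(\<integral>\<^sup>+w\<in>unit_disk. ennreal (?G ((cmod (w - z))\<^sup>2)) \<partial>lborel) \<le>
      (\<integral>\<^sup>+w. ennreal (?G ((cmod (w - z))\<^sup>2)) \<partial>lborel)"
    by (intro nn_integral_mono) (auto simp: indicator_def)
  also have "\<dots> = ennreal pi * (\<integral>\<^sup>+t\<in>{0..}. ennreal (?G t) \<partial>lborel)"
    by (rule nn_integral_radial) measurable
  also have "(\<integral>\<^sup>+t\<in>{0..}. ennreal (?G t) \<partial>lborel) = ennreal (0 - (- 256 * ?n\<^sup>2 / (?n\<^sup>2 + 0)))"
  proof (rule nn_integral_FTC_atLeast)
    fix x :: real assume x: "0 \<le> x"
    have "0 < ?n\<^sup>2 + x" using n x by (simp add: add_pos_nonneg)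
    then show "((\<lambda>x. - 256 * ?n\<^sup>2 / (?n\<^sup>2 + x)) has_real_derivative ?G x) (at x)"
      by (auto intro!: derivative_eq_intros simp: power2_eq_square)
  next
    have "filterlim (\<lambda>x. ?n\<^sup>2 + x) at_top at_top"
      by (rule filterlim_tendsto_add_at_top[OF tendsto_const filterlim_ident])
    then show "((\<lambda>x. - 256 * ?n\<^sup>2 / (?n\<^sup>2 + x)) \<longlongrightarrow> 0) at_top"
      by (intro tendsto_divide_0[OF tendsto_const] filterlim_at_top_imp_at_infinity)
  qed auto
  also have "ennreal (0 - (- 256 * ?n\<^sup>2 / (?n\<^sup>2 + 0))) = ennreal 256" using n by simp
  also have "ennreal (1 / (pi * \<kappa>\<^sup>2)) * (ennreal pi * ennreal 256) = ennreal (256 / \<kappa>\<^sup>2)"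
    using kappa by (simp add: ennreal_mult[symmetric] del: ennreal_numeral)
  finally have "ennreal (\<Sum>a\<in>S. ((?n / (cmod (1 - cnj a * z))\<^sup>2)\<^sup>2) * (1 - (cmod a)\<^sup>2)\<^sup>2) \<le> ennreal (256 / \<kappa>\<^sup>2)"
    by (simp add: mult_left_mono)
  moreover have "(\<Sum>a\<in>S. ((?n / (cmod (1 - cnj a * z))\<^sup>2)\<^sup>2) * (1 - (cmod a)\<^sup>2)\<^sup>2) =
     (\<Sum>a\<in>S. (1 - (pseudo_hyp z a)\<^sup>2)\<^sup>2)"
    using S Z_cmod by (intro sum.cong refl, subst one_minus_pseudo_hyp_sq[OF z])
      (auto simp: power_mult_distrib power_divide)
  ultimately show ?thesis using kappa by (subst (asm) ennreal_le_iff) auto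
qed

end

section \<open>Finite exhaustion of a countable set\<close>

text \<open>A sequence of finite sets in place of the net of all finite subsets, as Montel's theorem
  and monotone convergence require. The strict inequality puts a into every \<open>exh Z n\<close>
  with n at least \<open>Suc (to_nat_on Z a)\<close>.\<close>

definition exh :: "complex set \<Rightarrow> nat \<Rightarrow> complex set" where
  "exh Z n = {a \<in> Z. to_nat_on Z a < n}"

lemma exh_props:
  assumes "countable Z"
  shows "finite (exh Z n)" "exh Z n \<subseteq> Z" "m \<le> n \<Longrightarrow> exh Z m \<subseteq> exh Z n" "a \<in> Z \<Longrightarrow> \<exists>n. a \<in> exh Z n"
    "finite X \<Longrightarrow> X \<subseteq> Z \<Longrightarrow> \<exists>n. X \<subseteq> exh Z n"
proof -
  have "finite (to_nat_on Z ` exh Z n)"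
    by (rule finite_subset[of _ "{..<n}"]) (auto simp: exh_def)
  then show "finite (exh Z n)"
    by (rule finite_imageD) (rule inj_on_subset[OF inj_on_to_nat_on[OF assms]], auto simp: exh_def)
  show "exh Z n \<subseteq> Z" "m \<le> n \<Longrightarrow> exh Z m \<subseteq> exh Z n" by (auto simp: exh_def)
  show "\<exists>n. a \<in> exh Z n" if "a \<in> Z" using that by (auto simp: exh_def intro: exI[of _ "Suc (to_nat_on Z a)"])
  show "\<exists>n. X \<subseteq> exh Z n" if X: "finite X" "X \<subseteq> Z"
  proof
    show "X \<subseteq> exh Z (Suc (Max (insert 0 (to_nat_on Z ` X))))"
      using X by (auto simp: exh_def less_Suc_eq_le intro!: Max_ge)
  qed
qed

lemma filterlim_exh:
  assumes "countable Z"
  shows "filterlim (exh Z) (finite_subsets_at_top Z) sequentially"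
  unfolding filterlim_finite_subsets_at_top
proof safe
  fix X assume X: "finite X" "X \<subseteq> Z"
  then obtain n where "X \<subseteq> exh Z n" using exh_props(5)[OF assms] by blast
  then show "eventually (\<lambda>y. finite (exh Z y) \<and> X \<subseteq> exh Z y \<and> exh Z y \<subseteq> Z) sequentially"
    using exh_props[OF assms] by (intro eventually_sequentiallyI[of n]) blast
qed

lemma infsum_exh_tendsto:
  fixes f :: "complex \<Rightarrow> real"
  assumes "countable Z" "f summable_on Z"
  shows "(\<lambda>n. \<Sum>a\<in>exh Z n. f a) \<longlonglongrightarrow> infsum f Z"
  using filterlim_compose[OF has_sum_infsum[OF assms(2), unfolded has_sum_def] filterlim_exh[OF assms(1)]] .

section \<open>Bergman spaces\<close>

text \<open>The p-th power of the Bergman norm, as an extended number and for Borel measure, so that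
  estimates can be stated before finiteness is known.\<close>

definition Bint :: "real \<Rightarrow> (complex \<Rightarrow> complex) \<Rightarrow> ennreal" where
  "Bint p f = (\<integral>\<^sup>+z\<in>unit_disk. ennreal (cmod (f z) powr p) \<partial>lborel)"

lemma bergman_iff: "f \<in> bergman p \<longleftrightarrow> f holomorphic_on unit_disk \<and> Bint p f < \<infinity>"
  by (simp add: bergman_def Bint_def nn_integral_completion)

lemma bergman_measurable:
  assumes "f holomorphic_on unit_disk"
  shows "(\<lambda>z. ennreal (cmod (f z) powr p) * indicator unit_disk z) \<in> borel_measurable borel"
proof -
  have [measurable]: "(\<lambda>z. indicator unit_disk z * cmod (f z)) \<in> borel_measurable borel"
    by (rule holomorphic_indicator_measurable[OF assms open_ball])
  have [measurable]: "unit_disk \<in> sets borel" by simp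
  define g where "g = (\<lambda>z. indicator unit_disk z * cmod (f z))"
  have [measurable]: "g \<in> borel_measurable borel" unfolding g_def by fact
  have "(\<lambda>z. ennreal (g z powr p) * indicator unit_disk z) \<in> borel_measurable borel"
    by measurable
  moreover have "(\<lambda>z. ennreal (g z powr p) * indicator unit_disk z) =
     (\<lambda>z. ennreal (cmod (f z) powr p) * indicator unit_disk z)"
    by (auto simp: g_def indicator_def)
  ultimately show ?thesis by simp
qed

lemma Bint_add_le:
  assumes "f holomorphic_on unit_disk" "g holomorphic_on unit_disk" "p \<ge> 1"
  shows "Bint p (\<lambda>z. f z + g z) \<le> ennreal (2 powr p) * (Bint p f + Bint p g)"
proof -
  have "Bint p (\<lambda>z. f z + g z) \<le> (\<integral>\<^sup>+z. ennreal (2 powr p) * (ennreal (cmod (f z) powr p) * indicator unit_disk z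
     + ennreal (cmod (g z) powr p) * indicator unit_disk z) \<partial>lborel)"
    unfolding Bint_def
  proof (intro nn_integral_mono)
    fix z
    have "cmod (f z + g z) powr p \<le> (cmod (f z) + cmod (g z)) powr p"
      using assms by (intro powr_mono2 norm_triangle_ineq) auto
    also have "\<dots> \<le> 2 powr p * (cmod (f z) powr p + cmod (g z) powr p)"
      using assms by (intro powr_add_le) auto
    finally have "ennreal (cmod (f z + g z) powr p) \<le> ennreal (2 powr p * (cmod (f z) powr p + cmod (g z) powr p))"
      by (rule ennreal_leI)
    then show "ennreal (cmod (f z + g z) powr p) * indicator unit_disk z \<le>
       ennreal (2 powr p) * (ennreal (cmod (f z) powr p) * indicator unit_disk z
     + ennreal (cmod (g z) powr p) * indicator unit_disk z)"
      by (auto simp: indicator_def ennreal_mult ennreal_plus)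
  qed
  also have "\<dots> = ennreal (2 powr p) * (Bint p f + Bint p g)"
    unfolding Bint_def using bergman_measurable[OF assms(1)] bergman_measurable[OF assms(2)]
    by (subst nn_integral_cmult) (auto simp: nn_integral_add)
  finally show ?thesis .
qed

lemma Bint_cmult:
  assumes "f holomorphic_on unit_disk"
  shows "Bint p (\<lambda>z. c * f z) = ennreal (cmod c powr p) * Bint p f"
  unfolding Bint_def using bergman_measurable[OF assms]
  by (subst nn_integral_cmult[symmetric]) (auto simp: norm_mult powr_mult ennreal_mult mult.assoc)

lemma bergman_local_bound:
  assumes p: "p \<ge> 1"
  obtains C where "C > 0" "\<And>h \<zeta> r. h holomorphic_on unit_disk \<Longrightarrow> r > 0 \<Longrightarrow> ball \<zeta> r \<subseteq> unit_disk \<Longrightarrow>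
    ennreal (cmod (h \<zeta>) powr p) \<le> ennreal (C / r\<^sup>2) * (\<integral>\<^sup>+z\<in>ball \<zeta> r. ennreal (cmod (h z) powr p) \<partial>lborel)"
    "\<And>h \<zeta> r. h holomorphic_on unit_disk \<Longrightarrow> r > 0 \<Longrightarrow> ball \<zeta> r \<subseteq> unit_disk \<Longrightarrow>
    ennreal (cmod (h \<zeta>) powr p) \<le> ennreal (C / r\<^sup>2) * Bint p h"
proof -
  obtain C where C: "C > 0" "\<And>h \<zeta> r. h holomorphic_on ball \<zeta> r \<Longrightarrow> r > 0 \<Longrightarrow>
    ennreal (cmod (h \<zeta>) powr p) \<le>
      ennreal (C / r\<^sup>2) * (\<integral>\<^sup>+z\<in>ball \<zeta> r. ennreal (cmod (h z) powr p) \<partial>lborel)"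
    by (rule holomorphic_norm_powr_le[OF p], rule that)
  show thesis
  proof (rule that[OF C(1)])
    fix h :: "complex \<Rightarrow> complex" and \<zeta> :: complex and r :: real
    assume h: "h holomorphic_on unit_disk" and r: "r > 0" "ball \<zeta> r \<subseteq> unit_disk"
    have 1: "ennreal (cmod (h \<zeta>) powr p) \<le>
      ennreal (C / r\<^sup>2) * (\<integral>\<^sup>+z\<in>ball \<zeta> r. ennreal (cmod (h z) powr p) \<partial>lborel)"
      by (rule C(2)[OF holomorphic_on_subset[OF h r(2)] r(1)])
    then show "ennreal (cmod (h \<zeta>) powr p) \<le>
      ennreal (C / r\<^sup>2) * (\<integral>\<^sup>+z\<in>ball \<zeta> r. ennreal (cmod (h z) powr p) \<partial>lborel)" .
    also have "\<dots> \<le> ennreal (C / r\<^sup>2) * Bint p h"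
      unfolding Bint_def using r by (intro mult_left_mono nn_integral_mono) (auto simp: indicator_def)
    finally show "ennreal (cmod (h \<zeta>) powr p) \<le> ennreal (C / r\<^sup>2) * Bint p h" .
  qed
qed

lemma ball_subset_unit_disk: "cmod z < 1 \<Longrightarrow> r \<le> 1 - cmod z \<Longrightarrow> ball z r \<subseteq> unit_disk"
proof
  fix w assume "cmod z < 1" "r \<le> 1 - cmod z" "w \<in> ball z r"
  then show "w \<in> unit_disk"
    using norm_triangle_sub[of w z] by (simp add: dist_norm norm_minus_commute)
qed

lemma compact_subset_unit_disk:
  assumes "compact K" "K \<subseteq> unit_disk"
  obtains R where "0 < R" "R < 1" "K \<subseteq> cball 0 R"
proof (cases "K = {}")
  case True
  then show ?thesis using that[of "1/2"] by simp
next
  case False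
  have "continuous_on K cmod" by (intro continuous_intros)
  then obtain x where x: "x \<in> K" "\<And>y. y \<in> K \<Longrightarrow> cmod y \<le> cmod x"
    using continuous_attains_sup[OF assms(1) False] by blast
  have x1: "cmod x < 1" using x(1) assms(2) by (auto simp: subset_iff)
  show ?thesis
  proof (rule that[of "(1 + cmod x) / 2"])
    show "0 < (1 + cmod x) / 2" using norm_ge_zero[of x] by argo
    show "(1 + cmod x) / 2 < 1" using x1 by simp
    have "cmod y \<le> (1 + cmod x) / 2" if "y \<in> K" for y using x(2)[OF that] x1 by argo
    then show "K \<subseteq> cball 0 ((1 + cmod x) / 2)" by auto
  qed
qed

text \<open>The mean value inequality turns a norm bound into local boundedness, Montel's theorem
  supplies a limit, and Fatou's lemma keeps the same bound for it.\<close>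

lemma bergman_compact:
  assumes p: "p \<ge> 1" and F: "\<And>n. F n holomorphic_on unit_disk" "\<And>n::nat. Bint p (F n) \<le> ennreal L"
  obtains g r where "g holomorphic_on unit_disk" "strict_mono (r :: nat \<Rightarrow> nat)"
    "\<And>z. z \<in> unit_disk \<Longrightarrow> (\<lambda>n. F (r n) z) \<longlonglongrightarrow> g z" "Bint p g \<le> ennreal L"
proof -
  obtain C where C: "C > 0" "\<And>h \<zeta> r. h holomorphic_on unit_disk \<Longrightarrow> r > 0 \<Longrightarrow> ball \<zeta> r \<subseteq> unit_disk \<Longrightarrow>
    ennreal (cmod (h \<zeta>) powr p) \<le> ennreal (C / r\<^sup>2) * Bint p h"
    by (rule bergman_local_bound[OF p], rule that)
  obtain g r where g: "g holomorphic_on unit_disk" "strict_mono (r :: nat \<Rightarrow> nat)"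
    "\<And>z. z \<in> unit_disk \<Longrightarrow> (\<lambda>n. F (r n) z) \<longlonglongrightarrow> g z"
  proof (rule Montel[OF open_ball, of "range F" 0 1 F])
    fix K :: "complex set" assume K: "compact K" "K \<subseteq> unit_disk"
    then obtain R where R: "0 < R" "R < 1" "K \<subseteq> cball 0 R" by (rule compact_subset_unit_disk)
    \<comment> \<open>The absolute value handles negative L, for which \<open>ennreal L\<close> is
      0; the summand 1 handles values of modulus at most 1, which need not be dominated by their
      p-th powers.\<close>
    define B where "B = C / (1 - R)\<^sup>2 * \<bar>L\<bar> + 1"
    have "cmod (F n z) \<le> B" if z: "z \<in> K" for n z
    proof -
      have zR: "cmod z \<le> R" using R z by auto
      have "ennreal (cmod (F n z) powr p) \<le> ennreal (C / (1 - R)\<^sup>2) * Bint p (F n)"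
        by (rule C(2)[OF F(1)]) (use R zR ball_subset_unit_disk[of z "1 - R"] in auto)
      also have "\<dots> \<le> ennreal (C / (1 - R)\<^sup>2) * ennreal \<bar>L\<bar>"
        by (intro mult_left_mono order_trans[OF F(2)]) (auto intro: ennreal_leI)
      also have "\<dots> = ennreal (C / (1 - R)\<^sup>2 * \<bar>L\<bar>)" using C(1) by (intro ennreal_mult[symmetric]) auto
      finally have le: "cmod (F n z) powr p \<le> C / (1 - R)\<^sup>2 * \<bar>L\<bar>"
        using C by (subst (asm) ennreal_le_iff) auto
      show ?thesis
      proof (cases "cmod (F n z) \<le> 1")
        case True
        have "0 \<le> C / (1 - R)\<^sup>2 * \<bar>L\<bar>" using C by simp
        then show ?thesis using True unfolding B_def by linarith
      next
        case False
        then have "cmod (F n z) powr 1 \<le> cmod (F n z) powr p" using p by (intro powr_mono) auto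
        then show ?thesis using le False unfolding B_def by simp
      qed
    qed
    then show "\<exists>B. \<forall>h\<in>range F. \<forall>z\<in>K. cmod (h z) \<le> B" by auto
  qed (use F in auto)
  have "Bint p g = (\<integral>\<^sup>+z. liminf (\<lambda>n. ennreal (cmod (F (r n) z) powr p) * indicator unit_disk z) \<partial>lborel)"
    unfolding Bint_def
  proof (intro nn_integral_cong)
    fix z
    show "ennreal (cmod (g z) powr p) * indicator unit_disk z =
       liminf (\<lambda>n. ennreal (cmod (F (r n) z) powr p) * indicator unit_disk z)"
    proof (cases "z \<in> unit_disk")
      case True
      have "(\<lambda>n. ennreal (cmod (F (r n) z) powr p)) \<longlonglongrightarrow> ennreal (cmod (g z) powr p)"
        using g(3)[OF True] p
        by (intro tendsto_ennrealI tendsto_powr' tendsto_norm tendsto_const) auto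
      from lim_imp_Liminf[OF _ this] True show ?thesis by simp
    next
      case False then show ?thesis by (simp add: Liminf_const)
    qed
  qed
  also have "\<dots> \<le> liminf (\<lambda>n. Bint p (F (r n)))"
    unfolding Bint_def using bergman_measurable[OF F(1)] by (intro nn_integral_liminf) auto
  also have "\<dots> \<le> liminf (\<lambda>n. ennreal L)"
    by (intro Liminf_mono always_eventually allI F(2))
  also have "\<dots> = ennreal L" by (simp add: Liminf_const)
  finally show ?thesis using that g by blast
qed

section \<open>The canonical function of a separated sequence\<close>

text \<open>This is \<open>ln s \<le> s - 1\<close> for s = q^2.\<close>

lemma exp_factor_le_1:
  assumes "0 \<le> q" "q \<le> 1"
  shows "q * exp ((1 - q\<^sup>2) / 2) \<le> (1::real)"
proof (cases "q = 0")
  case False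
  then have q: "q > 0" using assms by simp
  have "2 * ln q = ln (q\<^sup>2)" using q by (simp add: ln_realpow)
  also have "\<dots> \<le> q\<^sup>2 - 1" using q by (intro ln_le_minus_one) auto
  finally have "ln q + (1 - q\<^sup>2) / 2 \<le> 0" by argo
  then have "exp (ln q + (1 - q\<^sup>2) / 2) \<le> 1" by simp
  then show ?thesis using q by (simp add: exp_add)
qed simp

text \<open>The exponent cancels the first-order term of ln q in \<open>1 - q^2\<close>, so the loss
  is only quadratic; \<open>ln (1 / s) \<le> 1 / s - 1\<close> with s = q^2 makes this explicit. The
  quadratic terms are summable by \<open>sum_pseudo_hyp_le\<close>.\<close>

lemma exp_factor_ge:
  fixes q \<rho> :: real
  assumes r: "0 < \<rho>" "\<rho> \<le> q" and q: "q \<le> 1"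
  shows "exp (- ((1 - q\<^sup>2)\<^sup>2 / (2 * \<rho>\<^sup>2))) \<le> q * exp ((1 - q\<^sup>2) / 2)"
proof -
  have q0: "q > 0" using r by simp
  define s where "s = q\<^sup>2"
  have s: "0 < s" "\<rho>\<^sup>2 \<le> s" using r q0 by (auto simp: s_def intro: power_mono)
  have "2 * ln q = - ln (1 / s)" using q0 by (simp add: s_def ln_realpow ln_div)
  moreover have "ln (1 / s) \<le> 1 / s - 1" using s by (intro ln_le_minus_one) auto
  ultimately have a: "ln q \<ge> (1 - 1 / s) / 2" by argo
  have "(1 - s)\<^sup>2 / (2 * \<rho>\<^sup>2) \<ge> (1 - s)\<^sup>2 / (2 * s)"
    using s r by (intro divide_left_mono) auto
  moreover have "(1 - s)\<^sup>2 / (2 * s) = - ((1 - 1 / s) / 2) - (1 - s) / 2"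
    using s by (simp add: field_simps power2_eq_square)
  ultimately have "- ((1 - s)\<^sup>2 / (2 * \<rho>\<^sup>2)) \<le> ln q + (1 - s) / 2" using a by argo
  then have "exp (- ((1 - s)\<^sup>2 / (2 * \<rho>\<^sup>2))) \<le> exp (ln q + (1 - s) / 2)" by simp
  also have "\<dots> = q * exp ((1 - s) / 2)" using q0 by (simp add: exp_add)
  finally show ?thesis by (simp add: s_def)
qed

text \<open>The exponential factor is chosen so that its modulus is
  \<open>exp ((1 - \<psi>\<^sup>2) / 2) * exp (\<bar>z\<bar>\<^sup>2 (1 - \<bar>a\<bar>\<^sup>2)\<^sup>2 / (2 \<bar>1 - cnj a * z\<bar>\<^sup>2))\<close> exactly:
  the sum of the two exponents is harmonic.\<close>

definition cfactor :: "complex \<Rightarrow> complex \<Rightarrow> complex" where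
  "cfactor a z = (z - a) / (1 - cnj a * z) *
     exp (of_real ((1 - (cmod a)\<^sup>2) / 2) * ((1 + cnj a * z) / (1 - cnj a * z)))"

lemma cmod_cfactor:
  assumes z: "cmod z < 1" and a: "cmod a < 1"
  shows "cmod (cfactor a z) = pseudo_hyp z a * exp ((1 - (pseudo_hyp z a)\<^sup>2) / 2) *
     exp ((cmod z)\<^sup>2 / 2 * ((1 - (cmod a)\<^sup>2)\<^sup>2 / (cmod (1 - cnj a * z))\<^sup>2))"
proof -
  define D where "D = (cmod (1 - cnj a * z))\<^sup>2"
  have D: "D > 0" using cmod_one_minus_ge(6)[OF z a] by (simp add: D_def)
  \<comment> \<open>The Poisson kernel.\<close>
  have "Re ((1 + cnj a * z) / (1 - cnj a * z)) = (1 - (cmod (cnj a * z))\<^sup>2) / D"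
  proof -
    have "Re ((1 + x) / (1 - x)) = (1 - (cmod x)\<^sup>2) / (cmod (1 - x))\<^sup>2" for x
      unfolding cmod_power2 Re_divide by (simp add: algebra_simps power2_eq_square)
    then show ?thesis by (simp add: D_def)
  qed
  then have R: "Re (of_real ((1 - (cmod a)\<^sup>2) / 2) * ((1 + cnj a * z) / (1 - cnj a * z))) =
     (1 - (cmod a)\<^sup>2) / 2 * ((1 - (cmod a)\<^sup>2 * (cmod z)\<^sup>2) / D)"
  proof -
    have "Re (of_real r * w) = r * Re w" for r w by simp
    with \<open>Re ((1 + cnj a * z) / (1 - cnj a * z)) = _\<close> show ?thesis
      by (simp only: norm_mult complex_mod_cnj power_mult_distrib)
  qed
  \<comment> \<open>Splits \<open>1 - \<bar>a\<bar>^2 \<bar>z\<bar>^2\<close> into \<open>(1 -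
    \<bar>z\<bar>^2) + \<bar>z\<bar>^2 (1 - \<bar>a\<bar>^2)\<close>: the first part gives
    \<open>1 - \<psi>^2\<close>, the second a term of \<open>kZ\<close>.\<close>
  have "(1 - (cmod a)\<^sup>2) / 2 * ((1 - (cmod a)\<^sup>2 * (cmod z)\<^sup>2) / D) =
     (1 - (pseudo_hyp z a)\<^sup>2) / 2 + (cmod z)\<^sup>2 / 2 * ((1 - (cmod a)\<^sup>2)\<^sup>2 / D)"
    unfolding one_minus_pseudo_hyp_sq[OF z a] D_def[symmetric] using D
    by (simp add: field_simps power2_eq_square)
  then show ?thesis unfolding cfactor_def norm_mult norm_exp_eq_Re R D_def[symmetric]
    by (simp add: exp_add norm_divide pseudo_hyp_eq)
qed

context separated_seq
begin

definition kterm :: "complex \<Rightarrow> complex \<Rightarrow> real" where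
  "kterm z a = (1 - (cmod a)\<^sup>2)\<^sup>2 / (cmod (1 - cnj a * z))\<^sup>2"

lemma kterm_nonneg: "kterm z a \<ge> 0" by (simp add: kterm_def)

lemma sum_kterm_le:
  assumes S: "finite S" "S \<subseteq> Z" and z: "cmod z < 1"
  shows "(\<Sum>a\<in>S. kterm z a) \<le> 1 / (\<kappa>\<^sup>2 * (1 - cmod z)\<^sup>2)"
proof -
  have "(\<Sum>a\<in>S. kterm z a) \<le> (\<Sum>a\<in>S. (1 - (cmod a)\<^sup>2)\<^sup>2 * (1 / (1 - cmod z)\<^sup>2))"
  proof (rule sum_mono)
    fix a assume "a \<in> S"
    then have a: "cmod a < 1" using S Z_cmod by auto
    have "(1 - cmod z)\<^sup>2 \<le> (cmod (1 - cnj a * z))\<^sup>2"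
      using cmod_one_minus_ge(1)[OF z a] z by (intro power_mono) auto
    then show "kterm z a \<le> (1 - (cmod a)\<^sup>2)\<^sup>2 * (1 / (1 - cmod z)\<^sup>2)"
      unfolding kterm_def using z cmod_one_minus_ge(7)[OF z a]
      by (simp add: divide_left_mono)
  qed
  also have "\<dots> \<le> (1 / \<kappa>\<^sup>2) * (1 / (1 - cmod z)\<^sup>2)"
    unfolding sum_distrib_right[symmetric] by (intro mult_right_mono sum_weights_le S) auto
  finally show ?thesis by simp
qed

lemma kterm_summable: "cmod z < 1 \<Longrightarrow> kterm z summable_on Z"
proof (rule nonneg_bdd_above_summable_on)
  assume z: "cmod z < 1"
  show "bdd_above (sum (kterm z) ` {F. F \<subseteq> Z \<and> finite F})"
    using sum_kterm_le[OF _ _ z] by (auto intro!: bdd_aboveI[of _ "1 / (\<kappa>\<^sup>2 * (1 - cmod z)\<^sup>2)"])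
qed (simp add: kterm_nonneg)

lemma kZ_eq: "kZ Z z = (cmod z)\<^sup>2 / 2 * infsum (kterm z) Z"
  by (simp add: kZ_def kterm_def[abs_def])

lemma sum_le_kZ:
  assumes "finite S" "S \<subseteq> Z" "cmod z < 1"
  shows "(cmod z)\<^sup>2 / 2 * (\<Sum>a\<in>S. kterm z a) \<le> kZ Z z"
  unfolding kZ_eq by (intro mult_left_mono finite_sum_le_infsum kterm_summable assms kterm_nonneg) auto

lemma kZ_nonneg: "cmod z < 1 \<Longrightarrow> kZ Z z \<ge> 0"
  using sum_le_kZ[of "{}" z] by simp

lemma kZ_le: "cmod z < 1 \<Longrightarrow> kZ Z z \<le> 1 / (\<kappa>\<^sup>2 * (1 - cmod z)\<^sup>2)"
proof -
  assume z: "cmod z < 1"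
  have "infsum (kterm z) Z \<le> 1 / (\<kappa>\<^sup>2 * (1 - cmod z)\<^sup>2)"
    by (intro infsum_le_finite_sums kterm_summable z sum_kterm_le)
  then have "kZ Z z \<le> 1 * (1 / (\<kappa>\<^sup>2 * (1 - cmod z)\<^sup>2))"
    unfolding kZ_eq using z
    using power_le_one[of "cmod z" 2]
    by (intro mult_mono infsum_nonneg kterm_nonneg) auto
  then show ?thesis by simp
qed

lemma kZ_tendsto:
  "cmod z < 1 \<Longrightarrow> (\<lambda>n. (cmod z)\<^sup>2 / 2 * (\<Sum>a\<in>exh Z n. kterm z a)) \<longlonglongrightarrow> kZ Z z"
  unfolding kZ_eq by (intro tendsto_mult tendsto_const infsum_exh_tendsto Z_countable kterm_summable)

lemma kZ_measurable: "(\<lambda>z. if z \<in> unit_disk then kZ Z z else 0) \<in> borel_measurable borel"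
proof (rule borel_measurable_LIMSEQ_real)
  fix z
  show "(\<lambda>n. if z \<in> unit_disk then (cmod z)\<^sup>2 / 2 * (\<Sum>a\<in>exh Z n. kterm z a) else 0) \<longlonglongrightarrow>
     (if z \<in> unit_disk then kZ Z z else 0)"
    using kZ_tendsto[of z] by auto
next
  fix n
  have "(\<lambda>z. (cmod z)\<^sup>2 / 2 * (\<Sum>a\<in>exh Z n. kterm z a)) \<in> borel_measurable borel"
    unfolding kterm_def by measurable
  then show "(\<lambda>z. if z \<in> unit_disk then (cmod z)\<^sup>2 / 2 * (\<Sum>a\<in>exh Z n. kterm z a) else 0) \<in> borel_measurable borel"
    by (rule measurable_If) auto
qed

definition pprod :: "nat \<Rightarrow> complex \<Rightarrow> complex" where
  "pprod n z = (\<Prod>a\<in>exh Z n. cfactor a z)"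

lemma pprod_holomorphic: "pprod n holomorphic_on unit_disk"
  unfolding pprod_def[abs_def] cfactor_def
  using exh_props(2)[OF Z_countable] Z_cmod cmod_one_minus_ge(7)
  by (intro holomorphic_intros) (auto simp: subset_iff)

lemma cmod_pprod:
  assumes z: "cmod z < 1"
  shows "cmod (pprod n z) = (\<Prod>a\<in>exh Z n. pseudo_hyp z a * exp ((1 - (pseudo_hyp z a)\<^sup>2) / 2)) *
     exp ((cmod z)\<^sup>2 / 2 * (\<Sum>a\<in>exh Z n. kterm z a))"
proof -
  have "cmod (pprod n z) = (\<Prod>a\<in>exh Z n. pseudo_hyp z a * exp ((1 - (pseudo_hyp z a)\<^sup>2) / 2) *
     exp ((cmod z)\<^sup>2 / 2 * kterm z a))"
    unfolding pprod_def prod_norm[symmetric] kterm_def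
    by (intro prod.cong refl cmod_cfactor z Z_cmod) (use exh_props(2)[OF Z_countable] in auto)
  then show ?thesis
    by (simp add: prod.distrib exp_sum[OF exh_props(1)[OF Z_countable]] sum_distrib_left)
qed

lemma hyp_factor_bounds:
  assumes "cmod z < 1" "a \<in> exh Z n"
  shows "0 \<le> pseudo_hyp z a * exp ((1 - (pseudo_hyp z a)\<^sup>2) / 2)"
    "pseudo_hyp z a * exp ((1 - (pseudo_hyp z a)\<^sup>2) / 2) \<le> 1"
proof -
  have a: "cmod a < 1" using assms exh_props(2)[OF Z_countable] Z_cmod by blast
  show "0 \<le> pseudo_hyp z a * exp ((1 - (pseudo_hyp z a)\<^sup>2) / 2)"
    "pseudo_hyp z a * exp ((1 - (pseudo_hyp z a)\<^sup>2) / 2) \<le> 1"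
    using pseudo_hyp_bounds[OF assms(1) a] by (auto intro: exp_factor_le_1)
qed

lemma cmod_pprod_le:
  assumes z: "cmod z < 1"
  shows "cmod (pprod n z) \<le> exp (kZ Z z)"
proof -
  have "(\<Prod>a\<in>exh Z n. pseudo_hyp z a * exp ((1 - (pseudo_hyp z a)\<^sup>2) / 2)) \<le> 1"
    using hyp_factor_bounds[OF z] by (intro prod_le_1) auto
  moreover have "exp ((cmod z)\<^sup>2 / 2 * (\<Sum>a\<in>exh Z n. kterm z a)) \<le> exp (kZ Z z)"
    using sum_le_kZ[OF exh_props(1,2)[OF Z_countable] z] by simp
  ultimately have "cmod (pprod n z) \<le> 1 * exp (kZ Z z)"
    unfolding cmod_pprod[OF z] by (intro mult_mono) auto
  then show ?thesis by simp
qed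

text \<open>As before, but the factor belonging to a is kept, with its exponential bounded by
  exp(1/2), which is less than 2. In the limit this produces the zero at a.\<close>

lemma cmod_pprod_le':
  assumes z: "cmod z < 1" and a: "a \<in> exh Z n"
  shows "cmod (pprod n z) \<le> 2 * pseudo_hyp z a * exp (kZ Z z)"
proof -
  let ?g = "\<lambda>a. pseudo_hyp z a * exp ((1 - (pseudo_hyp z a)\<^sup>2) / 2)"
  have a1: "cmod a < 1" using a exh_props(2)[OF Z_countable] Z_cmod by blast
  have f: "finite (exh Z n)" by (rule exh_props(1)[OF Z_countable])
  have "exp ((1 - (pseudo_hyp z a)\<^sup>2) / 2) \<le> exp (1 / 2)" by simp
  also have "\<dots> \<le> 1 + 1/2 + (1/2)\<^sup>2" by (rule exp_bound) auto
  also have "\<dots> \<le> (2::real)" by (simp add: power2_eq_square)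
  finally have e: "exp ((1 - (pseudo_hyp z a)\<^sup>2) / 2) \<le> 2" .
  have "(\<Prod>a\<in>exh Z n. ?g a) = ?g a * (\<Prod>b\<in>exh Z n - {a}. ?g b)" using prod.remove[OF f a] .
  also have "\<dots> \<le> ?g a * 1"
    using hyp_factor_bounds[OF z] a by (intro mult_left_mono prod_le_1) auto
  also have "\<dots> \<le> pseudo_hyp z a * 2"
    using e pseudo_hyp_bounds[OF z a1] by (simp add: mult_left_mono)
  finally have "(\<Prod>a\<in>exh Z n. ?g a) \<le> pseudo_hyp z a * 2" .
  moreover have "exp ((cmod z)\<^sup>2 / 2 * (\<Sum>a\<in>exh Z n. kterm z a)) \<le> exp (kZ Z z)"
    using sum_le_kZ[OF exh_props(1,2)[OF Z_countable] z] by simp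
  ultimately have "cmod (pprod n z) \<le> pseudo_hyp z a * 2 * exp (kZ Z z)"
    unfolding cmod_pprod[OF z] using pseudo_hyp_bounds[OF z a1] by (intro mult_mono) auto
  then show ?thesis by (simp add: mult_ac)
qed

text \<open>The exponent is the bound \<open>256 / \<kappa>^2\<close> of the quadratic sum times
  \<open>1 / (2 * \<rho>^2)\<close>, where \<rho> = \<kappa>/2 is the lower bound for the
  pseudo-hyperbolic distance off the discs.\<close>

definition lowc :: real where "lowc = exp (- (512 / \<kappa>^4))"

lemma prod_hyp_factor_ge:
  assumes z: "cmod z < 1" and S: "finite S" "S \<subseteq> Z" and far: "\<And>b. b \<in> S \<Longrightarrow> z \<notin> hball \<kappa> b"
  shows "lowc \<le> (\<Prod>a\<in>S. pseudo_hyp z a * exp ((1 - (pseudo_hyp z a)\<^sup>2) / 2))"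
proof -
  let ?r = "\<kappa> / 2"
  have "(\<Sum>a\<in>S. (1 - (pseudo_hyp z a)\<^sup>2)\<^sup>2 / (2 * ?r\<^sup>2)) \<le> (256 / \<kappa>\<^sup>2) / (2 * ?r\<^sup>2)"
    unfolding sum_divide_distrib[symmetric]
    by (intro divide_right_mono sum_pseudo_hyp_le S z) auto
  also have "\<dots> = 512 / \<kappa>^4" using kappa by (simp add: field_simps power2_eq_square power4_eq_xxxx)
  finally have "lowc \<le> exp (- (\<Sum>a\<in>S. (1 - (pseudo_hyp z a)\<^sup>2)\<^sup>2 / (2 * ?r\<^sup>2)))"
    by (simp add: lowc_def)
  also have "\<dots> = (\<Prod>a\<in>S. exp (- ((1 - (pseudo_hyp z a)\<^sup>2)\<^sup>2 / (2 * ?r\<^sup>2))))"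
    using S by (simp add: exp_sum sum_negf[symmetric])
  also have "\<dots> \<le> (\<Prod>a\<in>S. pseudo_hyp z a * exp ((1 - (pseudo_hyp z a)\<^sup>2) / 2))"
  proof (intro prod_mono conjI)
    fix a assume a: "a \<in> S"
    then have a1: "cmod a < 1" using S Z_cmod by auto
    show "exp (- ((1 - (pseudo_hyp z a)\<^sup>2)\<^sup>2 / (2 * ?r\<^sup>2))) \<le> pseudo_hyp z a * exp ((1 - (pseudo_hyp z a)\<^sup>2) / 2)"
      by (rule exp_factor_ge)
         (use pseudo_hyp_ge_off_hball[OF kappa a1 z far[OF a]] pseudo_hyp_bounds[OF z a1] kappa in auto)
  qed simp
  finally show ?thesis .
qed

text \<open>A locally uniform subsequential limit of the partial products suffices: all assertions
  concern moduli, and the bounds for the partial products converge because the partial sums of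
  \<open>kZ\<close> do. The lower bounds keep the limit from vanishing off \<open>Z\<close>.\<close>

theorem canonical_function:
  obtains \<Psi> where "\<Psi> holomorphic_on unit_disk"
    "\<And>z. cmod z < 1 \<Longrightarrow> cmod (\<Psi> z) \<le> exp (kZ Z z)"
    "\<And>z a. cmod z < 1 \<Longrightarrow> a \<in> Z \<Longrightarrow> cmod (\<Psi> z) \<le> 2 * pseudo_hyp z a * exp (kZ Z z)"
    "\<And>z. cmod z < 1 \<Longrightarrow> \<forall>b\<in>Z. z \<notin> hball \<kappa> b \<Longrightarrow> lowc * exp (kZ Z z) \<le> cmod (\<Psi> z)"
    "\<And>z a. a \<in> Z \<Longrightarrow> z \<in> hball \<kappa> a \<Longrightarrow> lowc * pseudo_hyp z a * exp (kZ Z z) \<le> cmod (\<Psi> z)"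
proof -
  obtain \<Psi> r where P: "\<Psi> holomorphic_on unit_disk" "strict_mono (r :: nat \<Rightarrow> nat)"
    "\<And>z. z \<in> unit_disk \<Longrightarrow> (\<lambda>n. pprod (r n) z) \<longlonglongrightarrow> \<Psi> z"
  proof (rule Montel[OF open_ball, of "range pprod" 0 1 pprod])
    fix K :: "complex set" assume K: "compact K" "K \<subseteq> unit_disk"
    then obtain R where R: "0 < R" "R < 1" "K \<subseteq> cball 0 R" by (rule compact_subset_unit_disk)
    have "cmod (pprod n z) \<le> exp (1 / (\<kappa>\<^sup>2 * (1 - R)\<^sup>2))" if z: "z \<in> K" for n z
    proof -
      have zR: "cmod z \<le> R" "cmod z < 1" using R z by auto
      have "cmod (pprod n z) \<le> exp (kZ Z z)" by (rule cmod_pprod_le[OF zR(2)])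
      also have "kZ Z z \<le> 1 / (\<kappa>\<^sup>2 * (1 - cmod z)\<^sup>2)" by (rule kZ_le[OF zR(2)])
      also have "\<dots> \<le> 1 / (\<kappa>\<^sup>2 * (1 - R)\<^sup>2)"
        using zR R kappa by (intro divide_left_mono mult_left_mono power_mono) auto
      finally show ?thesis by simp
    qed
    then show "\<exists>B. \<forall>h\<in>range pprod. \<forall>z\<in>K. cmod (h z) \<le> B" by auto
  qed (use pprod_holomorphic in auto)
  have rn: "r n \<ge> n" for n by (rule seq_suble[OF P(2)])
  have lim: "(\<lambda>n. cmod (pprod (r n) z)) \<longlonglongrightarrow> cmod (\<Psi> z)" if "cmod z < 1" for z
    using P(3)[of z] that by (intro tendsto_norm) auto
  have klim: "(\<lambda>n. exp ((cmod z)\<^sup>2 / 2 * (\<Sum>a\<in>exh Z (r n). kterm z a))) \<longlonglongrightarrow> exp (kZ Z z)" if "cmod z < 1" for z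
    using LIMSEQ_subseq_LIMSEQ[OF kZ_tendsto[OF that] P(2)] by (intro tendsto_exp) (simp add: o_def)
  show thesis
  proof (rule that[OF P(1)])
    fix z assume z: "cmod z < 1"
    show "cmod (\<Psi> z) \<le> exp (kZ Z z)"
      using cmod_pprod_le[OF z] by (intro LIMSEQ_le_const2[OF lim[OF z]]) auto
    show "cmod (\<Psi> z) \<le> 2 * pseudo_hyp z a * exp (kZ Z z)" if a: "a \<in> Z" for a
    proof -
      obtain N where N: "a \<in> exh Z N" using exh_props(4)[OF Z_countable a] by blast
      have "a \<in> exh Z (r n)" if "n \<ge> N" for n
        using N exh_props(3)[OF Z_countable, of N "r n"] rn[of n] that by auto
      then show ?thesis
        using cmod_pprod_le'[OF z] by (intro LIMSEQ_le_const2[OF lim[OF z]]) blast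
    qed
    show "lowc * exp (kZ Z z) \<le> cmod (\<Psi> z)" if far: "\<forall>b\<in>Z. z \<notin> hball \<kappa> b"
    proof (rule LIMSEQ_le[OF tendsto_mult[OF tendsto_const klim[OF z]] lim[OF z]])
      have "lowc * exp ((cmod z)\<^sup>2 / 2 * (\<Sum>a\<in>exh Z (r n). kterm z a)) \<le> cmod (pprod (r n) z)" for n
        unfolding cmod_pprod[OF z] using far exh_props(2)[OF Z_countable, of "r n"]
        by (intro mult_right_mono prod_hyp_factor_ge z exh_props[OF Z_countable]) auto
      then show "\<exists>N. \<forall>n\<ge>N. lowc * exp ((cmod z)\<^sup>2 / 2 * (\<Sum>a\<in>exh Z (r n). kterm z a)) \<le> cmod (pprod (r n) z)"
        by blast
    qed
  next
    fix z a assume a: "a \<in> Z" and z: "z \<in> hball \<kappa> a"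
    have a1: "cmod a < 1" and z1: "cmod z < 1" using hball_props(1)[OF kappa Z_cmod[OF a] z] Z_cmod[OF a] by auto
    \<comment> \<open>Disjointness of the discs: z is near at most one point of \<open>Z\<close>, so
      the product over the remaining points obeys the uniform lower bound.\<close>
    have far: "z \<notin> hball \<kappa> b" if "b \<in> Z" "b \<noteq> a" for b
      using disjoint[OF a that(1)] that z by auto
    let ?g = "\<lambda>a. pseudo_hyp z a * exp ((1 - (pseudo_hyp z a)\<^sup>2) / 2)"
    show "lowc * pseudo_hyp z a * exp (kZ Z z) \<le> cmod (\<Psi> z)"
    proof (rule LIMSEQ_le[OF tendsto_mult[OF tendsto_const klim[OF z1]] lim[OF z1]])
      obtain N where N: "a \<in> exh Z N" using exh_props(4)[OF Z_countable a] by blast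
      have "lowc * pseudo_hyp z a * exp ((cmod z)\<^sup>2 / 2 * (\<Sum>a\<in>exh Z (r n). kterm z a)) \<le> cmod (pprod (r n) z)"
        if n: "n \<ge> N" for n
      proof -
        have an: "a \<in> exh Z (r n)"
          using N exh_props(3)[OF Z_countable, of N "r n"] rn[of n] n by auto
        have f: "finite (exh Z (r n))" by (rule exh_props(1)[OF Z_countable])
        have 1: "lowc \<le> (\<Prod>b\<in>exh Z (r n) - {a}. ?g b)"
          using far exh_props(2)[OF Z_countable, of "r n"] f by (intro prod_hyp_factor_ge z1) auto
        have 2: "pseudo_hyp z a \<le> ?g a"
          using pseudo_hyp_bounds[OF z1 a1] by (simp add: mult_le_cancel_left1 abs_square_le_1)
        have "lowc * pseudo_hyp z a \<le> (\<Prod>b\<in>exh Z (r n) - {a}. ?g b) * ?g a"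
          using 1 2 pseudo_hyp_bounds[OF z1 a1] by (intro mult_mono order_trans[OF _ 1]) (auto simp: lowc_def)
        also have "\<dots> = (\<Prod>b\<in>exh Z (r n). ?g b)" using prod.remove[OF f an, of ?g] by (simp add: mult.commute)
        finally show ?thesis unfolding cmod_pprod[OF z1] by (intro mult_right_mono) auto
      qed
      then show "\<exists>N. \<forall>n\<ge>N. lowc * pseudo_hyp z a * exp ((cmod z)\<^sup>2 / 2 * (\<Sum>a\<in>exh Z (r n). kterm z a)) \<le> cmod (pprod (r n) z)"
        by blast
    qed
  qed
qed

end

section \<open>Weyl's lemma\<close>

text \<open>For w in the half disc the pole stays at distance \<rho>/2 from the support of g. The
  difference quotients of the kernel are \<open>inverse (z - X i) * inverse (z - w)\<close> exactly,
  so dominated convergence yields the complex derivative.\<close>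

lemma holomorphic_cauchy_transform:
  fixes g :: "complex \<Rightarrow> complex"
  assumes g: "integrable lborel g" and z: "\<And>z. cmod (z - \<zeta>) < \<rho> \<Longrightarrow> g z = 0" and \<rho>: "\<rho> > 0"
  shows "(\<lambda>w. \<integral>z. g z * inverse (z - w) \<partial>lborel) holomorphic_on ball \<zeta> (\<rho> / 2)"
proof (rule holomorphic_onI)
  fix w assume w: "w \<in> ball \<zeta> (\<rho> / 2)"
  have [measurable]: "g \<in> borel_measurable borel" using g by (auto dest: borel_measurable_integrable)
  have far: "\<rho> / 2 \<le> cmod (z - v)" if "v \<in> ball \<zeta> (\<rho> / 2)" "g z \<noteq> 0" for v z
  proof -
    have "\<rho> \<le> cmod (z - \<zeta>)" using z[of z] that(2) by force
    also have "\<dots> \<le> cmod (z - v) + cmod (v - \<zeta>)" using norm_triangle_ineq[of "z - v" "v - \<zeta>"] by simp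
    finally show ?thesis using that(1) by (simp add: dist_norm norm_minus_commute)
  qed
  have b1: "norm (g z * inverse (z - v)) \<le> norm (g z) * (2 / \<rho>)" if v: "v \<in> ball \<zeta> (\<rho> / 2)" for v z
  proof (cases "g z = 0")
    case False
    have "inverse (cmod (z - v)) \<le> inverse (\<rho> / 2)"
      using far[OF v False] \<rho> by (intro le_imp_inverse_le) auto
    from mult_left_mono[OF this norm_ge_zero[of "g z"]] show ?thesis
      by (simp add: norm_mult norm_inverse)
  qed simp
  have i1: "integrable lborel (\<lambda>z. g z * inverse (z - v))" if v: "v \<in> ball \<zeta> (\<rho> / 2)" for v
    by (rule Bochner_Integration.integrable_bound[OF integrable_mult_left[OF integrable_norm[OF g], of "2/\<rho>"]])
       (use b1[OF v] \<rho> in \<open>auto intro!: AE_I2 simp: abs_mult\<close>)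
  have b2: "norm (g z * inverse (z - v) * inverse (z - w)) \<le> norm (g z) * (2 / \<rho>) * (2 / \<rho>)"
    if v: "v \<in> ball \<zeta> (\<rho> / 2)" for v z
  proof (cases "g z = 0")
    case False
    have "inverse (cmod (z - w)) \<le> inverse (\<rho> / 2)"
      using far[OF w False] \<rho> by (intro le_imp_inverse_le) auto
    then have "norm (g z * inverse (z - v)) * inverse (cmod (z - w)) \<le> (norm (g z) * (2 / \<rho>)) * (2 / \<rho>)"
      using b1[OF v, of z] \<rho> by (intro mult_mono) auto
    then show ?thesis by (simp add: norm_mult norm_inverse)
  qed simp
  let ?d = "\<integral>z. g z * inverse (z - w) * inverse (z - w) \<partial>lborel"
  let ?N = "\<lambda>w. \<integral>z. g z * inverse (z - w) \<partial>lborel"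
  have "((\<lambda>v. (?N v - ?N w) / (v - w)) \<longlongrightarrow> ?d) (at w within ball \<zeta> (\<rho> / 2))"
    unfolding tendsto_at_iff_sequentially comp_def
  proof (intro allI impI)
    fix X :: "nat \<Rightarrow> complex" assume X: "\<forall>i. X i \<in> ball \<zeta> (\<rho> / 2) - {w}" "X \<longlonglongrightarrow> w"
    have e: "(?N (X i) - ?N w) / (X i - w) = (\<integral>z. g z * inverse (z - X i) * inverse (z - w) \<partial>lborel)" for i
    proof -
      have Xi: "X i \<in> ball \<zeta> (\<rho> / 2)" "X i \<noteq> w" using X by auto
      have "(?N (X i) - ?N w) / (X i - w) =
        (\<integral>z. (g z * inverse (z - X i) - g z * inverse (z - w)) / (X i - w) \<partial>lborel)"
        using i1[OF Xi(1)] i1[OF w] by (simp add: Bochner_Integration.integral_diff)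
      also have "\<dots> = (\<integral>z. g z * inverse (z - X i) * inverse (z - w) \<partial>lborel)"
      proof (rule Bochner_Integration.integral_cong[OF refl])
        fix z
        show "(g z * inverse (z - X i) - g z * inverse (z - w)) / (X i - w) = g z * inverse (z - X i) * inverse (z - w)"
        proof (cases "g z = 0")
          case False
          then have "z \<noteq> X i" "z \<noteq> w" using far[OF Xi(1) False] far[OF w False] \<rho> by auto
          then have "inverse (z - X i) - inverse (z - w) = - (inverse (z - X i) * ((z - X i) - (z - w)) * inverse (z - w))"
            by (intro inverse_diff_inverse) auto
          then have "g z * inverse (z - X i) - g z * inverse (z - w) =
              g z * inverse (z - X i) * inverse (z - w) * (X i - w)"
            by (simp add: right_diff_distrib[symmetric]) (simp add: algebra_simps)
          then show ?thesis using Xi(2) by simp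
        qed simp
      qed
      finally show ?thesis .
    qed
    show "(\<lambda>i. (?N (X i) - ?N w) / (X i - w)) \<longlonglongrightarrow> ?d"
      unfolding e
    proof (rule integral_dominated_convergence[where w="\<lambda>z. norm (g z) * (2 / \<rho>) * (2 / \<rho>)"])
      show "integrable lborel (\<lambda>z. norm (g z) * (2 / \<rho>) * (2 / \<rho>))"
        by (intro integrable_mult_left integrable_norm g)
      show "AE z in lborel. (\<lambda>i. g z * inverse (z - X i) * inverse (z - w)) \<longlonglongrightarrow> g z * inverse (z - w) * inverse (z - w)"
      proof (rule AE_I2)
        fix z
        show "(\<lambda>i. g z * inverse (z - X i) * inverse (z - w)) \<longlonglongrightarrow> g z * inverse (z - w) * inverse (z - w)"
        proof (cases "g z = 0")
          case False
          then have "z \<noteq> w" using far[OF w False] \<rho> by auto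
          then show ?thesis by (intro tendsto_intros X(2)) auto
        qed simp
      qed
      show "AE z in lborel. norm (g z * inverse (z - X i) * inverse (z - w)) \<le> norm (g z) * (2 / \<rho>) * (2 / \<rho>)" for i
        using X(1) b2 by (intro AE_I2) auto
    qed measurable
  qed
  then show "?N field_differentiable at w within ball \<zeta> (\<rho> / 2)"
    unfolding field_differentiable_def has_field_derivative_iff by blast
qed

lemma moll_commute: "moll \<zeta> r z = moll z r \<zeta>"
  by (simp add: moll_def norm_minus_commute)

lemma moll_measurable_pair[measurable]: "(\<lambda>(\<zeta>, z). moll \<zeta> r z) \<in> borel_measurable (borel \<Otimes>\<^sub>M borel)"
proof -
  have [measurable]: "step' \<in> borel_measurable borel"
    by (intro borel_measurable_continuous_onI continuous_on_step')
  show ?thesis unfolding moll_def[abs_def] by measurable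
qed

lemma integrable_of_powr:
  fixes f :: "'a \<Rightarrow> 'b::{banach, second_countable_topology}"
  assumes [measurable]: "f \<in> borel_measurable M" "A \<in> sets M" and A: "emeasure M A < \<infinity>" "\<And>x. x \<notin> A \<Longrightarrow> f x = 0"
    and p: "p \<ge> 1" and fin: "(\<integral>\<^sup>+x. ennreal (norm (f x) powr p) \<partial>M) < \<infinity>"
  shows "integrable M f"
proof (rule integrableI_bounded)
  have "(\<integral>\<^sup>+x. ennreal (norm (f x)) \<partial>M) \<le> (\<integral>\<^sup>+x. indicator A x + ennreal (norm (f x) powr p) \<partial>M)"
  proof (rule nn_integral_mono)
    fix x
    have "norm (f x) \<le> 1 + 1 powr (1 - p) * norm (f x) powr p" by (rule le_Young) (use p in auto)
    then have "ennreal (norm (f x)) \<le> ennreal (1 + norm (f x) powr p)" by (intro ennreal_leI) simp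
    then show "ennreal (norm (f x)) \<le> indicator A x + ennreal (norm (f x) powr p)"
      using A(2)[of x] by (cases "x \<in> A") (auto simp: ennreal_plus)
  qed
  also have "\<dots> = emeasure M A + (\<integral>\<^sup>+x. ennreal (norm (f x) powr p) \<partial>M)"
    by (subst nn_integral_add) auto
  also have "\<dots> < \<infinity>" using A fin by simp
  finally show "(\<integral>\<^sup>+x. ennreal (norm (f x)) \<partial>M) < \<infinity>" .
qed measurable

text \<open>Two cutoff Cauchy kernels with the same pole \<zeta> differ by a test function; testing
  W against it shows that the average of W against \<open>moll \<zeta> r\<close> does not depend on
  the small r and equals a Cauchy integral of a fixed function, hence is holomorphic in \<zeta>. The
  conclusion speaks of averages and not of almost everywhere equality, because averages determine H
  at the individual points of \<open>Z\<close>.\<close>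

theorem weyl_bergman:
  fixes W :: "complex \<Rightarrow> complex"
  assumes p: "p \<ge> 1" and W[measurable]: "W \<in> borel_measurable borel" and W0: "\<And>z. z \<notin> unit_disk \<Longrightarrow> W z = 0"
    and fin: "(\<integral>\<^sup>+z. ennreal (cmod (W z) powr p) \<partial>lborel) < \<infinity>"
    and test: "\<And>\<Phi> \<zeta> r. smooth_on UNIV \<Phi> \<Longrightarrow> r > 0 \<Longrightarrow> cball \<zeta> r \<subseteq> unit_disk \<Longrightarrow>
        (\<And>z. z \<notin> cball \<zeta> r \<Longrightarrow> \<Phi> z = 0) \<Longrightarrow> (\<integral>z. W z * dbar \<Phi> z \<partial>lborel) = 0"
  obtains H :: "complex \<Rightarrow> complex" where "H holomorphic_on unit_disk" "Bint p H < \<infinity>"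
    "\<And>\<zeta> r. cmod \<zeta> < 1 \<Longrightarrow> 0 < r \<Longrightarrow> r \<le> (1 - cmod \<zeta>) / 8 \<Longrightarrow>
       (\<integral>z. W z * of_real (moll \<zeta> r z) \<partial>lborel) = pi * H \<zeta>"
proof -
  have iW: "integrable lborel W"
    by (rule integrable_of_powr[where A=unit_disk and p=p])
       (use p fin W0 in \<open>auto simp: emeasure_ball\<close>)
  obtain B where B: "B > 0" "\<And>w r z. moll w r z \<le> B / r\<^sup>2" using moll_bounded by blast
  have iWm: "integrable lborel (\<lambda>z. W z * of_real (moll \<zeta> r z))" for \<zeta> r
  proof (rule Bochner_Integration.integrable_bound[OF integrable_mult_left[OF integrable_norm[OF iW], of "B / r\<^sup>2"]])
    have "norm (W z * of_real (moll \<zeta> r z)) \<le> norm (norm (W z) * (B / r\<^sup>2))" for z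
      using B(1) B(2)[of \<zeta> r z] moll_nonneg[of \<zeta> r z]
      by (simp add: norm_mult abs_mult del: times_divide_eq_right) (intro mult_left_mono; simp)
    then show "AE z in lborel. norm (W z * of_real (moll \<zeta> r z)) \<le> norm (norm (W z) * (B / r\<^sup>2))" by simp
  qed measurable
  \<comment> \<open>The density of that Cauchy integral: what \<open>dbar\<close> of the fixed outer
    cutoff around \<zeta>0 leaves after pairing with W. It vanishes near \<zeta>0, where \<zeta>
    moves.\<close>
  define g where "g = (\<lambda>\<zeta>0 z. W z * of_real (moll \<zeta>0 ((1 - cmod \<zeta>0) / 2) z) * (z - \<zeta>0))"
  have ig: "integrable lborel (g \<zeta>0)" if z0: "cmod \<zeta>0 < 1" for \<zeta>0
  proof (rule Bochner_Integration.integrable_bound[OF integrable_norm[OF iWm[of \<zeta>0 "(1 - cmod \<zeta>0) / 2"]]])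
    have "norm (g \<zeta>0 z) \<le> norm (norm (W z * of_real (moll \<zeta>0 ((1 - cmod \<zeta>0) / 2) z)))" for z
    proof (cases "cmod (z - \<zeta>0) \<le> 1")
      case True then show ?thesis by (simp add: g_def norm_mult mult_left_le)
    next
      case False
      then have "moll \<zeta>0 ((1 - cmod \<zeta>0) / 2) z = 0"
        using z0 norm_ge_zero[of \<zeta>0] by (intro moll_eq_0; argo)
      then show ?thesis by (simp add: g_def)
    qed
    then show "AE z in lborel. norm (g \<zeta>0 z) \<le> norm (norm (W z * of_real (moll \<zeta>0 ((1 - cmod \<zeta>0) / 2) z)))" by simp
  qed (simp add: g_def)
  have key: "(\<integral>z. W z * of_real (moll \<zeta> r z) \<partial>lborel) = (\<integral>z. g \<zeta>0 z * inverse (z - \<zeta>) \<partial>lborel)"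
    if z0: "cmod \<zeta>0 < 1" and z: "cmod (\<zeta> - \<zeta>0) < (1 - cmod \<zeta>0) / 8" and r: "0 < r" "r \<le> (1 - cmod \<zeta>0) / 8" for \<zeta> \<zeta>0 r
  proof -
    define e where "e = (1 - cmod \<zeta>0) / 2"
    have e: "e > 0" "cmod (\<zeta> - \<zeta>0) < e / 4" "r \<le> e / 4" using z0 z r by (auto simp: e_def)
    let ?A = "\<lambda>z. of_real (rstep \<zeta> r z) * inverse (z - \<zeta>)"
    let ?B = "\<lambda>z. of_real (rstep \<zeta>0 e z) * inverse (z - \<zeta>)"
    have sA: "smooth_on UNIV ?A" by (rule smooth_on_rstep_pole) (use r in auto)
    have sB: "smooth_on UNIV ?B" by (rule smooth_on_rstep_pole) (use e in auto)
    have sC: "smooth_on UNIV (\<lambda>z. (-1) * ?B z)" by (intro smooth_on_mult smooth_on_const sB open_UNIV)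
    \<comment> \<open>The test function: the poles of \<open>?A\<close> and \<open>?B\<close> are
      removed by their cutoffs, and outside \<open>cball \<zeta>0 e\<close> both cutoffs are 1 and
      the kernels cancel.\<close>
    have s: "smooth_on UNIV (\<lambda>z. ?A z + (-1) * ?B z)" by (intro smooth_on_add sA sC open_UNIV)
    have sup: "cball \<zeta>0 e \<subseteq> unit_disk"
    proof
      fix x assume "x \<in> cball \<zeta>0 e"
      then have "cmod x \<le> cmod \<zeta>0 + e" using norm_triangle_sub[of x \<zeta>0] by (simp add: dist_norm norm_minus_commute)
      then have "cmod x < 1" using z0 unfolding e_def by argo
      then show "x \<in> unit_disk" by simp
    qed
    have out: "?A z + (-1) * ?B z = 0" if "z \<notin> cball \<zeta>0 e" for z
    proof -
      have a: "e < cmod (z - \<zeta>0)" using that by (simp add: dist_norm norm_minus_commute)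
      have "cmod (z - \<zeta>0) \<le> cmod (z - \<zeta>) + cmod (\<zeta> - \<zeta>0)"
        using norm_triangle_ineq[of "z - \<zeta>" "\<zeta> - \<zeta>0"] by simp
      then have "r \<le> cmod (z - \<zeta>)" using a e by linarith
      then show ?thesis using a e r by (simp add: rstep_eq_1)
    qed
    have d: "dbar (\<lambda>z. ?A z + (-1) * ?B z) z = of_real (moll \<zeta> r z) -
        of_real (moll \<zeta>0 e z) * (z - \<zeta>0) * inverse (z - \<zeta>)" for z
    proof -
      have "dbar (\<lambda>z. ?A z + (-1) * ?B z) z = dbar ?A z + dbar (\<lambda>z. (-1) * ?B z) z"
        by (rule dbar_add) (use smooth_on_differentiable[OF sA] smooth_on_differentiable[OF sC] in auto)
      also have "dbar (\<lambda>z. (-1) * ?B z) z = dbar (\<lambda>_. -1) z * ?B z + (-1) * dbar ?B z"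
        by (rule dbar_mult) (use smooth_on_differentiable[OF sB] in auto)
      also have "dbar ?A z = of_real (moll \<zeta> r z)"
        using dbar_rstep_pole[OF r(1), of \<zeta> \<zeta> z] r moll_eq_0'[OF r(1), of \<zeta> \<zeta>]
        by (cases "z = \<zeta>") auto
      also have "dbar ?B z = of_real (moll \<zeta>0 e z) * (z - \<zeta>0) * inverse (z - \<zeta>)"
        by (rule dbar_rstep_pole) (use e in auto)
      finally show ?thesis by (simp add: dbar_const)
    qed
    have ig': "integrable lborel (\<lambda>z. g \<zeta>0 z * inverse (z - \<zeta>))"
    proof (rule Bochner_Integration.integrable_bound[OF integrable_mult_left[OF integrable_norm[OF ig[OF z0]], of "4 / e"]])
      have [measurable]: "g \<zeta>0 \<in> borel_measurable borel" using ig[OF z0] by (auto dest: borel_measurable_integrable)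
      show "(\<lambda>z. g \<zeta>0 z * inverse (z - \<zeta>)) \<in> borel_measurable lborel" by measurable
      have "norm (g \<zeta>0 z * inverse (z - \<zeta>)) \<le> norm (norm (g \<zeta>0 z) * (4 / e))" for z
      proof (cases "cmod (z - \<zeta>0) \<le> e / 2")
        case True then show ?thesis using moll_eq_0'[OF e(1)] by (simp add: g_def e_def[symmetric])
      next
        case False
        have "cmod (z - \<zeta>0) \<le> cmod (z - \<zeta>) + cmod (\<zeta> - \<zeta>0)"
          using norm_triangle_ineq[of "z - \<zeta>" "\<zeta> - \<zeta>0"] by simp
        then have "e / 4 \<le> cmod (z - \<zeta>)" using e False by linarith
        then have "inverse (cmod (z - \<zeta>)) \<le> inverse (e / 4)" using e by (intro le_imp_inverse_le) auto
        then have "norm (g \<zeta>0 z) * inverse (cmod (z - \<zeta>)) \<le> norm (g \<zeta>0 z) * (4 / e)" by (intro mult_left_mono) auto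
        then show ?thesis using e(1) by (simp add: norm_mult norm_inverse abs_mult)
      qed
      then show "AE z in lborel. norm (g \<zeta>0 z * inverse (z - \<zeta>)) \<le> norm (norm (g \<zeta>0 z) * (4 / e))" by simp
    qed
    have "0 = (\<integral>z. W z * dbar (\<lambda>z. ?A z + (-1) * ?B z) z \<partial>lborel)"
      by (rule test[OF s e(1) sup out, symmetric])
    also have "\<dots> = (\<integral>z. W z * of_real (moll \<zeta> r z) - g \<zeta>0 z * inverse (z - \<zeta>) \<partial>lborel)"
      unfolding d g_def e_def[symmetric] by (intro Bochner_Integration.integral_cong refl) (simp add: algebra_simps)
    also have "\<dots> = (\<integral>z. W z * of_real (moll \<zeta> r z) \<partial>lborel) - (\<integral>z. g \<zeta>0 z * inverse (z - \<zeta>) \<partial>lborel)"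
      by (rule Bochner_Integration.integral_diff[OF iWm ig'])
    finally show ?thesis by simp
  qed
  define H where "H = (\<lambda>\<zeta>. (\<integral>z. g \<zeta> z * inverse (z - \<zeta>) \<partial>lborel) / pi)"
  have H: "(\<integral>z. W z * of_real (moll \<zeta> r z) \<partial>lborel) = pi * H \<zeta>"
    if "cmod \<zeta> < 1" "0 < r" "r \<le> (1 - cmod \<zeta>) / 8" for \<zeta> r
    using key[of \<zeta> \<zeta> r] that by (simp add: H_def)
  have hol: "H holomorphic_on unit_disk"
  proof (rule holomorphic_onI)
    fix \<zeta>0 assume "\<zeta>0 \<in> unit_disk"
    then have z0: "cmod \<zeta>0 < 1" by simp
    define e where "e = (1 - cmod \<zeta>0) / 2"
    have e: "e > 0" using z0 by (simp add: e_def)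
    have "(\<lambda>w. \<integral>z. g \<zeta>0 z * inverse (z - w) \<partial>lborel) holomorphic_on ball \<zeta>0 (e / 2 / 2)"
    proof (rule holomorphic_cauchy_transform[OF ig[OF z0]])
      show "g \<zeta>0 z = 0" if "cmod (z - \<zeta>0) < e / 2" for z
        using moll_eq_0'[OF e, of z \<zeta>0] that by (simp add: g_def e_def[symmetric])
    qed (use e in auto)
    then have "(\<lambda>w. (\<integral>z. g \<zeta>0 z * inverse (z - w) \<partial>lborel) / pi) holomorphic_on ball \<zeta>0 (e / 4)"
      by (intro holomorphic_intros) auto
    moreover have "(\<integral>z. g \<zeta>0 z * inverse (z - w) \<partial>lborel) / pi = H w" if w: "w \<in> ball \<zeta>0 (e / 4)" for w
    proof -
      have w1: "cmod (w - \<zeta>0) < (1 - cmod \<zeta>0) / 8" using w by (simp add: e_def dist_norm norm_minus_commute)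
      have w2: "cmod w < 1" using norm_triangle_sub[of w \<zeta>0] w1 z0 by argo
      define r where "r = min ((1 - cmod \<zeta>0) / 8) ((1 - cmod w) / 8)"
      have r: "0 < r" unfolding r_def min_less_iff_conj using w2 z0 by simp
      have r': "r \<le> (1 - cmod \<zeta>0) / 8" "r \<le> (1 - cmod w) / 8"
        unfolding r_def by (rule min.cobounded1, rule min.cobounded2)
      have "(\<integral>z. g \<zeta>0 z * inverse (z - w) \<partial>lborel) = pi * H w"
        using key[OF z0 w1 r r'(1)] H[OF w2 r r'(2)] by simp
      then show ?thesis by simp
    qed
    ultimately have "H holomorphic_on ball \<zeta>0 (e / 4)" by (rule holomorphic_transform)
    then have "H field_differentiable at \<zeta>0"
      using e by (intro holomorphic_on_imp_differentiable_at[OF _ open_ball]) auto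
    then show "H field_differentiable at \<zeta>0 within unit_disk" by (rule field_differentiable_at_within)
  qed
  let ?L = "ennreal (2 powr p) * (\<integral>\<^sup>+z. ennreal (cmod (W z) powr p) \<partial>lborel)"
  have part: "(\<integral>\<^sup>+\<zeta>. ennreal (cmod (H \<zeta>) powr p) * indicator (ball 0 R) \<zeta> \<partial>lborel) \<le> ?L" if R: "R < 1" for R
  proof -
    \<comment> \<open>On a smaller disc one mollification radius is admissible for all centres, so
      Jensen and Fubini apply; the symmetry of \<open>moll\<close> in centre and variable evaluates
      the inner integral. Monotone convergence then lets R tend to 1.\<close>
    define r where "r = (1 - R) / 8"
    have r: "r > 0" using R by (simp add: r_def)
    have "ennreal (cmod (H \<zeta>) powr p) * indicator (ball 0 R) \<zeta> \<le>
      ennreal (2 powr p) * (\<integral>\<^sup>+z. ennreal (moll \<zeta> r z / pi * cmod (W z) powr p) \<partial>lborel)" for \<zeta>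
    proof (cases "\<zeta> \<in> ball 0 R")
      case True
      then have z1: "cmod \<zeta> < 1" "r \<le> (1 - cmod \<zeta>) / 8" using R by (auto simp: r_def)
      have e: "norm (W z * of_real (moll \<zeta> r z) / pi) = moll \<zeta> r z / pi * cmod (W z)" for z
        by (simp add: norm_mult norm_divide moll_nonneg)
      have f: "(\<integral>\<^sup>+z. ennreal (moll \<zeta> r z / pi * cmod (W z)) \<partial>lborel) < \<infinity>"
        using integrable_divide[OF iWm[of \<zeta> r], of "of_real pi"] unfolding integrable_iff_bounded e by simp
      have "H \<zeta> = (\<integral>z. W z * of_real (moll \<zeta> r z) / pi \<partial>lborel)"
        using H[OF z1(1) r z1(2)] by simp
      then have "cmod (H \<zeta>) \<le> enn2real (\<integral>\<^sup>+z. ennreal (moll \<zeta> r z / pi * cmod (W z)) \<partial>lborel)"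
        using norm_integral_le_enn2real[where M=lborel and f="\<lambda>z. W z * of_real (moll \<zeta> r z) / pi"] f unfolding e by simp
      then have "ennreal (cmod (H \<zeta>) powr p) \<le>
          ennreal (enn2real (\<integral>\<^sup>+z. ennreal (moll \<zeta> r z / pi * cmod (W z)) \<partial>lborel) powr p)"
        using p by (intro ennreal_leI powr_mono2) auto
      also have "\<dots> \<le> ennreal (2 powr p * 1 powr (p - 1)) * (\<integral>\<^sup>+z. ennreal (moll \<zeta> r z / pi * cmod (W z) powr p) \<partial>lborel)"
      proof (rule jensen_nn_integral)
        have "(\<integral>\<^sup>+z. ennreal (moll \<zeta> r z / pi) \<partial>lborel) = (\<integral>\<^sup>+z. ennreal (moll \<zeta> r z) * ennreal (1 / pi) \<partial>lborel)"
          by (intro nn_integral_cong) (simp add: ennreal_mult[symmetric] moll_nonneg)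
        also have "\<dots> = 1"
          using nn_integral_moll[OF r, of \<zeta>] by (subst nn_integral_multc) (auto simp: ennreal_mult[symmetric])
        finally show "(\<integral>\<^sup>+z. ennreal (moll \<zeta> r z / pi) \<partial>lborel) \<le> ennreal 1" by simp
      qed (use p in \<open>auto simp: moll_nonneg\<close>)
      finally show ?thesis using True by simp
    qed simp
    then have "(\<integral>\<^sup>+\<zeta>. ennreal (cmod (H \<zeta>) powr p) * indicator (ball 0 R) \<zeta> \<partial>lborel) \<le>
      (\<integral>\<^sup>+\<zeta>. ennreal (2 powr p) * (\<integral>\<^sup>+z. ennreal (moll \<zeta> r z / pi * cmod (W z) powr p) \<partial>lborel) \<partial>lborel)"
      by (intro nn_integral_mono)
    also have "\<dots> = ennreal (2 powr p) * (\<integral>\<^sup>+\<zeta>. (\<integral>\<^sup>+z. ennreal (moll \<zeta> r z / pi * cmod (W z) powr p) \<partial>lborel) \<partial>lborel)"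
      by (rule nn_integral_cmult) measurable
    also have "(\<integral>\<^sup>+\<zeta>. (\<integral>\<^sup>+z. ennreal (moll \<zeta> r z / pi * cmod (W z) powr p) \<partial>lborel) \<partial>lborel) =
      (\<integral>\<^sup>+z. (\<integral>\<^sup>+\<zeta>. ennreal (moll \<zeta> r z / pi * cmod (W z) powr p) \<partial>lborel) \<partial>lborel)"
      by (rule lborel_pair.Fubini') measurable
    also have "\<dots> = (\<integral>\<^sup>+z. ennreal (cmod (W z) powr p) \<partial>lborel)"
    proof (rule nn_integral_cong)
      fix z
      have "(\<integral>\<^sup>+\<zeta>. ennreal (moll \<zeta> r z / pi * cmod (W z) powr p) \<partial>lborel) =
        (\<integral>\<^sup>+\<zeta>. ennreal (moll z r \<zeta>) * ennreal (1 / pi * cmod (W z) powr p) \<partial>lborel)"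
        by (intro nn_integral_cong) (simp add: ennreal_mult[symmetric] moll_nonneg moll_commute[of z])
      also have "\<dots> = ennreal pi * ennreal (1 / pi * cmod (W z) powr p)"
        using nn_integral_moll[OF r, of z] by (subst nn_integral_multc) auto
      also have "\<dots> = ennreal (cmod (W z) powr p)" by (simp add: ennreal_mult[symmetric])
      finally show "(\<integral>\<^sup>+\<zeta>. ennreal (moll \<zeta> r z / pi * cmod (W z) powr p) \<partial>lborel) = ennreal (cmod (W z) powr p)" .
    qed
    finally show ?thesis .
  qed
  have "Bint p H \<le> ?L"
  proof -
    let ?R = "\<lambda>n::nat. 1 - inverse (real (Suc n))"
    let ?f = "\<lambda>n \<zeta>. ennreal (cmod (H \<zeta>) powr p) * indicator (ball 0 (?R n)) \<zeta>"
    have sub: "ball 0 (?R n) \<subseteq> unit_disk" for n by (intro subset_ball) simp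
    have mf: "?f n \<in> borel_measurable lborel" for n
    proof -
      have "?f n = (\<lambda>\<zeta>. (ennreal (cmod (H \<zeta>) powr p) * indicator unit_disk \<zeta>) * indicator (ball 0 (?R n)) \<zeta>)"
      proof (rule ext)
        fix \<zeta> show "?f n \<zeta> = (ennreal (cmod (H \<zeta>) powr p) * indicator unit_disk \<zeta>) * indicator (ball 0 (?R n)) \<zeta>"
          using sub[of n] by (cases "\<zeta> \<in> ball 0 (?R n)") (auto simp del: mem_ball of_nat_Suc)
      qed
      also have "\<dots> \<in> borel_measurable lborel"
        proof -
        define q where "q = (\<lambda>\<zeta>. ennreal (cmod (H \<zeta>) powr p) * indicator unit_disk \<zeta>)"
        have [measurable]: "q \<in> borel_measurable borel" "ball 0 (?R n) \<in> sets borel"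
          using bergman_measurable[OF hol, of p] by (auto simp: q_def)
        have "(\<lambda>\<zeta>. q \<zeta> * indicator (ball 0 (?R n)) \<zeta>) \<in> borel_measurable lborel" by measurable
        then show ?thesis by (simp add: q_def)
      qed
      finally show ?thesis .
    qed
    have "Bint p H = (\<integral>\<^sup>+\<zeta>. (SUP n. ?f n \<zeta>) \<partial>lborel)"
      unfolding Bint_def
    proof (intro nn_integral_cong antisym)
      fix \<zeta>
      show "ennreal (cmod (H \<zeta>) powr p) * indicator unit_disk \<zeta> \<le> (SUP n. ?f n \<zeta>)"
      proof (cases "\<zeta> \<in> unit_disk")
        case True
        then obtain n where "inverse (real (Suc n)) < 1 - cmod \<zeta>" using reals_Archimedean[of "1 - cmod \<zeta>"] by auto
        then have "ennreal (cmod (H \<zeta>) powr p) * indicator unit_disk \<zeta> \<le> ?f n \<zeta>" using True by simp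
        also have "\<dots> \<le> (SUP n. ?f n \<zeta>)" by (rule SUP_upper) simp
        finally show ?thesis .
      qed simp
      show "(SUP n. ?f n \<zeta>) \<le> ennreal (cmod (H \<zeta>) powr p) * indicator unit_disk \<zeta>"
      proof (rule SUP_least)
        fix n show "?f n \<zeta> \<le> ennreal (cmod (H \<zeta>) powr p) * indicator unit_disk \<zeta>"
          using sub[of n] by (cases "\<zeta> \<in> ball 0 (?R n)") (auto simp del: mem_ball of_nat_Suc)
      qed
    qed
    also have "\<dots> = (SUP n. \<integral>\<^sup>+\<zeta>. ?f n \<zeta> \<partial>lborel)"
    proof (rule nn_integral_monotone_convergence_SUP)
      have "?f n \<zeta> \<le> ?f (Suc n) \<zeta>" for n and \<zeta> :: complex
      proof -
        have "?R n \<le> ?R (Suc n)" by (simp add: le_imp_inverse_le)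
        from subset_ball[OF this, of "0::complex"] have "\<zeta> \<in> ball 0 (?R n) \<Longrightarrow> \<zeta> \<in> ball 0 (?R (Suc n))" by blast
        then show ?thesis
          by (cases "\<zeta> \<in> ball 0 (?R n)") (simp_all del: mem_ball of_nat_Suc)
      qed
      then show "incseq ?f" by (intro incseq_SucI le_funI)
    qed (rule mf)
    also have "\<dots> \<le> ?L" by (intro SUP_least part) simp
    finally show ?thesis .
  qed
  also have "?L < \<infinity>" using fin by (simp add: ennreal_mult_less_top)
  finally have "Bint p H < \<infinity>" .
  then show thesis using that hol H by blast
qed

text \<open>Functions in \<open>LpZ\<close> are measurable for the completed measure only, while
  Fubini and the kernel estimates run over \<open>lborel\<close>.\<close>

lemma lebesgue_borel_version:
  fixes f :: "complex \<Rightarrow> complex"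
  assumes f: "f \<in> borel_measurable lebesgue"
  obtains g where "g \<in> borel_measurable borel" "AE x in lborel. f x = g x"
proof -
  have "(\<lambda>x. Re (f x)) \<in> borel_measurable lebesgue" "(\<lambda>x. Im (f x)) \<in> borel_measurable lebesgue"
    using f by measurable
  then obtain a b where ab: "a \<in> borel_measurable lborel" "AE x in lborel. Re (f x) = a x"
    "b \<in> borel_measurable lborel" "AE x in lborel. Im (f x) = b x"
    using completion_ex_borel_measurable_real by metis
  show thesis
  proof (rule that[of "\<lambda>x. Complex (a x) (b x)"])
    have "(\<lambda>x. of_real (a x) + \<i> * of_real (b x)) \<in> borel_measurable borel"
      using ab by measurable
    then show "(\<lambda>x. Complex (a x) (b x)) \<in> borel_measurable borel" by (simp add: Complex_eq)
    show "AE x in lborel. f x = Complex (a x) (b x)"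
      using ab(2,4) by eventually_elim (simp add: complex_eq_iff)
  qed
qed

section \<open>Solvability implies interpolation\<close>

lemma set_lebesgue_integral_borel:
  fixes f g :: "complex \<Rightarrow> complex"
  assumes "g \<in> borel_measurable borel" "AE z in lborel. indicator unit_disk z *\<^sub>R f z = g z"
  shows "(\<integral>z\<in>unit_disk. f z \<partial>lebesgue) = (\<integral>z. g z \<partial>lborel)"
proof -
  have "(\<integral>z\<in>unit_disk. f z \<partial>lebesgue) = (\<integral>z. g z \<partial>lebesgue)"
    unfolding set_lebesgue_integral_def
  proof (rule integral_cong_AE)
    have g: "g \<in> borel_measurable lebesgue" using assms(1) by (simp add: measurable_completion)
    then show "g \<in> borel_measurable lebesgue" .
    have ae: "AE z in lebesgue. g z = indicator unit_disk z *\<^sub>R f z"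
      by (rule AE_completion) (use assms(2) in \<open>auto elim: eventually_mono\<close>)
    show "(\<lambda>z. indicator unit_disk z *\<^sub>R f z) \<in> borel_measurable lebesgue"
      by (rule borel_measurable_AE[OF g ae])
    show "AE z in lebesgue. indicator unit_disk z *\<^sub>R f z = g z"
      using ae by (auto elim: eventually_mono)
  qed
  also have "\<dots> = (\<integral>z. g z \<partial>lborel)" using assms(1) by (simp add: integral_completion)
  finally show ?thesis .
qed

lemma of_real_one_minus_sq_neq_0: "cmod z < 1 \<Longrightarrow> complex_of_real (1 - (cmod z)\<^sup>2) \<noteq> 0"
  using one_minus_sq_pos[of z] by (simp del: of_real_diff)

text \<open>The definition tests against \<open>(1 - \<bar>w\<bar>^2) * \<phi>\<close>; the choice
  \<phi> = \<theta> / (1 - \<bar>w\<bar>^2), extended by 0, gives the unweighted form. Smoothness of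
  \<theta> is asked on the disk only, because \<theta> will contain \<Psi> as a factor.\<close>

lemma dbar_weighted_solves_test:
  assumes sol: "dbar_weighted_solves u f" and \<theta>: "smooth_on unit_disk \<theta>"
    and r: "cball \<zeta> r \<subseteq> unit_disk" and out: "\<And>z. z \<notin> cball \<zeta> r \<Longrightarrow> \<theta> z = 0"
  shows "- (\<integral>z\<in>unit_disk. u z * dbar \<theta> z \<partial>lebesgue) =
    (\<integral>z\<in>unit_disk. f z * (\<theta> z * inverse (of_real (1 - (cmod z)\<^sup>2))) \<partial>lebesgue)"
proof -
  define \<phi> where "\<phi> = (\<lambda>z. if z \<in> unit_disk then \<theta> z * inverse (of_real (1 - (cmod z)\<^sup>2)) else 0)"
  have o: "open (- cball \<zeta> r)" by (intro open_Compl closed_cball)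
  have "smooth_on unit_disk (\<lambda>z. \<theta> z * inverse (of_real (1 - (cmod z)\<^sup>2)))"
    using of_real_one_minus_sq_neq_0
    by (intro smooth_on_mult \<theta> smooth_on_inverse smooth_on_subset[OF smooth_on_sqnorm subset_UNIV] open_ball) auto
  then have "smooth_on unit_disk \<phi>" by (rule smooth_on_cong[OF open_ball]) (simp add: \<phi>_def)
  moreover have "smooth_on (- cball \<zeta> r) \<phi>"
    by (rule smooth_on_cong[OF o smooth_on_const[OF o, of 0]]) (simp add: \<phi>_def out)
  ultimately have "smooth_on (unit_disk \<union> - cball \<zeta> r) \<phi>" by (rule smooth_on_Un)
  moreover have "unit_disk \<union> - cball \<zeta> r = UNIV" using r by auto
  ultimately have s: "smooth_fun \<phi>" by (intro smooth_on_UNIV) simp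
  have "closure {z. \<phi> z \<noteq> 0} \<subseteq> cball \<zeta> r"
  proof (rule closure_minimal)
    show "{z. \<phi> z \<noteq> 0} \<subseteq> cball \<zeta> r"
    proof
      fix z assume "z \<in> {z. \<phi> z \<noteq> 0}"
      then have "\<theta> z \<noteq> 0" unfolding \<phi>_def by (cases "z \<in> unit_disk") auto
      then show "z \<in> cball \<zeta> r" using out by blast
    qed
  qed simp
  moreover from this have "compact (closure {z. \<phi> z \<noteq> 0})"
    by (meson bounded_cball bounded_subset closed_closure compact_eq_bounded_closed)
  ultimately have "test_fun \<phi>" using s r by (auto simp: test_fun_def)
  then have "- (\<integral>z\<in>unit_disk. u z * dbar (\<lambda>w. complex_of_real (1 - (cmod w)\<^sup>2) * \<phi> w) z \<partial>lebesgue)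
        = (\<integral>z\<in>unit_disk. f z * \<phi> z \<partial>lebesgue)"
    using sol unfolding dbar_weighted_solves_def by blast
  moreover have "(\<integral>z\<in>unit_disk. u z * dbar (\<lambda>w. complex_of_real (1 - (cmod w)\<^sup>2) * \<phi> w) z \<partial>lebesgue) =
      (\<integral>z\<in>unit_disk. u z * dbar \<theta> z \<partial>lebesgue)"
  proof (rule set_lebesgue_integral_cong, simp, intro allI impI)
    fix z :: complex assume z: "z \<in> unit_disk"
    have "dbar (\<lambda>w. complex_of_real (1 - (cmod w)\<^sup>2) * \<phi> w) z = dbar \<theta> z"
    proof (rule dbar_cong_open[OF open_ball z])
      fix w :: complex assume "w \<in> unit_disk"
      then show "complex_of_real (1 - (cmod w)\<^sup>2) * \<phi> w = \<theta> w"
        using of_real_one_minus_sq_neq_0[of w] by (simp add: \<phi>_def)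
    qed
    then show "u z * dbar (\<lambda>w. complex_of_real (1 - (cmod w)\<^sup>2) * \<phi> w) z = u z * dbar \<theta> z" by simp
  qed
  moreover have "(\<integral>z\<in>unit_disk. f z * \<phi> z \<partial>lebesgue) =
      (\<integral>z\<in>unit_disk. f z * (\<theta> z * inverse (of_real (1 - (cmod z)\<^sup>2))) \<partial>lebesgue)"
    by (rule set_lebesgue_integral_cong) (auto simp: \<phi>_def)
  ultimately show ?thesis by simp
qed

lemma integrable_continuous_cball:
  fixes f :: "complex \<Rightarrow> complex"
  assumes "continuous_on UNIV f" "\<And>z. z \<notin> cball c r \<Longrightarrow> f z = 0"
  shows "integrable lborel f"
proof (rule continuous_bounded_cball[OF continuous_on_subset[OF assms(1) subset_UNIV]])
  fix B assume "\<And>z. z \<in> cball c r \<Longrightarrow> norm (f z) \<le> B"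
  then show ?thesis
    by (rule integrable_bounded_cball[OF borel_measurable_continuous_onI[OF assms(1)], of c r B]) (use assms(2) in auto)
qed

lemma integrable_mult_bounded:
  fixes f g :: "complex \<Rightarrow> complex"
  assumes f: "integrable lborel f" and [measurable]: "g \<in> borel_measurable borel" and B: "\<And>z. cmod (g z) \<le> B"
  shows "integrable lborel (\<lambda>z. f z * g z)"
proof (rule Bochner_Integration.integrable_bound[OF integrable_mult_left[OF integrable_norm[OF f], of B]])
  have [measurable]: "f \<in> borel_measurable borel" using f by (auto dest: borel_measurable_integrable)
  show "(\<lambda>z. f z * g z) \<in> borel_measurable lborel" by measurable
  have "norm (f z * g z) \<le> norm (norm (f z) * B)" for z
    using mult_left_mono[OF B[of z] norm_ge_zero[of "f z"]] by (simp add: norm_mult)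
  then show "AE z in lborel. norm (f z * g z) \<le> norm (norm (f z) * B)" by simp
qed

lemma smooth_compact_dbar_bounded:
  assumes s: "smooth_on UNIV \<Phi>" and out: "\<And>z. z \<notin> cball \<zeta> r \<Longrightarrow> \<Phi> z = 0"
  obtains B where "\<And>z. cmod (dbar \<Phi> z) \<le> B" "\<And>z. z \<notin> cball \<zeta> r \<Longrightarrow> dbar \<Phi> z = 0"
    "dbar \<Phi> \<in> borel_measurable borel" "continuous_on UNIV (dbar \<Phi>)"
proof -
  have c: "continuous_on UNIV (dbar \<Phi>)" using smooth_on_dbar[OF open_UNIV s] by (rule smooth_on_continuous)
  have z: "dbar \<Phi> z = 0" if "z \<notin> cball \<zeta> r" for z
  proof -
    have "dbar \<Phi> z = dbar (\<lambda>_. 0) z"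
      by (rule dbar_cong_open[of "- cball \<zeta> r"]) (use that out in \<open>auto intro!: open_Compl\<close>)
    then show ?thesis by (simp add: dbar_const)
  qed
  obtain B where B: "B > 0" "\<And>z. z \<in> cball \<zeta> r \<Longrightarrow> norm (dbar \<Phi> z) \<le> B"
    by (rule continuous_bounded_cball[OF continuous_on_subset[OF c subset_UNIV]], rule that)
  have "cmod (dbar \<Phi> z) \<le> B" for z using B z[of z] by (cases "z \<in> cball \<zeta> r") auto
  then show thesis using that z c borel_measurable_continuous_onI[OF c] by blast
qed

lemma cball_disk_subset:
  assumes "cball \<zeta> r \<subseteq> unit_disk"
  obtains R where "0 < R" "R < 1" "cball \<zeta> r \<subseteq> cball 0 R"
  by (rule compact_subset_unit_disk[OF compact_cball assms])

context separated_seq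
begin

lemma finite_Z_cball:
  assumes R: "R < 1"
  shows "finite {a \<in> Z. cmod a \<le> R}"
proof (rule ccontr)
  assume inf: "infinite {a \<in> Z. cmod a \<le> R}"
  then have "{a \<in> Z. cmod a \<le> R} \<noteq> {}" by force
  then obtain a0 where a0: "a0 \<in> Z" "cmod a0 \<le> R" by blast
  then have R0: "R \<ge> 0" using norm_ge_zero order_trans by blast
  define w where "w = (1 - R\<^sup>2)\<^sup>2"
  have R2: "R\<^sup>2 < 1" using R R0 by (simp add: abs_square_less_1)
  then have w: "w > 0" by (simp add: w_def)
  obtain N :: nat where N: "1 / \<kappa>\<^sup>2 / w < real N" using reals_Archimedean2 by blast
  obtain F where F: "F \<subseteq> {a \<in> Z. cmod a \<le> R}" "finite F" "card F = N"
    using infinite_arbitrarily_large[OF inf] by blast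
  have "real N * w = (\<Sum>a\<in>F. w)" using F by simp
  also have "\<dots> \<le> (\<Sum>a\<in>F. (1 - (cmod a)\<^sup>2)\<^sup>2)"
  proof (rule sum_mono)
    fix a assume "a \<in> F"
    then have "cmod a \<le> R" using F by auto
    then have "(cmod a)\<^sup>2 \<le> R\<^sup>2" by (intro power_mono) auto
    then show "w \<le> (1 - (cmod a)\<^sup>2)\<^sup>2" unfolding w_def using R2 by (intro power_mono) auto
  qed
  also have "\<dots> \<le> 1 / \<kappa>\<^sup>2" using F by (intro sum_weights_le) auto
  finally have "real N \<le> 1 / \<kappa>\<^sup>2 / w" using w by (subst pos_le_divide_eq) auto
  with N show False by simp
qed

lemma finite_hball_meets:
  assumes R: "R < 1"
  shows "finite {a \<in> Z. hball \<kappa> a \<inter> cball 0 R \<noteq> {}}"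
\<comment> \<open>If the disc of a meets \<open>cball 0 R\<close>, then \<open>\<bar>a\<bar>\<close>
  is at most \<open>R + (1 - \<bar>a\<bar>^2) / 8\<close> and so at most
  \<open>R + (1 - \<bar>a\<bar>) / 4\<close>; solving for \<open>\<bar>a\<bar>\<close> gives this
  radius, again less than 1.\<close>
proof (rule finite_subset[OF _ finite_Z_cball[of "(4 * R + 1) / 5"]])
  show "{a \<in> Z. hball \<kappa> a \<inter> cball 0 R \<noteq> {}} \<subseteq> {a \<in> Z. cmod a \<le> (4 * R + 1) / 5}"
  proof safe
    fix a z assume a: "a \<in> Z" and z: "z \<in> hball \<kappa> a" "z \<in> cball 0 R"
    define N where "N = 1 - (cmod a)\<^sup>2"
    have "0 < N" "N \<le> 2 - 2 * cmod a"
      using one_minus_sq_pos[OF Z_cmod[OF a]] one_minus_sq_le[of a] by (simp_all add: N_def)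
    moreover have "cmod (z - a) < \<kappa> * N" using hball_props(2)[OF kappa Z_cmod[OF a] z(1)] by (simp add: N_def)
    moreover have "\<kappa> * N \<le> 1/8 * N" using kappa \<open>0 < N\<close> by (intro mult_right_mono) auto
    moreover have "cmod a \<le> cmod z + cmod (z - a)" using norm_triangle_sub[of a z] by (simp add: norm_minus_commute)
    moreover have "cmod z \<le> R" using z by simp
    ultimately show "cmod a \<le> (4 * R + 1) / 5" by argo
  qed
qed (use R in simp)

section \<open>Gluing over the disjoint discs\<close>

text \<open>A sum over \<open>Z\<close> of functions supported in disjoint discs, defined without
  convergence questions by selecting the only disc that contains z.\<close>

definition glue :: "(complex \<Rightarrow> complex \<Rightarrow> complex) \<Rightarrow> complex \<Rightarrow> complex" where
  "glue g z = (if \<exists>a\<in>Z. z \<in> hball \<kappa> a then g (THE a. a \<in> Z \<and> z \<in> hball \<kappa> a) z else 0)"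

lemma glue_eq: "a \<in> Z \<Longrightarrow> z \<in> hball \<kappa> a \<Longrightarrow> glue g z = g a z"
proof -
  assume a: "a \<in> Z" "z \<in> hball \<kappa> a"
  then have "(THE a. a \<in> Z \<and> z \<in> hball \<kappa> a) = a" using disjoint by (intro the_equality) blast+
  then show ?thesis using a by (auto simp: glue_def)
qed

lemma glue_0: "(\<And>a. a \<in> Z \<Longrightarrow> z \<notin> hball \<kappa> a) \<Longrightarrow> glue g z = 0"
  by (auto simp: glue_def)

lemma glue_sum:
  assumes S: "finite S" "S \<subseteq> Z" and cov: "\<And>a. a \<in> Z \<Longrightarrow> z \<in> hball \<kappa> a \<Longrightarrow> a \<in> S"
  shows "glue g z = (\<Sum>a\<in>S. indicator (hball \<kappa> a) z * g a z)"
proof (cases "\<exists>a\<in>Z. z \<in> hball \<kappa> a")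
  case True
  then obtain a where a: "a \<in> Z" "z \<in> hball \<kappa> a" by blast
  have "(\<Sum>b\<in>S. indicator (hball \<kappa> b) z * g b z) = (\<Sum>b\<in>S. if b = a then g a z else 0)"
    using disjoint[of a] a S by (intro sum.cong) (auto simp: indicator_def)
  also have "\<dots> = g a z" using cov[OF a] S by simp
  finally show ?thesis using glue_eq[OF a] by simp
next
  case False
  then have "(\<Sum>a\<in>S. indicator (hball \<kappa> a) z * g a z) = 0" using S by (intro sum.neutral) auto
  then show ?thesis using False by (simp add: glue_def)
qed

lemma glue_measurable:
  assumes g: "\<And>a. a \<in> Z \<Longrightarrow> g a \<in> borel_measurable borel"
  shows "glue g \<in> borel_measurable borel"
proof (rule borel_measurable_LIMSEQ_metric)
  fix z
  show "(\<lambda>n. \<Sum>a\<in>exh Z n. indicator (hball \<kappa> a) z * g a z) \<longlonglongrightarrow> glue g z"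
  proof (rule tendsto_eventually)
    obtain N where N: "\<And>a. a \<in> Z \<Longrightarrow> z \<in> hball \<kappa> a \<Longrightarrow> a \<in> exh Z N"
    proof (cases "\<exists>a\<in>Z. z \<in> hball \<kappa> a")
      case True
      then obtain a where a: "a \<in> Z" "z \<in> hball \<kappa> a" by blast
      then obtain N where "a \<in> exh Z N" using exh_props(4)[OF Z_countable] by blast
      then show ?thesis using that[of N] disjoint[of a] a by blast
    qed (use that in blast)
    have "(\<Sum>a\<in>exh Z n. indicator (hball \<kappa> a) z * g a z) = glue g z" if "n \<ge> N" for n
      using N exh_props(3)[OF Z_countable that]
      by (intro glue_sum[symmetric] exh_props[OF Z_countable]) blast
    then show "eventually (\<lambda>n. (\<Sum>a\<in>exh Z n. indicator (hball \<kappa> a) z * g a z) = glue g z) sequentially"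
      by (intro eventually_sequentiallyI[of N]) auto
  qed
next
  fix n
  show "(\<lambda>z. \<Sum>a\<in>exh Z n. indicator (hball \<kappa> a) z * g a z) \<in> borel_measurable borel"
  proof (intro borel_measurable_sum)
    fix a assume "a \<in> exh Z n"
    then have [measurable]: "g a \<in> borel_measurable borel" using exh_props(2)[OF Z_countable] g by blast
    have [measurable]: "hball \<kappa> a \<in> sets borel" by (simp add: hball_def)
    show "(\<lambda>z. indicator (hball \<kappa> a) z * g a z) \<in> borel_measurable borel" by measurable
  qed
qed

lemma nn_integral_Union_hball_le:
  assumes F[measurable]: "F \<in> borel_measurable borel"
    and L: "\<And>S. finite S \<Longrightarrow> S \<subseteq> Z \<Longrightarrow> (\<Sum>a\<in>S. (\<integral>\<^sup>+z\<in>hball \<kappa> a. F z \<partial>lborel)) \<le> L"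
  shows "(\<integral>\<^sup>+z\<in>\<Union>a\<in>Z. hball \<kappa> a. F z \<partial>lborel) \<le> L"
proof -
  have [measurable]: "hball \<kappa> a \<in> sets borel" for a by (simp add: hball_def)
  let ?f = "\<lambda>n z. \<Sum>a\<in>exh Z n. F z * indicator (hball \<kappa> a) z"
  have "(\<integral>\<^sup>+z\<in>\<Union>a\<in>Z. hball \<kappa> a. F z \<partial>lborel) \<le> (\<integral>\<^sup>+z. (SUP n. ?f n z) \<partial>lborel)"
  proof (rule nn_integral_mono)
    fix z
    show "F z * indicator (\<Union>a\<in>Z. hball \<kappa> a) z \<le> (SUP n. ?f n z)"
    proof (cases "z \<in> (\<Union>a\<in>Z. hball \<kappa> a)")
      case True
      then obtain a where a: "a \<in> Z" "z \<in> hball \<kappa> a" by blast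
      then obtain n where n: "a \<in> exh Z n" using exh_props(4)[OF Z_countable] by blast
      have "F z * indicator (\<Union>a\<in>Z. hball \<kappa> a) z = F z * indicator (hball \<kappa> a) z"
        using True a by simp
      also have "\<dots> \<le> ?f n z"
        using n exh_props(1)[OF Z_countable] by (intro sum_nonneg_leq_bound[OF _ _ refl]) auto
      also have "\<dots> \<le> (SUP n. ?f n z)" by (rule SUP_upper) simp
      finally show ?thesis .
    qed simp
  qed
  also have "\<dots> = (SUP n. \<integral>\<^sup>+z. ?f n z \<partial>lborel)"
  proof (rule nn_integral_monotone_convergence_SUP)
    show "incseq ?f"
      using exh_props[OF Z_countable] by (intro incseq_SucI le_funI sum_mono2) auto
  qed measurable
  also have "\<dots> \<le> L"
  proof (rule SUP_least)
    fix n
    have "(\<integral>\<^sup>+z. ?f n z \<partial>lborel) = (\<Sum>a\<in>exh Z n. (\<integral>\<^sup>+z\<in>hball \<kappa> a. F z \<partial>lborel))"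
      by (rule nn_integral_sum) measurable
    also have "\<dots> \<le> L" by (rule L[OF exh_props(1,2)[OF Z_countable]])
    finally show "(\<integral>\<^sup>+z. ?f n z \<partial>lborel) \<le> L" .
  qed
  finally show ?thesis .
qed

lemma nn_integral_Union_hball_coeff:
  assumes [measurable]: "F \<in> borel_measurable borel" and c: "c \<in> lpZ p Z" and K: "K \<ge> 0"
    and F: "\<And>a z. a \<in> Z \<Longrightarrow> z \<in> hball \<kappa> a \<Longrightarrow> F z \<le> ennreal (K * cmod (c a) powr p)"
  shows "(\<integral>\<^sup>+z\<in>\<Union>a\<in>Z. hball \<kappa> a. F z \<partial>lborel) < \<infinity>"
proof -
  let ?w = "\<lambda>a. cmod (c a) powr p * (1 - (cmod a)\<^sup>2)\<^sup>2"
  have s: "?w summable_on Z" using c by (simp add: lpZ_def)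
  have "(\<integral>\<^sup>+z\<in>\<Union>a\<in>Z. hball \<kappa> a. F z \<partial>lborel) \<le> ennreal (K * pi * \<kappa>\<^sup>2 * infsum ?w Z)"
  proof (rule nn_integral_Union_hball_le)
    fix S assume S: "finite S" "S \<subseteq> Z"
    have "(\<Sum>a\<in>S. (\<integral>\<^sup>+z\<in>hball \<kappa> a. F z \<partial>lborel)) \<le> (\<Sum>a\<in>S. ennreal (K * pi * \<kappa>\<^sup>2 * ?w a))"
    proof (rule sum_mono)
      fix a assume a: "a \<in> S"
      then have aZ: "a \<in> Z" using S by auto
      have "(\<integral>\<^sup>+z\<in>hball \<kappa> a. F z \<partial>lborel) \<le>
         (\<integral>\<^sup>+z\<in>hball \<kappa> a. ennreal (K * cmod (c a) powr p) \<partial>lborel)"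
        using F[OF aZ] by (intro nn_integral_mono) (auto simp: indicator_def)
      also have "\<dots> = ennreal (K * cmod (c a) powr p) * ennreal (pi * \<kappa>\<^sup>2 * (1 - (cmod a)\<^sup>2)\<^sup>2)"
        using aZ by (subst nn_integral_cmult_indicator) (auto simp: emeasure_hball, simp add: hball_def)
      also have "\<dots> = ennreal (K * pi * \<kappa>\<^sup>2 * ?w a)"
        using K by (simp add: ennreal_mult[symmetric] mult_ac)
      finally show "(\<integral>\<^sup>+z\<in>hball \<kappa> a. F z \<partial>lborel) \<le> ennreal (K * pi * \<kappa>\<^sup>2 * ?w a)" .
    qed
    also have "\<dots> = ennreal (K * pi * \<kappa>\<^sup>2 * (\<Sum>a\<in>S. ?w a))"
      using K by (subst sum_ennreal) (auto simp: sum_distrib_left)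
    also have "\<dots> \<le> ennreal (K * pi * \<kappa>\<^sup>2 * infsum ?w Z)"
      using K by (intro ennreal_leI mult_left_mono finite_sum_le_infsum s S) auto
    finally show "(\<Sum>a\<in>S. (\<integral>\<^sup>+z\<in>hball \<kappa> a. F z \<partial>lborel)) \<le> ennreal (K * pi * \<kappa>\<^sup>2 * infsum ?w Z)" .
  qed simp
  then show ?thesis by (simp add: le_less_trans)
qed

lemma LpZ_int_eq: "LpZ_int p Z f =
   (\<integral>\<^sup>+z\<in>unit_disk. ennreal ((cmod (f z) * exp (kZ Z z)) powr p) \<partial>lborel)"
  by (simp add: LpZ_int_def nn_integral_completion)

text \<open>The mean value inequality on the disc of a carries the factor
  \<open>1 / (\<kappa> (1 - \<bar>a\<bar>^2))^2\<close>, which the weight of a cancels; the discs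
  are disjoint, so the local integrals add up to at most \<open>Bint p f\<close>.\<close>

theorem bergman_restrict:
  assumes p: "p \<ge> 1"
  obtains C where "C > 0" "\<And>f S. f holomorphic_on unit_disk \<Longrightarrow> finite S \<Longrightarrow> S \<subseteq> Z \<Longrightarrow>
     ennreal (\<Sum>a\<in>S. cmod (f a) powr p * (1 - (cmod a)\<^sup>2)\<^sup>2) \<le> ennreal C * Bint p f"
proof -
  obtain C where C: "C > 0" "\<And>h \<zeta> r. h holomorphic_on ball \<zeta> r \<Longrightarrow> r > 0 \<Longrightarrow>
    ennreal (cmod (h \<zeta>) powr p) \<le>
      ennreal (C / r\<^sup>2) * (\<integral>\<^sup>+z\<in>ball \<zeta> r. ennreal (cmod (h z) powr p) \<partial>lborel)"
    by (rule holomorphic_norm_powr_le[OF p], rule that)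
  show thesis
  proof (rule that[of "C / \<kappa>\<^sup>2"])
    fix f S assume f: "f holomorphic_on unit_disk" and S: "finite S" "S \<subseteq> Z"
    define q where "q = (\<lambda>z. ennreal (cmod (f z) powr p) * indicator unit_disk z)"
    have [measurable]: "q \<in> borel_measurable borel" unfolding q_def by (rule bergman_measurable[OF f])
    have "ennreal (cmod (f a) powr p * (1 - (cmod a)\<^sup>2)\<^sup>2) \<le>
      ennreal (C / \<kappa>\<^sup>2) * (\<integral>\<^sup>+z\<in>hball \<kappa> a. q z \<partial>lborel)" if a: "a \<in> S" for a
    proof -
      have a1: "cmod a < 1" using a S Z_cmod by auto
      define N where "N = 1 - (cmod a)\<^sup>2"
      have N: "N > 0" using one_minus_sq_pos[OF a1] by (simp add: N_def)
      have sub: "hball \<kappa> a \<subseteq> unit_disk" using hball_props(1)[OF kappa a1] by auto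
      have "ennreal (cmod (f a) powr p) \<le> ennreal (C / (\<kappa> * N)\<^sup>2) *
          (\<integral>\<^sup>+z\<in>ball a (\<kappa> * N). ennreal (cmod (f z) powr p) \<partial>lborel)"
        using sub N kappa by (intro C(2) holomorphic_on_subset[OF f]) (auto simp: hball_def N_def)
      also have "(\<integral>\<^sup>+z\<in>ball a (\<kappa> * N). ennreal (cmod (f z) powr p) \<partial>lborel) =
         (\<integral>\<^sup>+z\<in>hball \<kappa> a. q z \<partial>lborel)"
        using sub by (intro nn_integral_cong) (auto simp: q_def hball_def N_def indicator_def)
      finally have "ennreal (N\<^sup>2) * ennreal (cmod (f a) powr p) \<le>
         ennreal (N\<^sup>2) * (ennreal (C / (\<kappa> * N)\<^sup>2) * (\<integral>\<^sup>+z\<in>hball \<kappa> a. q z \<partial>lborel))"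
        by (rule mult_left_mono) simp
      also have "\<dots> = ennreal (C / \<kappa>\<^sup>2) * (\<integral>\<^sup>+z\<in>hball \<kappa> a. q z \<partial>lborel)"
        using N C kappa by (simp add: mult.assoc[symmetric] ennreal_mult[symmetric] power_mult_distrib)
      finally show ?thesis by (simp add: ennreal_mult N_def mult.commute)
    qed
    then have "(\<Sum>a\<in>S. ennreal (cmod (f a) powr p * (1 - (cmod a)\<^sup>2)\<^sup>2)) \<le>
      (\<Sum>a\<in>S. ennreal (C / \<kappa>\<^sup>2) * (\<integral>\<^sup>+z\<in>hball \<kappa> a. q z \<partial>lborel))"
      by (rule sum_mono)
    also have "\<dots> \<le> ennreal (C / \<kappa>\<^sup>2) * (\<integral>\<^sup>+z\<in>unit_disk. q z \<partial>lborel)"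
      unfolding sum_distrib_left[symmetric] by (intro mult_left_mono sum_nn_integral_hball_le S) auto
    also have "(\<integral>\<^sup>+z\<in>unit_disk. q z \<partial>lborel) = Bint p f"
      unfolding Bint_def q_def by (intro nn_integral_cong) (auto simp: indicator_def)
    finally show "ennreal (\<Sum>a\<in>S. cmod (f a) powr p * (1 - (cmod a)\<^sup>2)\<^sup>2) \<le> ennreal (C / \<kappa>\<^sup>2) * Bint p f"
      by (subst sum_ennreal[symmetric]) auto
  qed (use C kappa in auto)
qed

lemma bergman_lpZ:
  assumes p: "p \<ge> 1" and f: "f \<in> bergman p"
  shows "f \<in> lpZ p Z"
proof -
  obtain C where C: "C > 0" "\<And>f S. f holomorphic_on unit_disk \<Longrightarrow> finite S \<Longrightarrow> S \<subseteq> Z \<Longrightarrow>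
     ennreal (\<Sum>a\<in>S. cmod (f a) powr p * (1 - (cmod a)\<^sup>2)\<^sup>2) \<le> ennreal C * Bint p f"
    by (rule bergman_restrict[OF p], rule that)
  have f': "f holomorphic_on unit_disk" "Bint p f < \<infinity>" using f by (auto simp: bergman_iff)
  then obtain b where b: "Bint p f = ennreal b" "b \<ge> 0" by (cases "Bint p f") auto
  have "(\<Sum>a\<in>S. cmod (f a) powr p * (1 - (cmod a)\<^sup>2)\<^sup>2) \<le> C * b" if "finite S" "S \<subseteq> Z" for S
    using C(2)[OF f'(1) that] C(1) b by (simp add: ennreal_mult[symmetric] ennreal_le_iff)
  then show ?thesis unfolding lpZ_def
    by (auto intro!: nonneg_bdd_above_summable_on bdd_aboveI[of _ "C * b"])
qed

text \<open>Since u is only an L^p function, neither holomorphy of the corrected function nor the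
  vanishing of \<open>u * \<Psi>\<close> at a point of \<open>Z\<close> can be read off pointwise.
  Both are obtained by testing: the first against all test functions, the second against the test
  function \<open>\<Psi> z / (z - a)\<close> cut off near a.\<close>

theorem interpolate_of_dbar:
  assumes p: "p \<ge> 1" and solv: "\<And>f. f \<in> LpZ p Z \<Longrightarrow> \<exists>u\<in>LpZ p Z. dbar_weighted_solves u f"
    and c: "c \<in> lpZ p Z"
  shows "\<exists>H\<in>bergman p. \<forall>a\<in>Z. H a = c a"
proof -
  obtain \<Psi> where P: "\<Psi> holomorphic_on unit_disk"
    "\<And>z. cmod z < 1 \<Longrightarrow> cmod (\<Psi> z) \<le> exp (kZ Z z)"
    "\<And>z a. cmod z < 1 \<Longrightarrow> a \<in> Z \<Longrightarrow> cmod (\<Psi> z) \<le> 2 * pseudo_hyp z a * exp (kZ Z z)"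
    "\<And>z. cmod z < 1 \<Longrightarrow> \<forall>b\<in>Z. z \<notin> hball \<kappa> b \<Longrightarrow> lowc * exp (kZ Z z) \<le> cmod (\<Psi> z)"
    "\<And>z a. a \<in> Z \<Longrightarrow> z \<in> hball \<kappa> a \<Longrightarrow> lowc * pseudo_hyp z a * exp (kZ Z z) \<le> cmod (\<Psi> z)"
    by (rule canonical_function, rule that)
  \<comment> \<open>The values of \<Psi> off the disk are arbitrary; the truncation is Borel on the
    whole plane.\<close>
  define P' where "P' = (\<lambda>z. indicator unit_disk z *\<^sub>R \<Psi> z)"
  have P'm[measurable]: "P' \<in> borel_measurable borel"
    unfolding P'_def by (rule holomorphic_indicator_measurable[OF P(1) open_ball])
  have P'_eq: "P' z = \<Psi> z" if "z \<in> unit_disk" for z using that by (simp add: P'_def)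
  define r where "r = (\<lambda>a. \<kappa> * (1 - (cmod a)\<^sup>2))"
  have r: "r a > 0" if "a \<in> Z" for a using kappa one_minus_sq_pos[OF Z_cmod[OF that]] by (simp add: r_def)
  have hball_r: "z \<in> hball \<kappa> a \<longleftrightarrow> cmod (z - a) < r a" for z a
    by (simp add: hball_def r_def dist_norm norm_minus_commute)
  have hb_disk: "z \<in> unit_disk" if "a \<in> Z" "z \<in> hball \<kappa> a" for a z
    using hball_props(1)[OF kappa Z_cmod[OF that(1)] that(2)] by simp
  define cut where "cut = (\<lambda>a z. c a * of_real (1 - rstep a (r a) z))"
  define dcut where "dcut = (\<lambda>a z. - (c a * of_real (moll a (r a) z) * (z - a)))"
  have cut_m[measurable]: "cut a \<in> borel_measurable borel" and dcut_m[measurable]: "dcut a \<in> borel_measurable borel" for a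
    by (simp_all add: cut_def dcut_def)
  have s_cut: "smooth_on UNIV (cut a)" if a: "a \<in> Z" for a
  proof -
    have "smooth_on UNIV (\<lambda>z. c a * (1 + (-1) * of_real (rstep a (r a) z)))"
      by (intro smooth_on_mult smooth_on_add smooth_on_const smooth_on_rstep r a open_UNIV)
    then show ?thesis by (simp add: cut_def)
  qed
  have d_cut: "dbar (cut a) z = dcut a z" if a: "a \<in> Z" for a z
  proof -
    have "dbar (\<lambda>z. c a + (- c a) * complex_of_real (rstep a (r a) z)) z =
        dbar (\<lambda>_. c a) z + (dbar (\<lambda>_. - c a) z * of_real (rstep a (r a) z) + (- c a) * dbar (\<lambda>z. of_real (rstep a (r a) z)) z)"
      using smooth_on_differentiable[OF smooth_on_rstep[OF r[OF a]] UNIV_I]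
      by (subst dbar_add, simp, simp, subst dbar_mult) auto
    then show ?thesis by (simp add: cut_def dcut_def dbar_const dbar_rstep_moll algebra_simps)
  qed
  have cut_0: "cut a z = 0" "dcut a z = 0" if "a \<in> Z" "z \<notin> hball \<kappa> a" for a z
    using that r[of a] by (auto simp: cut_def dcut_def hball_r rstep_eq_1 moll_eq_0)
  define F where "F = glue cut"
  define DF where "DF = glue dcut"
  have F_m[measurable]: "F \<in> borel_measurable borel" and DF_m[measurable]: "DF \<in> borel_measurable borel"
    unfolding F_def DF_def by (rule glue_measurable, measurable)+
  have F_eq: "F z = cut a z" "DF z = dcut a z" if "a \<in> Z" "z \<in> hball \<kappa> a" for a z
    using glue_eq[OF that] by (simp_all add: F_def DF_def)
  have F_0: "F z = 0" "DF z = 0" if "\<And>a. a \<in> Z \<Longrightarrow> z \<notin> hball \<kappa> a" for z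
    using glue_0[OF that] by (simp_all add: F_def DF_def)
  have F_disk: "F z = 0" "DF z = 0" if "z \<notin> unit_disk" for z
    using F_0[of z] hb_disk that by blast+
  \<comment> \<open>No singularity arises at \<open>Z\<close>: \<open>DF\<close> vanishes on the
    half-size discs, and at the zeros themselves the inverse is 0 by convention.\<close>
  define f where "f = (\<lambda>z. of_real (1 - (cmod z)\<^sup>2) * DF z * inverse (P' z))"
  have f_m[measurable]: "f \<in> borel_measurable borel" unfolding f_def by measurable
  obtain B where B: "B > 0" "\<And>w r z. moll w r z \<le> B / r\<^sup>2" using moll_bounded by blast
  have lowc: "lowc > 0" by (simp add: lowc_def)
  \<comment> \<open>The distance \<open>\<bar>z - a\<bar>\<close> in \<open>DF\<close> cancels the
    pseudo-hyperbolic distance in the lower bound for \<Psi>. The comparison constants multiply to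
    5/2 * 5/4 = 25/8, rounded up to 4.\<close>
  define K where "K = 4 * B / (\<kappa>\<^sup>2 * lowc)"
  have K: "K > 0" using B lowc kappa by (simp add: K_def)
  have f_bd: "cmod (f z) * exp (kZ Z z) \<le> K * cmod (c a)" if a: "a \<in> Z" and z: "z \<in> hball \<kappa> a" for a z
  proof (cases "z = a")
    case True
    then show ?thesis using F_eq(2)[OF a z] K by (simp add: f_def dcut_def)
  next
    case False
    have a1: "cmod a < 1" by (rule Z_cmod[OF a])
    note h = hball_props[OF kappa a1 z]
    define N where "N = 1 - (cmod a)\<^sup>2"
    have N: "N > 0" using one_minus_sq_pos[OF a1] by (simp add: N_def)
    define q where "q = pseudo_hyp z a"
    have q: "q > 0" using False cmod_one_minus_ge(6)[OF h(1) a1] by (simp add: q_def pseudo_hyp_eq)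
    have za: "cmod (z - a) \<le> 5/4 * N * q" using h(5) by (simp add: N_def q_def)
    have aa: "cmod (1 - cnj a * a) = N"
    proof -
      have "1 - cnj a * a = of_real N"
        unfolding N_def by (metis complex_norm_square mult.commute of_real_1 of_real_diff)
      then show ?thesis using N by (simp only: norm_of_real)
    qed
    have "1 - (cmod z)\<^sup>2 \<le> 2 * cmod (1 - cnj a * z)" by (rule cmod_one_minus_ge(3)[OF h(1) a1])
    also have "\<dots> \<le> 2 * (5/4 * N)" using h(4)[OF a1] aa by simp
    finally have z2: "1 - (cmod z)\<^sup>2 \<le> 5/2 * N" by simp
    have z3: "0 \<le> 1 - (cmod z)\<^sup>2" using one_minus_sq_pos[OF h(1)] by simp
    have psi: "lowc * q * exp (kZ Z z) \<le> cmod (\<Psi> z)" using P(5)[OF a z] by (simp add: q_def)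
    have psi0: "0 < lowc * q * exp (kZ Z z)" using lowc q by simp
    have ip: "inverse (cmod (\<Psi> z)) * exp (kZ Z z) \<le> 1 / (lowc * q)"
    proof -
      have "inverse (cmod (\<Psi> z)) \<le> inverse (lowc * q * exp (kZ Z z))"
        using psi psi0 by (intro le_imp_inverse_le)
      then have "inverse (cmod (\<Psi> z)) * exp (kZ Z z) \<le> inverse (lowc * q * exp (kZ Z z)) * exp (kZ Z z)"
        by (intro mult_right_mono) auto
      also have "inverse (lowc * q * exp (kZ Z z)) * exp (kZ Z z) = 1 / (lowc * q)"
        using lowc q by (simp add: field_simps)
      finally show ?thesis .
    qed
    have m: "moll a (r a) z \<le> B / (\<kappa> * N)\<^sup>2" using B(2)[of a "r a" z] by (simp add: r_def N_def)
    have "cmod (f z) * exp (kZ Z z) = (1 - (cmod z)\<^sup>2) * (cmod (c a) * moll a (r a) z * cmod (z - a)) *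
        (inverse (cmod (\<Psi> z)) * exp (kZ Z z))"
      using F_eq(2)[OF a z] P'_eq[OF hb_disk[OF a z]] z3
      by (simp add: f_def dcut_def norm_mult norm_inverse moll_nonneg del: of_real_diff)
    also have "\<dots> \<le> (5/2 * N) * (cmod (c a) * (B / (\<kappa> * N)\<^sup>2) * (5/4 * N * q)) * (1 / (lowc * q))"
      using z2 z3 m za ip N q moll_nonneg B(1) by (intro mult_mono mult_nonneg_nonneg) auto
    also have "\<dots> = (25/8 * B / (\<kappa>\<^sup>2 * lowc)) * cmod (c a)"
      using N q by (simp add: power2_eq_square mult_ac)
    also have "\<dots> \<le> K * cmod (c a)"
      unfolding K_def using B lowc by (intro mult_right_mono divide_right_mono) auto
    finally show ?thesis .
  qed
  define kk where "kk = (\<lambda>z. if z \<in> unit_disk then kZ Z z else 0)"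
  have kk[measurable]: "kk \<in> borel_measurable borel" unfolding kk_def by (rule kZ_measurable)
  have f_L: "f \<in> LpZ p Z"
  proof -
    have [measurable]: "unit_disk \<in> sets borel" by simp
    have "(\<lambda>z. indicator unit_disk z *\<^sub>R f z) \<in> borel_measurable lborel"
      by measurable
    then have 1: "set_borel_measurable lebesgue unit_disk f"
      unfolding set_borel_measurable_def by (rule measurable_completion)
    let ?G = "\<lambda>z. ennreal ((cmod (f z) * exp (kk z)) powr p)"
    have "LpZ_int p Z f \<le> (\<integral>\<^sup>+z\<in>\<Union>a\<in>Z. hball \<kappa> a. ?G z \<partial>lborel)"
      unfolding LpZ_int_eq
    proof (rule nn_integral_mono)
      fix z
      show "ennreal ((cmod (f z) * exp (kZ Z z)) powr p) * indicator unit_disk z \<le>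
        ?G z * indicator (\<Union>a\<in>Z. hball \<kappa> a) z"
      proof (cases "z \<in> (\<Union>a\<in>Z. hball \<kappa> a)")
        case True then show ?thesis by (simp add: kk_def indicator_def)
      next
        case False
        then have "f z = 0" using F_0(2)[of z] by (simp add: f_def)
        then show ?thesis by simp
      qed
    qed
    also have "\<dots> < \<infinity>"
    proof (rule nn_integral_Union_hball_coeff[OF _ c, of _ "K powr p"])
      fix a z assume a: "a \<in> Z" and z: "z \<in> hball \<kappa> a"
      have "(cmod (f z) * exp (kk z)) powr p \<le> (K * cmod (c a)) powr p"
        using f_bd[OF a z] hb_disk[OF a z] p by (intro powr_mono2) (auto simp: kk_def)
      then show "?G z \<le> ennreal (K powr p * cmod (c a) powr p)"
        using K by (intro ennreal_leI) (simp add: powr_mult)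
    qed auto
    finally show ?thesis using 1 by (simp add: LpZ_def)
  qed
  then obtain u where u: "u \<in> LpZ p Z" and sol: "dbar_weighted_solves u f" using solv by blast
  have "(\<lambda>z. indicator unit_disk z *\<^sub>R u z) \<in> borel_measurable lebesgue"
    using u by (simp add: LpZ_def set_borel_measurable_def)
  then obtain ub where ub[measurable]: "ub \<in> borel_measurable borel" and ub_ae: "AE z in lborel. indicator unit_disk z *\<^sub>R u z = ub z"
    by (rule lebesgue_borel_version)
  define U where "U = (\<lambda>z. indicator unit_disk z *\<^sub>R ub z)"
  have [measurable]: "unit_disk \<in> sets borel" by simp
  have U_m[measurable]: "U \<in> borel_measurable borel" unfolding U_def by measurable
  have U_ae: "AE z in lborel. indicator unit_disk z *\<^sub>R u z = U z"
    using ub_ae by eventually_elim (auto simp: U_def indicator_def split: if_splits)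
  have UP_fin: "(\<integral>\<^sup>+z. ennreal (cmod (U z * P' z) powr p) \<partial>lborel) < \<infinity>"
  proof -
    have "(\<integral>\<^sup>+z. ennreal (cmod (U z * P' z) powr p) \<partial>lborel) \<le> LpZ_int p Z u"
      unfolding LpZ_int_eq
    proof (rule nn_integral_mono_AE)
      show "AE z in lborel. ennreal (cmod (U z * P' z) powr p) \<le>
         ennreal ((cmod (u z) * exp (kZ Z z)) powr p) * indicator unit_disk z"
        using U_ae
      proof eventually_elim
        case (elim z)
        show ?case
        proof (cases "z \<in> unit_disk")
          case True
          then have "cmod (U z * P' z) \<le> cmod (u z) * exp (kZ Z z)"
            using elim P(2)[of z] by (simp add: P'_def norm_mult mult_left_mono)
          then have "cmod (U z * P' z) powr p \<le> (cmod (u z) * exp (kZ Z z)) powr p"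
            using p by (intro powr_mono2) auto
          then show ?thesis using True by (simp add: ennreal_leI)
        qed (simp add: U_def)
      qed
    qed
    also have "\<dots> < \<infinity>" using u by (simp add: LpZ_def)
    finally show ?thesis .
  qed
  have F_fin: "(\<integral>\<^sup>+z. ennreal (cmod (F z) powr p) \<partial>lborel) < \<infinity>"
  proof -
    have "(\<integral>\<^sup>+z. ennreal (cmod (F z) powr p) \<partial>lborel) =
       (\<integral>\<^sup>+z\<in>\<Union>a\<in>Z. hball \<kappa> a. ennreal (cmod (F z) powr p) \<partial>lborel)"
    proof (rule nn_integral_cong)
      fix z
      show "ennreal (cmod (F z) powr p) = ennreal (cmod (F z) powr p) * indicator (\<Union>a\<in>Z. hball \<kappa> a) z"
        using F_0(1)[of z] by (cases "z \<in> (\<Union>a\<in>Z. hball \<kappa> a)") auto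
    qed
    also have "\<dots> < \<infinity>"
    proof (rule nn_integral_Union_hball_coeff[OF _ c, of _ 1])
      fix a z assume a: "a \<in> Z" and z: "z \<in> hball \<kappa> a"
      have "cmod (F z) = cmod (c a) * (1 - rstep a (r a) z)"
        using F_eq(1)[OF a z] rstep_bounds[of a "r a" z] by (simp add: cut_def norm_mult del: of_real_diff)
      also have "\<dots> \<le> cmod (c a)" using rstep_bounds[of a "r a" z] by (simp add: mult_left_le)
      finally show "ennreal (cmod (F z) powr p) \<le> ennreal (1 * cmod (c a) powr p)"
        using p by (simp add: ennreal_leI powr_mono2)
    qed auto
    finally show ?thesis .
  qed
  have i_F: "integrable lborel F"
    by (rule integrable_of_powr[where A=unit_disk and p=p]) (use p F_fin F_disk in \<open>auto simp: emeasure_ball\<close>)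
  have U_disk: "U z = 0" if "z \<notin> unit_disk" for z using that by (simp add: U_def)
  have i_UP: "integrable lborel (\<lambda>z. U z * P' z)"
    by (rule integrable_of_powr[where A=unit_disk and p=p]) (use p UP_fin U_disk in \<open>auto simp: emeasure_ball\<close>)
  define W where "W = (\<lambda>z. F z - U z * P' z)"
  have W_m[measurable]: "W \<in> borel_measurable borel" unfolding W_def by measurable
  have W_fin: "(\<integral>\<^sup>+z. ennreal (cmod (W z) powr p) \<partial>lborel) < \<infinity>"
  proof -
    have "(\<integral>\<^sup>+z. ennreal (cmod (W z) powr p) \<partial>lborel) \<le>
      (\<integral>\<^sup>+z. ennreal (2 powr p) * (ennreal (cmod (F z) powr p) + ennreal (cmod (U z * P' z) powr p)) \<partial>lborel)"
    proof (rule nn_integral_mono)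
      fix z
      have "cmod (W z) powr p \<le> (cmod (F z) + cmod (U z * P' z)) powr p"
        unfolding W_def using p by (intro powr_mono2 norm_triangle_ineq4) auto
      also have "\<dots> \<le> 2 powr p * (cmod (F z) powr p + cmod (U z * P' z) powr p)"
        using p by (intro powr_add_le) auto
      finally have "ennreal (cmod (W z) powr p) \<le> ennreal (2 powr p * (cmod (F z) powr p + cmod (U z * P' z) powr p))"
        by (rule ennreal_leI)
      then show "ennreal (cmod (W z) powr p) \<le>
         ennreal (2 powr p) * (ennreal (cmod (F z) powr p) + ennreal (cmod (U z * P' z) powr p))"
        by (simp add: ennreal_mult ennreal_plus)
    qed
    also have "\<dots> = ennreal (2 powr p) * ((\<integral>\<^sup>+z. ennreal (cmod (F z) powr p) \<partial>lborel) + (\<integral>\<^sup>+z. ennreal (cmod (U z * P' z) powr p) \<partial>lborel))"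
      by (subst nn_integral_cmult) (auto simp: nn_integral_add)
    also have "\<dots> < \<infinity>" using F_fin UP_fin by (simp add: ennreal_mult_less_top)
    finally show ?thesis .
  qed
  have W_disk: "W z = 0" if "z \<notin> unit_disk" for z using that F_disk by (simp add: W_def U_def)
  have Psi_a: "\<Psi> a = 0" if "a \<in> Z" for a
    using P(3)[OF Z_cmod[OF that] that] by (simp add: pseudo_hyp_eq)
  \<comment> \<open>Cancelling \<Psi> is legitimate since \<open>DF\<close> is 0 wherever \<Psi>
    is.\<close>
  have f_id: "f z * (\<Psi> z * x * inverse (of_real (1 - (cmod z)\<^sup>2))) = DF z * x" if z: "z \<in> unit_disk" for z x
  proof (cases "DF z = 0")
    case False
    then obtain a where a: "a \<in> Z" "z \<in> hball \<kappa> a" using F_0(2)[of z] by blast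
    have "z \<noteq> a" using False F_eq(2)[OF a] by (auto simp: dcut_def)
    then have "0 < lowc * pseudo_hyp z a * exp (kZ Z z)"
      using lowc cmod_one_minus_ge(6)[of z a] Z_cmod[OF a(1)] z by (simp add: pseudo_hyp_eq)
    then have "\<Psi> z \<noteq> 0" using P(5)[OF a] by auto
    define m where "m = complex_of_real (1 - (cmod z)\<^sup>2)"
    have "m \<noteq> 0" using of_real_one_minus_sq_neq_0[of z] z by (simp add: m_def del: of_real_diff)
    then show ?thesis using \<open>\<Psi> z \<noteq> 0\<close> z
      unfolding f_def P'_eq[OF z] m_def[symmetric] by (simp add: field_simps)
  qed (simp add: f_def)
  have test: "(\<integral>z. W z * dbar \<Phi> z \<partial>lborel) = 0"
    if s: "smooth_on UNIV \<Phi>" and rr: "\<rho> > 0" "cball \<zeta> \<rho> \<subseteq> unit_disk" and out: "\<And>z. z \<notin> cball \<zeta> \<rho> \<Longrightarrow> \<Phi> z = 0"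
    for \<Phi> \<zeta> \<rho>
  proof -
    obtain D where D: "\<And>z. cmod (dbar \<Phi> z) \<le> D" "\<And>z. z \<notin> cball \<zeta> \<rho> \<Longrightarrow> dbar \<Phi> z = 0"
      and Dm[measurable]: "dbar \<Phi> \<in> borel_measurable borel" and Dc: "continuous_on UNIV (dbar \<Phi>)"
      by (rule smooth_compact_dbar_bounded[OF s out], assumption, rule that)
    have Phc: "continuous_on UNIV \<Phi>" by (rule smooth_on_continuous[OF s])
    have [measurable]: "\<Phi> \<in> borel_measurable borel" by (rule borel_measurable_continuous_onI[OF Phc])
    have dP: "dbar (\<lambda>z. \<Psi> z * \<Phi> z) z = \<Psi> z * dbar \<Phi> z" if z: "z \<in> unit_disk" for z
    proof -
      have "(\<Psi> has_field_derivative deriv \<Psi> z) (at z)" using P(1) z holomorphic_derivI open_ball by blast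
      note h = dbar_holomorphic[OF this] partials_frechet(1)[OF partials_holomorphic[OF this]]
      show ?thesis using dbar_mult[OF h(2) smooth_on_differentiable[OF s UNIV_I]] h(1) by simp
    qed
    have A: "(\<integral>z. (U z * P' z) * dbar \<Phi> z \<partial>lborel) = - (\<integral>z. DF z * \<Phi> z \<partial>lborel)"
    proof -
      have "- (\<integral>z\<in>unit_disk. u z * dbar (\<lambda>z. \<Psi> z * \<Phi> z) z \<partial>lebesgue) =
        (\<integral>z\<in>unit_disk. f z * ((\<Psi> z * \<Phi> z) * inverse (of_real (1 - (cmod z)\<^sup>2))) \<partial>lebesgue)"
        by (rule dbar_weighted_solves_test[OF sol _ rr(2)])
           (use out smooth_on_mult[OF open_ball smooth_on_holomorphic[OF open_ball P(1)] smooth_on_subset[OF s subset_UNIV]] in auto)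
      moreover have "(\<integral>z\<in>unit_disk. u z * dbar (\<lambda>z. \<Psi> z * \<Phi> z) z \<partial>lebesgue) = (\<integral>z. (U z * P' z) * dbar \<Phi> z \<partial>lborel)"
      proof (rule set_lebesgue_integral_borel)
        show "AE z in lborel. indicator unit_disk z *\<^sub>R (u z * dbar (\<lambda>z. \<Psi> z * \<Phi> z) z) = U z * P' z * dbar \<Phi> z"
          using U_ae
        proof eventually_elim
          case (elim z)
          then show ?case by (cases "z \<in> unit_disk") (auto simp: dP P'_def)
        qed
      qed measurable
      moreover have "(\<integral>z\<in>unit_disk. f z * ((\<Psi> z * \<Phi> z) * inverse (of_real (1 - (cmod z)\<^sup>2))) \<partial>lebesgue) =
         (\<integral>z. DF z * \<Phi> z \<partial>lborel)"
      proof (rule set_lebesgue_integral_borel)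
        have "indicator unit_disk z *\<^sub>R (f z * ((\<Psi> z * \<Phi> z) * inverse (of_real (1 - (cmod z)\<^sup>2)))) = DF z * \<Phi> z" for z
          using f_id[of z "\<Phi> z"] F_disk(2)[of z] by (cases "z \<in> unit_disk") (auto simp del: of_real_diff)
        then show "AE z in lborel. indicator unit_disk z *\<^sub>R (f z * ((\<Psi> z * \<Phi> z) * inverse (of_real (1 - (cmod z)\<^sup>2)))) = DF z * \<Phi> z"
          by simp
      qed measurable
      ultimately show ?thesis by (metis add.inverse_inverse)
    qed
    obtain R where R: "0 < R" "R < 1" "cball \<zeta> \<rho> \<subseteq> cball 0 R" by (rule cball_disk_subset[OF rr(2)])
    \<comment> \<open>Only finitely many discs meet the support of the test function, so on it the
      glued functions are finite sums and the product rule can be integrated term by term.\<close>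
    define S where "S = {a \<in> Z. hball \<kappa> a \<inter> cball 0 R \<noteq> {}}"
    have S: "finite S" "S \<subseteq> Z" using finite_hball_meets[OF R(2)] by (auto simp: S_def)
    have gs: "F z = (\<Sum>a\<in>S. cut a z) \<and> DF z = (\<Sum>a\<in>S. dcut a z)" if z: "z \<in> cball \<zeta> \<rho>" for z
    proof -
      have cov: "a \<in> S" if "a \<in> Z" "z \<in> hball \<kappa> a" for a using that z R(3) by (auto simp: S_def)
      have "F z = (\<Sum>a\<in>S. indicator (hball \<kappa> a) z * cut a z)" "DF z = (\<Sum>a\<in>S. indicator (hball \<kappa> a) z * dcut a z)"
        unfolding F_def DF_def by (rule glue_sum[OF S cov], assumption+)+
      moreover have "(\<Sum>a\<in>S. indicator (hball \<kappa> a) z * cut a z) = (\<Sum>a\<in>S. cut a z)"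
        "(\<Sum>a\<in>S. indicator (hball \<kappa> a) z * dcut a z) = (\<Sum>a\<in>S. dcut a z)"
      proof -
        have "indicator (hball \<kappa> a) z * cut a z = cut a z" "indicator (hball \<kappa> a) z * dcut a z = dcut a z" if "a \<in> S" for a
          using cut_0[of a z] S(2) that by (cases "z \<in> hball \<kappa> a"; force)+
        note * = this
        show "(\<Sum>a\<in>S. indicator (hball \<kappa> a) z * cut a z) = (\<Sum>a\<in>S. cut a z)"
          by (rule sum.cong[OF refl *(1)])
        show "(\<Sum>a\<in>S. indicator (hball \<kappa> a) z * dcut a z) = (\<Sum>a\<in>S. dcut a z)"
          by (rule sum.cong[OF refl *(2)])
      qed
      ultimately show ?thesis by simp
    qed
    have each: "integrable lborel (\<lambda>z. cut a z * dbar \<Phi> z) \<and> integrable lborel (\<lambda>z. dcut a z * \<Phi> z) \<and>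
       (\<integral>z. cut a z * dbar \<Phi> z \<partial>lborel) = - (\<integral>z. dcut a z * \<Phi> z \<partial>lborel)" if a: "a \<in> S" for a
    proof -
      have aZ: "a \<in> Z" using a S by auto
      have cc: "continuous_on UNIV (cut a)" by (rule smooth_on_continuous[OF s_cut[OF aZ]])
      have "continuous_on UNIV (dbar (cut a))" by (rule smooth_on_continuous[OF smooth_on_dbar[OF open_UNIV s_cut[OF aZ]]])
      then have dc: "continuous_on UNIV (dcut a)" using d_cut[OF aZ] by (simp cong: continuous_on_cong)
      have i: "integrable lborel (\<lambda>z. cut a z * dbar \<Phi> z)" "integrable lborel (\<lambda>z. dcut a z * \<Phi> z)"
        by (rule integrable_continuous_cball[of _ \<zeta> \<rho>], intro continuous_intros cc dc Dc Phc, use D(2) out in simp)+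
      have "0 = (\<integral>z. dbar (\<lambda>z. cut a z * \<Phi> z) z \<partial>lborel)"
      proof (rule integral_dbar_compact_support(2)[symmetric, of _ 1])
        show "smooth_on UNIV (\<lambda>z. cut a z * \<Phi> z)" by (intro smooth_on_mult s s_cut aZ open_UNIV)
        show "cut a z * \<Phi> z = 0" if "1 \<le> cmod z" for z
          using out[of z] rr(2) that by (force simp: subset_iff)
      qed
      also have "\<dots> = (\<integral>z. dcut a z * \<Phi> z + cut a z * dbar \<Phi> z \<partial>lborel)"
        using dbar_mult[OF smooth_on_differentiable[OF s_cut[OF aZ] UNIV_I] smooth_on_differentiable[OF s UNIV_I]]
        by (simp add: d_cut[OF aZ])
      also have "\<dots> = (\<integral>z. dcut a z * \<Phi> z \<partial>lborel) + (\<integral>z. cut a z * dbar \<Phi> z \<partial>lborel)"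
        using i by (intro Bochner_Integration.integral_add)
      finally show ?thesis using i by (simp add: eq_neg_iff_add_eq_0 add.commute)
    qed
    have e1: "F z * dbar \<Phi> z = (\<Sum>a\<in>S. cut a z * dbar \<Phi> z)" for z
      using gs[of z] D(2)[of z] by (cases "z \<in> cball \<zeta> \<rho>") (simp_all add: sum_distrib_right)
    have e2: "DF z * \<Phi> z = (\<Sum>a\<in>S. dcut a z * \<Phi> z)" for z
      using gs[of z] out[of z] by (cases "z \<in> cball \<zeta> \<rho>") (simp_all add: sum_distrib_right)
    have "(\<integral>z. F z * dbar \<Phi> z \<partial>lborel) = (\<Sum>a\<in>S. \<integral>z. cut a z * dbar \<Phi> z \<partial>lborel)"
      unfolding e1 using each by (intro Bochner_Integration.integral_sum) auto
    also have "\<dots> = - (\<Sum>a\<in>S. \<integral>z. dcut a z * \<Phi> z \<partial>lborel)"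
      using each by (simp add: sum_negf)
    also have "(\<Sum>a\<in>S. \<integral>z. dcut a z * \<Phi> z \<partial>lborel) = (\<integral>z. DF z * \<Phi> z \<partial>lborel)"
      unfolding e2 using each by (intro Bochner_Integration.integral_sum[symmetric]) auto
    finally have Bq: "(\<integral>z. F z * dbar \<Phi> z \<partial>lborel) = - (\<integral>z. DF z * \<Phi> z \<partial>lborel)" .
    have "(\<integral>z. W z * dbar \<Phi> z \<partial>lborel) = (\<integral>z. F z * dbar \<Phi> z - (U z * P' z) * dbar \<Phi> z \<partial>lborel)"
      unfolding W_def by (simp add: algebra_simps)
    also have "\<dots> = (\<integral>z. F z * dbar \<Phi> z \<partial>lborel) - (\<integral>z. (U z * P' z) * dbar \<Phi> z \<partial>lborel)"
      by (intro Bochner_Integration.integral_diff integrable_mult_bounded[OF i_F Dm D(1)] integrable_mult_bounded[OF i_UP Dm D(1)])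
    finally show ?thesis using A Bq by simp
  qed
  obtain H :: "complex \<Rightarrow> complex" where H: "H holomorphic_on unit_disk" "Bint p H < \<infinity>"
    "\<And>\<zeta> r. cmod \<zeta> < 1 \<Longrightarrow> 0 < r \<Longrightarrow> r \<le> (1 - cmod \<zeta>) / 8 \<Longrightarrow>
       (\<integral>z. W z * of_real (moll \<zeta> r z) \<partial>lborel) = pi * H \<zeta>"
    by (rule weyl_bergman[OF p W_m W_disk W_fin test], assumption+, rule that)
  have "H a = c a" if a: "a \<in> Z" for a
  proof -
    have a1: "cmod a < 1" by (rule Z_cmod[OF a])
    \<comment> \<open>The first bound keeps the averaging disc inside the region where
      \<open>F\<close> is constantly \<open>c a\<close> and f vanishes; the second is the range in
      which averages of W represent H.\<close>
    define \<rho> where "\<rho> = min (r a / 4) ((1 - cmod a) / 8)"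
    have "0 < \<rho>" unfolding \<rho>_def using r[OF a] a1 by simp
    moreover have "\<rho> \<le> r a / 4" "\<rho> \<le> (1 - cmod a) / 8"
      unfolding \<rho>_def by (rule min.cobounded1, rule min.cobounded2)
    ultimately have rho: "0 < \<rho>" "\<rho> \<le> r a / 4" "\<rho> \<le> (1 - cmod a) / 8" .
    have in_hb: "z \<in> hball \<kappa> a" if "cmod (z - a) \<le> \<rho>" for z
      using that rho r[OF a] by (simp add: hball_r)
    have sub: "cball a \<rho> \<subseteq> unit_disk"
      using in_hb hb_disk[OF a] by (auto simp: dist_norm norm_minus_commute)
    obtain Q where Q: "\<And>w z. moll w \<rho> z \<le> Q" using B(2) by blast
    have mm: "(\<lambda>z. complex_of_real (moll a \<rho> z)) \<in> borel_measurable borel" by measurable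
    have mb: "cmod (of_real (moll a \<rho> z)) \<le> Q" for z using Q[of a z] moll_nonneg[of a \<rho> z] by simp
    have F1: "(\<integral>z. F z * of_real (moll a \<rho> z) \<partial>lborel) = c a * pi"
    proof -
      have "F z * of_real (moll a \<rho> z) = c a * of_real (moll a \<rho> z)" for z
      proof (cases "cmod (z - a) \<le> \<rho>")
        case True
        have "rstep a (r a) z = 0" using True rho r[OF a] by (intro rstep_eq_0) auto
        then show ?thesis using F_eq(1)[OF a in_hb[OF True]] by (simp add: cut_def)
      qed (use moll_eq_0[OF rho(1), of z a] in auto)
      then have "(\<integral>z. F z * of_real (moll a \<rho> z) \<partial>lborel) = (\<integral>z. c a * of_real (moll a \<rho> z) \<partial>lborel)"
        by (intro Bochner_Integration.integral_cong refl)
      then show ?thesis using integral_moll(2)[OF rho(1), of a] by simp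
    qed
    have U1: "(\<integral>z. (U z * P' z) * of_real (moll a \<rho> z) \<partial>lborel) = 0"
    proof -
      define \<Psi>1 where "\<Psi>1 = (\<lambda>z. if z = a then deriv \<Psi> a else (\<Psi> z - \<Psi> a) / (z - a))"
      have hol1: "\<Psi>1 holomorphic_on unit_disk"
        unfolding \<Psi>1_def by (rule pole_lemma[OF P(1)]) (use a1 in \<open>simp add: interior_open\<close>)
      have P1: "\<Psi>1 z * (z - a) = \<Psi> z" for z using Psi_a[OF a] by (simp add: \<Psi>1_def)
      \<comment> \<open>With \<Psi> = (z - a) \<Psi>1, \<open>dbar\<close> of this function is
        \<open>- \<Psi> z * moll a \<rho> z\<close>, so the equation tested against it computes the
        average of \<open>u * \<Psi>\<close> at a; the right-hand side is 0 because f vanishes on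
        the support.\<close>
      let ?t = "\<lambda>z. \<Psi>1 z * of_real (1 - rstep a \<rho> z)"
      have s1: "smooth_on unit_disk ?t"
        by (rule smooth_on_subset[OF smooth_on_cutoff[OF open_ball smooth_on_holomorphic[OF open_ball hol1] rho(1) sub]]) simp
      have "- (\<integral>z\<in>unit_disk. u z * dbar ?t z \<partial>lebesgue) =
        (\<integral>z\<in>unit_disk. f z * (?t z * inverse (of_real (1 - (cmod z)\<^sup>2))) \<partial>lebesgue)"
        by (rule dbar_weighted_solves_test[OF sol s1 sub])
           (use rho in \<open>auto simp: rstep_eq_1 dist_norm norm_minus_commute\<close>)
      moreover have "f z * (?t z * inverse (of_real (1 - (cmod z)\<^sup>2))) = 0" for z
      proof (cases "cmod (z - a) \<le> \<rho>")
        case True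
        have "moll a (r a) z = 0" using True rho r[OF a] by (intro moll_eq_0') auto
        then show ?thesis using F_eq(2)[OF a in_hb[OF True]] by (simp add: f_def dcut_def)
      qed (use rho in \<open>simp add: rstep_eq_1\<close>)
      ultimately have "- (\<integral>z\<in>unit_disk. u z * dbar ?t z \<partial>lebesgue) = (\<integral>z\<in>unit_disk. 0 \<partial>lebesgue)"
        by (simp only:)
      then have "(\<integral>z\<in>unit_disk. u z * dbar ?t z \<partial>lebesgue) = 0"
        by (simp only: set_lebesgue_integral_def scaleR_zero_right Bochner_Integration.integral_zero neg_equal_0_iff_equal)
      moreover have "(\<integral>z\<in>unit_disk. u z * dbar ?t z \<partial>lebesgue) = (\<integral>z. - ((U z * P' z) * of_real (moll a \<rho> z)) \<partial>lborel)"
      proof (rule set_lebesgue_integral_borel)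
        have dt: "dbar ?t z = - (\<Psi> z * of_real (moll a \<rho> z))" if z: "z \<in> unit_disk" for z
        proof -
          have "(\<Psi>1 has_field_derivative deriv \<Psi>1 z) (at z)" using hol1 z holomorphic_derivI open_ball by blast
          note h = dbar_holomorphic[OF this] partials_frechet(1)[OF partials_holomorphic[OF this]]
          have dr: "(\<lambda>z. complex_of_real (rstep a \<rho> z)) differentiable (at z)"
            by (rule smooth_on_differentiable[OF smooth_on_rstep[OF rho(1)] UNIV_I])
          have "dbar (\<lambda>z. 1 + (- 1) * complex_of_real (rstep a \<rho> z)) z =
            dbar (\<lambda>_. 1) z + (dbar (\<lambda>_. - 1) z * of_real (rstep a \<rho> z) + (- 1) * dbar (\<lambda>z. of_real (rstep a \<rho> z)) z)"
            using dr by (subst dbar_add, simp, simp, subst dbar_mult) auto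
          then have "dbar (\<lambda>z. complex_of_real (1 - rstep a \<rho> z)) z = - (of_real (moll a \<rho> z) * (z - a))"
            by (simp add: dbar_const dbar_rstep_moll)
          moreover have "(\<lambda>z. complex_of_real (1 - rstep a \<rho> z)) differentiable (at z)"
            unfolding of_real_diff by (intro differentiable_diff differentiable_const dr)
          ultimately have "dbar ?t z = - (\<Psi>1 z * (z - a) * of_real (moll a \<rho> z))"
            using dbar_mult[OF h(2), of "\<lambda>z. of_real (1 - rstep a \<rho> z)"] h(1) by (simp add: mult_ac)
          then show ?thesis by (simp add: P1)
        qed
        show "AE z in lborel. indicator unit_disk z *\<^sub>R (u z * dbar ?t z) = - ((U z * P' z) * of_real (moll a \<rho> z))"
          using U_ae
        proof eventually_elim
          case (elim z)
          show ?case
          proof (cases "z \<in> unit_disk")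
            case True
            show ?thesis unfolding dt[OF True] P'_eq[OF True] using elim True by (simp add: mult_ac)
          qed (simp add: U_disk)
        qed
      qed measurable
      ultimately show ?thesis by simp
    qed
    have "pi * H a = (\<integral>z. W z * of_real (moll a \<rho> z) \<partial>lborel)" by (rule H(3)[OF a1 rho(1,3), symmetric])
    also have "\<dots> = (\<integral>z. F z * of_real (moll a \<rho> z) - (U z * P' z) * of_real (moll a \<rho> z) \<partial>lborel)"
      unfolding W_def by (simp add: algebra_simps)
    also have "\<dots> = c a * pi"
      using F1 U1 integrable_mult_bounded[OF i_F mm mb] integrable_mult_bounded[OF i_UP mm mb]
      by (subst Bochner_Integration.integral_diff) auto
    finally show ?thesis by simp
  qed
  then show ?thesis using H(1,2) by (intro bexI[of _ H]) (auto simp: bergman_iff)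
qed

end

section \<open>Interpolation with a uniform bound\<close>

definition wsum :: "real \<Rightarrow> complex set \<Rightarrow> (complex \<Rightarrow> complex) \<Rightarrow> real" where
  "wsum p Z c = (\<Sum>\<^sub>\<infinity>a\<in>Z. cmod (c a) powr p * (1 - (cmod a)\<^sup>2)\<^sup>2)"

text \<open>Existence of an interpolating function and its norm bound form a single predicate, so
  that its failure for a given bound can be carried through an inductive construction.
  \<open>Z\<close> will also be a finite piece \<open>exh Z n\<close>.\<close>

definition interp_by :: "real \<Rightarrow> complex set \<Rightarrow> real \<Rightarrow> (complex \<Rightarrow> complex) \<Rightarrow> bool" where
  "interp_by p Z L c \<longleftrightarrow> (\<exists>h. h holomorphic_on unit_disk \<and> Bint p h \<le> ennreal L \<and> (\<forall>a\<in>Z. h a = c a))"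

lemma interp_by_mono: "interp_by p Z L c \<Longrightarrow> L \<le> M \<Longrightarrow> interp_by p Z M c"
  unfolding interp_by_def by (meson ennreal_leI order_trans)

lemma interp_by_cong: "(\<And>a. a \<in> Z \<Longrightarrow> c a = d a) \<Longrightarrow> interp_by p Z L c = interp_by p Z L d"
  by (simp add: interp_by_def)

lemma interp_by_add:
  assumes p: "p \<ge> 1" and c: "interp_by p Z L c" "interp_by p Z M d" and nn: "L \<ge> 0" "M \<ge> 0"
  shows "interp_by p Z (2 powr p * (L + M)) (\<lambda>a. c a + d a)"
proof -
  obtain h g where h: "h holomorphic_on unit_disk" "Bint p h \<le> ennreal L" "\<forall>a\<in>Z. h a = c a"
    and g: "g holomorphic_on unit_disk" "Bint p g \<le> ennreal M" "\<forall>a\<in>Z. g a = d a"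
    using c by (auto simp: interp_by_def)
  have "Bint p (\<lambda>z. h z + g z) \<le> ennreal (2 powr p) * (Bint p h + Bint p g)"
    by (rule Bint_add_le[OF h(1) g(1) p])
  also have "\<dots> \<le> ennreal (2 powr p) * (ennreal L + ennreal M)" by (intro mult_left_mono add_mono h g) auto
  also have "\<dots> = ennreal (2 powr p * (L + M))" using nn by (simp add: ennreal_mult ennreal_plus)
  finally show ?thesis unfolding interp_by_def using h g
    by (intro exI[of _ "\<lambda>z. h z + g z"]) (auto intro!: holomorphic_intros)
qed

lemma interp_by_cmult:
  assumes c: "interp_by p Z L c" and nn: "L \<ge> 0"
  shows "interp_by p Z (cmod t powr p * L) (\<lambda>a. t * c a)"
proof -
  obtain h where h: "h holomorphic_on unit_disk" "Bint p h \<le> ennreal L" "\<forall>a\<in>Z. h a = c a"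
    using c by (auto simp: interp_by_def)
  have "Bint p (\<lambda>z. t * h z) \<le> ennreal (cmod t powr p) * ennreal L"
    unfolding Bint_cmult[OF h(1)] by (intro mult_left_mono h) auto
  also have "\<dots> = ennreal (cmod t powr p * L)" using nn by (simp add: ennreal_mult)
  finally show ?thesis unfolding interp_by_def using h
    by (intro exI[of _ "\<lambda>z. t * h z"]) (auto intro!: holomorphic_intros)
qed

lemma interp_by_zero: "(\<And>a. a \<in> Z \<Longrightarrow> c a = 0) \<Longrightarrow> interp_by p Z 0 c"
  unfolding interp_by_def by (intro exI[of _ "\<lambda>_. 0"]) (simp add: Bint_def)

text \<open>Normality of the interpolants on the finite pieces. It is used contrapositively: when
  the bound L fails on \<open>Z\<close>, it already fails on some finite piece.\<close>

lemma interp_by_limit: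
  assumes p: "p \<ge> 1" and Z: "Z \<subseteq> unit_disk" "countable Z"
    and n: "\<And>n. interp_by p (exh Z n) L c"
  shows "interp_by p Z L c"
proof -
  obtain F where F: "\<And>n. F n holomorphic_on unit_disk" "\<And>n. Bint p (F n) \<le> ennreal L"
    "\<And>n a. a \<in> exh Z n \<Longrightarrow> F n a = c a"
    using n unfolding interp_by_def by metis
  obtain g r where g: "g holomorphic_on unit_disk" "strict_mono (r :: nat \<Rightarrow> nat)"
    "\<And>z. z \<in> unit_disk \<Longrightarrow> (\<lambda>n. F (r n) z) \<longlonglongrightarrow> g z" "Bint p g \<le> ennreal L"
    by (rule bergman_compact[OF p F(1,2)], rule that)
  have "g a = c a" if a: "a \<in> Z" for a
  proof -
    obtain N where N: "a \<in> exh Z N" using exh_props(4)[OF Z(2) a] by blast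
    have "F (r n) a = c a" if "n \<ge> N" for n
      using N exh_props(3)[OF Z(2), of N "r n"] seq_suble[OF g(2), of n] that by (intro F(3)) auto
    then have "(\<lambda>n. F (r n) a) \<longlonglongrightarrow> c a"
      by (intro tendsto_eventually eventually_sequentiallyI[of N]) auto
    moreover have "(\<lambda>n. F (r n) a) \<longlonglongrightarrow> g a" using g(3) a Z(1) by blast
    ultimately show ?thesis by (rule LIMSEQ_unique[rotated])
  qed
  then show ?thesis unfolding interp_by_def using g by blast
qed

lemma lpZ_I:
  assumes "\<And>F. finite F \<Longrightarrow> F \<subseteq> Z \<Longrightarrow> (\<Sum>a\<in>F. cmod (c a) powr p * (1 - (cmod a)\<^sup>2)\<^sup>2) \<le> B"
  shows "c \<in> lpZ p Z" "wsum p Z c \<le> B"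
proof -
  show "c \<in> lpZ p Z" unfolding lpZ_def
    using assms by (auto intro!: nonneg_bdd_above_summable_on bdd_aboveI[of _ B])
  then show "wsum p Z c \<le> B"
    using assms unfolding wsum_def lpZ_def by (intro infsum_le_finite_sums) auto
qed

lemma wsum_finite_le:
  assumes "c \<in> lpZ p Z" "finite F" "F \<subseteq> Z"
  shows "(\<Sum>a\<in>F. cmod (c a) powr p * (1 - (cmod a)\<^sup>2)\<^sup>2) \<le> wsum p Z c"
  using assms unfolding wsum_def lpZ_def by (intro finite_sum_le_infsum) auto

lemma wsum_nonneg: "wsum p Z c \<ge> 0"
  by (simp add: wsum_def infsum_nonneg)

lemma lpZ_restrict:
  assumes "c \<in> lpZ p Z" "\<And>a. a \<in> Z \<Longrightarrow> d a = c a \<or> d a = 0"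
  shows "d \<in> lpZ p Z" "wsum p Z d \<le> wsum p Z c"
proof -
  have "(\<Sum>a\<in>F. cmod (d a) powr p * (1 - (cmod a)\<^sup>2)\<^sup>2) \<le> wsum p Z c" if F: "finite F" "F \<subseteq> Z" for F
  proof -
    have "(\<Sum>a\<in>F. cmod (d a) powr p * (1 - (cmod a)\<^sup>2)\<^sup>2) \<le> (\<Sum>a\<in>F. cmod (c a) powr p * (1 - (cmod a)\<^sup>2)\<^sup>2)"
    proof (rule sum_mono)
      fix a assume "a \<in> F"
      then have "d a = c a \<or> d a = 0" using assms(2) F by blast
      then show "cmod (d a) powr p * (1 - (cmod a)\<^sup>2)\<^sup>2 \<le> cmod (c a) powr p * (1 - (cmod a)\<^sup>2)\<^sup>2" by auto
    qed
    also have "\<dots> \<le> wsum p Z c" by (rule wsum_finite_le[OF assms(1) F])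
    finally show ?thesis .
  qed
  note * = this
  show "d \<in> lpZ p Z" using * by (rule lpZ_I(1))
  show "wsum p Z d \<le> wsum p Z c" using * by (rule lpZ_I(2))
qed

lemma lpZ_single: "(\<lambda>z. if z = a then 1 else 0) \<in> lpZ p Z"
  "wsum p Z (\<lambda>z. if z = a then 1 else 0) \<le> (1 - (cmod a)\<^sup>2)\<^sup>2"
proof -
  have "(\<Sum>b\<in>F. cmod (if b = a then 1 else 0) powr p * (1 - (cmod b)\<^sup>2)\<^sup>2) \<le> (1 - (cmod a)\<^sup>2)\<^sup>2"
    if F: "finite F" "F \<subseteq> Z" for F
  proof -
    have "(\<Sum>b\<in>F. cmod (if b = a then 1 else 0) powr p * (1 - (cmod b)\<^sup>2)\<^sup>2) =
       (\<Sum>b\<in>F. if b = a then (1 - (cmod a)\<^sup>2)\<^sup>2 else 0)"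
      by (intro sum.cong) auto
    then show ?thesis using F by simp
  qed
  note * = this
  show "(\<lambda>z. if z = a then 1 else 0) \<in> lpZ p Z" using * by (rule lpZ_I(1))
  show "wsum p Z (\<lambda>z. if z = a then 1 else 0) \<le> (1 - (cmod a)\<^sup>2)\<^sup>2" using * by (rule lpZ_I(2))
qed

text \<open>On the unit ball of the weighted l^p space each coordinate is bounded, and each unit
  vector has some interpolant; finitely many of them are combined, one point at a time.\<close>

lemma interp_by_finite_part:
  assumes p: "p \<ge> 1" and Z: "Z \<subseteq> unit_disk"
    and ex: "\<And>c. c \<in> lpZ p Z \<Longrightarrow> \<exists>L\<ge>0. interp_by p Z L c" and T: "finite T" "T \<subseteq> Z"
  shows "\<exists>L\<ge>0. \<forall>c\<in>lpZ p Z. wsum p Z c \<le> 1 \<longrightarrow> interp_by p Z L (\<lambda>a. if a \<in> T then c a else 0)"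
  using T
proof (induction T rule: finite_induct)
  case empty
  show ?case by (intro exI[of _ 0]) (auto intro: interp_by_zero)
next
  case (insert b T)
  then obtain L where L: "L \<ge> 0" "\<forall>c\<in>lpZ p Z. wsum p Z c \<le> 1 \<longrightarrow> interp_by p Z L (\<lambda>a. if a \<in> T then c a else 0)"
    by auto
  obtain K where K: "K \<ge> 0" "interp_by p Z K (\<lambda>z. if z = b then 1 else 0)" using ex[OF lpZ_single(1)] by blast
  have b: "cmod b < 1" "b \<in> Z" using insert.prems Z by auto
  define N where "N = (1 - (cmod b)\<^sup>2)\<^sup>2"
  have N: "N > 0" using one_minus_sq_pos[OF b(1)] by (simp add: N_def)
  show ?case
  proof (intro exI[of _ "2 powr p * (L + 1 / N * K)"] conjI ballI impI)
    show "0 \<le> 2 powr p * (L + 1 / N * K)" using L K N by simp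
    fix c assume c: "c \<in> lpZ p Z" "wsum p Z c \<le> 1"
    have "cmod (c b) powr p * N \<le> 1" using wsum_finite_le[OF c(1), of "{b}"] b c(2) by (simp add: N_def)
    then have cb: "cmod (c b) powr p \<le> 1 / N" using N by (simp add: field_simps)
    have "interp_by p Z (1 / N * K) (\<lambda>z. c b * (if z = b then 1 else 0))"
      by (rule interp_by_mono[OF interp_by_cmult[OF K(2,1)]]) (intro mult_right_mono cb K)
    then have "interp_by p Z (2 powr p * (L + 1 / N * K)) (\<lambda>a. (if a \<in> T then c a else 0) + c b * (if a = b then 1 else 0))"
      using L c K N by (intro interp_by_add p) auto
    also have "(\<lambda>a. (if a \<in> T then c a else 0) + c b * (if a = b then 1 else 0)) = (\<lambda>a. if a \<in> insert b T then c a else 0)"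
      using insert.hyps by auto
    finally show "interp_by p Z (2 powr p * (L + 1 / N * K)) (\<lambda>a. if a \<in> insert b T then c a else 0)" .
  qed
qed

text \<open>A gliding hump: were there no uniform bound, one could add up pieces with disjoint finite
  supports to a sequence which by normality has no interpolating function of any finite norm.\<close>

theorem interpolating_uniform:
  assumes p: "p \<ge> 1" and Z: "Z \<subseteq> unit_disk" "countable Z" and int: "interpolating p Z"
  obtains M where "M > 0" "\<And>c. c \<in> lpZ p Z \<Longrightarrow> interp_by p Z (M * wsum p Z c) c"
proof (rule ccontr)
  note th = that
  assume nt: "\<not> thesis"
  have contra: "\<exists>c\<in>lpZ p Z. \<not> interp_by p Z (M * wsum p Z c) c" if M: "M > 0" for M
  proof (rule ccontr)
    assume "\<not> ?thesis"
    then have *: "\<forall>c\<in>lpZ p Z. interp_by p Z (M * wsum p Z c) c" by (simp only: bex_simps not_not)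
    have thesis by (rule th[OF M]) (rule bspec[OF *])
    with nt show False by contradiction
  qed
  have ex: "\<exists>L\<ge>0. interp_by p Z L c" if "c \<in> lpZ p Z" for c
  proof -
    have "\<forall>c\<in>lpZ p Z. \<exists>f\<in>bergman p. \<forall>a\<in>Z. f a = c a" using int unfolding interpolating_def by (rule conjunct2)
    from bspec[OF this that] obtain f where f: "f \<in> bergman p" "\<forall>a\<in>Z. f a = c a" by (rule bexE)
    then have "Bint p f < \<infinity>" "f holomorphic_on unit_disk" by (auto simp: bergman_iff)
    then obtain b where "Bint p f = ennreal b" "b \<ge> 0" by (cases "Bint p f") auto
    moreover from this have "interp_by p Z b c"
      unfolding interp_by_def using f(2) \<open>f holomorphic_on unit_disk\<close>
      by (intro exI[of _ f] conjI) simp_all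
    ultimately show ?thesis by blast
  qed
  \<comment> \<open>Homogeneity: data violating the uniform bound with constant L/s are rescaled to
    weighted sum s. Data with weighted sum 0 vanish on \<open>Z\<close> and are interpolated by
    0.\<close>
  have unb: "\<exists>c\<in>lpZ p Z. wsum p Z c \<le> s \<and> \<not> interp_by p Z L c" if s: "s > 0" and L: "L > 0" for s L
  proof -
    obtain c where c: "c \<in> lpZ p Z" "\<not> interp_by p Z (L / s * wsum p Z c) c" using contra[of "L / s"] s L by auto
    define w where "w = wsum p Z c"
    have "w \<noteq> 0"
    proof
      assume w0: "w = 0"
      have "c a = 0" if a: "a \<in> Z" for a
      proof -
        have "cmod (c a) powr p * (1 - (cmod a)\<^sup>2)\<^sup>2 \<le> 0"
          using wsum_finite_le[OF c(1), of "{a}"] a w0 by (simp add: w_def)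
        moreover have "(1 - (cmod a)\<^sup>2)\<^sup>2 > 0" using one_minus_sq_pos[of a] a Z(1) by (auto simp: subset_iff)
        ultimately have "cmod (c a) powr p \<le> 0" by (simp add: mult_le_0_iff)
        then show ?thesis by simp
      qed
      then show False using c(2) w0 interp_by_zero[of Z c p] by (simp add: w_def)
    qed
    then have w: "w > 0" using wsum_nonneg[of p Z c] by (simp add: w_def)
    define t where "t = (s / w) powr (1 / p)"
    have t: "t > 0" "t powr p = s / w" using s w p by (auto simp: t_def powr_powr)
    have le: "(\<Sum>a\<in>F. cmod (of_real t * c a) powr p * (1 - (cmod a)\<^sup>2)\<^sup>2) \<le> s" if F: "finite F" "F \<subseteq> Z" for F
    proof -
      have "(\<Sum>a\<in>F. cmod (of_real t * c a) powr p * (1 - (cmod a)\<^sup>2)\<^sup>2) =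
         (s / w) * (\<Sum>a\<in>F. cmod (c a) powr p * (1 - (cmod a)\<^sup>2)\<^sup>2)"
        unfolding sum_distrib_left t(2)[symmetric] using t(1)
        by (intro sum.cong refl) (simp add: norm_mult powr_mult)
      also have "\<dots> \<le> (s / w) * w"
        unfolding w_def using s w by (intro mult_left_mono wsum_finite_le c F) (auto simp: w_def)
      finally show ?thesis using w by simp
    qed
    have "\<not> interp_by p Z L (\<lambda>a. of_real t * c a)"
    proof
      assume "interp_by p Z L (\<lambda>a. of_real t * c a)"
      then have "interp_by p Z (cmod (inverse (of_real t)) powr p * L) (\<lambda>a. inverse (of_real t) * (of_real t * c a))"
        using L by (intro interp_by_cmult) auto
      moreover have "(\<lambda>a. inverse (of_real t) * (of_real t * c a)) = c" using t by (auto simp: field_simps)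
      moreover have "cmod (inverse (of_real t)) powr p * L = L / s * w"
      proof -
        have "cmod (inverse (of_real t)) powr p = inverse (t powr p)"
        proof -
          have "cmod (inverse (of_real t)) = inverse t" using t(1) by (simp add: norm_inverse)
          then show ?thesis using t(1) by (simp add: powr_def ln_inverse exp_minus)
        qed
        then show ?thesis using t(2) s w by simp
      qed
      ultimately show False using c(2) by (simp add: w_def)
    qed
    moreover have "(\<lambda>a. of_real t * c a) \<in> lpZ p Z" "wsum p Z (\<lambda>a. of_real t * c a) \<le> s"
      using lpZ_I(1)[of Z "\<lambda>a. of_real t * c a" p s] lpZ_I(2)[of Z "\<lambda>a. of_real t * c a" p s] le by auto
    ultimately show ?thesis by blast
  qed
  \<comment> \<open>The next hump. Choose small data whose interpolation cost exceeds the cost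
    \<open>LT\<close> of their part on T together with the cost of passing from L to s; deleting the
    part on T leaves data d that are still expensive, and if \<open>s + d\<close> were cheap then so
    would be d, the difference of \<open>s + d\<close> and s.\<close>
  have stp: "\<exists>c\<in>lpZ p Z. (\<forall>a\<in>T. c a = 0) \<and> wsum p Z c \<le> e \<and> \<not> interp_by p Z L (\<lambda>a. s a + c a)"
    if T: "finite T" "T \<subseteq> Z" and s: "s \<in> lpZ p Z" and e: "0 < e" "e \<le> 1" and L: "L \<ge> 0" for T s e L
  proof -
    obtain LT where LT: "LT \<ge> 0" "\<forall>c\<in>lpZ p Z. wsum p Z c \<le> 1 \<longrightarrow> interp_by p Z LT (\<lambda>a. if a \<in> T then c a else 0)"
      using interp_by_finite_part[OF p Z(1) ex T] by blast
    obtain Ls where Ls: "Ls \<ge> 0" "interp_by p Z Ls s" using ex[OF s] by blast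
    have Ls': "interp_by p Z Ls (\<lambda>a. (-1) * s a)" using interp_by_cmult[OF Ls(2,1), of "-1"] by simp
    define L2 where "L2 = 2 powr p * (L + Ls)"
    have L2: "L2 \<ge> 0" using L Ls by (simp add: L2_def)
    obtain c where c: "c \<in> lpZ p Z" "wsum p Z c \<le> e" "\<not> interp_by p Z (2 powr p * (LT + L2) + 1) c"
    proof -
      have "0 \<le> 2 powr p * (LT + L2)" using LT(1) L2 by simp
      then have "0 < 2 powr p * (LT + L2) + 1" by linarith
      from unb[OF e(1) this] show ?thesis using that by blast
    qed
    define d where "d = (\<lambda>a. if a \<in> T then 0 else c a)"
    have d: "d \<in> lpZ p Z" "wsum p Z d \<le> wsum p Z c" by (rule lpZ_restrict[OF c(1)]; simp add: d_def)+
    have n2: "\<not> interp_by p Z L2 d"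
    proof
      assume "interp_by p Z L2 d"
      then have "interp_by p Z (2 powr p * (LT + L2)) (\<lambda>a. (if a \<in> T then c a else 0) + d a)"
      proof (intro interp_by_add p LT(1) L2)
        show "interp_by p Z LT (\<lambda>a. if a \<in> T then c a else 0)"
          using bspec[OF LT(2) c(1)] c(2) e(2) by linarith
      qed
      moreover have "(\<lambda>a. (if a \<in> T then c a else 0) + d a) = c" by (rule ext) (simp add: d_def)
      ultimately have "interp_by p Z (2 powr p * (LT + L2)) c" by (simp only:)
      from interp_by_mono[OF this, of "2 powr p * (LT + L2) + 1"] show False using c(3) by simp
    qed
    have "\<not> interp_by p Z L (\<lambda>a. s a + d a)"
    proof
      assume "interp_by p Z L (\<lambda>a. s a + d a)"
      from interp_by_add[OF p this Ls' L Ls(1)] have "interp_by p Z L2 (\<lambda>a. s a + d a + (-1) * s a)"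
        by (simp only: L2_def)
      moreover have "(\<lambda>a. s a + d a + (-1) * s a) = d" by (rule ext) simp
      ultimately show False using n2 by (simp only:)
    qed
    moreover have "\<forall>a\<in>T. d a = 0" by (simp add: d_def)
    moreover have "wsum p Z d \<le> e" using d(2) c(2) by linarith
    ultimately show ?thesis using d(1) by blast
  qed
  \<comment> \<open>A state is a finitely supported sequence together with the index of a finite
    piece containing its support, on which the bound j already fails. The budget
    \<open>2 - (1/2)^j\<close> starts at 1 and pays for humps of size
    \<open>(1/2)^(j+1)\<close>.\<close>
  define Q where "Q = (\<lambda>(j::nat) (x::(complex \<Rightarrow> complex) \<times> nat). fst x \<in> lpZ p Z \<and> j \<le> snd x \<and>
     (\<forall>a\<in>Z. a \<notin> exh Z (snd x) \<longrightarrow> fst x a = 0) \<and> \<not> interp_by p (exh Z (snd x)) (real j) (fst x) \<and>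
     wsum p Z (fst x) \<le> 2 - (1/2)^j)"
  define R where "R = (\<lambda>(j::nat) (x::(complex \<Rightarrow> complex) \<times> nat) (y::(complex \<Rightarrow> complex) \<times> nat).
     snd x \<le> snd y \<and> (\<forall>a\<in>exh Z (snd x). fst y a = fst x a))"
  note E = exh_props[OF Z(2)]
  \<comment> \<open>Failure on a finite piece persists on larger ones, so the index may be taken
    beyond m; this makes the pieces of the construction exhaust \<open>Z\<close>.\<close>
  have trunc: "\<exists>N\<ge>m. \<not> interp_by p (exh Z N) L s" if "\<not> interp_by p Z L s" for L s m
  proof -
    obtain n where n: "\<not> interp_by p (exh Z n) L s"
    proof (rule ccontr)
      assume "\<not> thesis"
      then have "interp_by p (exh Z n) L s" for n using that by (rule_tac ccontr) simp
      from interp_by_limit[OF p Z this] show False using \<open>\<not> interp_by p Z L s\<close> by contradiction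
    qed
    have "exh Z n \<subseteq> exh Z (max m n)" by (rule E(3)) simp
    then have "\<not> interp_by p (exh Z (max m n)) L s"
      using n unfolding interp_by_def by blast
    then show ?thesis by (intro exI[of _ "max m n"]) auto
  qed
  have start: "\<exists>x. Q 0 x"
  proof -
    have z: "(\<lambda>_. 0) \<in> lpZ p Z" by (rule lpZ_I(1)[of _ _ _ 0]) simp
    obtain c where c: "c \<in> lpZ p Z" "wsum p Z c \<le> 1" "\<not> interp_by p Z 0 c"
      using stp[of "{}" "\<lambda>_. 0" 1 0] z by auto
    obtain N where N: "\<not> interp_by p (exh Z N) 0 c" using trunc[OF c(3), of 0] by blast
    define s where "s = (\<lambda>a. if a \<in> exh Z N then c a else 0)"
    have s: "s \<in> lpZ p Z" "wsum p Z s \<le> wsum p Z c" by (rule lpZ_restrict[OF c(1)]; simp add: s_def)+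
    have "\<not> interp_by p (exh Z N) 0 s" using N interp_by_cong[of "exh Z N" s c p 0] by (simp add: s_def)
    then show ?thesis using s c(2) by (intro exI[of _ "(s, N)"]) (auto simp: Q_def s_def)
  qed
  have step: "\<exists>y. Q (Suc j) y \<and> R j x y" if Qx: "Q j x" for j x
  proof -
    define s n where "s = fst x" and "n = snd x"
    have s: "s \<in> lpZ p Z" "j \<le> n" "\<And>a. a \<in> Z \<Longrightarrow> a \<notin> exh Z n \<Longrightarrow> s a = 0" "wsum p Z s \<le> 2 - (1/2)^j"
      using Qx by (auto simp: Q_def s_def n_def)
    have e: "0 < (1/2::real) ^ Suc j" "(1/2::real) ^ Suc j \<le> 1" by (simp, rule power_le_one) auto
    obtain c where c: "c \<in> lpZ p Z" "\<And>a. a \<in> exh Z n \<Longrightarrow> c a = 0" "wsum p Z c \<le> (1/2) ^ Suc j"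
      "\<not> interp_by p Z (real (Suc j)) (\<lambda>a. s a + c a)"
      using stp[OF E(1,2) s(1) e, of "real (Suc j)" n] by auto
    obtain N where N: "max n (Suc j) \<le> N" "\<not> interp_by p (exh Z N) (real (Suc j)) (\<lambda>a. s a + c a)"
      using trunc[OF c(4), of "max n (Suc j)"] by blast
    define s' where "s' = (\<lambda>a. if a \<in> exh Z N then s a + c a else 0)"
    have "(\<Sum>a\<in>F. cmod (s' a) powr p * (1 - (cmod a)\<^sup>2)\<^sup>2) \<le> 2 - (1/2) ^ Suc j" if F: "finite F" "F \<subseteq> Z" for F
    proof -
      have "(\<Sum>a\<in>F. cmod (s' a) powr p * (1 - (cmod a)\<^sup>2)\<^sup>2) \<le>
        (\<Sum>a\<in>F. cmod (s a) powr p * (1 - (cmod a)\<^sup>2)\<^sup>2 + cmod (c a) powr p * (1 - (cmod a)\<^sup>2)\<^sup>2)"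
      proof (rule sum_mono)
        fix a assume "a \<in> F"
        then have "a \<in> Z" using F by auto
        then have "s a = 0 \<or> c a = 0" using s(3) c(2) by blast
        then show "cmod (s' a) powr p * (1 - (cmod a)\<^sup>2)\<^sup>2 \<le>
           cmod (s a) powr p * (1 - (cmod a)\<^sup>2)\<^sup>2 + cmod (c a) powr p * (1 - (cmod a)\<^sup>2)\<^sup>2"
          by (auto simp: s'_def)
      qed
      also have "\<dots> \<le> wsum p Z s + wsum p Z c"
        unfolding sum.distrib by (intro add_mono wsum_finite_le s c F)
      also have "\<dots> \<le> (2 - (1/2)^j) + (1/2) ^ Suc j" using s c by (intro add_mono)
      also have "\<dots> = 2 - (1/2) ^ Suc j" by simp
      finally show ?thesis .
    qed
    note le = this
    have s': "s' \<in> lpZ p Z" using le by (rule lpZ_I(1))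
    have s'': "wsum p Z s' \<le> 2 - (1/2) ^ Suc j" using le by (rule lpZ_I(2))
    have "\<not> interp_by p (exh Z N) (real (Suc j)) s'"
      using N(2) interp_by_cong[of "exh Z N" s' "\<lambda>a. s a + c a" p] by (simp add: s'_def)
    moreover have "s' a = s a" if "a \<in> exh Z n" for a
      using that c(2) E(3)[of n N] N(1) by (auto simp: s'_def)
    ultimately show ?thesis using s' s'' N(1)
      by (intro exI[of _ "(s', N)"]) (auto simp: Q_def R_def s'_def s_def n_def)
  qed
  obtain x where x: "\<And>j. Q j (x j)" "\<And>j. R j (x j) (x (Suc j))"
    using dependent_nat_choice[of Q R, OF start step] by blast
  define s n where "s = (\<lambda>j. fst (x j))" and "n = (\<lambda>j. snd (x j))"
  have s: "s j \<in> lpZ p Z" "j \<le> n j" "\<not> interp_by p (exh Z (n j)) (real j) (s j)" "wsum p Z (s j) \<le> 2" for j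
  proof -
    have "0 \<le> (1/2::real) ^ j" by simp
    moreover have "wsum p Z (s j) \<le> 2 - (1/2) ^ j" using x(1)[of j] by (simp only: Q_def s_def)
    ultimately show "wsum p Z (s j) \<le> 2" by linarith
  qed (use x(1)[of j] in \<open>auto simp: Q_def s_def n_def\<close>)
  have chain: "n i \<le> n k \<and> (\<forall>a\<in>exh Z (n i). s k a = s i a)" if "i \<le> k" for i k
    using that
  proof (induction k rule: dec_induct)
    case base then show ?case by simp
  next
    case (step k)
    have "n k \<le> n (Suc k)" "\<forall>a\<in>exh Z (n k). s (Suc k) a = s k a" using x(2)[of k] by (auto simp: R_def s_def n_def)
    then show ?case using step E(3)[of "n i" "n k"] by auto
  qed
  \<comment> \<open>The pointwise limit of the stages. The piece of stage j contains
    \<open>exh Z j\<close>, so the value at a no longer changes from stage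
    \<open>Suc (to_nat_on Z a)\<close> on.\<close>
  define c where "c = (\<lambda>a. s (Suc (to_nat_on Z a)) a)"
  have c_eq: "c a = s j a" if a: "a \<in> exh Z (n j)" for a j
  proof -
    let ?J = "Suc (to_nat_on Z a)"
    have aZ: "a \<in> Z" using a E(2) by blast
    have aJ: "a \<in> exh Z (n ?J)" using aZ s(2)[of ?J] by (simp add: exh_def)
    show ?thesis
    proof (cases "j \<le> ?J")
      case True then show ?thesis using chain[OF True] a by (simp add: c_def)
    next
      case False then show ?thesis using chain[of ?J j] aJ by (simp add: c_def)
    qed
  qed
  have "(\<Sum>a\<in>F. cmod (c a) powr p * (1 - (cmod a)\<^sup>2)\<^sup>2) \<le> 2" if F: "finite F" "F \<subseteq> Z" for F
  proof -
    obtain N where "F \<subseteq> exh Z N" using E(5)[OF F] by blast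
    then have FN: "F \<subseteq> exh Z (n N)" using E(3)[OF s(2)[of N]] by blast
    have "(\<Sum>a\<in>F. cmod (c a) powr p * (1 - (cmod a)\<^sup>2)\<^sup>2) = (\<Sum>a\<in>F. cmod (s N a) powr p * (1 - (cmod a)\<^sup>2)\<^sup>2)"
      using FN c_eq by (intro sum.cong) auto
    also have "\<dots> \<le> wsum p Z (s N)" by (rule wsum_finite_le[OF s(1) F])
    also have "\<dots> \<le> 2" by (rule s(4))
    finally show ?thesis .
  qed
  then have "c \<in> lpZ p Z" by (rule lpZ_I(1))
  then obtain L where L: "L \<ge> 0" "interp_by p Z L c" using ex by blast
  obtain j :: nat where j: "L \<le> real j" using real_arch_simple by blast
  have "interp_by p (exh Z (n j)) L c" using L(2) E(2)[of "n j"] unfolding interp_by_def by blast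
  then have "interp_by p (exh Z (n j)) (real j) (s j)"
    using interp_by_mono[OF _ j] interp_by_cong[of "exh Z (n j)" c "s j" p "real j"] c_eq by blast
  then show False using s(3) by blast
qed

text \<open>Cauchy's estimate on discs of radius R/4, which stay inside the large disc for centres
  in the half disc.\<close>

lemma holomorphic_lipschitz:
  assumes h: "h holomorphic_on ball a R" and R: "R > 0" and K: "\<And>z. z \<in> ball a R \<Longrightarrow> cmod (h z) \<le> K"
    and z: "z \<in> ball a (R / 2)"
  shows "cmod (h z - h a) \<le> 4 * K / R * cmod (z - a)"
proof (rule field_differentiable_bound[of "ball a (R / 2)" h "deriv h"])
  fix w assume w: "w \<in> ball a (R / 2)"
  have sub: "cball w (R / 4) \<subseteq> ball a R"
  proof
    fix v assume "v \<in> cball w (R / 4)"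
    then show "v \<in> ball a R" using w R dist_triangle[of a v w] by simp
  qed
  have hol: "h holomorphic_on ball w (R / 4)" by (rule holomorphic_on_subset[OF h]) (use sub in auto)
  have "norm ((deriv ^^ 1) h w) \<le> fact 1 * K / (R / 4) ^ 1"
  proof (rule Cauchy_inequality[OF hol])
    show "continuous_on (cball w (R / 4)) h"
      by (rule continuous_on_subset[OF holomorphic_on_imp_continuous_on[OF h] sub])
    fix v assume "cmod (w - v) = R / 4"
    then show "cmod (h v) \<le> K" using sub by (intro K) (auto simp: dist_norm)
  qed (use R in auto)
  then show "cmod (deriv h w) \<le> 4 * K / R" by (simp add: mult.commute)
  have "w \<in> ball a R" using w R by auto
  then show "(h has_field_derivative deriv h w) (at w within ball a (R / 2))"
    by (intro holomorphic_derivI[OF h open_ball])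
qed (use R z in auto)

section \<open>Separation of interpolating sequences\<close>

text \<open>The function that is 1 at a and 0 on the rest of \<open>Z\<close> has norm comparable to
  the weight of a, hence is bounded by a universal K on a disc of radius comparable to
  \<open>1 - \<bar>a\<bar>^2\<close>. Its Lipschitz bound there prevents another zero from lying too
  close to a.\<close>

theorem interpolating_separated:
  assumes p: "p \<ge> 1" and Z: "Z \<subseteq> unit_disk" "countable Z" and int: "interpolating p Z"
  shows "separated Z"
proof -
  obtain M where M: "M > 0" "\<And>c. c \<in> lpZ p Z \<Longrightarrow> interp_by p Z (M * wsum p Z c) c"
    by (rule interpolating_uniform[OF p Z int], rule that)
  obtain C where C: "C > 0"
    "\<And>h \<zeta> r. h holomorphic_on unit_disk \<Longrightarrow> r > 0 \<Longrightarrow> ball \<zeta> r \<subseteq> unit_disk \<Longrightarrow>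
    ennreal (cmod (h \<zeta>) powr p) \<le> ennreal (C / r\<^sup>2) * Bint p h"
    by (rule bergman_local_bound[OF p], rule that)
  \<comment> \<open>The number 64 comes from the mean value inequality on a disc of radius N/8; the
    factors \<open>N^2\<close> of that inequality and of the norm bound cancel.\<close>
  define K where "K = (64 * C * M) powr (1 / p)"
  have K: "K > 0" using C M by (simp add: K_def)
  \<comment> \<open>The first bound puts b into the half disc of radius N/16, the second makes the
    increment \<open>32 * K * d\<close> at most 1.\<close>
  define d where "d = min (1/16) (1 / (32 * K))"
  have "d > 0" using K unfolding d_def by simp
  moreover have "d \<le> 1/16" "d \<le> 1 / (32 * K)"
    unfolding d_def by (rule min.cobounded1, rule min.cobounded2)
  ultimately have d: "d > 0" "d \<le> 1/16" "d \<le> 1 / (32 * K)" .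
  have "d / 2 \<le> pseudo_hyp a b" if ab: "a \<in> Z" "b \<in> Z" "a \<noteq> b" for a b
  proof -
    have a1: "cmod a < 1" and b1: "cmod b < 1" using ab Z by (auto simp: subset_iff)
    define N where "N = 1 - (cmod a)\<^sup>2"
    have N: "N > 0" "N \<le> 2 - 2 * cmod a" using one_minus_sq_pos[OF a1] one_minus_sq_le[of a] by (simp_all add: N_def)
    obtain h where h: "h holomorphic_on unit_disk" "Bint p h \<le> ennreal (M * wsum p Z (\<lambda>z. if z = a then 1 else 0))"
      "\<forall>x\<in>Z. h x = (if x = a then 1 else 0)"
      using M(2)[OF lpZ_single(1)[of a p Z]] unfolding interp_by_def by blast
    have hB: "Bint p h \<le> ennreal (M * N\<^sup>2)"
      using M(1) lpZ_single(2)[of p Z a] by (intro order_trans[OF h(2)] ennreal_leI mult_left_mono) (auto simp: N_def)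
    have hK: "cmod (h z) \<le> K" if z: "z \<in> ball a (N / 8)" for z
    proof -
      have sub: "ball z (N / 8) \<subseteq> unit_disk"
      proof
        fix w assume "w \<in> ball z (N / 8)"
        then have "cmod (w - a) < N / 4"
          using z dist_triangle[of w a z] by (simp add: dist_norm[symmetric] dist_commute)
        then have "cmod w < 1" using norm_triangle_sub[of w a] N a1 by argo
        then show "w \<in> unit_disk" by simp
      qed
      have "ennreal (cmod (h z) powr p) \<le> ennreal (C / (N / 8)\<^sup>2) * Bint p h"
        by (rule C(2)[OF h(1) _ sub]) (use N in simp)
      also have "\<dots> \<le> ennreal (C / (N / 8)\<^sup>2) * ennreal (M * N\<^sup>2)" by (intro mult_left_mono hB) simp
      also have "\<dots> = ennreal (C / (N / 8)\<^sup>2 * (M * N\<^sup>2))" using C M by (intro ennreal_mult[symmetric]) auto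
      also have "C / (N / 8)\<^sup>2 * (M * N\<^sup>2) = 64 * C * M" using N by (simp add: power_divide)
      finally have "cmod (h z) powr p \<le> 64 * C * M" using C M by (subst (asm) ennreal_le_iff) auto
      then have "(cmod (h z) powr p) powr (1 / p) \<le> K" unfolding K_def using p by (intro powr_mono2) auto
      then show ?thesis using p by (simp add: powr_powr)
    qed
    have sub: "ball a (N / 8) \<subseteq> unit_disk" by (rule ball_subset_unit_disk[OF a1]) (use N a1 in argo)
    have "b \<notin> hball d a"
    proof
      assume "b \<in> hball d a"
      then have bd: "cmod (b - a) < d * N" by (simp add: hball_def N_def dist_norm norm_minus_commute)
      also have "\<dots> \<le> 1/16 * N" using d N by (intro mult_right_mono) auto
      finally have "b \<in> ball a (N / 8 / 2)" by (simp add: dist_norm norm_minus_commute)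
      then have "cmod (h b - h a) \<le> 4 * K / (N / 8) * cmod (b - a)"
        by (intro holomorphic_lipschitz[OF holomorphic_on_subset[OF h(1) sub]] hK) (use N in auto)
      also have "\<dots> < 4 * K / (N / 8) * (d * N)" using K N by (intro mult_strict_left_mono bd) auto
      also have "\<dots> = 32 * K * d" using N by simp
      also have "\<dots> \<le> 1" using d K by (simp add: field_simps)
      finally show False using h(3) ab by simp
    qed
    then have "d / 2 \<le> pseudo_hyp b a"
      using d by (intro pseudo_hyp_ge_off_hball[OF _ _ a1 b1]) auto
    then show ?thesis by (simp add: pseudo_hyp_commute)
  qed
  then show ?thesis unfolding separated_def using d(1) by (intro exI[of _ "d / 2"]) auto
qed

section \<open>Moebius change of variables\<close>

text \<open>The area of a differentiable image is expressed by a determinant on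
  \<open>real^2\<close>; these coordinates carry the formula over to the complex plane.\<close>

definition cx :: "real^2 \<Rightarrow> complex" where "cx v = Complex (v $ 1) (v $ 2)"
definition xc :: "complex \<Rightarrow> real^2" where "xc z = vector [Re z, Im z]"

lemma cx_xc [simp]: "cx (xc z) = z" and xc_cx [simp]: "xc (cx v) = v"
  by (simp_all add: cx_def xc_def vec_eq_iff forall_2)

lemma bounded_linear_cx: "bounded_linear cx"
  unfolding linear_conv_bounded_linear[symmetric]
  by (rule linearI) (simp_all add: cx_def complex_eq_iff)

lemma bounded_linear_xc: "bounded_linear xc"
  unfolding linear_conv_bounded_linear[symmetric]
  by (rule linearI) (simp_all add: xc_def vec_eq_iff forall_2)

lemma cx_measurable[measurable]: "cx \<in> borel_measurable borel"
  by (intro borel_measurable_continuous_onI linear_continuous_on bounded_linear_cx)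

lemma Basis_real2: "(Basis :: (real^2) set) = {axis 1 1, axis 2 1}"
  by (auto simp: Basis_vec_def UNIV_2)

lemma distr_cx: "distr lborel borel cx = lborel"
proof (rule lborel_eqI[symmetric])
  fix l u :: complex assume le: "\<And>b. b \<in> Basis \<Longrightarrow> l \<bullet> b \<le> u \<bullet> b"
  have ne: "axis 1 (1::real) \<noteq> (axis 2 1 :: real^2)" by (simp add: axis_eq_axis)
  have inn: "xc z \<bullet> axis 1 1 = Re z" "xc z \<bullet> axis 2 1 = Im z" for z
    by (simp_all add: inner_axis xc_def)
  have "cx -` box l u = box (xc l) (xc u)"
    by (auto simp: mem_box Basis_real2 Basis_complex_def inner_axis xc_def cx_def inner_complex_def)
  then have "emeasure (distr lborel borel cx) (box l u) = emeasure lborel (box (xc l) (xc u))"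
    by (subst emeasure_distr) auto
  also have "\<dots> = (\<Prod>b\<in>Basis. (xc u - xc l) \<bullet> b)"
  proof (rule emeasure_lborel_box)
    fix b :: "real^2" assume "b \<in> Basis"
    then show "xc l \<bullet> b \<le> xc u \<bullet> b"
      using le[of 1] le[of \<i>] unfolding Basis_real2 by (auto simp: inn Basis_complex_def)
  qed
  also have "(\<Prod>b\<in>Basis. (xc u - xc l) \<bullet> b) = (\<Prod>b\<in>Basis. (u - l) \<bullet> b)"
    unfolding Basis_real2 Basis_complex_def using ne
    by (simp add: inner_diff_left inn)
  finally show "emeasure (distr lborel borel cx) (box l u) = ennreal (\<Prod>b\<in>Basis. (u - l) \<bullet> b)" .
qed simp

lemma nn_integral_cx:
  assumes [measurable]: "F \<in> borel_measurable borel"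
  shows "(\<integral>\<^sup>+z. F z \<partial>lborel) = (\<integral>\<^sup>+v. F (cx v) \<partial>lborel)"
  by (subst distr_cx[symmetric], subst nn_integral_distr) auto

lemma emeasure_xc_image:
  assumes [measurable]: "A \<in> sets borel"
  shows "xc ` A \<in> sets borel" "emeasure lborel (xc ` A) = emeasure lborel A"
proof -
  have e: "xc ` A = cx -` A"
    by (auto intro: image_eqI[of _ xc "cx _"])
  show "xc ` A \<in> sets borel" unfolding e using measurable_sets[OF cx_measurable assms] by simp
  have "emeasure lborel A = emeasure (distr lborel borel cx) A" by (simp add: distr_cx)
  also have "\<dots> = emeasure lborel (cx -` A)" by (subst emeasure_distr) auto
  finally show "emeasure lborel (xc ` A) = emeasure lborel A" by (simp add: e)
qed

text \<open>By the Cauchy-Riemann equations the real Jacobian of a holomorphic map is the squared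
  modulus of its derivative.\<close>

lemma emeasure_holomorphic_image:
  assumes A[measurable]: "A \<in> sets borel" and B: "f ` A \<in> sets borel" "bounded (f ` A)"
    and der: "\<And>z. z \<in> A \<Longrightarrow> (f has_field_derivative f' z) (at z)" and inj: "inj_on f A"
    and f'[measurable]: "f' \<in> borel_measurable borel"
  shows "emeasure lborel (f ` A) = (\<integral>\<^sup>+z\<in>A. ennreal ((cmod (f' z))\<^sup>2) \<partial>lborel)"
proof -
  let ?S = "xc ` A" and ?T = "\<lambda>v. xc (f (cx v))" and ?T' = "\<lambda>v h. xc (f' (cx v) * cx h)"
  have TS: "?T ` ?S = xc ` f ` A" by (auto simp: image_image)
  have S: "?S \<in> sets lebesgue" using emeasure_xc_image(1)[OF A] by simp
  have der': "(?T has_derivative ?T' x) (at x within ?S)" if "x \<in> ?S" for x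
  proof -
    from that obtain z where z: "x = xc z" "z \<in> A" by (rule imageE)
    have "(f has_derivative (*) (f' (cx x))) (at (cx x))" using der[OF z(2)] z(1) by (simp add: has_field_derivative_def)
    moreover have "(cx has_derivative cx) (at x within ?S)" by (rule bounded_linear_imp_has_derivative[OF bounded_linear_cx])
    ultimately have "((\<lambda>v. f (cx v)) has_derivative (\<lambda>h. f' (cx x) * cx h)) (at x within ?S)"
      by (rule has_derivative_compose[rotated])
    then show ?thesis by (rule bounded_linear.has_derivative[OF bounded_linear_xc])
  qed
  have inj': "inj_on ?T ?S"
  proof (rule inj_onI)
    fix x y assume x: "x \<in> ?S" and y: "y \<in> ?S" and e: "?T x = ?T y"
    from e have "cx (?T x) = cx (?T y)" by (rule arg_cong)
    then have "f (cx x) = f (cx y)" by simp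
    moreover have "cx x \<in> A" "cx y \<in> A" using x y by auto
    ultimately have "cx x = cx y" by (rule inj_onD[OF inj])
    then have "xc (cx x) = xc (cx y)" by (rule arg_cong)
    then show "x = y" by simp
  qed
  have det: "\<bar>det (matrix (?T' v))\<bar> = (cmod (f' (cx v)))\<^sup>2" for v
  proof -
    have "det (matrix (?T' v)) = (Re (f' (cx v)))\<^sup>2 + (Im (f' (cx v)))\<^sup>2"
      by (simp add: det_2 matrix_def cx_def xc_def axis_def power2_eq_square)
    then show ?thesis by (simp add: cmod_power2)
  qed
  have fm: "xc ` f ` A \<in> sets borel" by (rule emeasure_xc_image(1)[OF B(1)])
  have "bounded (xc ` f ` A)" by (rule bounded_linear_image[OF B(2) bounded_linear_xc])
  then have lm: "xc ` f ` A \<in> lmeasurable" using fm by (intro bounded_set_imp_lmeasurable) auto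
  define m where "m = measure lebesgue (xc ` f ` A)"
  have "((\<lambda>x. \<bar>det (matrix (?T' x))\<bar>) has_integral m) ?S"
    using has_measure_differentiable_image[OF S der' inj', of m] lm unfolding TS by (simp add: m_def)
  then have "((\<lambda>v. (cmod (f' (cx v)))\<^sup>2) has_integral m) ?S" by (simp only: det)
  from nn_integral_has_integral_lebesgue'[OF _ this]
  have "(\<integral>\<^sup>+v\<in>?S. ennreal ((cmod (f' (cx v)))\<^sup>2) \<partial>lborel) = ennreal m" by simp
  moreover have "(\<integral>\<^sup>+z\<in>A. ennreal ((cmod (f' z))\<^sup>2) \<partial>lborel) =
      (\<integral>\<^sup>+v\<in>?S. ennreal ((cmod (f' (cx v)))\<^sup>2) \<partial>lborel)"
  proof (subst nn_integral_cx)
    have "indicator A (cx v) = (indicator ?S v :: ennreal)" for v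
    proof -
      have "cx v \<in> A \<longleftrightarrow> v \<in> ?S"
      proof
        assume "cx v \<in> A"
        then have "xc (cx v) \<in> ?S" by (rule imageI)
        then show "v \<in> ?S" by simp
      qed auto
      then show ?thesis by (simp add: indicator_def)
    qed
    then show "(\<integral>\<^sup>+v. ennreal ((cmod (f' (cx v)))\<^sup>2) * indicator A (cx v) \<partial>lborel) =
        (\<integral>\<^sup>+v\<in>?S. ennreal ((cmod (f' (cx v)))\<^sup>2) \<partial>lborel)" by simp
  qed measurable
  moreover have "ennreal m = emeasure lborel (f ` A)"
  proof -
    have "ennreal m = emeasure lebesgue (xc ` f ` A)"
      unfolding m_def by (rule emeasure_eq_measure2[OF lm, symmetric])
    also have "\<dots> = emeasure lborel (xc ` f ` A)" using fm by simp
    finally show ?thesis by (simp add: emeasure_xc_image(2)[OF B(1)])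
  qed
  ultimately show ?thesis by simp
qed

text \<open>The disk automorphism with the sign that makes it an involution exchanging 0 and
  w.\<close>

definition mob :: "complex \<Rightarrow> complex \<Rightarrow> complex" where
  "mob w z = (w - z) / (1 - cnj w * z)"

lemma cmod_mob_lt_1:
  assumes "cmod w < 1" "cmod z < 1" shows "cmod (mob w z) < 1"
proof -
  have "0 < (1 - (cmod z)\<^sup>2) * (1 - (cmod w)\<^sup>2)" using one_minus_sq_pos assms by simp
  then have "(cmod (z - w))\<^sup>2 < (cmod (1 - cnj w * z))\<^sup>2" unfolding cmod_one_minus_sq by simp
  then have "cmod (z - w) < cmod (1 - cnj w * z)" by (rule power2_less_imp_less) simp
  then show ?thesis using cmod_one_minus_ge(6)[OF assms(2,1)]
    by (simp add: mob_def norm_divide norm_minus_commute)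
qed

lemma mob_identities:
  assumes w: "cmod w < 1" and z: "cmod z < 1"
  shows "1 - cnj w * mob w z = of_real (1 - (cmod w)\<^sup>2) / (1 - cnj w * z)"
    "mob w z - w = - (z * of_real (1 - (cmod w)\<^sup>2)) / (1 - cnj w * z)"
    "mob w (mob w z) = z"
    "1 - (cmod (mob w z))\<^sup>2 = (1 - (cmod w)\<^sup>2) * (1 - (cmod z)\<^sup>2) / (cmod (1 - cnj w * z))\<^sup>2"
    "(mob w has_field_derivative - of_real (1 - (cmod w)\<^sup>2) / (1 - cnj w * z)\<^sup>2) (at z)"
proof -
  have D: "1 - cnj w * z \<noteq> 0" by (rule cmod_one_minus_ge(7)[OF z w])
  have n: "complex_of_real (1 - (cmod w)\<^sup>2) = 1 - cnj w * w"
    by (metis complex_norm_square mult.commute of_real_1 of_real_diff)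
  have n0: "1 - cnj w * w \<noteq> 0" using of_real_one_minus_sq_neq_0[OF w] n by simp
  show 1: "1 - cnj w * mob w z = of_real (1 - (cmod w)\<^sup>2) / (1 - cnj w * z)"
    unfolding n mob_def using D by (simp add: field_simps)
  show 2: "mob w z - w = - (z * of_real (1 - (cmod w)\<^sup>2)) / (1 - cnj w * z)"
    unfolding n mob_def using D by (simp add: field_simps)
  have "mob w (mob w z) = - (mob w z - w) / (1 - cnj w * mob w z)" by (simp add: mob_def[of w "mob w z"])
  also have "\<dots> = z" unfolding 1 2 unfolding n using D n0 by simp
  finally show "mob w (mob w z) = z" .
  have "1 - (cmod (mob w z))\<^sup>2 = 1 - (pseudo_hyp z w)\<^sup>2"
    by (simp add: mob_def pseudo_hyp_eq norm_divide norm_minus_commute)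
  then show "1 - (cmod (mob w z))\<^sup>2 = (1 - (cmod w)\<^sup>2) * (1 - (cmod z)\<^sup>2) / (cmod (1 - cnj w * z))\<^sup>2"
    unfolding one_minus_pseudo_hyp_sq[OF z w] by (simp add: mult.commute)
  have "((\<lambda>z. (w - z) / (1 - cnj w * z)) has_field_derivative
      ((-1) * (1 - cnj w * z) - (w - z) * (- cnj w)) / ((1 - cnj w * z) * (1 - cnj w * z))) (at z)"
    using D by (auto intro!: derivative_eq_intros)
  moreover have "((-1) * (1 - cnj w * z) - (w - z) * (- cnj w)) = - (1 - cnj w * w)" by (simp add: algebra_simps)
  ultimately have "((\<lambda>z. (w - z) / (1 - cnj w * z)) has_field_derivative
      - (1 - cnj w * w) / ((1 - cnj w * z) * (1 - cnj w * z))) (at z)" by (simp only:)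
  then show "(mob w has_field_derivative - of_real (1 - (cmod w)\<^sup>2) / (1 - cnj w * z)\<^sup>2) (at z)"
    unfolding n mob_def[abs_def] power2_eq_square[of "1 - cnj w * z"] .
qed

text \<open>Area measure on the disk is identified with the image under \<open>mob w\<close> of the
  measure with density \<open>\<bar>mob'\<bar>^2\<close>, first on Borel sets; integrals of
  arbitrary F follow at once. Being its own inverse, \<open>mob w\<close> maps preimages onto
  sets.\<close>

lemma nn_integral_mob:
  assumes w: "cmod w < 1" and [measurable]: "F \<in> borel_measurable borel"
  shows "(\<integral>\<^sup>+z\<in>unit_disk. F z \<partial>lborel) =
    (\<integral>\<^sup>+z\<in>unit_disk. F (mob w z) * ennreal ((1 - (cmod w)\<^sup>2)\<^sup>2 / cmod (1 - cnj w * z) ^ 4) \<partial>lborel)"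
proof -
  let ?d = "\<lambda>z. ennreal ((1 - (cmod w)\<^sup>2)\<^sup>2 / cmod (1 - cnj w * z) ^ 4)"
  have [measurable]: "unit_disk \<in> sets borel" by simp
  have [measurable]: "mob w \<in> borel_measurable borel"
    unfolding mob_def[abs_def] by measurable
  let ?N = "density lborel (\<lambda>z. ?d z * indicator unit_disk z)"
  have eq: "density lborel (indicator unit_disk) = distr ?N borel (mob w)"
  proof (rule measure_eqI)
    fix A assume "A \<in> sets (density lborel (indicator unit_disk))"
    then have A[measurable]: "A \<in> sets borel" by simp
    define S where "S = mob w -` A \<inter> unit_disk"
    have S[measurable]: "S \<in> sets borel"
      unfolding S_def using measurable_sets[OF \<open>mob w \<in> borel_measurable borel\<close> A] by simp
    have img: "mob w ` S = A \<inter> unit_disk"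
    proof safe
      fix z assume z: "z \<in> S"
      then show "mob w z \<in> A" "mob w z \<in> unit_disk" using cmod_mob_lt_1[OF w] by (auto simp: S_def)
    next
      fix z assume z: "z \<in> A" "z \<in> unit_disk"
      then have "mob w (mob w z) = z" using mob_identities(3)[OF w] by simp
      then show "z \<in> mob w ` S" using z cmod_mob_lt_1[OF w]
        by (intro image_eqI[of _ _ "mob w z"]) (auto simp: S_def)
    qed
    have "emeasure lborel (mob w ` S) =
      (\<integral>\<^sup>+z\<in>S. ennreal ((cmod (- of_real (1 - (cmod w)\<^sup>2) / (1 - cnj w * z)\<^sup>2))\<^sup>2) \<partial>lborel)"
    proof (rule emeasure_holomorphic_image[OF S])
      show "mob w ` S \<in> sets borel" unfolding img by measurable
      show "bounded (mob w ` S)" unfolding img by (rule bounded_subset[OF bounded_ball]) auto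
      show "(mob w has_field_derivative - of_real (1 - (cmod w)\<^sup>2) / (1 - cnj w * z)\<^sup>2) (at z)" if "z \<in> S" for z
        using that by (intro mob_identities(5)[OF w]) (simp add: S_def)
      show "inj_on (mob w) S"
        by (rule inj_on_inverseI[of _ "mob w"]) (auto simp: S_def mob_identities(3)[OF w])
    qed measurable
    also have "\<dots> = (\<integral>\<^sup>+z\<in>mob w -` A. (?d z * indicator unit_disk z) \<partial>lborel)"
      by (intro nn_integral_cong)
         (auto simp: S_def indicator_def norm_divide norm_power power_divide simp del: of_real_diff simp flip: power_mult)
    also have "\<dots> = emeasure ?N (mob w -` A)"
      using measurable_sets[OF \<open>mob w \<in> borel_measurable borel\<close> A] by (subst emeasure_density) auto
    also have "\<dots> = emeasure (distr ?N borel (mob w)) A" by (subst emeasure_distr) auto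
    finally have "emeasure lborel (A \<inter> unit_disk) = emeasure (distr ?N borel (mob w)) A" unfolding img .
    moreover have "emeasure (density lborel (indicator unit_disk)) A = emeasure lborel (A \<inter> unit_disk)"
      by (subst emeasure_density) (auto simp: Int_commute indicator_inter_arith[symmetric] simp flip: nn_integral_indicator intro!: nn_integral_cong split: split_indicator)
    ultimately show "emeasure (density lborel (indicator unit_disk)) A = emeasure (distr ?N borel (mob w)) A" by simp
  qed simp
  have "(\<integral>\<^sup>+z\<in>unit_disk. F z \<partial>lborel) = (\<integral>\<^sup>+z. F z \<partial>density lborel (indicator unit_disk))"
    by (subst nn_integral_density) (auto simp: mult.commute)
  also have "\<dots> = (\<integral>\<^sup>+z. F (mob w z) \<partial>?N)" unfolding eq by (subst nn_integral_distr) auto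
  also have "\<dots> = (\<integral>\<^sup>+z. (?d z * indicator unit_disk z) * F (mob w z) \<partial>lborel)"
    by (subst nn_integral_density) auto
  finally show ?thesis by (simp add: mult_ac)
qed

section \<open>Kernel estimates\<close>

text \<open>The modulus of the solution kernel \<open>cker\<close>. On the diagonal it has the
  singularity of the Cauchy kernel, and the powers of \<open>1 - \<bar>w\<bar>^2\<close> and
  \<open>1 - cnj w * z\<close> make it satisfy Schur's test with powers of
  \<open>1 - \<bar>w\<bar>^2\<close>.\<close>

definition ker :: "complex \<Rightarrow> complex \<Rightarrow> real" where
  "ker z w = (1 - (cmod w)\<^sup>2)\<^sup>2 / (pi * cmod (z - w) * cmod (1 - cnj w * z) ^ 3)"

lemma ker_nonneg: "ker z w \<ge> 0"
  by (simp add: ker_def)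

lemma ker_measurable_pair[measurable]: "(\<lambda>(z, w). ker z w) \<in> borel_measurable (borel \<Otimes>\<^sub>M borel)"
proof -
  have [measurable]: "cnj \<in> borel_measurable borel"
    by (intro borel_measurable_continuous_onI continuous_intros)
  show ?thesis unfolding ker_def[abs_def] by measurable
qed

lemma ker_measurable[measurable]: "ker z \<in> borel_measurable borel" "(\<lambda>z. ker z w) \<in> borel_measurable borel"
  using measurable_Pair2[OF ker_measurable_pair, of z] measurable_Pair1[OF ker_measurable_pair, of w] by simp_all

lemma nn_integral_powr_tail:
  assumes "\<alpha> < -1" "c > 0"
  shows "(\<integral>\<^sup>+t\<in>{c..}. ennreal (t powr \<alpha>) \<partial>lborel) = ennreal (- (c powr (\<alpha> + 1)) / (\<alpha> + 1))"
  by (rule nn_integral_has_integral_lebesgue'[OF _ has_integral_powr_to_inf[OF assms]]) simp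

text \<open>The quantity \<open>D = \<bar>1 - cnj w * z\<bar>\<close> dominates
  \<open>(1 - \<bar>w\<bar>^2) / 2\<close>, s and \<open>\<bar>z - w\<bar>\<close>. The first
  absorbs the weights in the numerator and leaves \<open>1 / (\<bar>z - w\<bar> D^(1+e))\<close>;
  then D is bounded below by s within distance s of z and by \<open>\<bar>z - w\<bar>\<close>
  farther away, where the exponent e makes the tail integrable.\<close>

lemma ker_bound_1:
  assumes z: "cmod z < 1" and e: "0 < e" "e \<le> 1/2"
  shows "(\<integral>\<^sup>+w\<in>unit_disk. ennreal (ker z w * (1 - (cmod w)\<^sup>2) powr (- e)) \<partial>lborel) \<le>
     ennreal ((16 + 16 / e) * (1 - (cmod z)\<^sup>2) powr (- e))"
proof -
  define s where "s = (1 - (cmod z)\<^sup>2) / 2"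
  have s: "s > 0" using one_minus_sq_pos[OF z] by (simp add: s_def)
  let ?G = "\<lambda>t. ennreal (4 / pi) * (ennreal (s powr (-1 - e)) * (ennreal (t powr (-1/2)) * indicator {0..s\<^sup>2} t)
      + ennreal (t powr (-1 - e/2)) * indicator {s\<^sup>2..} t)"
  have "(\<integral>\<^sup>+w\<in>unit_disk. ennreal (ker z w * (1 - (cmod w)\<^sup>2) powr (- e)) \<partial>lborel) \<le>
     (\<integral>\<^sup>+w. ?G ((cmod (w - z))\<^sup>2) \<partial>lborel)"
  proof (rule nn_integral_mono)
    fix w
    show "ennreal (ker z w * (1 - (cmod w)\<^sup>2) powr (- e)) * indicator unit_disk w \<le> ?G ((cmod (w - z))\<^sup>2)"
    proof (cases "w \<in> unit_disk \<and> w \<noteq> z")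
      case True
      then have w: "cmod w < 1" "w \<noteq> z" by auto
      define \<rho> where "\<rho> = cmod (w - z)"
      define D where "D = cmod (1 - cnj w * z)"
      define n where "n = 1 - (cmod w)\<^sup>2"
      have rho: "\<rho> > 0" using w by (simp add: \<rho>_def)
      have n: "n > 0" using one_minus_sq_pos[OF w(1)] by (simp add: n_def)
      have D: "n \<le> 2 * D" "s \<le> D" "\<rho> \<le> D" "D > 0"
        using cmod_one_minus_ge[OF z w(1)] by (simp_all add: n_def s_def D_def \<rho>_def norm_minus_commute)
      have "ker z w * n powr (- e) = n powr (2 - e) / (pi * \<rho> * D ^ 3)"
        using n by (simp add: ker_def n_def[symmetric] \<rho>_def D_def norm_minus_commute powr_diff powr_minus field_simps)
      also have "\<dots> \<le> (2 * D) powr (2 - e) / (pi * \<rho> * D ^ 3)"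
        using n D rho e by (intro divide_right_mono powr_mono2) auto
      also have "\<dots> \<le> 4 * D powr (2 - e) / (pi * \<rho> * D ^ 3)"
      proof -
        have "(2::real) powr (2 - e) \<le> 2 powr 2" using e by (intro powr_mono) auto
        then have "(2 * D) powr (2 - e) \<le> 4 * D powr (2 - e)" using D by (simp add: powr_mult mult_right_mono)
        then show ?thesis using rho D by (intro divide_right_mono) auto
      qed
      also have "\<dots> = 4 / pi * (inverse \<rho> * D powr (-1 - e))"
      proof -
        have "D powr (2 - e) = D powr ((-1 - e) + 3)" by simp
        also have "\<dots> = D powr (-1 - e) * D ^ 3" using D(4) by (simp only: powr_add) simp
        finally have *: "D powr (2 - e) = D powr (-1 - e) * D ^ 3" .
        have "4 * (x * D ^ 3) / (pi * \<rho> * D ^ 3) = 4 / pi * (inverse \<rho> * x)" for x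
          using D(4) rho by (simp add: field_simps)
        then show ?thesis unfolding * .
      qed
      finally have 1: "ker z w * n powr (- e) \<le> 4 / pi * (inverse \<rho> * D powr (-1 - e))" .
      have ir: "inverse \<rho> = (\<rho>\<^sup>2) powr (-1/2)"
      proof -
        have "(\<rho>\<^sup>2) powr (-1/2) = (\<rho> powr 2) powr (-1/2)" using rho by simp
        also have "\<dots> = \<rho> powr (-1)" by (subst powr_powr) simp
        finally show ?thesis using rho by (simp add: powr_minus)
      qed
      show ?thesis
      proof (cases "\<rho>\<^sup>2 \<le> s\<^sup>2")
        case True
        have "D powr (-1 - e) \<le> s powr (-1 - e)" using D s e by (intro powr_mono2') auto
        then have "4 / pi * (inverse \<rho> * D powr (-1 - e)) \<le> 4 / pi * (s powr (-1 - e) * (\<rho>\<^sup>2) powr (-1/2))"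
          unfolding ir using rho by (intro mult_left_mono) (auto simp: mult.commute)
        with 1 have "ennreal (ker z w * n powr (- e)) \<le> ennreal (4 / pi * (s powr (-1 - e) * (\<rho>\<^sup>2) powr (-1/2)))"
          by (intro ennreal_leI) linarith
        also have "\<dots> = ennreal (4 / pi) * (ennreal (s powr (-1 - e)) * (ennreal ((\<rho>\<^sup>2) powr (-1/2)) * indicator {0..s\<^sup>2} (\<rho>\<^sup>2)))"
          using True by (subst ennreal_mult, simp, simp, subst ennreal_mult, simp, simp) simp
        also have "\<dots> \<le> ?G (\<rho>\<^sup>2)" by (intro mult_left_mono) auto
        finally show ?thesis using w by (simp add: n_def \<rho>_def)
      next
        case False
        have "D powr (-1 - e) \<le> \<rho> powr (-1 - e)" using D rho e by (intro powr_mono2') auto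
        moreover have "inverse \<rho> * \<rho> powr (-1 - e) = (\<rho>\<^sup>2) powr (-1 - e/2)"
        proof -
          have "(\<rho>\<^sup>2) powr (-1 - e/2) = (\<rho> powr 2) powr (-1 - e/2)" using rho by simp
          also have "\<dots> = \<rho> powr (-1 + (-1 - e))" by (subst powr_powr) (simp add: algebra_simps)
          also have "\<dots> = inverse \<rho> * \<rho> powr (-1 - e)" using rho by (simp only: powr_add) (simp add: powr_minus)
          finally show ?thesis by simp
        qed
        ultimately have "inverse \<rho> * D powr (-1 - e) \<le> (\<rho>\<^sup>2) powr (-1 - e/2)"
          using mult_left_mono[of "D powr (-1 - e)" "\<rho> powr (-1 - e)" "inverse \<rho>"] rho by simp
        then have "4 / pi * (inverse \<rho> * D powr (-1 - e)) \<le> 4 / pi * (\<rho>\<^sup>2) powr (-1 - e/2)"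
          by (rule mult_left_mono) simp
        with 1 have "ennreal (ker z w * n powr (- e)) \<le> ennreal (4 / pi * (\<rho>\<^sup>2) powr (-1 - e/2))"
          by (intro ennreal_leI) linarith
        also have "\<dots> = ennreal (4 / pi) * (ennreal ((\<rho>\<^sup>2) powr (-1 - e/2)) * indicator {s\<^sup>2..} (\<rho>\<^sup>2))"
          using False by (subst ennreal_mult, simp, simp) simp
        also have "\<dots> \<le> ?G (\<rho>\<^sup>2)" by (intro mult_left_mono) auto
        finally show ?thesis using w by (simp add: n_def \<rho>_def)
      qed
    next
      case False
      then show ?thesis by (auto simp: ker_def)
    qed
  qed
  also have "\<dots> = ennreal pi * (\<integral>\<^sup>+t\<in>{0..}. ?G t \<partial>lborel)"
    by (rule nn_integral_radial) measurable
  also have "(\<integral>\<^sup>+t\<in>{0..}. ?G t \<partial>lborel) = (\<integral>\<^sup>+t. ?G t \<partial>lborel)"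
    by (intro nn_integral_cong) (auto simp: indicator_def dest: order_trans[OF zero_le_power2])
  also have "\<dots> = ennreal (4 / pi) * (ennreal (s powr (-1 - e)) * (\<integral>\<^sup>+t\<in>{0..s\<^sup>2}. ennreal (t powr (-1/2)) \<partial>lborel)
     + (\<integral>\<^sup>+t\<in>{s\<^sup>2..}. ennreal (t powr (-1 - e/2)) \<partial>lborel))"
    by (subst nn_integral_cmult, measurable, subst nn_integral_add, measurable, subst nn_integral_cmult) auto
  also have "(\<integral>\<^sup>+t\<in>{0..s\<^sup>2}. ennreal (t powr (-1/2)) \<partial>lborel) = ennreal (2 * s)"
    using s by (subst nn_integral_powr_from_0) (auto simp: powr_half_sqrt)
  also have "(\<integral>\<^sup>+t\<in>{s\<^sup>2..}. ennreal (t powr (-1 - e/2)) \<partial>lborel) = ennreal (2 / e * s powr (- e))"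
  proof -
    have "(s\<^sup>2) powr (- e/2) = (s powr 2) powr (- e/2)" using s by simp
    also have "\<dots> = s powr (- e)" by (subst powr_powr) simp
    finally show ?thesis using s e by (subst nn_integral_powr_tail) (auto simp: field_simps)
  qed
  also have "ennreal (s powr (-1 - e)) * ennreal (2 * s) = ennreal (2 * s powr (- e))"
  proof -
    have "s powr (-1 - e) * (2 * s) = 2 * (s powr (-1 - e) * s powr 1)" using s by simp
    also have "\<dots> = 2 * s powr (- e)" by (simp only: powr_add[symmetric]) simp
    finally show ?thesis using s by (simp add: ennreal_mult[symmetric])
  qed
  also have "ennreal pi * (ennreal (4 / pi) * (ennreal (2 * s powr (- e)) + ennreal (2 / e * s powr (- e)))) =
     ennreal (4 * (2 * s powr (- e) + 2 / e * s powr (- e)))"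
    using e by (simp add: ennreal_plus[symmetric] ennreal_mult[symmetric] del: ennreal_plus)
  also have "4 * (2 * s powr (- e) + 2 / e * s powr (- e)) = (8 + 8 / e) * s powr (- e)"
    using e by (simp add: field_simps)
  also have "s powr (- e) = 2 powr e * (1 - (cmod z)\<^sup>2) powr (- e)"
    using one_minus_sq_pos[OF z] by (simp add: s_def powr_divide powr_minus field_simps)
  also have "ennreal ((8 + 8 / e) * (2 powr e * (1 - (cmod z)\<^sup>2) powr (- e))) \<le>
      ennreal ((16 + 16 / e) * (1 - (cmod z)\<^sup>2) powr (- e))"
  proof (rule ennreal_leI)
    have "(2::real) powr e \<le> 2 powr 1" using e by (intro powr_mono) auto
    then have "(8 + 8 / e) * (2 powr e * (1 - (cmod z)\<^sup>2) powr (- e)) \<le> (8 + 8 / e) * (2 * (1 - (cmod z)\<^sup>2) powr (- e))"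
      using e by (intro mult_left_mono mult_right_mono) auto
    also have "\<dots> = (16 + 16 / e) * (1 - (cmod z)\<^sup>2) powr (- e)" by (simp add: algebra_simps)
    finally show "(8 + 8 / e) * (2 powr e * (1 - (cmod z)\<^sup>2) powr (- e)) \<le> (16 + 16 / e) * (1 - (cmod z)\<^sup>2) powr (- e)" .
  qed
  finally show ?thesis .
qed

text \<open>The substitution \<open>mob w\<close> turns the kernel, Jacobian included, into
  \<open>1 / (pi * \<bar>z\<bar>)\<close> exactly and extracts
  \<open>(1 - \<bar>w\<bar>^2) powr (- d)\<close> from the weight. What remains is bounded
  independently of w, because \<open>d \<le> 1/2\<close> keeps the boundary singularity
  integrable.\<close>

lemma ker_bound_2:
  assumes w: "cmod w < 1" and d: "0 \<le> d" "d \<le> 1/2"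
  shows "(\<integral>\<^sup>+z\<in>unit_disk. ennreal (ker z w * (1 - (cmod z)\<^sup>2) powr (- d)) \<partial>lborel) \<le>
     ennreal (16 * (1 - (cmod w)\<^sup>2) powr (- d))"
proof -
  define n where "n = 1 - (cmod w)\<^sup>2"
  have n: "n > 0" using one_minus_sq_pos[OF w] by (simp add: n_def)
  have cm[measurable]: "(\<lambda>z. ennreal (ker z w * (1 - (cmod z)\<^sup>2) powr (- d))) \<in> borel_measurable borel" by measurable
  let ?H = "\<lambda>t. ennreal (2 / pi * n powr (- d)) * (ennreal 2 * (ennreal (t powr (-1/2)) * indicator {0..1} t)
      + ennreal 2 * (ennreal ((1 - t) powr (-1/2)) * indicator {0..1} (1 - t)))"
  have "(\<integral>\<^sup>+z\<in>unit_disk. ennreal (ker z w * (1 - (cmod z)\<^sup>2) powr (- d)) \<partial>lborel) =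
    (\<integral>\<^sup>+z\<in>unit_disk. ennreal (ker (mob w z) w * (1 - (cmod (mob w z))\<^sup>2) powr (- d)) * ennreal (n\<^sup>2 / cmod (1 - cnj w * z) ^ 4) \<partial>lborel)"
    unfolding n_def by (rule nn_integral_mob[OF w cm])
  also have "\<dots> \<le> (\<integral>\<^sup>+z. ?H ((cmod (z - 0))\<^sup>2) \<partial>lborel)"
  proof (rule nn_integral_mono)
    fix z
    show "ennreal (ker (mob w z) w * (1 - (cmod (mob w z))\<^sup>2) powr (- d)) * ennreal (n\<^sup>2 / cmod (1 - cnj w * z) ^ 4) * indicator unit_disk z
       \<le> ?H ((cmod (z - 0))\<^sup>2)"
    proof (cases "z \<in> unit_disk \<and> z \<noteq> 0")
      case True
      then have z: "cmod z < 1" "z \<noteq> 0" by auto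
      note mi = mob_identities[OF w z(1)]
      define D where "D = cmod (1 - cnj w * z)"
      define m where "m = 1 - (cmod z)\<^sup>2"
      define \<rho> where "\<rho> = cmod z"
      have D: "D > 0" "D \<le> 2" using cmod_one_minus_ge[OF z(1) w] by (auto simp: D_def)
      have m: "m > 0" "m \<le> 1" using one_minus_sq_pos[OF z(1)] by (auto simp: m_def)
      have rho: "\<rho> > 0" using z by (simp add: \<rho>_def)
      have nn: "cmod (of_real (1 - (cmod w)\<^sup>2)) = n" using n unfolding n_def by (simp only: norm_of_real)
      have a: "cmod (1 - cnj w * mob w z) = n / D" unfolding mi(1) norm_divide nn D_def ..
      have b: "cmod (mob w z - w) = \<rho> * n / D"
        unfolding mi(2) norm_divide norm_minus_cancel norm_mult nn D_def \<rho>_def ..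
      have c: "1 - (cmod (mob w z))\<^sup>2 = n * m / D\<^sup>2" unfolding mi(4) n_def m_def D_def ..
      have "ker (mob w z) w * (1 - (cmod (mob w z))\<^sup>2) powr (- d) * (n\<^sup>2 / D ^ 4) =
         n\<^sup>2 / (pi * (\<rho> * n / D) * (n / D) ^ 3) * (n\<^sup>2 / D ^ 4) * (n * m / D\<^sup>2) powr (- d)"
        unfolding ker_def a b c n_def[symmetric] by simp
      also have "n\<^sup>2 / (pi * (\<rho> * n / D) * (n / D) ^ 3) * (n\<^sup>2 / D ^ 4) = 1 / pi * inverse \<rho>"
        using n D rho by (simp add: field_simps power2_eq_square power3_eq_cube power4_eq_xxxx)
      also have "(n * m / D\<^sup>2) powr (- d) = n powr (- d) * m powr (- d) * (D\<^sup>2) powr d"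
        using n m D by (simp add: powr_mult powr_divide powr_minus field_simps)
      also have "1 / pi * inverse \<rho> * (n powr (- d) * m powr (- d) * (D\<^sup>2) powr d) \<le>
         1 / pi * inverse \<rho> * (n powr (- d) * m powr (-1/2) * 2)"
      proof -
        have "(D\<^sup>2) powr d \<le> (2\<^sup>2) powr d" using D d by (intro powr_mono2 power_mono) auto
        also have "\<dots> \<le> (2\<^sup>2) powr (1/2)" using d by (intro powr_mono) auto
        also have "\<dots> = (2::real)" by (simp add: powr_half_sqrt)
        finally have "(D\<^sup>2) powr d \<le> 2" .
        moreover have "m powr (- d) \<le> m powr (-1/2)" using m d by (intro powr_mono') auto
        ultimately show ?thesis using rho by (intro mult_left_mono mult_mono) auto
      qed
      also have "\<dots> = 2 / pi * n powr (- d) * (inverse \<rho> * m powr (-1/2))" by simp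
      also have "inverse \<rho> = (\<rho>\<^sup>2) powr (-1/2)"
      proof -
        have "(\<rho>\<^sup>2) powr (-1/2) = (\<rho> powr 2) powr (-1/2)" using rho by simp
        also have "\<dots> = \<rho> powr (-1)" by (subst powr_powr) simp
        finally show ?thesis using rho by (simp add: powr_minus)
      qed
      \<comment> \<open>The singularities at the centre and at the boundary are separated: \<rho>^2
        + m = 1, so one of the two factors is bounded by 2.\<close>
      also have "(\<rho>\<^sup>2) powr (-1/2) * m powr (-1/2) \<le> 2 * (\<rho>\<^sup>2) powr (-1/2) + 2 * m powr (-1/2)"
      proof -
        have half: "x powr (-1/2) \<le> 2" if "1/2 \<le> x" for x :: real
        proof -
          have "x powr (-1/2) \<le> (1/4) powr (-1/2)" using that by (intro powr_mono2') auto
          also have "\<dots> = (2::real)"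
          proof -
            have "(1/4::real) powr (-1/2) = inverse ((1/4) powr (1/2))" by (simp add: powr_minus[symmetric])
            also have "(1/4::real) powr (1/2) = 1/2" by (simp add: powr_half_sqrt real_sqrt_divide)
            finally show ?thesis by simp
          qed
          finally show ?thesis .
        qed
        have "\<rho>\<^sup>2 + m = 1" by (simp add: m_def \<rho>_def)
        then consider "1/2 \<le> \<rho>\<^sup>2" | "1/2 \<le> m" by linarith
        then show ?thesis
        proof cases
          case 1
          have "(\<rho>\<^sup>2) powr (-1/2) * m powr (-1/2) \<le> 2 * m powr (-1/2)" by (intro mult_right_mono half 1) auto
          then show ?thesis using powr_ge_zero[of "\<rho>\<^sup>2" "-1/2"] by linarith
        next
          case 2
          have "(\<rho>\<^sup>2) powr (-1/2) * m powr (-1/2) \<le> (\<rho>\<^sup>2) powr (-1/2) * 2" by (intro mult_left_mono half 2) auto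
          then show ?thesis using powr_ge_zero[of m "-1/2"] by linarith
        qed
      qed
      finally have "ker (mob w z) w * (1 - (cmod (mob w z))\<^sup>2) powr (- d) * (n\<^sup>2 / D ^ 4) \<le>
         2 / pi * n powr (- d) * (2 * (\<rho>\<^sup>2) powr (-1/2) + 2 * m powr (-1/2))"
        by - (erule meta_mp, rule mult_left_mono, assumption, simp)
      then have "ennreal (ker (mob w z) w * (1 - (cmod (mob w z))\<^sup>2) powr (- d)) * ennreal (n\<^sup>2 / D ^ 4) \<le>
         ennreal (2 / pi * n powr (- d) * (2 * (\<rho>\<^sup>2) powr (-1/2) + 2 * m powr (-1/2)))"
        by (subst ennreal_mult[symmetric]) (auto simp: ker_nonneg intro!: ennreal_leI)
      also have "\<dots> = ?H (\<rho>\<^sup>2)"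
      proof -
        have i: "indicator {0..1} (\<rho>\<^sup>2) = (1::ennreal)" "indicator {0..1} (1 - \<rho>\<^sup>2) = (1::ennreal)"
          using m unfolding m_def \<rho>_def[symmetric] by (simp_all add: indicator_def)
        show ?thesis unfolding i mult_1_right m_def \<rho>_def[symmetric]
          by (subst ennreal_mult, simp, simp, subst ennreal_plus, simp, simp, subst ennreal_mult, simp, simp,
              subst ennreal_mult, simp, simp, rule refl)
      qed
      finally show ?thesis using z by (simp add: D_def \<rho>_def)
    next
      case False
      then show ?thesis using mob_identities(2)[OF w, of 0] by (auto simp: ker_def)
    qed
  qed
  also have "\<dots> = ennreal pi * (\<integral>\<^sup>+t\<in>{0..}. ?H t \<partial>lborel)"
    by (rule nn_integral_radial) measurable
  also have "(\<integral>\<^sup>+t\<in>{0..}. ?H t \<partial>lborel) \<le> (\<integral>\<^sup>+t. ?H t \<partial>lborel)"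
    by (intro nn_integral_mono) (auto simp: indicator_def)
  also have "(\<integral>\<^sup>+t. ?H t \<partial>lborel) = ennreal (2 / pi * n powr (- d)) * (ennreal 2 * (\<integral>\<^sup>+t\<in>{0..1}. ennreal (t powr (-1/2)) \<partial>lborel)
     + ennreal 2 * (\<integral>\<^sup>+t. ennreal ((1 - t) powr (-1/2)) * indicator {0..1} (1 - t) \<partial>lborel))"
    by (subst nn_integral_cmult, measurable, subst nn_integral_add, measurable, subst nn_integral_cmult, measurable, subst nn_integral_cmult, measurable)
  also have "(\<integral>\<^sup>+t. ennreal ((1 - t) powr (-1/2)) * indicator {0..1} (1 - t) \<partial>lborel) =
      (\<integral>\<^sup>+t\<in>{0..1}. ennreal (t powr (-1/2)) \<partial>lborel)"
    using nn_integral_real_affine[of "\<lambda>t. ennreal (t powr (-1/2)) * indicator {0..1::real} t" "-1" 1] by simp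
  also have "(\<integral>\<^sup>+t\<in>{0..1}. ennreal (t powr (-1/2)) \<partial>lborel) = ennreal 2"
    by (subst nn_integral_powr_from_0) auto
  also have "ennreal pi * (ennreal (2 / pi * n powr (- d)) * (ennreal 2 * ennreal 2 + ennreal 2 * ennreal 2)) =
     ennreal (16 * n powr (- d))"
    by (simp add: ennreal_mult[symmetric] ennreal_plus[symmetric] del: ennreal_plus ennreal_numeral)
  finally show ?thesis by (simp add: n_def mult_left_mono)
qed

text \<open>The second clause is a separate demand: \<open>enn2real\<close> sends infinity to 0, so
  the norm inequality by itself would not exclude an infinite potential.\<close>

definition kernel_bound :: "real \<Rightarrow> real \<Rightarrow> bool" where
  "kernel_bound p C \<longleftrightarrow> (\<forall>F::complex \<Rightarrow> real. F \<in> borel_measurable borel \<longrightarrow> (\<forall>w. F w \<ge> 0) \<longrightarrow>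
    (\<integral>\<^sup>+z\<in>unit_disk. ennreal (enn2real (\<integral>\<^sup>+w\<in>unit_disk. ennreal (ker z w * F w) \<partial>lborel) powr p) \<partial>lborel) \<le>
      ennreal C * (\<integral>\<^sup>+w\<in>unit_disk. ennreal (F w powr p) \<partial>lborel) \<and>
    ((\<integral>\<^sup>+w\<in>unit_disk. ennreal (F w powr p) \<partial>lborel) < \<infinity> \<longrightarrow>
      (AE z in lborel. z \<in> unit_disk \<longrightarrow> (\<integral>\<^sup>+w\<in>unit_disk. ennreal (ker z w * F w) \<partial>lborel) < \<infinity>)))"

text \<open>Schur's test with the power \<open>(1 - \<bar>w\<bar>\<^sup>2) powr (- 1 / (2 * p))\<close>.\<close>

theorem kernel_bound_exists:
  assumes p: "p \<ge> 1"
  obtains C where "C > 0" "kernel_bound p C"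
proof -
  \<comment> \<open>With this exponent \<open>(p - 1) * e\<close> lies between 0 and 1/2. After
    Jensen the test function q appears with power \<open>p - 1\<close>, that is as
    \<open>(1 - \<bar>z\<bar>^2) powr (- d)\<close>, and \<open>ker_bound_2\<close> applies.\<close>
  define e where "e = 1 / (2 * p)"
  have e: "0 < e" "e \<le> 1/2" using p by (auto simp: e_def field_simps)
  define d where "d = (p - 1) * e"
  have d: "0 \<le> d" "d \<le> 1/2" using p by (auto simp: d_def e_def field_simps)
  define K where "K = 16 + 16 / e"
  have K: "K > 0" using e by (simp add: K_def add_pos_pos)
  define q where "q = (\<lambda>w::complex. (1 - (cmod w)\<^sup>2) powr (- e))"
  have q[measurable]: "q \<in> borel_measurable borel" unfolding q_def by measurable
  have q0: "q w > 0" if "cmod w < 1" for w using one_minus_sq_pos[OF that] by (simp add: q_def)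
  have [measurable]: "unit_disk \<in> sets borel" by simp
  define C where "C = 2 powr p * K powr (p - 1) * 16"
  have C: "C > 0" using K by (simp add: C_def)
  let ?T = "\<lambda>F z. \<integral>\<^sup>+w\<in>unit_disk. ennreal (ker z w * F w) \<partial>lborel"
    and ?R = "\<lambda>F z. \<integral>\<^sup>+w\<in>unit_disk. ennreal (ker z w * q w * (F w / q w) powr p) \<partial>lborel"
    and ?N = "\<lambda>F. \<integral>\<^sup>+w\<in>unit_disk. ennreal (F w powr p) \<partial>lborel"
  \<comment> \<open>Jensen is applied to the density \<open>ker z w * q w\<close> and the function
    \<open>F / q\<close>. By \<open>ker_bound_1\<close> the mass of this density is at most
    \<open>K * q z\<close>; after Fubini the powers of q cancel and leave the integral of
    \<open>F powr p\<close>.\<close>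
  have main: "(\<forall>z\<in>unit_disk. ennreal (enn2real (?T F z) powr p) \<le>
      ennreal (2 powr p * (K * q z) powr (p - 1)) * ?R F z) \<and>
    (\<forall>z\<in>unit_disk. ?R F z < \<infinity> \<longrightarrow>
      ?T F z < \<infinity>) \<and>
    (\<integral>\<^sup>+z. ennreal (2 powr p * (K * q z) powr (p - 1)) * ?R F z
       * indicator unit_disk z \<partial>lborel) \<le> ennreal C * ?N F"
    if F[measurable]: "F \<in> borel_measurable borel" and F0: "\<And>w. F w \<ge> (0::real)" for F
  proof (intro conjI ballI impI)
    have rw: "ennreal (ker z w * F w) * indicator unit_disk w = ennreal ((indicator unit_disk w * ker z w * q w) * (F w / q w))" for z w
      using q0[of w] by (auto simp: indicator_def)
    have rw2: "ennreal (ker z w * q w * (F w / q w) powr p) * indicator unit_disk w =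
       ennreal ((indicator unit_disk w * ker z w * q w) * (F w / q w) powr p)" for z w
      by (auto simp: indicator_def)
    have k1: "(\<integral>\<^sup>+w. ennreal (indicator unit_disk w * ker z w * q w) \<partial>lborel) \<le> ennreal (K * q z)" if "z \<in> unit_disk" for z
    proof -
      have "(\<integral>\<^sup>+w. ennreal (indicator unit_disk w * ker z w * q w) \<partial>lborel) =
        (\<integral>\<^sup>+w\<in>unit_disk. ennreal (ker z w * (1 - (cmod w)\<^sup>2) powr (- e)) \<partial>lborel)"
        by (intro nn_integral_cong) (auto simp: indicator_def q_def)
      also have "\<dots> \<le> ennreal (K * q z)" unfolding K_def q_def by (rule ker_bound_1) (use that e in auto)
      finally show ?thesis .
    qed
    have nn: "0 \<le> indicator unit_disk w * ker z w * q w" "0 \<le> F w / q w" for z w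
      by (simp_all add: ker_nonneg q_def F0)
    show "ennreal (enn2real (?T F z) powr p) \<le>
      ennreal (2 powr p * (K * q z) powr (p - 1)) * ?R F z"
      if z: "z \<in> unit_disk" for z
      unfolding rw rw2
      by (rule jensen_nn_integral[OF _ _ nn p _ k1[OF z]]) (measurable, use K q0[of z] z in simp)
    show "?T F z < \<infinity>"
      if z: "z \<in> unit_disk" and fin: "?R F z < \<infinity>" for z
      unfolding rw
      by (rule jensen_finite[OF _ _ nn p _ k1[OF z]]) (measurable, use K q0[of z] z fin[unfolded rw2] in simp_all)
    let ?J = "\<lambda>z w. ennreal (2 powr p * (K * q z) powr (p - 1)) * (ennreal (ker z w * q w * (F w / q w) powr p) * indicator unit_disk w) * indicator unit_disk z"
    have "(\<integral>\<^sup>+z. ennreal (2 powr p * (K * q z) powr (p - 1)) * ?R F z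
       * indicator unit_disk z \<partial>lborel) = (\<integral>\<^sup>+z. (\<integral>\<^sup>+w. ?J z w \<partial>lborel) \<partial>lborel)"
      by (intro nn_integral_cong) (subst nn_integral_multc, measurable, subst nn_integral_cmult, measurable)
    also have "\<dots> = (\<integral>\<^sup>+w. (\<integral>\<^sup>+z. ?J z w \<partial>lborel) \<partial>lborel)"
      by (rule lborel_pair.Fubini') measurable
    also have "\<dots> \<le> (\<integral>\<^sup>+w. ennreal C * (ennreal (F w powr p) * indicator unit_disk w) \<partial>lborel)"
    proof (rule nn_integral_mono)
      fix w
      show "(\<integral>\<^sup>+z. ?J z w \<partial>lborel) \<le> ennreal C * (ennreal (F w powr p) * indicator unit_disk w)"
      proof (cases "w \<in> unit_disk")
        case True
        then have w: "cmod w < 1" by simp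
        define a where "a = 2 powr p * K powr (p - 1) * (q w * (F w / q w) powr p)"
        have a: "a \<ge> 0" using q0[OF w] by (simp add: a_def)
        have qp: "q z powr (p - 1) = (1 - (cmod z)\<^sup>2) powr (- d)" for z
          by (simp add: q_def d_def powr_powr mult.commute)
        have "(\<integral>\<^sup>+z. ?J z w \<partial>lborel) = (\<integral>\<^sup>+z. ennreal a * (ennreal (ker z w * (1 - (cmod z)\<^sup>2) powr (- d)) * indicator unit_disk z) \<partial>lborel)"
        proof (rule nn_integral_cong)
          fix z
          show "?J z w = ennreal a * (ennreal (ker z w * (1 - (cmod z)\<^sup>2) powr (- d)) * indicator unit_disk z)"
          proof (cases "z \<in> unit_disk")
            case z: True
            have qz: "q z > 0" using q0 z by simp
            have "2 powr p * (K * q z) powr (p - 1) * (ker z w * q w * (F w / q w) powr p) = a * (ker z w * (1 - (cmod z)\<^sup>2) powr (- d))"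
              unfolding a_def qp[symmetric] using K qz by (simp add: powr_mult mult_ac)
            then show ?thesis using z True a ker_nonneg[of z w] q0[OF w]
              by (simp add: ennreal_mult[symmetric])
          qed simp
        qed
        also have "\<dots> = ennreal a * (\<integral>\<^sup>+z\<in>unit_disk. ennreal (ker z w * (1 - (cmod z)\<^sup>2) powr (- d)) \<partial>lborel)"
          by (rule nn_integral_cmult) measurable
        also have "\<dots> \<le> ennreal a * ennreal (16 * (1 - (cmod w)\<^sup>2) powr (- d))"
          by (intro mult_left_mono ker_bound_2 w d) simp
        also have "\<dots> = ennreal (a * (16 * q w powr (p - 1)))" using a by (simp add: ennreal_mult qp)
        also have "a * (16 * q w powr (p - 1)) = C * F w powr p"
        proof -
          have "(F w / q w) powr p = F w powr p / q w powr p" using F0[of w] q0[OF w] by (simp add: powr_divide)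
          moreover have "q w * q w powr (p - 1) = q w powr p" using q0[OF w] by (simp add: powr_diff)
          moreover have "a * (16 * q w powr (p - 1)) = C * ((q w * q w powr (p - 1)) * (F w / q w) powr p)"
            by (simp add: a_def C_def)
          ultimately show ?thesis using q0[OF w] by simp
        qed
        finally show ?thesis using True C by (simp add: ennreal_mult)
      qed simp
    qed
    also have "\<dots> = ennreal C * ?N F"
      by (rule nn_integral_cmult) measurable
    finally show "(\<integral>\<^sup>+z. ennreal (2 powr p * (K * q z) powr (p - 1)) * ?R F z
       * indicator unit_disk z \<partial>lborel) \<le> ennreal C * ?N F" .
  qed
  have "kernel_bound p C"
    unfolding kernel_bound_def
  proof (intro allI impI, rule conjI)
    fix F :: "complex \<Rightarrow> real" assume F[measurable]: "F \<in> borel_measurable borel" and F0: "\<forall>w. F w \<ge> 0"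
    note M = main[OF F spec[OF F0]]
    have "(\<integral>\<^sup>+z\<in>unit_disk. ennreal (enn2real (?T F z) powr p) \<partial>lborel) \<le>
      (\<integral>\<^sup>+z\<in>unit_disk. ennreal (2 powr p * (K * q z) powr (p - 1)) * ?R F z \<partial>lborel)"
      using M by (intro nn_integral_mono) (auto simp: indicator_def)
    also have "\<dots> \<le> ennreal C * ?N F" using M by blast
    finally show "(\<integral>\<^sup>+z\<in>unit_disk. ennreal (enn2real (?T F z) powr p) \<partial>lborel) \<le> ennreal C * ?N F" .
    show "?N F < \<infinity> \<longrightarrow> (AE z in lborel. z \<in> unit_disk \<longrightarrow> ?T F z < \<infinity>)"
    proof
      assume fin: "?N F < \<infinity>"
      have "(\<integral>\<^sup>+z\<in>unit_disk. ennreal (2 powr p * (K * q z) powr (p - 1)) * ?R F z \<partial>lborel) < \<infinity>"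
        using M fin by (auto intro: le_less_trans simp: ennreal_mult_less_top)
      then have "AE z in lborel. ennreal (2 powr p * (K * q z) powr (p - 1)) * ?R F z * indicator unit_disk z \<noteq> \<infinity>"
        by (intro nn_integral_PInf_AE) auto
      then show "AE z in lborel. z \<in> unit_disk \<longrightarrow> ?T F z < \<infinity>"
      proof eventually_elim
        case (elim z)
        show ?case
        proof
          assume z: "z \<in> unit_disk"
          have "2 powr p * (K * q z) powr (p - 1) > 0" using K q0[of z] z by simp
          then have "?R F z < \<infinity>" using elim z by (auto simp: ennreal_mult_eq_top_iff less_top)
          then show "?T F z < \<infinity>" using M z by blast
        qed
      qed
    qed
  qed
  with C show thesis by (rule that)
qed

section \<open>The Cauchy-type kernel near a point of the sequence\<close>

text \<open>Up to the factor \<open>(1 - \<bar>w\<bar>\<^sup>2)\<^sup>2 / (1 - cnj w * z) ^ 3\<close>, holomorphic in \<open>z\<close> and equal to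
  \<open>1 / (1 - \<bar>w\<bar>\<^sup>2)\<close> on the diagonal, this is the Cauchy kernel.\<close>

definition cker :: "complex \<Rightarrow> complex \<Rightarrow> complex" where
  "cker z w = of_real ((1 - (cmod w)\<^sup>2)\<^sup>2) / (of_real pi * (z - w) * (1 - cnj w * z) ^ 3)"

lemma norm_cker: "cmod (cker z w) = ker z w"
  by (simp add: cker_def ker_def norm_divide norm_mult norm_power del: of_real_diff of_real_power)

lemma cker_measurable_pair[measurable]: "(\<lambda>(z, w). cker z w) \<in> borel_measurable (borel \<Otimes>\<^sub>M borel)"
proof -
  have [measurable]: "cnj \<in> borel_measurable borel"
    by (intro borel_measurable_continuous_onI continuous_intros)
  show ?thesis unfolding cker_def[abs_def] by measurable
qed

lemma cker_measurable[measurable]: "cker z \<in> borel_measurable borel"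
  using measurable_Pair2[OF cker_measurable_pair, of z] by simp

text \<open>The factor \<open>pseudo_hyp w a\<close>, which \<open>\<bar>\<Psi>\<bar>\<close>
  supplies near a, cancels the pole of \<open>ker a\<close> at a; what remains is comparable to
  \<open>1 / \<bar>1 - cnj w * z\<bar>^4\<close> and hence bounded by \<open>ker z w\<close>. The
  constant covers the fourth power of 5/4. At w = z the kernel has the default value 0, so this
  point is excluded.\<close>

lemma ker_mult_pseudo_hyp_le:
  assumes k: "0 < \<kappa>" "\<kappa> \<le> 1/8" and a: "cmod a < 1" and z: "z \<in> hball \<kappa> a" and w: "cmod w < 1" "w \<noteq> z"
  shows "ker a w * pseudo_hyp w a \<le> 3 * ker z w"
proof (cases "w = a")
  case True
  then show ?thesis by (simp add: ker_nonneg pseudo_hyp_eq)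
next
  case False
  note hz = hball_props[OF k a z]
  define P where "P = cmod (1 - cnj w * z)"
  define Q where "Q = cmod (1 - cnj w * a)"
  define c where "c = (1 - (cmod w)\<^sup>2)\<^sup>2 / pi"
  have c: "c \<ge> 0" by (simp add: c_def)
  have P: "P > 0" using cmod_one_minus_ge(6)[OF hz(1) w(1)] by (simp add: P_def)
  have Q: "Q > 0" using cmod_one_minus_ge(6)[OF a w(1)] by (simp add: Q_def)
  have PQ: "P \<le> 5/4 * Q" using hz(4)[OF w(1)] by (simp add: P_def Q_def)
  have "ker a w * pseudo_hyp w a = c / Q ^ 4"
    using False Q c unfolding ker_def pseudo_hyp_eq cmod_one_minus_commute[of a w] Q_def[symmetric]
    by (simp add: c_def norm_minus_commute[of w a] field_simps power4_eq_xxxx power3_eq_cube)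
  also have "\<dots> \<le> 3 * (c / P ^ 4)"
  proof -
    have "P ^ 4 \<le> (5/4 * Q) ^ 4" using PQ P by (intro power_mono) auto
    also have "\<dots> \<le> 3 * Q ^ 4" using Q by (simp add: power_mult_distrib power_divide)
    finally have "c * P ^ 4 \<le> c * (3 * Q ^ 4)" using c by (rule mult_left_mono)
    then show ?thesis using P Q by (simp add: field_simps)
  qed
  also have "c / P ^ 4 \<le> ker z w"
  proof -
    have "cmod (z - w) \<le> P" using cmod_one_minus_ge(5)[OF hz(1) w(1)] by (simp add: P_def)
    then have "cmod (z - w) * P ^ 3 \<le> P * P ^ 3" using P by (intro mult_right_mono) auto
    moreover have "P * P ^ 3 = P ^ 4" by (simp add: power4_eq_xxxx power3_eq_cube)
    ultimately have "c / P ^ 4 \<le> c / (cmod (z - w) * P ^ 3)"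
      using P w(2) c by (intro divide_left_mono mult_pos_pos) auto
    then show ?thesis by (simp add: ker_def P_def c_def)
  qed
  finally show ?thesis by simp
qed

text \<open>The same cancellation for the increment of the kernel: the difference of the two
  denominators contains the factor \<open>a - z\<close>, which becomes
  \<open>pseudo_hyp z a\<close>. The constant 15 is 6 * 5/2, where 6 bounds the cofactor.\<close>

lemma cker_diff_mult_pseudo_hyp_le:
  assumes k: "0 < \<kappa>" "\<kappa> \<le> 1/8" and a: "cmod a < 1" and z: "z \<in> hball \<kappa> a" and w: "cmod w < 1" "w \<noteq> z"
  shows "cmod (cker z w - cker a w) * pseudo_hyp w a \<le> 15 * pseudo_hyp z a * ker z w"
proof (cases "w = a")
  case True
  then show ?thesis using pseudo_hyp_bounds[OF hball_props(1)[OF k a z] a] by (simp add: ker_nonneg pseudo_hyp_eq)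
next
  case False
  note hz = hball_props[OF k a z]
  define P where "P = 1 - cnj w * z"
  define Q where "Q = 1 - cnj w * a"
  define c where "c = (1 - (cmod w)\<^sup>2)\<^sup>2 / pi"
  have c: "c \<ge> 0" by (simp add: c_def)
  have P: "P \<noteq> 0" using cmod_one_minus_ge(7)[OF hz(1) w(1)] by (simp add: P_def)
  have Q: "Q \<noteq> 0" using cmod_one_minus_ge(7)[OF a w(1)] by (simp add: Q_def)
  have PQ: "cmod P \<le> 5/4 * cmod Q" using hz(4)[OF w(1)] by (simp add: P_def Q_def)
  have zw: "z - w \<noteq> 0" "a - w \<noteq> 0" using w False by auto
  have ck: "cker z w = of_real c / ((z - w) * P ^ 3)" "cker a w = of_real c / ((a - w) * Q ^ 3)"
    by (simp_all add: cker_def P_def Q_def c_def mult.assoc)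
  have kz: "ker z w = c / (cmod (z - w) * cmod P ^ 3)"
    by (simp add: ker_def P_def c_def mult.assoc)
  have "cker z w - cker a w = of_real c * ((a - w) * Q ^ 3 - (z - w) * P ^ 3) / ((z - w) * P ^ 3 * ((a - w) * Q ^ 3))"
    unfolding ck using zw P Q by (simp add: divide_simps) (simp add: algebra_simps)
  \<comment> \<open>Extracts the factor \<open>a - z\<close>: by definition
    \<open>P - Q = cnj w * (a - z)\<close>, so it divides both \<open>P^3 - Q^3\<close> and the
    difference of the linear factors.\<close>
  also have "(a - w) * Q ^ 3 - (z - w) * P ^ 3 = (a - z) * (Q ^ 3 - (z - w) * cnj w * (- 1) * (- (Q\<^sup>2 + Q * P + P\<^sup>2)))"
    unfolding P_def Q_def by algebra
  finally have "cmod (cker z w - cker a w) = c * (cmod (z - a) * cmod (Q ^ 3 - (z - w) * cnj w * (- 1) * (- (Q\<^sup>2 + Q * P + P\<^sup>2))))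
      / (cmod (z - w) * cmod P ^ 3 * (cmod (a - w) * cmod Q ^ 3))"
    using c by (simp add: norm_divide norm_mult norm_power norm_minus_commute[of a z])
  also have "\<dots> \<le> c * (cmod (z - a) * (6 * cmod Q ^ 3)) / (cmod (z - w) * cmod P ^ 3 * (cmod (a - w) * cmod Q ^ 3))"
  proof (intro divide_right_mono mult_left_mono)
    have "cmod (Q ^ 3 - (z - w) * cnj w * (- 1) * (- (Q\<^sup>2 + Q * P + P\<^sup>2))) \<le>
        cmod Q ^ 3 + cmod (z - w) * cmod w * (cmod Q ^ 2 + cmod Q * cmod P + cmod P ^ 2)"
    proof -
      have "cmod (Q\<^sup>2 + Q * P + P\<^sup>2) \<le> cmod Q ^ 2 + cmod Q * cmod P + cmod P ^ 2"
        by (rule order_trans[OF norm_triangle_ineq], rule add_mono, rule order_trans[OF norm_triangle_ineq])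
           (simp_all add: norm_mult norm_power)
      then have "cmod ((z - w) * cnj w * (- 1) * (- (Q\<^sup>2 + Q * P + P\<^sup>2))) \<le>
          cmod (z - w) * cmod w * (cmod Q ^ 2 + cmod Q * cmod P + cmod P ^ 2)"
        unfolding norm_mult norm_minus_cancel complex_mod_cnj norm_one mult_1_right by (intro mult_left_mono) auto
      then show ?thesis using norm_triangle_ineq4[of "Q ^ 3" "(z - w) * cnj w * (- 1) * (- (Q\<^sup>2 + Q * P + P\<^sup>2))"]
        by (simp add: norm_power)
    qed
    also have "\<dots> \<le> cmod Q ^ 3 + (5/4 * cmod Q) * 1 * (cmod Q ^ 2 + cmod Q * (5/4 * cmod Q) + (5/4 * cmod Q) ^ 2)"
    proof -
      have "cmod (z - w) \<le> 5/4 * cmod Q"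
        using cmod_one_minus_ge(5)[OF hz(1) w(1)] PQ by (simp add: P_def)
      then show ?thesis using PQ w(1)
        by (intro add_left_mono mult_mono add_mono power_mono) auto
    qed
    also have "\<dots> \<le> 6 * cmod Q ^ 3"
      by (simp add: power2_eq_square power3_eq_cube algebra_simps)
    finally show "cmod (Q ^ 3 - (z - w) * cnj w * (- 1) * (- (Q\<^sup>2 + Q * P + P\<^sup>2))) \<le> 6 * cmod Q ^ 3" .
  qed (use c in auto)
  also have "\<dots> = 6 * (cmod (z - a) / cmod (a - w)) * ker z w"
    unfolding kz using P Q zw by (simp add: field_simps)
  finally have "cmod (cker z w - cker a w) * pseudo_hyp w a \<le> 6 * (cmod (z - a) / cmod (a - w)) * ker z w * pseudo_hyp w a"
    using pseudo_hyp_bounds(1)[OF w(1) a] by (rule mult_right_mono)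
  also have "\<dots> = 6 * (cmod (z - a) / cmod Q) * ker z w"
    unfolding pseudo_hyp_eq cmod_one_minus_commute[of a w] Q_def[symmetric] using zw(2)
    by (simp add: norm_minus_commute[of w a])
  also have "\<dots> \<le> 6 * (5/2 * pseudo_hyp z a) * ker z w"
  proof (intro mult_right_mono mult_left_mono ker_nonneg)
    have "cmod (z - a) \<le> 5/4 * (1 - (cmod a)\<^sup>2) * pseudo_hyp z a" by (rule hz(5))
    also have "\<dots> \<le> 5/4 * (2 * cmod Q) * pseudo_hyp z a"
      using cmod_one_minus_ge(3)[OF a w(1)] pseudo_hyp_bounds(1)[OF hz(1) a]
      by (intro mult_right_mono mult_left_mono) (auto simp: Q_def)
    finally show "cmod (z - a) / cmod Q \<le> 5/2 * pseudo_hyp z a" using Q by (simp add: field_simps)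
  qed simp
  finally show ?thesis by simp
qed

section \<open>The solution operator\<close>

text \<open>The constants \<open>Cs\<close>, \<open>Cb\<close>, \<open>M\<close> are parameters
  subject only to estimates that do not involve f. In the final theorem they are fixed before f is
  chosen, which makes the solution bound uniform.\<close>

locale dbar_data = separated_seq +
  fixes p :: real and \<Psi> f :: "complex \<Rightarrow> complex"
  assumes p: "p \<ge> 1"
    and Psi_hol: "\<Psi> holomorphic_on unit_disk"
    and Psi_le: "\<And>z. cmod z < 1 \<Longrightarrow> cmod (\<Psi> z) \<le> exp (kZ Z z)"
    and Psi_le': "\<And>z a. cmod z < 1 \<Longrightarrow> a \<in> Z \<Longrightarrow> cmod (\<Psi> z) \<le> 2 * pseudo_hyp z a * exp (kZ Z z)"
    and Psi_ge: "\<And>z. cmod z < 1 \<Longrightarrow> \<forall>b\<in>Z. z \<notin> hball \<kappa> b \<Longrightarrow> lowc * exp (kZ Z z) \<le> cmod (\<Psi> z)"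
    and Psi_ge': "\<And>z a. a \<in> Z \<Longrightarrow> z \<in> hball \<kappa> a \<Longrightarrow> lowc * pseudo_hyp z a * exp (kZ Z z) \<le> cmod (\<Psi> z)"
    and f_meas[measurable]: "f \<in> borel_measurable borel"
    and f_0: "\<And>z. z \<notin> unit_disk \<Longrightarrow> f z = 0"
    and f_fin: "LpZ_int p Z f < \<infinity>"
  fixes Cs Cb M :: real
  assumes Cs: "Cs > 0" and schur: "kernel_bound p Cs"
    and Cb: "Cb > 0" and local_bound: "\<And>h \<zeta> r. h holomorphic_on unit_disk \<Longrightarrow> r > 0 \<Longrightarrow> ball \<zeta> r \<subseteq> unit_disk \<Longrightarrow>
      ennreal (cmod (h \<zeta>) powr p) \<le> ennreal (Cb / r\<^sup>2) * (\<integral>\<^sup>+z\<in>ball \<zeta> r. ennreal (cmod (h z) powr p) \<partial>lborel)"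
    and M: "M > 0" and interp: "\<And>c. c \<in> lpZ p Z \<Longrightarrow> interp_by p Z (M * wsum p Z c) c"
begin

text \<open>The size of f in the weighted norm. Off the disk the weight is replaced by 1, which
  makes the function Borel on the whole plane.\<close>

definition F :: "complex \<Rightarrow> real" where
  "F z = cmod (f z) * exp (if z \<in> unit_disk then kZ Z z else 0)"

definition g :: "complex \<Rightarrow> complex" where
  "g z = \<Psi> z * f z"

text \<open>A positive majorant of the potential v. It is finite only almost everywhere; its real
  version t is 0 where T is infinite, so estimates by t always assume that T is finite at the
  point.\<close>

definition T :: "complex \<Rightarrow> ennreal" where
  "T z = (\<integral>\<^sup>+w\<in>unit_disk. ennreal (ker z w * F w) \<partial>lborel)"

definition t :: "complex \<Rightarrow> real" where "t z = enn2real (T z)"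

definition v :: "complex \<Rightarrow> complex" where
  "v z = (\<integral>w. cker z w * g w \<partial>lborel)"

lemma disk_borel[measurable]: "unit_disk \<in> sets borel" by simp

lemma F_measurable[measurable]: "F \<in> borel_measurable borel"
  unfolding F_def[abs_def] using kZ_measurable by measurable

lemma F_nonneg: "F z \<ge> 0" by (simp add: F_def)

lemma F_0: "z \<notin> unit_disk \<Longrightarrow> F z = 0" by (simp add: F_def f_0)

lemma Psi_measurable: "(\<lambda>z. indicator unit_disk z * \<Psi> z) \<in> borel_measurable borel"
proof -
  have "(\<lambda>z. indicator unit_disk z *\<^sub>R \<Psi> z) \<in> borel_measurable borel"
    by (rule borel_measurable_continuous_on_indicator) (auto intro: holomorphic_on_imp_continuous_on Psi_hol)
  moreover have "(\<lambda>z. indicator unit_disk z *\<^sub>R \<Psi> z) = (\<lambda>z. indicator unit_disk z * \<Psi> z)"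
    by (rule ext) (simp add: indicator_def)
  ultimately show ?thesis by (simp only:)
qed

lemma g_measurable[measurable]: "g \<in> borel_measurable borel"
proof -
  have "g = (\<lambda>z. (indicator unit_disk z * \<Psi> z) * f z)"
    by (rule ext) (use f_0 in \<open>auto simp: g_def indicator_def\<close>)
  then show ?thesis using Psi_measurable by simp
qed

lemma g_0: "z \<notin> unit_disk \<Longrightarrow> g z = 0" by (simp add: g_def f_0)

lemma g_le: "cmod (g z) \<le> F z"
proof (cases "z \<in> unit_disk")
  case True
  then have "cmod (\<Psi> z) * cmod (f z) \<le> exp (kZ Z z) * cmod (f z)"
    by (intro mult_right_mono Psi_le) auto
  then show ?thesis using True by (simp add: g_def F_def norm_mult mult.commute)
qed (simp add: g_0 F_nonneg)

lemma g_le': "a \<in> Z \<Longrightarrow> cmod z < 1 \<Longrightarrow> cmod (g z) \<le> 2 * pseudo_hyp z a * F z"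
  using mult_right_mono[OF Psi_le'[of z a], of "cmod (f z)"] by (simp add: g_def F_def norm_mult mult_ac)

lemma F_fin: "(\<integral>\<^sup>+z\<in>unit_disk. ennreal (F z powr p) \<partial>lborel) = LpZ_int p Z f"
  unfolding LpZ_int_eq by (intro nn_integral_cong) (auto simp: F_def indicator_def)

lemma F_integrable: "integrable lborel F"
proof (rule integrable_of_powr[of _ _ unit_disk, OF _ _ _ _ p])
  have "(\<integral>\<^sup>+z. ennreal (norm (F z) powr p) \<partial>lborel) = (\<integral>\<^sup>+z\<in>unit_disk. ennreal (F z powr p) \<partial>lborel)"
    by (intro nn_integral_cong) (auto simp: indicator_def F_0 F_nonneg)
  also have "\<dots> < \<infinity>" unfolding F_fin by (rule f_fin)
  finally show "(\<integral>\<^sup>+z. ennreal (norm (F z) powr p) \<partial>lborel) < \<infinity>" .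
  show "emeasure lborel unit_disk < \<infinity>" by (rule emeasure_bounded_finite) simp
qed (auto simp: F_0)

lemma T_eq: "T z = (\<integral>\<^sup>+w. ennreal (ker z w * F w) \<partial>lborel)"
  unfolding T_def by (intro nn_integral_cong) (auto simp: indicator_def F_0)

lemma T_measurable[measurable]: "T \<in> borel_measurable borel"
  unfolding T_eq[abs_def] by measurable

lemma t_measurable[measurable]: "t \<in> borel_measurable borel"
  unfolding t_def[abs_def] by measurable

lemma t_nonneg: "t z \<ge> 0" by (simp add: t_def)

lemma v_measurable[measurable]: "v \<in> borel_measurable borel"
  unfolding v_def[abs_def] by measurable

lemma integrable_v:
  assumes "T z < \<infinity>"
  shows "integrable lborel (\<lambda>w. cker z w * g w)" "cmod (v z) \<le> t z"
proof -
  have "(\<integral>\<^sup>+w. ennreal (cmod (cker z w * g w)) \<partial>lborel) \<le> T z"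
    unfolding T_eq
    by (intro nn_integral_mono ennreal_leI) (simp add: norm_mult norm_cker mult_left_mono g_le ker_nonneg)
  note le = this and fin = le_less_trans[OF this assms]
  show "integrable lborel (\<lambda>w. cker z w * g w)" by (rule integrableI_bounded) (use fin in auto)
  have "cmod (v z) \<le> enn2real (\<integral>\<^sup>+w. ennreal (cmod (cker z w * g w)) \<partial>lborel)"
    unfolding v_def by (rule norm_integral_le_enn2real[OF fin])
  also have "\<dots> \<le> t z" unfolding t_def by (rule enn2real_mono[OF le assms[unfolded infinity_ennreal_def]])
  finally show "cmod (v z) \<le> t z" .
qed

lemma AE_neq: "AE w in lborel. w \<noteq> (z::complex)"
  by (rule AE_lborel_singleton)

text \<open>Convergence of the integral defining \<open>v a\<close> is inherited from any single
  nearby z with finite potential: \<open>\<bar>g w\<bar>\<close> is at most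
  \<open>2 * pseudo_hyp w a * F w\<close>, and the two kernel comparisons bound the integrands by
  multiples of \<open>ker z w * F w\<close>. The constants are 2 * 3 and 2 * 15.\<close>

lemma v_center:
  assumes a: "a \<in> Z" and z: "z \<in> hball \<kappa> a" and fin: "T z < \<infinity>"
  shows "integrable lborel (\<lambda>w. cker a w * g w)" "cmod (v a) \<le> 6 * t z"
    "cmod (v z - v a) \<le> 30 * pseudo_hyp z a * t z"
proof -
  have ca: "cmod a < 1" by (rule Z_cmod[OF a])
  have cz: "cmod z < 1" by (rule hball_props(1)[OF kappa ca z])
  have cT: "(\<integral>\<^sup>+w. ennreal (c * (ker z w * F w)) \<partial>lborel) = ennreal c * T z" if "c \<ge> 0" for c
    unfolding T_eq using that by (subst nn_integral_cmult[symmetric]) (auto simp: ennreal_mult ker_nonneg F_nonneg)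
  have ft: "ennreal (t z) = T z" using fin by (simp add: t_def)
  have le1: "(\<integral>\<^sup>+w. ennreal (cmod (cker a w * g w)) \<partial>lborel) \<le> ennreal (6 * t z)"
  proof -
    have "(\<integral>\<^sup>+w. ennreal (cmod (cker a w * g w)) \<partial>lborel) \<le> (\<integral>\<^sup>+w. ennreal (6 * (ker z w * F w)) \<partial>lborel)"
      using AE_neq[of z]
    proof (intro nn_integral_mono_AE, eventually_elim)
      case (elim w)
      show ?case
      proof (cases "w \<in> unit_disk")
        case True
        have "cmod (cker a w * g w) \<le> ker a w * (2 * pseudo_hyp w a * F w)"
          using True unfolding norm_mult norm_cker by (intro mult_left_mono g_le' a ker_nonneg) simp
        also have "\<dots> = (ker a w * pseudo_hyp w a) * (2 * F w)" by simp
        also have "\<dots> \<le> (3 * ker z w) * (2 * F w)"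
          using True elim by (intro mult_right_mono ker_mult_pseudo_hyp_le[OF kappa ca z]) (auto simp: F_nonneg)
        finally show ?thesis by (intro ennreal_leI) simp
      qed (simp add: g_0)
    qed
    also have "\<dots> = ennreal (6 * t z)" by (subst cT) (simp_all add: ft[symmetric] ennreal_mult t_nonneg)
    finally show ?thesis .
  qed
  note fin1 = le_less_trans[OF le1 ennreal_less_top]
  show int: "integrable lborel (\<lambda>w. cker a w * g w)" by (rule integrableI_bounded) (use fin1 in auto)
  have "cmod (v a) \<le> enn2real (\<integral>\<^sup>+w. ennreal (cmod (cker a w * g w)) \<partial>lborel)"
    unfolding v_def by (rule norm_integral_le_enn2real) (use fin1 in simp)
  also have "\<dots> \<le> enn2real (ennreal (6 * t z))" by (rule enn2real_mono[OF le1]) simp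
  finally show "cmod (v a) \<le> 6 * t z" using t_nonneg by simp
  have psi: "pseudo_hyp z a \<ge> 0" by (rule pseudo_hyp_bounds(1)[OF cz ca])
  have le2: "(\<integral>\<^sup>+w. ennreal (cmod (cker z w * g w - cker a w * g w)) \<partial>lborel) \<le> ennreal (30 * pseudo_hyp z a * t z)"
  proof -
    have "(\<integral>\<^sup>+w. ennreal (cmod (cker z w * g w - cker a w * g w)) \<partial>lborel) \<le>
      (\<integral>\<^sup>+w. ennreal ((30 * pseudo_hyp z a) * (ker z w * F w)) \<partial>lborel)"
      using AE_neq[of z]
    proof (intro nn_integral_mono_AE, eventually_elim)
      case (elim w)
      show ?case
      proof (cases "w \<in> unit_disk")
        case True
        have "cmod (cker z w * g w - cker a w * g w) = cmod (cker z w - cker a w) * cmod (g w)"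
          by (simp add: left_diff_distrib[symmetric] norm_mult)
        also have "\<dots> \<le> cmod (cker z w - cker a w) * (2 * pseudo_hyp w a * F w)"
          using True by (intro mult_left_mono g_le' a) auto
        also have "\<dots> = (cmod (cker z w - cker a w) * pseudo_hyp w a) * (2 * F w)" by simp
        also have "\<dots> \<le> (15 * pseudo_hyp z a * ker z w) * (2 * F w)"
          using True elim by (intro mult_right_mono cker_diff_mult_pseudo_hyp_le[OF kappa ca z]) (auto simp: F_nonneg)
        finally show ?thesis by (intro ennreal_leI) simp
      qed (simp add: g_0)
    qed
    also have "\<dots> = ennreal (30 * pseudo_hyp z a * t z)"
      using psi by (subst cT) (simp_all add: ft[symmetric] ennreal_mult t_nonneg)
    finally show ?thesis .
  qed
  note fin2 = le_less_trans[OF le2 ennreal_less_top]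
  have "v z - v a = (\<integral>w. cker z w * g w - cker a w * g w \<partial>lborel)"
    unfolding v_def using integrable_v(1)[OF fin] int by simp
  then have "cmod (v z - v a) \<le> enn2real (\<integral>\<^sup>+w. ennreal (cmod (cker z w * g w - cker a w * g w)) \<partial>lborel)"
    using norm_integral_le_enn2real[of lborel "\<lambda>w. cker z w * g w - cker a w * g w"] fin2 by simp
  also have "\<dots> \<le> enn2real (ennreal (30 * pseudo_hyp z a * t z))" by (rule enn2real_mono[OF le2]) simp
  finally show "cmod (v z - v a) \<le> 30 * pseudo_hyp z a * t z" using t_nonneg psi by simp
qed

definition I :: real where "I = enn2real (LpZ_int p Z f)"

lemma I: "I \<ge> 0" "ennreal I = LpZ_int p Z f"
  using f_fin by (simp_all add: I_def)

lemmas schur_F = schur[unfolded kernel_bound_def, rule_format, OF F_measurable F_nonneg]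

lemma T_AE: "AE z in lborel. z \<in> unit_disk \<longrightarrow> T z < \<infinity>"
  using schur_F f_fin unfolding F_fin T_def by simp

lemma t_bound: "(\<integral>\<^sup>+z\<in>unit_disk. ennreal (t z powr p) \<partial>lborel) \<le> ennreal (Cs * I)"
  using schur_F Cs I unfolding F_fin t_def T_def by (simp add: ennreal_mult)

lemma Psi_zero: "a \<in> Z \<Longrightarrow> \<Psi> a = 0"
  using Psi_le'[of a a] Z_cmod[of a] by (simp add: pseudo_hyp_eq)

lemma lowc_pos: "lowc > 0" by (simp add: lowc_def)

lemma Psi_nonzero:
  assumes z: "cmod z < 1" "z \<notin> Z"
  shows "\<Psi> z \<noteq> 0"
proof (cases "\<forall>b\<in>Z. z \<notin> hball \<kappa> b")
  case True
  have "0 < lowc * exp (kZ Z z)" using lowc_pos by simp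
  also have "\<dots> \<le> cmod (\<Psi> z)" by (rule Psi_ge[OF z(1) True])
  finally show ?thesis by auto
next
  case False
  then obtain a where a: "a \<in> Z" "z \<in> hball \<kappa> a" by auto
  have "z \<noteq> a" using a z by auto
  then have "pseudo_hyp z a > 0"
    using cmod_one_minus_ge(6)[OF z(1) Z_cmod[OF a(1)]] by (simp add: pseudo_hyp_eq)
  then have "0 < lowc * pseudo_hyp z a * exp (kZ Z z)" using lowc_pos by simp
  also have "\<dots> \<le> cmod (\<Psi> z)" by (rule Psi_ge'[OF a])
  finally show ?thesis by auto
qed

text \<open>The bound \<open>6 * t z\<close> for \<open>\<bar>v a\<bar>\<close> holds at almost
  every z in the disc of a, so it may be averaged over the disc. The discs are disjoint, and the sum
  is controlled by the L^p norm of t.\<close>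

lemma v_lpZ: "v \<in> lpZ p Z" "wsum p Z v \<le> 6 powr p / (pi * \<kappa>\<^sup>2) * (Cs * I)"
proof -
  have "(\<Sum>a\<in>S. cmod (v a) powr p * (1 - (cmod a)\<^sup>2)\<^sup>2) \<le> 6 powr p / (pi * \<kappa>\<^sup>2) * (Cs * I)"
    if S: "finite S" "S \<subseteq> Z" for S
  proof -
    have "ennreal (pi * \<kappa>\<^sup>2 * (\<Sum>a\<in>S. cmod (v a) powr p * (1 - (cmod a)\<^sup>2)\<^sup>2)) =
      (\<Sum>a\<in>S. ennreal (cmod (v a) powr p) * emeasure lborel (hball \<kappa> a))"
    proof -
      have "(\<Sum>a\<in>S. ennreal (cmod (v a) powr p) * emeasure lborel (hball \<kappa> a)) =
          (\<Sum>a\<in>S. ennreal (cmod (v a) powr p * (pi * \<kappa>\<^sup>2 * (1 - (cmod a)\<^sup>2)\<^sup>2)))"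
        using S by (intro sum.cong refl) (auto simp: emeasure_hball subset_iff ennreal_mult)
      also have "\<dots> = ennreal (\<Sum>a\<in>S. cmod (v a) powr p * (pi * \<kappa>\<^sup>2 * (1 - (cmod a)\<^sup>2)\<^sup>2))"
        by (rule sum_ennreal) simp
      also have "(\<Sum>a\<in>S. cmod (v a) powr p * (pi * \<kappa>\<^sup>2 * (1 - (cmod a)\<^sup>2)\<^sup>2)) =
          pi * \<kappa>\<^sup>2 * (\<Sum>a\<in>S. cmod (v a) powr p * (1 - (cmod a)\<^sup>2)\<^sup>2)"
        by (simp add: sum_distrib_left mult_ac)
      finally show ?thesis by simp
    qed
    also have "\<dots> \<le> (\<Sum>a\<in>S. (\<integral>\<^sup>+z\<in>hball \<kappa> a. ennreal (6 powr p * t z powr p) \<partial>lborel))"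
    proof (rule sum_mono)
      fix a assume "a \<in> S"
      then have a: "a \<in> Z" using S by auto
      have "ennreal (cmod (v a) powr p) * emeasure lborel (hball \<kappa> a) =
         (\<integral>\<^sup>+z\<in>hball \<kappa> a. ennreal (cmod (v a) powr p) \<partial>lborel)"
        by (rule nn_integral_cmult_indicator[symmetric]) (simp add: hball_def)
      also have "\<dots> \<le> (\<integral>\<^sup>+z\<in>hball \<kappa> a. ennreal (6 powr p * t z powr p) \<partial>lborel)"
        using T_AE
      proof (intro nn_integral_mono_AE, eventually_elim)
        case (elim z)
        show ?case
        proof (cases "z \<in> hball \<kappa> a")
          case True
          then have "T z < \<infinity>" using elim hball_props(1)[OF kappa Z_cmod[OF a] True] by simp
          from v_center(2)[OF a True this] have "cmod (v a) powr p \<le> (6 * t z) powr p"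
            using p by (intro powr_mono2) auto
          then show ?thesis using t_nonneg[of z] True by (simp add: powr_mult ennreal_leI)
        qed simp
      qed
      finally show "ennreal (cmod (v a) powr p) * emeasure lborel (hball \<kappa> a) \<le>
        (\<integral>\<^sup>+z\<in>hball \<kappa> a. ennreal (6 powr p * t z powr p) \<partial>lborel)" .
    qed
    also have "\<dots> \<le> (\<integral>\<^sup>+z\<in>unit_disk. ennreal (6 powr p * t z powr p) \<partial>lborel)"
      by (rule sum_nn_integral_hball_le[OF S]) measurable
    also have "\<dots> = ennreal (6 powr p) * (\<integral>\<^sup>+z\<in>unit_disk. ennreal (t z powr p) \<partial>lborel)"
      by (subst nn_integral_cmult[symmetric]) (auto simp: ennreal_mult mult.assoc)
    also have "\<dots> \<le> ennreal (6 powr p) * ennreal (Cs * I)" by (intro mult_left_mono t_bound) simp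
    also have "\<dots> = ennreal (6 powr p * (Cs * I))" using Cs I(1) by (simp add: ennreal_mult)
    finally have "pi * \<kappa>\<^sup>2 * (\<Sum>a\<in>S. cmod (v a) powr p * (1 - (cmod a)\<^sup>2)\<^sup>2) \<le> 6 powr p * (Cs * I)"
      using Cs I(1) by (subst (asm) ennreal_le_iff) auto
    then show ?thesis using kappa(1) by (simp add: field_simps)
  qed
  note * = this
  show "v \<in> lpZ p Z" by (rule lpZ_I(1)[OF *])
  show "wsum p Z v \<le> 6 powr p / (pi * \<kappa>\<^sup>2) * (Cs * I)" by (rule lpZ_I(2)[OF *])
qed

section \<open>The corrected solution and its norm\<close>

definition u :: "(complex \<Rightarrow> complex) \<Rightarrow> complex \<Rightarrow> complex" where
  "u h z = (if z \<in> unit_disk then (v z - h z) / \<Psi> z else 0)"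

definition J :: "(complex \<Rightarrow> complex) \<Rightarrow> complex \<Rightarrow> ennreal" where
  "J h a = (\<integral>\<^sup>+z\<in>hball \<kappa> a. ennreal (cmod (h z) powr p) \<partial>lborel)"

text \<open>A bound for \<open>\<bar>h\<bar>\<close> on the disc of half radius, from the mean value
  inequality with radius \<open>\<kappa> * (1 - \<bar>a\<bar>^2) / 2\<close>; the factor 4 is the
  square of that 2.\<close>

definition H :: "(complex \<Rightarrow> complex) \<Rightarrow> complex \<Rightarrow> real" where
  "H h a = (4 * Cb / (\<kappa> * (1 - (cmod a)\<^sup>2))\<^sup>2 * enn2real (J h a)) powr (1 / p)"

text \<open>The factor 30 is the increment constant of v, \<open>1 / \<kappa>\<close> covers the
  Lipschitz constant of h on the discs, and \<open>lowc\<close> is the lower bound for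
  \<Psi>.\<close>

definition A :: real where "A = 30 / (lowc * \<kappa>)"

lemma A_pos: "A > 0" using lowc_pos kappa by (simp add: A_def)

lemma u_measurable:
  assumes h: "h holomorphic_on unit_disk"
  shows "u h \<in> borel_measurable borel"
proof -
  have "(\<lambda>z. indicator unit_disk z *\<^sub>R h z) \<in> borel_measurable borel"
    by (rule borel_measurable_continuous_on_indicator) (auto intro: holomorphic_on_imp_continuous_on h)
  moreover have "u h = (\<lambda>z. (indicator unit_disk z * v z - indicator unit_disk z *\<^sub>R h z) / (indicator unit_disk z * \<Psi> z))"
    by (rule ext) (simp add: u_def indicator_def)
  ultimately show ?thesis using Psi_measurable by simp
qed

lemma hball_subset_disk: "a \<in> Z \<Longrightarrow> hball \<kappa> a \<subseteq> unit_disk"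
  using hball_props(1)[OF kappa Z_cmod] by auto

lemma hball_mono: "a \<in> Z \<Longrightarrow> c \<le> \<kappa> \<Longrightarrow> hball c a \<subseteq> hball \<kappa> a"
  unfolding hball_def using one_minus_sq_pos[OF Z_cmod[of a]] by (intro subset_ball mult_right_mono) auto

lemma J_fin: "Bint p h < \<infinity> \<Longrightarrow> a \<in> Z \<Longrightarrow> J h a < \<infinity>"
  unfolding J_def Bint_def using hball_subset_disk[of a]
  by (elim le_less_trans[rotated], intro nn_integral_mono) (auto simp: indicator_def)

lemma H_powr:
  assumes "a \<in> Z" shows "H h a powr p = 4 * Cb / (\<kappa> * (1 - (cmod a)\<^sup>2))\<^sup>2 * enn2real (J h a)"
  using p Cb by (simp add: H_def powr_powr)

lemma h_le_H:
  assumes h: "h holomorphic_on unit_disk" "Bint p h < \<infinity>" and a: "a \<in> Z" and z: "z \<in> hball (\<kappa> / 2) a"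
  shows "cmod (h z) \<le> H h a"
proof -
  define r where "r = \<kappa> * (1 - (cmod a)\<^sup>2) / 2"
  have r: "r > 0" using kappa(1) one_minus_sq_pos[OF Z_cmod[OF a]] by (simp add: r_def)
  have sub: "ball z r \<subseteq> hball \<kappa> a"
  proof
    fix w assume w: "w \<in> ball z r"
    have "dist a z < r" using z by (simp add: hball_def r_def)
    then have "dist a w < r + r" using w dist_triangle[of a w z] by simp
    then show "w \<in> hball \<kappa> a" by (simp add: hball_def r_def)
  qed
  have "ennreal (cmod (h z) powr p) \<le> ennreal (Cb / r\<^sup>2) * (\<integral>\<^sup>+w\<in>ball z r. ennreal (cmod (h w) powr p) \<partial>lborel)"
    by (rule local_bound[OF h(1) r]) (use sub hball_subset_disk[OF a] in blast)
  also have "\<dots> \<le> ennreal (Cb / r\<^sup>2) * J h a"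
    unfolding J_def using sub by (intro mult_left_mono nn_integral_mono) (auto simp: indicator_def)
  also have "\<dots> = ennreal (Cb / r\<^sup>2 * enn2real (J h a))"
    using J_fin[OF h(2) a] Cb by (subst ennreal_mult) auto
  finally have "cmod (h z) powr p \<le> Cb / r\<^sup>2 * enn2real (J h a)"
    using Cb by (subst (asm) ennreal_le_iff) auto
  also have "\<dots> = H h a powr p" unfolding H_powr[OF a] by (simp add: r_def power_divide)
  finally have le: "cmod (h z) powr p \<le> H h a powr p" .
  show ?thesis
  proof (rule ccontr)
    assume "\<not> cmod (h z) \<le> H h a"
    then have "H h a powr p < cmod (h z) powr p"
      using p by (intro powr_less_mono2) (auto simp: H_def)
    with le show False by simp
  qed
qed

text \<open>Numerator and denominator both vanish to first order: v and h agree at a, so their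
  difference at z is O(\<open>pseudo_hyp z a\<close>), which matches the lower bound for \<Psi>. At
  z = a itself u is 0, being a quotient by 0.\<close>

lemma u_inner:
  assumes h: "h holomorphic_on unit_disk" "Bint p h < \<infinity>" "\<forall>a\<in>Z. h a = v a"
    and a: "a \<in> Z" and z: "z \<in> hball (\<kappa> / 4) a" and fin: "T z < \<infinity>"
  shows "cmod (u h z) * exp (kZ Z z) \<le> A * (t z + H h a)"
proof (cases "z = a")
  case True
  then show ?thesis using A_pos t_nonneg by (simp add: u_def Psi_zero[OF a] H_def)
next
  case False
  have ca: "cmod a < 1" by (rule Z_cmod[OF a])
  have zk: "z \<in> hball \<kappa> a" using z hball_mono[OF a, of "\<kappa>/4"] kappa by auto
  note hz = hball_props[OF kappa ca zk]
  define s where "s = pseudo_hyp z a"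
  have s: "s > 0" using False cmod_one_minus_ge(6)[OF hz(1) ca] by (simp add: pseudo_hyp_eq s_def)
  have n: "1 - (cmod a)\<^sup>2 > 0" by (rule one_minus_sq_pos[OF ca])
  \<comment> \<open>On this disc h is bounded by \<open>H h a\<close>; the point z lies in the disc
    of half that radius, as \<open>holomorphic_lipschitz\<close> requires.\<close>
  define R where "R = \<kappa> * (1 - (cmod a)\<^sup>2) / 2"
  have R: "R > 0" using n kappa by (simp add: R_def)
  have bR: "ball a R = hball (\<kappa> / 2) a" by (simp add: hball_def R_def)
  have "h holomorphic_on ball a R" unfolding bR
    using hball_mono[OF a, of "\<kappa>/2"] hball_subset_disk[OF a] kappa by (intro holomorphic_on_subset[OF h(1)]) auto
  then have "cmod (h z - h a) \<le> 4 * H h a / R * cmod (z - a)"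
    by (rule holomorphic_lipschitz[OF _ R]) (use z in \<open>auto simp: bR hball_def R_def intro!: h_le_H[OF h(1,2) a]\<close>)
  also have "\<dots> \<le> 4 * H h a / R * (5/4 * (1 - (cmod a)\<^sup>2) * s)"
    using hz(5) R by (intro mult_left_mono) (auto simp: s_def H_def)
  also have "\<dots> = 10 / \<kappa> * H h a * s" using n kappa by (simp add: R_def field_simps)
  finally have hh: "cmod (h z - h a) \<le> 10 / \<kappa> * H h a * s" .
  have H0: "H h a \<ge> 0" by (simp add: H_def)
  have "cmod (v z - h z) \<le> cmod (v z - v a) + cmod (h z - h a)"
    using norm_triangle_ineq4[of "v z - v a" "h z - h a"] h(3) a by simp
  also have "\<dots> \<le> 30 * s * t z + 10 / \<kappa> * H h a * s"
    using v_center(3)[OF a zk fin] hh by (simp add: s_def)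
  also have "\<dots> \<le> 30 / \<kappa> * s * (t z + H h a)"
  proof -
    have "30 * (s * t z) \<le> 30 / \<kappa> * (s * t z)"
      using kappa s t_nonneg[of z] by (intro mult_right_mono) (auto simp: field_simps)
    moreover have "10 / \<kappa> * (H h a * s) \<le> 30 / \<kappa> * (H h a * s)"
      using kappa s H0 by (intro mult_right_mono divide_right_mono) auto
    ultimately show ?thesis by (simp add: algebra_simps)
  qed
  finally have num: "cmod (v z - h z) \<le> 30 / \<kappa> * s * (t z + H h a)" .
  have den: "lowc * s * exp (kZ Z z) \<le> cmod (\<Psi> z)" using Psi_ge'[OF a zk] by (simp add: s_def)
  have pos: "lowc * s * exp (kZ Z z) > 0" using lowc_pos s by simp
  have "cmod (u h z) * exp (kZ Z z) = cmod (v z - h z) * exp (kZ Z z) / cmod (\<Psi> z)"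
    using hz(1) by (simp add: u_def norm_divide)
  also have "\<dots> \<le> (30 / \<kappa> * s * (t z + H h a)) * exp (kZ Z z) / (lowc * s * exp (kZ Z z))"
    using num den pos s t_nonneg[of z] H0 kappa by (intro frac_le mult_right_mono mult_nonneg_nonneg) auto
  also have "\<dots> = A * (t z + H h a)" using s lowc_pos kappa by (simp add: A_def field_simps)
  finally show ?thesis .
qed

text \<open>Away from the quarter-size discs the pseudo-hyperbolic distance to the relevant point is
  at least \<kappa>/8, so \<Psi> is comparable to its weight and v and h may be estimated
  separately.\<close>

lemma u_outer:
  assumes z: "cmod z < 1" "\<forall>a\<in>Z. z \<notin> hball (\<kappa> / 4) a" and fin: "T z < \<infinity>"
  shows "cmod (u h z) * exp (kZ Z z) \<le> A * (t z + cmod (h z))"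
proof -
  have den: "lowc * (\<kappa> / 8) * exp (kZ Z z) \<le> cmod (\<Psi> z)"
  proof (cases "\<forall>b\<in>Z. z \<notin> hball \<kappa> b")
    case True
    have "lowc * (\<kappa> / 8) * exp (kZ Z z) \<le> lowc * 1 * exp (kZ Z z)"
      using lowc_pos kappa by (intro mult_right_mono mult_left_mono) auto
    also have "\<dots> \<le> cmod (\<Psi> z)" using Psi_ge[OF z(1) True] by simp
    finally show ?thesis .
  next
    case False
    then obtain a where a: "a \<in> Z" "z \<in> hball \<kappa> a" by auto
    have "\<kappa> / 4 / 2 \<le> pseudo_hyp z a"
      by (rule pseudo_hyp_ge_off_hball) (use kappa Z_cmod[OF a(1)] z a in auto)
    then have "lowc * (\<kappa> / 8) * exp (kZ Z z) \<le> lowc * pseudo_hyp z a * exp (kZ Z z)"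
      using lowc_pos by (intro mult_right_mono mult_left_mono) auto
    also have "\<dots> \<le> cmod (\<Psi> z)" by (rule Psi_ge'[OF a])
    finally show ?thesis .
  qed
  have num: "cmod (v z - h z) \<le> t z + cmod (h z)"
    using norm_triangle_ineq4[of "v z" "h z"] integrable_v(2)[OF fin] by linarith
  have pos: "lowc * (\<kappa> / 8) * exp (kZ Z z) > 0" using lowc_pos kappa by simp
  have "cmod (u h z) * exp (kZ Z z) = cmod (v z - h z) * exp (kZ Z z) / cmod (\<Psi> z)"
    using z(1) by (simp add: u_def norm_divide)
  also have "\<dots> \<le> (t z + cmod (h z)) * exp (kZ Z z) / (lowc * (\<kappa> / 8) * exp (kZ Z z))"
    using num den pos t_nonneg[of z] by (intro frac_le mult_right_mono mult_nonneg_nonneg) auto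
  also have "\<dots> = 8 / (lowc * \<kappa>) * (t z + cmod (h z))" using lowc_pos kappa by (simp add: field_simps)
  also have "\<dots> \<le> A * (t z + cmod (h z))"
    unfolding A_def using lowc_pos kappa t_nonneg[of z] by (intro mult_right_mono divide_right_mono) auto
  finally show ?thesis .
qed

definition B :: real where "B = A powr p * 4 powr p"

lemma B_pos: "B > 0" using A_pos by (simp add: B_def)

lemma powr_add3_le:
  assumes "x \<ge> 0" "y \<ge> 0" "z \<ge> 0" "s \<le> A * (x + y + z)" "s \<ge> 0"
  shows "s powr p \<le> B * (x powr p + y powr p + z powr p)"
proof -
  have "(x + (y + z)) powr p \<le> 2 powr p * (x powr p + (y + z) powr p)"
    by (rule powr_add_le) (use assms p in auto)
  also have "\<dots> \<le> 2 powr p * (2 powr p * x powr p + 2 powr p * (y powr p + z powr p))"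
  proof (intro mult_left_mono add_mono)
    show "x powr p \<le> 2 powr p * x powr p"
      using mult_right_mono[of 1 "2 powr p" "x powr p"] p by (simp add: ge_one_powr_ge_zero)
    show "(y + z) powr p \<le> 2 powr p * (y powr p + z powr p)" by (rule powr_add_le) (use assms p in auto)
  qed simp
  also have "\<dots> = 4 powr p * (x powr p + y powr p + z powr p)"
    using powr_mult[of 2 2 p] by (simp add: algebra_simps)
  finally have 1: "(x + (y + z)) powr p \<le> 4 powr p * (x powr p + y powr p + z powr p)" .
  have "s powr p \<le> (A * (x + (y + z))) powr p" using assms p by (intro powr_mono2) (auto simp: add.assoc)
  also have "\<dots> = A powr p * (x + (y + z)) powr p" using A_pos assms by (simp add: powr_mult)
  also have "\<dots> \<le> A powr p * (4 powr p * (x powr p + y powr p + z powr p))" by (rule mult_left_mono[OF 1]) simp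
  finally show ?thesis by (simp add: B_def)
qed

text \<open>\<open>H h a\<close> is constant on the disc of a, and its p-th power times the area of
  the disc is a multiple of the integral of \<open>\<bar>h\<bar> powr p\<close> over that disc; thus
  all inner bounds sum to \<open>Bint p h\<close>. The factor 2 arises because the union of the
  discs and the rest of the disk are each estimated by the integral of \<open>W\<close> over the
  whole disk.\<close>

lemma LpZ_int_u:
  assumes h: "h holomorphic_on unit_disk" "Bint p h < \<infinity>" "\<forall>a\<in>Z. h a = v a"
  shows "LpZ_int p Z (u h) \<le> ennreal (2 * B) * (ennreal (Cs * I) + ennreal (1 + 4 * pi * Cb) * Bint p h)"
proof -
  define G where "G = (\<lambda>z. ennreal ((cmod (u h z) * exp (if z \<in> unit_disk then kZ Z z else 0)) powr p))"
  have [measurable]: "u h \<in> borel_measurable borel" by (rule u_measurable[OF h(1)])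
  have G[measurable]: "G \<in> borel_measurable borel" unfolding G_def using kZ_measurable by measurable
  define hh where "hh = (\<lambda>z. ennreal (cmod (h z) powr p) * indicator unit_disk z)"
  have hm[measurable]: "hh \<in> borel_measurable borel" unfolding hh_def by (rule bergman_measurable[OF h(1)])
  define W where "W = (\<lambda>z. ennreal B * (ennreal (t z powr p) + ennreal (1 + 4 * pi * Cb) * hh z))"
  have W[measurable]: "W \<in> borel_measurable borel" unfolding W_def by measurable
  have hb[measurable]: "hball \<kappa> a \<in> sets borel" for a by (simp add: hball_def)
  let ?U = "\<Union>a\<in>Z. hball \<kappa> a"
  have U[measurable]: "?U \<in> sets borel" by (intro sets.countable_UN'' Z_countable) simp
  have one: "(\<integral>\<^sup>+z\<in>hball \<kappa> a. G z \<partial>lborel) \<le> (\<integral>\<^sup>+z\<in>hball \<kappa> a. W z \<partial>lborel)"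
    if a: "a \<in> Z" for a
  proof -
    have "(\<integral>\<^sup>+z\<in>hball \<kappa> a. G z \<partial>lborel) \<le>
      (\<integral>\<^sup>+z. ennreal B * ((ennreal (t z powr p) + hh z) * indicator (hball \<kappa> a) z + ennreal (H h a powr p) * indicator (hball \<kappa> a) z) \<partial>lborel)"
      using T_AE
    proof (intro nn_integral_mono_AE, eventually_elim)
      case (elim z)
      show ?case
      proof (cases "z \<in> hball \<kappa> a")
        case True
        have z: "cmod z < 1" by (rule hball_props(1)[OF kappa Z_cmod[OF a] True])
        then have fin: "T z < \<infinity>" using elim by simp
        have "cmod (u h z) * exp (kZ Z z) \<le> A * (t z + cmod (h z) + H h a)"
        proof (cases "z \<in> hball (\<kappa> / 4) a")
          case True
          have "A * (t z + H h a) \<le> A * (t z + cmod (h z) + H h a)" using A_pos by simp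
          then show ?thesis using u_inner[OF h a True fin] by linarith
        next
          case False
          have "\<forall>b\<in>Z. z \<notin> hball (\<kappa> / 4) b"
          proof
            fix b assume b: "b \<in> Z"
            show "z \<notin> hball (\<kappa> / 4) b"
            proof (cases "b = a")
              case True then show ?thesis using False by simp
            next
              case False
              then show ?thesis using disjoint[OF b a False] \<open>z \<in> hball \<kappa> a\<close> hball_mono[OF b, of "\<kappa>/4"] kappa by auto
            qed
          qed
          from u_outer[OF z this fin] have "cmod (u h z) * exp (kZ Z z) \<le> A * (t z + cmod (h z))" .
          also have "\<dots> \<le> A * (t z + cmod (h z) + H h a)" using A_pos by (simp add: H_def)
          finally show ?thesis .
        qed
        then have "(cmod (u h z) * exp (kZ Z z)) powr p \<le> B * (t z powr p + cmod (h z) powr p + H h a powr p)"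
          by (intro powr_add3_le) (auto simp: t_nonneg H_def)
        then have "G z \<le> ennreal (B * (t z powr p + cmod (h z) powr p + H h a powr p))"
          using z unfolding G_def by (auto intro: ennreal_leI)
        also have "\<dots> = ennreal B * (ennreal (t z powr p) + hh z + ennreal (H h a powr p))"
          using z B_pos by (simp add: hh_def ennreal_mult)
        finally show ?thesis using True by simp
      qed simp
    qed
    also have "\<dots> = ennreal B * ((\<integral>\<^sup>+z\<in>hball \<kappa> a. (ennreal (t z powr p) + hh z) \<partial>lborel)
        + ennreal (H h a powr p) * emeasure lborel (hball \<kappa> a))"
      by (subst nn_integral_cmult, measurable, subst nn_integral_add, measurable, subst nn_integral_cmult_indicator, simp, simp)
    \<comment> \<open>The area \<open>pi * \<kappa>^2 * (1 - \<bar>a\<bar>^2)^2\<close> cancels the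
      squared radius in \<open>H h a powr p\<close>, leaving the constant
      \<open>4 * pi * Cb\<close>.\<close>
    also have "ennreal (H h a powr p) * emeasure lborel (hball \<kappa> a) = ennreal (4 * pi * Cb) * J h a"
    proof -
      have n: "1 - (cmod a)\<^sup>2 > 0" by (rule one_minus_sq_pos[OF Z_cmod[OF a]])
      have "H h a powr p * (pi * \<kappa>\<^sup>2 * (1 - (cmod a)\<^sup>2)\<^sup>2) = 4 * pi * Cb * enn2real (J h a)"
        unfolding H_powr[OF a] power_mult_distrib using n kappa by (simp add: field_simps)
      then have "ennreal (H h a powr p) * emeasure lborel (hball \<kappa> a) = ennreal (4 * pi * Cb * enn2real (J h a))"
        unfolding emeasure_hball[OF a] by (subst ennreal_mult[symmetric], simp, simp) (simp only:)
      also have "\<dots> = ennreal (4 * pi * Cb) * ennreal (enn2real (J h a))"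
        using Cb by (intro ennreal_mult) auto
      finally show ?thesis using J_fin[OF h(2) a] by simp
    qed
    also have "J h a = (\<integral>\<^sup>+z\<in>hball \<kappa> a. hh z \<partial>lborel)"
      unfolding J_def hh_def using hball_subset_disk[OF a] by (intro nn_integral_cong) (auto simp: indicator_def)
    also have "ennreal (4 * pi * Cb) * \<dots> = (\<integral>\<^sup>+z. ennreal (4 * pi * Cb) * (hh z * indicator (hball \<kappa> a) z) \<partial>lborel)"
      by (rule nn_integral_cmult[symmetric]) measurable
    also have "(\<integral>\<^sup>+z\<in>hball \<kappa> a. (ennreal (t z powr p) + hh z) \<partial>lborel) + \<dots> =
       (\<integral>\<^sup>+z. (ennreal (t z powr p) + hh z) * indicator (hball \<kappa> a) z + ennreal (4 * pi * Cb) * (hh z * indicator (hball \<kappa> a) z) \<partial>lborel)"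
      by (rule nn_integral_add[symmetric]) measurable
    also have "ennreal B * \<dots> = (\<integral>\<^sup>+z. ennreal B * ((ennreal (t z powr p) + hh z) * indicator (hball \<kappa> a) z + ennreal (4 * pi * Cb) * (hh z * indicator (hball \<kappa> a) z)) \<partial>lborel)"
      by (rule nn_integral_cmult[symmetric]) measurable
    also have "\<dots> = (\<integral>\<^sup>+z\<in>hball \<kappa> a. W z \<partial>lborel)"
    proof (intro nn_integral_cong)
      fix z
      have "ennreal (1 + 4 * pi * Cb) = 1 + ennreal (4 * pi * Cb)" using Cb by simp
      then show "ennreal B * ((ennreal (t z powr p) + hh z) * indicator (hball \<kappa> a) z + ennreal (4 * pi * Cb) * (hh z * indicator (hball \<kappa> a) z))
         = W z * indicator (hball \<kappa> a) z"
        unfolding W_def by (simp add: indicator_def distrib_right add.assoc)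
    qed
    finally show ?thesis .
  qed
  have "LpZ_int p Z (u h) = (\<integral>\<^sup>+z\<in>unit_disk. G z \<partial>lborel)"
    unfolding LpZ_int_eq G_def by (intro nn_integral_cong) (auto simp: indicator_def)
  also have "\<dots> \<le> (\<integral>\<^sup>+z. G z * indicator ?U z + W z * indicator unit_disk z \<partial>lborel)"
    using T_AE
  proof (intro nn_integral_mono_AE, eventually_elim)
    case (elim z)
    show ?case
    proof (cases "z \<in> unit_disk \<and> z \<notin> ?U")
      case True
      then have z: "cmod z < 1" and fin: "T z < \<infinity>" using elim by auto
      have "\<forall>b\<in>Z. z \<notin> hball (\<kappa> / 4) b"
        using True hball_mono[of _ "\<kappa>/4"] kappa by auto
      from u_outer[OF z this fin, of h] have "(cmod (u h z) * exp (kZ Z z)) powr p \<le> B * (t z powr p + cmod (h z) powr p + 0 powr p)"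
        by (intro powr_add3_le) (auto simp: t_nonneg)
      then have "G z \<le> ennreal (B * (t z powr p + cmod (h z) powr p))"
        using z unfolding G_def by (auto intro: ennreal_leI)
      also have "\<dots> = ennreal B * (ennreal (t z powr p) + 1 * hh z)"
        using z B_pos by (simp add: hh_def ennreal_mult)
      also have "\<dots> \<le> W z"
        unfolding W_def using Cb by (intro mult_left_mono add_left_mono mult_right_mono) auto
      finally show ?thesis using True by (simp add: add_increasing)
    next
      case False
      then show ?thesis by (auto simp: indicator_def)
    qed
  qed
  also have "\<dots> = (\<integral>\<^sup>+z\<in>?U. G z \<partial>lborel) + (\<integral>\<^sup>+z\<in>unit_disk. W z \<partial>lborel)"
    by (rule nn_integral_add) measurable
  finally have u_le: "LpZ_int p Z (u h) \<le> (\<integral>\<^sup>+z\<in>?U. G z \<partial>lborel) + (\<integral>\<^sup>+z\<in>unit_disk. W z \<partial>lborel)" .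
  have U_le: "(\<integral>\<^sup>+z\<in>?U. G z \<partial>lborel) \<le> (\<integral>\<^sup>+z\<in>unit_disk. W z \<partial>lborel)"
  proof (rule nn_integral_Union_hball_le[OF G])
    fix S assume S: "finite S" "S \<subseteq> Z"
    have "(\<Sum>a\<in>S. (\<integral>\<^sup>+z\<in>hball \<kappa> a. G z \<partial>lborel)) \<le> (\<Sum>a\<in>S. (\<integral>\<^sup>+z\<in>hball \<kappa> a. W z \<partial>lborel))"
      using S by (intro sum_mono one) auto
    also have "\<dots> \<le> (\<integral>\<^sup>+z\<in>unit_disk. W z \<partial>lborel)" by (rule sum_nn_integral_hball_le[OF S W])
    finally show "(\<Sum>a\<in>S. (\<integral>\<^sup>+z\<in>hball \<kappa> a. G z \<partial>lborel)) \<le> (\<integral>\<^sup>+z\<in>unit_disk. W z \<partial>lborel)" .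
  qed
  have "(\<integral>\<^sup>+z\<in>unit_disk. W z \<partial>lborel) = ennreal B * ((\<integral>\<^sup>+z\<in>unit_disk. ennreal (t z powr p) \<partial>lborel)
       + ennreal (1 + 4 * pi * Cb) * Bint p h)"
  proof -
    have "(\<integral>\<^sup>+z\<in>unit_disk. W z \<partial>lborel) =
      (\<integral>\<^sup>+z. ennreal B * (ennreal (t z powr p) * indicator unit_disk z + ennreal (1 + 4 * pi * Cb) * hh z) \<partial>lborel)"
      unfolding W_def hh_def by (intro nn_integral_cong) (auto simp: indicator_def)
    also have "\<dots> = ennreal B * ((\<integral>\<^sup>+z\<in>unit_disk. ennreal (t z powr p) \<partial>lborel)
       + ennreal (1 + 4 * pi * Cb) * (\<integral>\<^sup>+z. hh z \<partial>lborel))"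
      by (subst nn_integral_cmult, measurable, subst nn_integral_add, measurable, subst nn_integral_cmult, measurable)
    finally show ?thesis by (simp add: hh_def Bint_def)
  qed
  also have "\<dots> \<le> ennreal B * (ennreal (Cs * I) + ennreal (1 + 4 * pi * Cb) * Bint p h)"
    by (intro mult_left_mono add_right_mono t_bound) simp
  finally have W_le: "(\<integral>\<^sup>+z\<in>unit_disk. W z \<partial>lborel) \<le>
      ennreal B * (ennreal (Cs * I) + ennreal (1 + 4 * pi * Cb) * Bint p h)" .
  have "LpZ_int p Z (u h) \<le> ennreal B * (ennreal (Cs * I) + ennreal (1 + 4 * pi * Cb) * Bint p h)
     + ennreal B * (ennreal (Cs * I) + ennreal (1 + 4 * pi * Cb) * Bint p h)"
    by (rule order_trans[OF u_le add_mono[OF order_trans[OF U_le W_le] W_le]])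
  also have "\<dots> = ennreal (2 * B) * (ennreal (Cs * I) + ennreal (1 + 4 * pi * Cb) * Bint p h)"
  proof -
    have "ennreal (2 * B) = ennreal B + ennreal B" using B_pos by (simp add: ennreal_plus[symmetric] del: ennreal_plus)
    then show ?thesis by (simp add: distrib_right)
  qed
  finally show ?thesis .
qed

end

section \<open>Distributional solution\<close>

lemma smooth_on_extend:
  assumes s: "smooth_on unit_disk Y" and R: "R < 1" and out: "\<And>z. z \<notin> cball 0 R \<Longrightarrow> Y z = 0"
  shows "smooth_on UNIV Y"
proof -
  have o: "open (- cball (0::complex) R)" by (intro open_Compl closed_cball)
  have "smooth_on (- cball 0 R) Y"
    by (rule smooth_on_cong[OF o smooth_on_const[OF o, of 0]]) (use out in auto)
  with s have "smooth_on (unit_disk \<union> - cball 0 R) Y" by (rule smooth_on_Un)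
  moreover have "unit_disk \<union> - cball (0::complex) R = UNIV" using R by auto
  ultimately show ?thesis by simp
qed

lemma dbar_eq_0_outside:
  assumes out: "\<And>z. z \<notin> cball c r \<Longrightarrow> X z = 0" and z: "z \<notin> cball c r"
  shows "dbar X z = 0"
proof -
  have "dbar X z = dbar (\<lambda>_. 0) z"
    by (rule dbar_cong_open[of "- cball c r"]) (use z out in \<open>auto intro!: open_Compl\<close>)
  then show ?thesis by (simp add: dbar_const)
qed

lemma smooth_compact_mult_holomorphic:
  assumes X: "smooth_on UNIV X" and R: "R < 1" and out: "\<And>z. z \<notin> cball 0 R \<Longrightarrow> X z = 0"
    and q: "q holomorphic_on unit_disk"
  shows "smooth_on UNIV (\<lambda>z. X z * q z)" "\<And>z. dbar (\<lambda>z. X z * q z) z = dbar X z * q z"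
proof -
  have o: "open (unit_disk)" by simp
  show s: "smooth_on UNIV (\<lambda>z. X z * q z)"
    by (rule smooth_on_extend[OF _ R], rule smooth_on_mult[OF o smooth_on_subset[OF X] smooth_on_holomorphic[OF o q]])
       (simp_all add: out)
  fix z
  show "dbar (\<lambda>z. X z * q z) z = dbar X z * q z"
  proof (cases "z \<in> unit_disk")
    case True
    then obtain d where d: "(q has_field_derivative d) (at z)"
      using q by (meson holomorphic_derivI o)
    show ?thesis
      by (subst dbar_mult[OF smooth_on_differentiable[OF X] field_differentiable_imp_differentiable])
         (use d dbar_holomorphic[OF d] in \<open>auto simp: field_differentiable_def\<close>)
  next
    case False
    then have z: "z \<notin> cball 0 R" using R by auto
    have "dbar (\<lambda>z. X z * q z) z = 0" by (rule dbar_eq_0_outside[OF _ z]) (simp add: out)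
    moreover have "dbar X z = 0" by (rule dbar_eq_0_outside[OF _ z]) (simp add: out)
    ultimately show ?thesis by simp
  qed
qed

text \<open>All factors lie between 0 and 1, so the product rule costs nothing beyond the sum of the
  individual derivatives.\<close>

lemma dbar_prod_bound:
  assumes fin: "finite S" and r: "r > 0"
  shows "smooth_on UNIV (\<lambda>z. of_real (\<Prod>a\<in>S. rstep a r z)) \<and>
    (\<forall>z. cmod (dbar (\<lambda>z. of_real (\<Prod>a\<in>S. rstep a r z)) z) \<le> (\<Sum>a\<in>S. cmod (dbar (\<lambda>z. of_real (rstep a r z)) z)))"
  using fin
proof (induction S rule: finite_induct)
  case empty
  show ?case by (simp add: smooth_on_const dbar_const)
next
  case (insert b S)
  let ?P = "\<lambda>z. complex_of_real (\<Prod>a\<in>S. rstep a r z)" and ?b = "\<lambda>z. complex_of_real (rstep b r z)"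
  have eq: "(\<lambda>z. complex_of_real (\<Prod>a\<in>insert b S. rstep a r z)) = (\<lambda>z. ?b z * ?P z)"
    by (rule ext) (simp add: insert.hyps)
  have P: "smooth_on UNIV ?P" by (rule conjunct1[OF insert.IH])
  have b: "smooth_on UNIV ?b" by (rule smooth_on_rstep[OF r])
  have Pd: "cmod (dbar ?P z) \<le> (\<Sum>a\<in>S. cmod (dbar (\<lambda>z. of_real (rstep a r z)) z))" for z
    by (rule spec[OF conjunct2[OF insert.IH]])
  show ?case unfolding eq
  proof (intro conjI allI)
    show "smooth_on UNIV (\<lambda>z. ?b z * ?P z)" by (rule smooth_on_mult[OF open_UNIV b P])
    fix z
    have "dbar (\<lambda>z. ?b z * ?P z) z = dbar ?b z * ?P z + ?b z * dbar ?P z"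
      by (rule dbar_mult; rule smooth_on_differentiable) (use P b in auto)
    then have "cmod (dbar (\<lambda>z. ?b z * ?P z) z) \<le> cmod (dbar ?b z) * cmod (?P z) + cmod (?b z) * cmod (dbar ?P z)"
      unfolding norm_mult[symmetric] by (simp only: norm_triangle_ineq)
    also have "\<dots> \<le> cmod (dbar ?b z) * 1 + 1 * cmod (dbar ?P z)"
    proof (intro add_mono mult_left_mono mult_right_mono)
      show "cmod (?P z) \<le> 1" unfolding norm_of_real
        by (simp add: abs_prod rstep_bounds prod_le_1)
      show "cmod (?b z) \<le> 1" using rstep_bounds[of b r z] by simp
    qed auto
    also have "\<dots> \<le> (\<Sum>a\<in>insert b S. cmod (dbar (\<lambda>z. of_real (rstep a r z)) z))"
      using Pd[of z] insert.hyps by simp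
    finally show "cmod (dbar (\<lambda>z. ?b z * ?P z) z) \<le> (\<Sum>a\<in>insert b S. cmod (dbar (\<lambda>z. of_real (rstep a r z)) z))" .
  qed
qed

lemma dbar_rstep_le:
  obtains B0 where "B0 > 0" "\<And>a r z. r > 0 \<Longrightarrow> cmod (dbar (\<lambda>z. of_real (rstep a r z)) z) \<le> B0 / r * indicator (ball a r) z"
proof -
  obtain B0 where B0: "B0 > 0" "\<forall>w r z. moll w r z \<le> B0 / r\<^sup>2" using moll_bounded by auto
  show thesis
  proof (rule that[OF B0(1)])
    fix a z :: complex and r :: real assume r: "r > 0"
    show "cmod (dbar (\<lambda>z. of_real (rstep a r z)) z) \<le> B0 / r * indicator (ball a r) z"
    proof (cases "z \<in> ball a r")
      case True
      then have "cmod (z - a) \<le> r" by (simp add: dist_norm norm_minus_commute)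
      then have "moll a r z * cmod (z - a) \<le> B0 / r\<^sup>2 * r"
        using B0 moll_nonneg by (intro mult_mono) auto
      then show ?thesis using True r moll_nonneg[of a r z]
        by (simp add: dbar_rstep_moll norm_mult power2_eq_square)
    next
      case False
      then have "cmod (z - a) \<ge> r" by (simp add: dist_norm norm_minus_commute)
      then show ?thesis using False r by (simp add: dbar_rstep_moll moll_eq_0)
    qed
  qed
qed

text \<open>Of order r uniformly in w: the part within r of w gives at most 2 * pi * r, and on the
  rest the integrand is at most 1/r while the area is pi * r^2.\<close>

lemma nn_integral_inverse_dist_ball_le:
  assumes r: "r > 0"
  shows "(\<integral>\<^sup>+z\<in>ball a r. ennreal (1 / cmod (z - w)) \<partial>lborel) \<le> ennreal (3 * pi * r)"
proof -
  have [measurable]: "ball a r \<in> sets borel" "cball w r \<in> sets borel" by simp_all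
  have "(\<integral>\<^sup>+z\<in>ball a r. ennreal (1 / cmod (z - w)) \<partial>lborel) \<le>
    (\<integral>\<^sup>+z. ennreal (1 / cmod (z - w)) * indicator (cball w r) z + ennreal (1 / r) * indicator (ball a r) z \<partial>lborel)"
  proof (rule nn_integral_mono)
    fix z
    show "ennreal (1 / cmod (z - w)) * indicator (ball a r) z \<le>
       ennreal (1 / cmod (z - w)) * indicator (cball w r) z + ennreal (1 / r) * indicator (ball a r) z"
    proof (cases "z \<in> cball w r")
      case False
      then have "1 / cmod (z - w) \<le> 1 / r" using r
        by (intro divide_left_mono) (auto simp: dist_norm norm_minus_commute intro!: mult_pos_pos)
      then show ?thesis using False by (auto simp: indicator_def intro!: ennreal_leI)
    qed (auto simp: indicator_def)
  qed
  also have "\<dots> = ennreal (2 * pi * r) + ennreal (1 / r) * emeasure lborel (ball a r)"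
    using r by (subst nn_integral_add, measurable, simp add: nn_integral_inverse_dist nn_integral_cmult_indicator)
  also have "emeasure lborel (ball a r) = ennreal (pi * r\<^sup>2)"
    using r by (simp add: emeasure_ball unit_ball_vol_2)
  also have "ennreal (2 * pi * r) + ennreal (1 / r) * ennreal (pi * r\<^sup>2) = ennreal (3 * pi * r)"
  proof -
    have "1 / r * (pi * r\<^sup>2) = pi * r" using r by (simp add: power2_eq_square)
    then have "ennreal (1 / r) * ennreal (pi * r\<^sup>2) = ennreal (pi * r)" using r by (simp add: ennreal_mult[symmetric])
    moreover have "ennreal (2 * pi * r) + ennreal (pi * r) = ennreal (2 * pi * r + pi * r)"
      using r by (intro ennreal_plus[symmetric]) auto
    moreover have "2 * pi * r + pi * r = 3 * pi * r" by simp
    ultimately show ?thesis by (simp only:)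
  qed
  finally show ?thesis .
qed

context dbar_data
begin

lemma ker_le_inverse_dist:
  assumes z: "cmod z \<le> R" and R: "R < 1" and w: "cmod w < 1"
  shows "ker z w \<le> 1 / (1 - R) ^ 3 * (1 / cmod (z - w))"
proof -
  have z1: "cmod z < 1" using z R by simp
  have D: "(1 - R) ^ 3 \<le> cmod (1 - cnj w * z) ^ 3"
    using cmod_one_minus_ge(1)[OF z1 w] z R by (intro power_mono) auto
  have n: "(1 - (cmod w)\<^sup>2)\<^sup>2 \<le> 1" using one_minus_sq_pos[OF w] by (intro power_le_one) auto
  have "ker z w = (1 - (cmod w)\<^sup>2)\<^sup>2 * (1 / pi) * (1 / cmod (1 - cnj w * z) ^ 3) * (1 / cmod (z - w))"
    by (simp add: ker_def)
  also have "\<dots> \<le> 1 * 1 * (1 / (1 - R) ^ 3) * (1 / cmod (z - w))"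
    using n D R pi_gt3 by (intro mult_right_mono mult_mono divide_left_mono mult_pos_pos) auto
  finally show ?thesis by simp
qed

text \<open>Fubini moves the test function under the kernel. For fixed w the inner integral is the
  Cauchy-Pompeiu formula for X times the holomorphic part of \<open>cker\<close>, evaluated at
  w.\<close>

lemma integral_v_dbar:
  assumes X: "smooth_on UNIV X" and R: "0 < R" "R < 1" and out: "\<And>z. z \<notin> cball 0 R \<Longrightarrow> X z = 0"
  shows "integrable lborel (\<lambda>z. v z * dbar X z)"
    "(\<integral>z. v z * dbar X z \<partial>lborel) = - (\<integral>w. g w * (X w / of_real (1 - (cmod w)\<^sup>2)) \<partial>lborel)"
proof -
  obtain Bd where Bd: "\<And>z. cmod (dbar X z) \<le> Bd" and dX0: "\<And>z. z \<notin> cball 0 R \<Longrightarrow> dbar X z = 0"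
    and dX[measurable]: "dbar X \<in> borel_measurable borel"
    by (rule smooth_compact_dbar_bounded[OF X, of 0 R], rule out, assumption) (rule that)
  have Bd0: "Bd \<ge> 0" using Bd[of 0] norm_ge_zero order_trans by blast
  have [measurable]: "cball (0::complex) R \<in> sets borel" by simp
  define c where "c = Bd / (1 - R) ^ 3"
  have c: "c \<ge> 0" using Bd0 R by (simp add: c_def)
  let ?k = "\<lambda>z w. cker z w * g w * dbar X z"
  have k[measurable]: "(\<lambda>(z, w). ?k z w) \<in> borel_measurable (lborel \<Otimes>\<^sub>M lborel)" by measurable
  have int: "integrable (lborel \<Otimes>\<^sub>M lborel) (\<lambda>(z, w). ?k z w)"
  proof (rule integrableI_bounded[OF k])
    have "(\<integral>\<^sup>+ x. ennreal (norm (case x of (z, w) \<Rightarrow> ?k z w)) \<partial>(lborel \<Otimes>\<^sub>M lborel)) =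
       (\<integral>\<^sup>+w. \<integral>\<^sup>+z. ennreal (cmod (?k z w)) \<partial>lborel \<partial>lborel)"
      by (subst lborel_pair.nn_integral_snd[symmetric]) auto
    also have "\<dots> \<le> (\<integral>\<^sup>+w. ennreal (c * (2 * pi + pi * R\<^sup>2)) * ennreal (F w) \<partial>lborel)"
    proof (rule nn_integral_mono)
      fix w
      show "(\<integral>\<^sup>+z. ennreal (cmod (?k z w)) \<partial>lborel) \<le> ennreal (c * (2 * pi + pi * R\<^sup>2)) * ennreal (F w)"
      proof (cases "w \<in> unit_disk")
        case True
        have "(\<integral>\<^sup>+z. ennreal (cmod (?k z w)) \<partial>lborel) \<le>
          (\<integral>\<^sup>+z. ennreal (c * F w) * (ennreal (1 / cmod (z - w)) * indicator (cball 0 R) z) \<partial>lborel)"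
        proof (rule nn_integral_mono)
          fix z
          show "ennreal (cmod (?k z w)) \<le> ennreal (c * F w) * (ennreal (1 / cmod (z - w)) * indicator (cball 0 R) z)"
          proof (cases "z \<in> cball 0 R")
            case zR: True
            have "cmod (?k z w) \<le> 1 / (1 - R) ^ 3 * (1 / cmod (z - w)) * F w * Bd"
              unfolding norm_mult norm_cker using zR True R
              by (intro mult_mono ker_le_inverse_dist g_le Bd mult_nonneg_nonneg F_nonneg ker_nonneg) auto
            also have "\<dots> = c * F w * (1 / cmod (z - w))" by (simp add: c_def)
            finally have "ennreal (cmod (?k z w)) \<le> ennreal (c * F w * (1 / cmod (z - w)))" by (rule ennreal_leI)
            also have "\<dots> = ennreal (c * F w) * ennreal (1 / cmod (z - w))"
              using c F_nonneg[of w] by (intro ennreal_mult) auto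
            finally show ?thesis using zR by simp
          qed (simp add: dX0)
        qed
        also have "\<dots> = ennreal (c * F w) * (\<integral>\<^sup>+z\<in>cball 0 R. ennreal (1 / cmod (z - w)) \<partial>lborel)"
          by (rule nn_integral_cmult) measurable
        also have "\<dots> \<le> ennreal (c * F w) * ennreal (2 * pi + pi * R\<^sup>2)"
          using R by (intro mult_left_mono nn_integral_inverse_dist_le) auto
        also have "\<dots> = ennreal (c * F w * (2 * pi + pi * R\<^sup>2))"
          using c F_nonneg[of w] by (intro ennreal_mult[symmetric]) auto
        also have "\<dots> = ennreal (c * (2 * pi + pi * R\<^sup>2)) * ennreal (F w)"
          using c F_nonneg[of w] by (subst ennreal_mult[symmetric]) (auto simp: mult_ac)
        finally show ?thesis .
      qed (simp add: g_0)
    qed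
    also have "\<dots> = ennreal (c * (2 * pi + pi * R\<^sup>2)) * (\<integral>\<^sup>+w. ennreal (F w) \<partial>lborel)"
      by (rule nn_integral_cmult) measurable
    also have "\<dots> < \<infinity>"
      using F_integrable F_nonneg by (simp add: nn_integral_eq_integral ennreal_mult_less_top)
    finally show "(\<integral>\<^sup>+ x. ennreal (norm (case x of (z, w) \<Rightarrow> ?k z w)) \<partial>(lborel \<Otimes>\<^sub>M lborel)) < \<infinity>" .
  qed
  have inner: "(\<integral>w. ?k z w \<partial>lborel) = v z * dbar X z" for z
    unfolding v_def by (rule integral_mult_left_zero)
  have "integrable lborel (\<lambda>z. \<integral>w. ?k z w \<partial>lborel)"
    using lborel_pair.integrable_fst[OF int] by simp
  then show "integrable lborel (\<lambda>z. v z * dbar X z)" unfolding inner .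
  have "(\<integral>z. v z * dbar X z \<partial>lborel) = (\<integral>w. (\<integral>z. ?k z w \<partial>lborel) \<partial>lborel)"
    unfolding inner[symmetric] by (rule lborel_pair.Fubini_integral[OF int, symmetric])
  also have "\<dots> = (\<integral>w. - (g w * (X w / of_real (1 - (cmod w)\<^sup>2))) \<partial>lborel)"
  proof (rule Bochner_Integration.integral_cong[OF refl])
    fix w
    show "(\<integral>z. ?k z w \<partial>lborel) = - (g w * (X w / of_real (1 - (cmod w)\<^sup>2)))"
    proof (cases "w \<in> unit_disk")
      case True
      then have w: "cmod w < 1" by simp
      define q where "q = (\<lambda>z. inverse ((1 - cnj w * z) ^ 3))"
      define n where "n = complex_of_real (1 - (cmod w)\<^sup>2)"
      have n0: "n \<noteq> 0" unfolding n_def by (rule of_real_one_minus_sq_neq_0[OF w])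
      have q: "q holomorphic_on unit_disk"
        unfolding q_def by (intro holomorphic_intros) (use cmod_one_minus_ge(7)[OF _ w] in auto)
      note sm = smooth_compact_mult_holomorphic[OF X R(2) out q]
      have "(\<integral>z. ?k z w \<partial>lborel) = (\<integral>z. (g w * (n\<^sup>2 / of_real pi)) * (dbar (\<lambda>z. X z * q z) z * inverse (z - w)) \<partial>lborel)"
      proof (rule Bochner_Integration.integral_cong[OF refl])
        fix z
        have d: "dbar (\<lambda>z. X z * q z) z = dbar X z * q z" by (rule sm(2))
        have "cker z w = n\<^sup>2 / of_real pi * (q z * inverse (z - w))"
          by (simp add: cker_def q_def n_def divide_inverse del: of_real_diff)
        then show "?k z w = (g w * (n\<^sup>2 / of_real pi)) * (dbar (\<lambda>z. X z * q z) z * inverse (z - w))"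
          unfolding d by simp
      qed
      also have "\<dots> = (g w * (n\<^sup>2 / of_real pi)) * (\<integral>z. dbar (\<lambda>z. X z * q z) z * inverse (z - w) \<partial>lborel)"
        by (rule integral_mult_right_zero)
      also have "(\<integral>z. dbar (\<lambda>z. X z * q z) z * inverse (z - w) \<partial>lborel) = - (of_real pi * (X w * q w))"
        by (rule cauchy_pompeiu(2)[of _ 1]) (use sm(1) R out in auto)
      \<comment> \<open>On the diagonal \<open>1 - cnj w * w\<close> is n, so the factor
        \<open>n^2\<close> of the kernel leaves the required weight 1/n.\<close>
      also have "q w = inverse (n ^ 3)"
      proof -
        have "1 - cnj w * w = n" unfolding n_def
          by (metis complex_norm_square mult.commute of_real_1 of_real_diff)
        then show ?thesis by (simp add: q_def)
      qed
      also have "g w * (n\<^sup>2 / of_real pi) * - (of_real pi * (X w * inverse (n ^ 3))) = - (g w * (X w / n))"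
        using n0 by (simp add: field_simps power2_eq_square power3_eq_cube)
      finally show ?thesis unfolding n_def .
    qed (simp add: g_0)
  qed
  finally show "(\<integral>z. v z * dbar X z \<partial>lborel) = - (\<integral>w. g w * (X w / of_real (1 - (cmod w)\<^sup>2)) \<partial>lborel)"
    by simp
qed

definition cut :: "real \<Rightarrow> real \<Rightarrow> complex \<Rightarrow> real" where
  "cut R r z = (\<Prod>a\<in>{a\<in>Z. cmod a \<le> R}. rstep a r z)"

text \<open>Once a neighbourhood of the poles of \<open>1/\<Psi>\<close> is cut off, division by \<open>\<Psi>\<close> preserves smoothness, and
  the equation for \<open>u\<close> reduces to the one for \<open>v\<close>.\<close>

lemma integral_u_dbar_cut:
  assumes \<Phi>: "smooth_on UNIV \<Phi>" and R: "0 < R" "R < 1" and out: "\<And>z. z \<notin> cball 0 R \<Longrightarrow> \<Phi> z = 0" and r: "r > 0"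
    and h: "h holomorphic_on unit_disk"
  shows "(\<integral>z. u h z * dbar (\<lambda>z. \<Phi> z * of_real (cut R r z)) z \<partial>lborel) =
    - (\<integral>w. f w * (\<Phi> w * of_real (cut R r w) / of_real (1 - (cmod w)\<^sup>2)) \<partial>lborel)"
proof -
  let ?S = "{a\<in>Z. cmod a \<le> R}"
  have fin: "finite ?S" by (rule finite_Z_cball[OF R(2)])
  let ?\<Theta> = "\<lambda>z. \<Phi> z * of_real (cut R r z)"
  have cs: "smooth_on UNIV (\<lambda>z. of_real (cut R r z))"
    unfolding cut_def using dbar_prod_bound[OF fin r] by (rule conjunct1)
  have \<Theta>: "smooth_on UNIV ?\<Theta>" by (rule smooth_on_mult[OF open_UNIV \<Phi> cs])
  \<comment> \<open>Smoothness is checked on three open sets covering the plane: where \<Psi> does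
    not vanish, around the points of \<open>Z\<close> in the support, where the cutoff is 0, and
    outside the support.\<close>
  define X where "X = (\<lambda>z. if z \<in> unit_disk then ?\<Theta> z * inverse (\<Psi> z) else 0)"
  have Xout: "X z = 0" if "z \<notin> cball 0 R" for z using out[OF that] by (simp add: X_def)
  have o1: "open (unit_disk \<inter> \<Psi> -` (- {0}))"
    using holomorphic_on_imp_continuous_on[OF Psi_hol] by (intro continuous_open_preimage) auto
  have s1: "smooth_on (unit_disk \<inter> \<Psi> -` (- {0})) X"
  proof (rule smooth_on_cong[OF o1])
    show "smooth_on (unit_disk \<inter> \<Psi> -` (- {0})) (\<lambda>z. ?\<Theta> z * inverse (\<Psi> z))"
    proof (rule smooth_on_mult[OF o1 smooth_on_subset[OF \<Theta> subset_UNIV] smooth_on_inverse[OF o1 smooth_on_holomorphic[OF o1]]])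
      show "\<Psi> holomorphic_on unit_disk \<inter> \<Psi> -` (- {0})"
        by (rule holomorphic_on_subset[OF Psi_hol]) simp
    qed simp
  qed (simp add: X_def)
  have cut0: "cut R r z = 0" if "z \<in> ball a (r / 2)" "a \<in> ?S" for z a
  proof -
    have "rstep a r z = 0" using that(1) r by (intro rstep_eq_0) (auto simp: dist_norm norm_minus_commute)
    then show ?thesis unfolding cut_def using that(2) by (intro prod_zero fin bexI[of _ a])
  qed
  let ?V = "\<Union>a\<in>?S. ball a (r / 2)"
  have o2: "open ?V" by auto
  have s2: "smooth_on ?V X"
    by (rule smooth_on_cong[OF o2 smooth_on_const[OF o2, of 0]]) (use cut0 in \<open>auto simp: X_def\<close>)
  have o3: "open (- cball (0::complex) R)" by (intro open_Compl closed_cball)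
  have s3: "smooth_on (- cball 0 R) X"
    by (rule smooth_on_cong[OF o3 smooth_on_const[OF o3, of 0]]) (use Xout in auto)
  have "smooth_on ((unit_disk \<inter> \<Psi> -` (- {0}) \<union> ?V) \<union> - cball 0 R) X"
    by (intro smooth_on_Un s1 s2 s3)
  moreover have "(unit_disk \<inter> \<Psi> -` (- {0}) \<union> ?V) \<union> - cball 0 R = UNIV"
  proof -
    have "z \<in> unit_disk \<inter> \<Psi> -` (- {0}) \<union> ?V" if "z \<in> cball 0 R" for z
    proof (cases "z \<in> Z")
      case True
      then have "z \<in> ?S" using that by simp
      then show ?thesis using r by (intro UnI2 UN_I) auto
    next
      case False
      then show ?thesis using Psi_nonzero[of z] that R by auto
    qed
    then show ?thesis by blast
  qed
  ultimately have X: "smooth_on UNIV X" by simp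
  have \<Theta>X: "?\<Theta> z = X z * \<Psi> z" for z
  proof (cases "z \<in> cball 0 R")
    case True
    then have z: "cmod z < 1" using R by simp
    show ?thesis
    proof (cases "z \<in> Z")
      case zZ: True
      then have "cut R r z = 0" using True r by (intro cut0[of z z]) auto
      then show ?thesis by (simp add: X_def)
    next
      case False
      then show ?thesis using Psi_nonzero[OF z] z by (simp add: X_def)
    qed
  qed (simp add: out Xout)
  have d\<Theta>: "dbar ?\<Theta> z = dbar X z * \<Psi> z" for z
    using smooth_compact_mult_holomorphic(2)[OF X R(2) Xout Psi_hol, of z] unfolding \<Theta>X[symmetric] .
  have dX0: "dbar X z = 0" if "z \<notin> cball 0 R" for z
    by (rule dbar_eq_0_outside[OF Xout that])
  have AEZ: "AE z in lborel. z \<notin> Z"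
    using Z_countable by (intro AE_not_in countable_imp_null_set_lborel)
  have hX: "(\<integral>z. dbar (\<lambda>z. X z * h z) z \<partial>lborel) = 0" "integrable lborel (\<lambda>z. dbar (\<lambda>z. X z * h z) z)"
    using integral_dbar_compact_support[OF smooth_compact_mult_holomorphic(1)[OF X R(2) Xout h], of 1] R Xout by auto
  have [measurable]: "dbar X \<in> borel_measurable borel" "dbar ?\<Theta> \<in> borel_measurable borel"
    using smooth_on_continuous[OF smooth_on_dbar[OF open_UNIV X]] smooth_on_continuous[OF smooth_on_dbar[OF open_UNIV \<Theta>]]
    by (auto intro: borel_measurable_continuous_onI)
  have [measurable]: "u h \<in> borel_measurable borel" by (rule u_measurable[OF h])
  \<comment> \<open>Off the null set \<open>Z\<close>, division by \<Psi> cancels. The holomorphic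
    correction contributes \<open>dbar\<close> of \<open>X * h\<close>, compactly supported and
    hence of integral 0.\<close>
  have "(\<integral>z. u h z * dbar ?\<Theta> z \<partial>lborel) = (\<integral>z. v z * dbar X z - dbar (\<lambda>z. X z * h z) z \<partial>lborel)"
  proof (rule integral_cong_AE)
    show "(\<lambda>z. v z * dbar X z - dbar (\<lambda>z. X z * h z) z) \<in> borel_measurable lborel"
      using borel_measurable_integrable[OF hX(2)] by measurable
    show "AE z in lborel. u h z * dbar ?\<Theta> z = v z * dbar X z - dbar (\<lambda>z. X z * h z) z"
      using AEZ
    proof eventually_elim
      case (elim z)
      have e: "dbar (\<lambda>z. X z * h z) z = dbar X z * h z"
        by (rule smooth_compact_mult_holomorphic(2)[OF X R(2) Xout h])
      show ?case
      proof (cases "z \<in> unit_disk")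
        case True
        then have "\<Psi> z \<noteq> 0" using Psi_nonzero elim by simp
        then show ?thesis unfolding e d\<Theta> using True by (simp add: u_def field_simps)
      next
        case False
        then have "z \<notin> cball 0 R" using R by auto
        then show ?thesis unfolding e d\<Theta> by (simp add: dX0)
      qed
    qed
  qed measurable
  also have "\<dots> = (\<integral>z. v z * dbar X z \<partial>lborel)"
    using integral_v_dbar(1)[OF X R Xout] hX by simp
  also have "\<dots> = - (\<integral>w. g w * (X w / of_real (1 - (cmod w)\<^sup>2)) \<partial>lborel)"
    by (rule integral_v_dbar(2)[OF X R Xout])
  also have "(\<lambda>w. g w * (X w / of_real (1 - (cmod w)\<^sup>2))) = (\<lambda>w. f w * (?\<Theta> w / of_real (1 - (cmod w)\<^sup>2)))"
    by (rule ext) (simp add: g_def \<Theta>X)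
  finally show ?thesis .
qed

lemma inverse_Suc_tendsto_0: "(\<lambda>n. inverse (real (Suc n))) \<longlonglongrightarrow> 0"
  by (rule LIMSEQ_inverse_real_of_nat)

section \<open>Removing the cutoff around the points of \<open>Z\<close>\<close>

text \<open>Dominated convergence with F merely integrable. With radius r = 1/(n+1), the scaled
  potential of the disc is bounded by 3 * pi for all w, and for fixed w other than a it is of order
  r, since the kernel is bounded there and the area is pi * r^2. The scale n+1 is the size of the
  derivative of a cutoff of radius r.\<close>

lemma nn_integral_inverse_dist_shrinking:
  assumes a: "cmod a < 1"
  shows "(\<lambda>n. \<integral>\<^sup>+w. ennreal (F w) * (ennreal (Suc n) *
      (\<integral>\<^sup>+z\<in>ball a (inverse (Suc n)). ennreal (1 / cmod (z - w)) \<partial>lborel)) \<partial>lborel) \<longlonglongrightarrow> 0"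
proof -
  define r where "r n = inverse (real (Suc n))" for n
  have r: "r n > 0" "real (Suc n) * r n = 1" for n by (simp_all add: r_def del: of_nat_Suc)
  have [measurable]: "ball a (r n) \<in> sets borel" for n by simp
  let ?D = "\<lambda>n w. \<integral>\<^sup>+z. ennreal (1 / cmod (z - w)) * indicator (ball a (r n)) z \<partial>lborel"
  have "(\<lambda>n. \<integral>\<^sup>+w. ennreal (F w) * (ennreal (Suc n) * ?D n w) \<partial>lborel) \<longlonglongrightarrow> (\<integral>\<^sup>+w. 0 \<partial>(lborel::complex measure))"
  proof (rule nn_integral_dominated_convergence[where w="\<lambda>w. ennreal (3 * pi) * ennreal (F w)"])
    have [measurable]: "(\<lambda>w. ?D n w) \<in> borel_measurable borel" for n by measurable
    show "(\<lambda>w. ennreal (F w) * (ennreal (Suc n) * ?D n w)) \<in> borel_measurable lborel" for n by measurable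
    have "(\<integral>\<^sup>+w. ennreal (3 * pi) * ennreal (F w) \<partial>lborel) = ennreal (3 * pi) * (\<integral>\<^sup>+w. ennreal (F w) \<partial>lborel)"
      by (rule nn_integral_cmult) measurable
    then show "(\<integral>\<^sup>+w. ennreal (3 * pi) * ennreal (F w) \<partial>lborel) < \<infinity>"
      using F_integrable F_nonneg by (simp add: nn_integral_eq_integral ennreal_mult_less_top)
    show "AE w in lborel. ennreal (F w) * (ennreal (Suc n) * ?D n w) \<le> ennreal (3 * pi) * ennreal (F w)" for n
    proof (rule AE_I2)
      fix w
      have "ennreal (Suc n) * ?D n w \<le> ennreal (Suc n) * ennreal (3 * pi * r n)"
        by (intro mult_left_mono nn_integral_inverse_dist_ball_le r) simp
      also have "\<dots> = ennreal (real (Suc n) * (3 * pi * r n))" using r(1)[of n] by (intro ennreal_mult[symmetric]) auto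
      also have "real (Suc n) * (3 * pi * r n) = 3 * pi" using r(2)[of n] by (simp add: mult_ac del: of_nat_Suc)
      finally show "ennreal (F w) * (ennreal (Suc n) * ?D n w) \<le> ennreal (3 * pi) * ennreal (F w)"
        by (subst mult.commute) (rule mult_right_mono, auto)
    qed
    show "AE w in lborel. (\<lambda>n. ennreal (F w) * (ennreal (Suc n) * ?D n w)) \<longlonglongrightarrow> 0"
      using AE_neq[of a]
    proof eventually_elim
      case (elim w)
      define \<rho> where "\<rho> = cmod (w - a)"
      have rho: "\<rho> > 0" using elim by (simp add: \<rho>_def)
      have "(\<lambda>n. ennreal (F w * (2 * pi / \<rho>) * r n)) \<longlonglongrightarrow> ennreal (F w * (2 * pi / \<rho>) * 0)"
        unfolding r_def by (intro tendsto_ennrealI tendsto_mult tendsto_const inverse_Suc_tendsto_0)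
      then have lim: "(\<lambda>n. ennreal (F w * (2 * pi / \<rho>) * r n)) \<longlonglongrightarrow> 0" by simp
      have "eventually (\<lambda>n. r n < \<rho> / 2) sequentially"
        unfolding r_def using rho by (intro order_tendstoD(2)[OF inverse_Suc_tendsto_0]) simp
      then have "eventually (\<lambda>n. ennreal (F w) * (ennreal (Suc n) * ?D n w) \<le> ennreal (F w * (2 * pi / \<rho>) * r n)) sequentially"
      proof eventually_elim
        case (elim n)
        have "?D n w \<le> (\<integral>\<^sup>+z\<in>ball a (r n). ennreal (2 / \<rho>) \<partial>lborel)"
        proof (rule nn_integral_mono)
          fix z
          show "ennreal (1 / cmod (z - w)) * indicator (ball a (r n)) z \<le> ennreal (2 / \<rho>) * indicator (ball a (r n)) z"
          proof (cases "z \<in> ball a (r n)")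
            case True
            then have "cmod (a - z) < \<rho> / 2" using elim by (simp add: dist_norm)
            moreover have "\<rho> \<le> cmod (a - z) + cmod (z - w)"
              using norm_triangle_ineq[of "a - z" "z - w"] by (simp add: \<rho>_def norm_minus_commute)
            ultimately have "\<rho> / 2 \<le> cmod (z - w)" by linarith
            then have "1 / cmod (z - w) \<le> 1 / (\<rho> / 2)" using rho by (intro divide_left_mono mult_pos_pos) auto
            then show ?thesis using True by (auto intro: ennreal_leI)
          qed simp
        qed
        also have "\<dots> = ennreal (2 / \<rho>) * emeasure lborel (ball a (r n))" by (rule nn_integral_cmult_indicator) simp
        also have "emeasure lborel (ball a (r n)) = ennreal (pi * (r n)\<^sup>2)"
          using r(1)[of n] by (simp add: emeasure_ball unit_ball_vol_2)
        finally have "ennreal (F w) * (ennreal (Suc n) * ?D n w) \<le>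
           ennreal (F w) * (ennreal (Suc n) * (ennreal (2 / \<rho>) * ennreal (pi * (r n)\<^sup>2)))"
          by (intro mult_left_mono) auto
        also have "\<dots> = ennreal (F w * (real (Suc n) * (2 / \<rho> * (pi * (r n)\<^sup>2))))"
          using rho F_nonneg[of w] by (simp only: ennreal_mult[symmetric] mult_nonneg_nonneg divide_nonneg_nonneg less_imp_le
              of_nat_0_le_iff zero_le_numeral pi_ge_zero zero_le_power2)
        also have "F w * (real (Suc n) * (2 / \<rho> * (pi * (r n)\<^sup>2))) = F w * (2 * pi / \<rho>) * (real (Suc n) * r n) * r n"
          by (simp add: power2_eq_square mult_ac del: of_nat_Suc)
        also have "\<dots> = F w * (2 * pi / \<rho>) * r n" by (simp only: r(2) mult_1_right)
        finally show ?case .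
      qed
      then show ?case
        by (intro tendsto_sandwich[OF _ _ tendsto_const lim]) auto
    qed
  qed measurable
  then show ?thesis by (simp add: r_def)
qed

lemma T_shrinking:
  assumes a: "cmod a < 1" and n: "inverse (real (Suc n)) \<le> (1 - cmod a) / 2"
  shows "(\<integral>\<^sup>+z\<in>ball a (inverse (Suc n)). T z \<partial>lborel) \<le>
    ennreal (1 / (1 - (1 + cmod a) / 2) ^ 3) * (\<integral>\<^sup>+w. ennreal (F w) *
      (\<integral>\<^sup>+z\<in>ball a (inverse (Suc n)). ennreal (1 / cmod (z - w)) \<partial>lborel) \<partial>lborel)"
proof -
  \<comment> \<open>The constant of \<open>ker_le_inverse_dist\<close> for the radius
    \<open>(1 + \<bar>a\<bar>) / 2\<close>, which exceeds the modulus of every point of the small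
    disc.\<close>
  define c where "c = 1 / (1 - (1 + cmod a) / 2) ^ 3"
  define S where "S = ball a (inverse (real (Suc n)))"
  have [measurable]: "S \<in> sets borel" by (simp add: S_def)
  have c: "c \<ge> 0" using a by (simp add: c_def)
  have "(\<integral>\<^sup>+z\<in>S. T z \<partial>lborel) = (\<integral>\<^sup>+z. \<integral>\<^sup>+w. ennreal (ker z w * F w) * indicator S z \<partial>lborel \<partial>lborel)"
    unfolding T_eq by (intro nn_integral_cong) (subst nn_integral_multc, measurable)
  also have "\<dots> = (\<integral>\<^sup>+w. (\<integral>\<^sup>+z\<in>S. ennreal (ker z w * F w) \<partial>lborel) \<partial>lborel)"
    by (rule lborel_pair.Fubini') measurable
  also have "\<dots> \<le> (\<integral>\<^sup>+w. ennreal c * (ennreal (F w) * (\<integral>\<^sup>+z\<in>S. ennreal (1 / cmod (z - w)) \<partial>lborel)) \<partial>lborel)"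
  proof (rule nn_integral_mono)
    fix w
    have "(\<integral>\<^sup>+z\<in>S. ennreal (ker z w * F w) \<partial>lborel) \<le>
       (\<integral>\<^sup>+z. (ennreal c * ennreal (F w)) * (ennreal (1 / cmod (z - w)) * indicator S z) \<partial>lborel)"
    proof (rule nn_integral_mono)
      fix z
      show "ennreal (ker z w * F w) * indicator S z \<le> (ennreal c * ennreal (F w)) * (ennreal (1 / cmod (z - w)) * indicator S z)"
      proof (cases "z \<in> S \<and> w \<in> unit_disk")
        case True
        have "cmod z \<le> cmod a + cmod (a - z)" using norm_triangle_ineq4[of a "a - z"] by simp
        moreover have "cmod (a - z) < inverse (real (Suc n))" using True by (simp add: S_def dist_norm del: of_nat_Suc)
        ultimately have "cmod z \<le> (1 + cmod a) / 2" using n by argo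
        then have "ker z w \<le> c * (1 / cmod (z - w))"
          unfolding c_def by (rule ker_le_inverse_dist) (use a True in auto)
        then have "ker z w * F w \<le> c * (1 / cmod (z - w)) * F w" by (rule mult_right_mono[OF _ F_nonneg])
        then have "ennreal (ker z w * F w) \<le> ennreal (c * F w * (1 / cmod (z - w)))" by (intro ennreal_leI) (simp add: mult_ac)
        also have "\<dots> = ennreal c * ennreal (F w) * ennreal (1 / cmod (z - w))"
          using c F_nonneg[of w] by (subst ennreal_mult, simp, simp) (simp add: ennreal_mult)
        finally show ?thesis using True by simp
      next
        case False
        then show ?thesis using F_0[of w] by (auto simp: indicator_def)
      qed
    qed
    also have "\<dots> = (ennreal c * ennreal (F w)) * (\<integral>\<^sup>+z\<in>S. ennreal (1 / cmod (z - w)) \<partial>lborel)"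
      by (rule nn_integral_cmult) measurable
    finally show "(\<integral>\<^sup>+z\<in>S. ennreal (ker z w * F w) \<partial>lborel) \<le>
       ennreal c * (ennreal (F w) * (\<integral>\<^sup>+z\<in>S. ennreal (1 / cmod (z - w)) \<partial>lborel))"
      by (simp only: mult.assoc)
  qed
  also have "\<dots> = ennreal c * (\<integral>\<^sup>+w. ennreal (F w) * (\<integral>\<^sup>+z\<in>S. ennreal (1 / cmod (z - w)) \<partial>lborel) \<partial>lborel)"
    by (rule nn_integral_cmult) measurable
  finally show ?thesis unfolding c_def S_def .
qed

text \<open>Near a, \<open>\<bar>u\<bar>\<close> is at most \<open>A * (t + H h a)\<close>. The
  constant part contributes n+1 times an area of order 1/(n+1)^2; the potential part is handled by
  Fubini, which moves the average from t onto the kernel.\<close>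

lemma u_shrinking:
  assumes h: "h holomorphic_on unit_disk" "Bint p h < \<infinity>" "\<forall>a\<in>Z. h a = v a" and a: "a \<in> Z"
  shows "(\<lambda>n. \<integral>\<^sup>+z. ennreal (cmod (u h z) * real (Suc n)) * indicator (ball a (inverse (Suc n))) z \<partial>lborel) \<longlonglongrightarrow> 0"
proof -
  have ca: "cmod a < 1" by (rule Z_cmod[OF a])
  define r where "r n = inverse (real (Suc n))" for n
  have r: "r n > 0" "real (Suc n) * r n = 1" for n by (simp_all add: r_def del: of_nat_Suc)
  have [measurable]: "ball a (r n) \<in> sets borel" for n by simp
  have [measurable]: "u h \<in> borel_measurable borel" by (rule u_measurable[OF h(1)])
  define c where "c = 1 / (1 - (1 + cmod a) / 2) ^ 3"
  let ?D = "\<lambda>n w. \<integral>\<^sup>+z. ennreal (1 / cmod (z - w)) * indicator (ball a (r n)) z \<partial>lborel"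
  define Q where "Q n = (\<integral>\<^sup>+w. ennreal (F w) * (ennreal (Suc n) * ?D n w) \<partial>lborel)" for n
  have Q: "Q \<longlonglongrightarrow> 0" unfolding Q_def r_def by (rule nn_integral_inverse_dist_shrinking[OF ca])
  have H0: "H h a \<ge> 0" by (simp add: H_def)
  have L1: "(\<lambda>n. ennreal A * (ennreal c * Q n + ennreal (H h a * pi * r n))) \<longlonglongrightarrow> ennreal A * (ennreal c * 0 + ennreal (H h a * pi * 0))"
    unfolding r_def by (intro ennreal_tendsto_cmult tendsto_add Q tendsto_ennrealI tendsto_mult tendsto_const inverse_Suc_tendsto_0) auto
  have e1: "eventually (\<lambda>n. r n < (1 - cmod a) / 2) sequentially"
    unfolding r_def using ca by (intro order_tendstoD(2)[OF inverse_Suc_tendsto_0]) simp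
  have e2: "eventually (\<lambda>n. r n < \<kappa> / 4 * (1 - (cmod a)\<^sup>2)) sequentially"
    unfolding r_def using kappa(1) one_minus_sq_pos[OF ca] by (intro order_tendstoD(2)[OF inverse_Suc_tendsto_0]) simp
  have "eventually (\<lambda>n. (\<integral>\<^sup>+z\<in>ball a (r n). ennreal (cmod (u h z) * real (Suc n)) \<partial>lborel) \<le>
      ennreal A * (ennreal c * Q n + ennreal (H h a * pi * r n))) sequentially"
    using e1 e2
  proof eventually_elim
    case (elim n)
    have sub: "ball a (r n) \<subseteq> hball (\<kappa> / 4) a" unfolding hball_def using elim(2) by (intro subset_ball) simp
    let ?m = "ennreal (real (Suc n))"
    have "(\<integral>\<^sup>+z\<in>ball a (r n). ennreal (cmod (u h z) * real (Suc n)) \<partial>lborel) \<le>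
       (\<integral>\<^sup>+z. (ennreal A * ?m) * (T z * indicator (ball a (r n)) z + ennreal (H h a) * indicator (ball a (r n)) z) \<partial>lborel)"
      using T_AE
    proof (intro nn_integral_mono_AE, eventually_elim)
      case (elim z)
      show ?case
      proof (cases "z \<in> ball a (r n)")
        case True
        then have z: "z \<in> hball (\<kappa> / 4) a" using sub by auto
        have z1: "cmod z < 1" using z hball_mono[OF a, of "\<kappa>/4"] hball_subset_disk[OF a] kappa by auto
        have fin: "T z < \<infinity>" using elim z1 by simp
        have "cmod (u h z) * 1 \<le> cmod (u h z) * exp (kZ Z z)"
          using kZ_nonneg[OF z1] by (intro mult_left_mono) auto
        also have "\<dots> \<le> A * (t z + H h a)" by (rule u_inner[OF h a z fin])
        finally have "cmod (u h z) * real (Suc n) \<le> A * (t z + H h a) * real (Suc n)"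
          by (intro mult_right_mono) auto
        then have "ennreal (cmod (u h z) * real (Suc n)) \<le> ennreal (A * (t z + H h a) * real (Suc n))" by (rule ennreal_leI)
        also have "\<dots> = ennreal A * (ennreal (t z) + ennreal (H h a)) * ?m"
          using A_pos t_nonneg[of z] H0 by (subst ennreal_mult, simp, simp, subst ennreal_mult, simp, simp) (simp del: of_nat_Suc)
        also have "ennreal (t z) = T z" using fin by (simp add: t_def)
        finally show ?thesis using True by (simp add: mult_ac del: of_nat_Suc)
      qed simp
    qed
    also have "\<dots> = (ennreal A * ?m) * ((\<integral>\<^sup>+z\<in>ball a (r n). T z \<partial>lborel) + ennreal (H h a) * emeasure lborel (ball a (r n)))"
      by (subst nn_integral_cmult, measurable, subst nn_integral_add, measurable, subst nn_integral_cmult_indicator, simp, simp)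
    also have "emeasure lborel (ball a (r n)) = ennreal (pi * (r n)\<^sup>2)"
      using r(1)[of n] by (simp add: emeasure_ball unit_ball_vol_2)
    also have "(\<integral>\<^sup>+z\<in>ball a (r n). T z \<partial>lborel) \<le> ennreal c * (\<integral>\<^sup>+w. ennreal (F w) * ?D n w \<partial>lborel)"
      unfolding r_def c_def by (rule T_shrinking[OF ca]) (use elim(1) in \<open>simp add: r_def\<close>)
    finally have "(\<integral>\<^sup>+z\<in>ball a (r n). ennreal (cmod (u h z) * real (Suc n)) \<partial>lborel) \<le>
      (ennreal A * ?m) * (ennreal c * (\<integral>\<^sup>+w. ennreal (F w) * ?D n w \<partial>lborel) + ennreal (H h a) * ennreal (pi * (r n)\<^sup>2))"
      by - (erule meta_mp, intro mult_left_mono add_right_mono, auto)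
    also have "\<dots> = ennreal A * (ennreal c * (?m * (\<integral>\<^sup>+w. ennreal (F w) * ?D n w \<partial>lborel)) + ?m * (ennreal (H h a) * ennreal (pi * (r n)\<^sup>2)))"
      by (simp add: distrib_left mult_ac del: of_nat_Suc)
    also have "?m * (\<integral>\<^sup>+w. ennreal (F w) * ?D n w \<partial>lborel) = Q n"
      unfolding Q_def by (subst nn_integral_cmult[symmetric], measurable) (intro nn_integral_cong, simp only: mult_ac)
    also have "?m * (ennreal (H h a) * ennreal (pi * (r n)\<^sup>2)) = ennreal (H h a * pi * r n)"
    proof -
      have "?m * (ennreal (H h a) * ennreal (pi * (r n)\<^sup>2)) = ennreal (real (Suc n) * (H h a * (pi * (r n)\<^sup>2)))"
        using H0 by (simp only: ennreal_mult[symmetric] mult_nonneg_nonneg of_nat_0_le_iff pi_ge_zero zero_le_power2)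
      also have "real (Suc n) * (H h a * (pi * (r n)\<^sup>2)) = H h a * pi * (real (Suc n) * r n) * r n"
        by (simp add: power2_eq_square mult_ac del: of_nat_Suc)
      also have "\<dots> = H h a * pi * r n" by (simp only: r(2) mult_1_right)
      finally show ?thesis .
    qed
    finally show ?case .
  qed
  note le = this
  have L0: "(\<lambda>n. ennreal A * (ennreal c * Q n + ennreal (H h a * pi * r n))) \<longlonglongrightarrow> 0" using L1 by simp
  have "(\<lambda>n. \<integral>\<^sup>+z. ennreal (cmod (u h z) * real (Suc n)) * indicator (ball a (r n)) z \<partial>lborel) \<longlonglongrightarrow> 0"
    by (rule tendsto_sandwich[OF _ le tendsto_const L0]) simp
  then show ?thesis unfolding r_def .
qed

lemma u_integrable:
  assumes h: "h holomorphic_on unit_disk" and fin: "LpZ_int p Z (u h) < \<infinity>"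
  shows "integrable lborel (u h)"
proof (rule integrable_of_powr[where A=unit_disk and p=p])
  have "(\<integral>\<^sup>+z. ennreal (norm (u h z) powr p) \<partial>lborel) \<le> LpZ_int p Z (u h)"
    unfolding LpZ_int_eq
  proof (rule nn_integral_mono)
    fix z
    show "ennreal (cmod (u h z) powr p) \<le> ennreal ((cmod (u h z) * exp (kZ Z z)) powr p) * indicator unit_disk z"
    proof (cases "z \<in> unit_disk")
      case True
      then have "cmod (u h z) * 1 \<le> cmod (u h z) * exp (kZ Z z)" using kZ_nonneg by (intro mult_left_mono) auto
      then show ?thesis using True p by (auto intro!: ennreal_leI powr_mono2)
    qed (simp add: u_def)
  qed
  then show "(\<integral>\<^sup>+z. ennreal (norm (u h z) powr p) \<partial>lborel) < \<infinity>" using fin by (rule le_less_trans)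
  show "emeasure lborel unit_disk < \<infinity>" by (rule emeasure_bounded_finite) simp
  show "u h \<in> borel_measurable lborel" using u_measurable[OF h] by simp
qed (auto simp: u_def p)

lemma cut_bounds: "0 \<le> cut R r z" "cut R r z \<le> 1"
  unfolding cut_def by (auto intro!: prod_nonneg prod_le_1 simp: rstep_bounds)

lemma cut_tendsto:
  assumes R: "R < 1" and z: "z \<notin> Z"
  shows "(\<lambda>n. cut R (inverse (Suc n)) z) \<longlonglongrightarrow> 1"
proof (rule tendsto_eventually)
  let ?S = "{a\<in>Z. cmod a \<le> R}"
  have "eventually (\<lambda>n. \<forall>a\<in>?S. inverse (real (Suc n)) < cmod (z - a)) sequentially"
  proof (rule eventually_ball_finite[OF finite_Z_cball[OF R]], rule ballI)
    fix a assume "a \<in> ?S"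
    then have "cmod (z - a) > 0" using z by auto
    then show "eventually (\<lambda>n. inverse (real (Suc n)) < cmod (z - a)) sequentially"
      by (rule order_tendstoD(2)[OF inverse_Suc_tendsto_0])
  qed
  then show "eventually (\<lambda>n. cut R (inverse (Suc n)) z = 1) sequentially"
  proof eventually_elim
    case (elim n)
    then show ?case unfolding cut_def by (intro prod.neutral ballI rstep_eq_1) (auto simp del: of_nat_Suc simp: less_imp_le)
  qed
qed

text \<open>The derivative of the cutoff is of order n+1 and lives on finitely many discs of radius
  1/(n+1), so this error term is dominated by the averages of \<open>u_shrinking\<close>.\<close>

lemma u_dbar_cut_tendsto_0:
  assumes h: "h holomorphic_on unit_disk" "Bint p h < \<infinity>" "\<forall>a\<in>Z. h a = v a"
    and \<Phi>: "\<And>z. cmod (\<Phi> z) \<le> K" and R: "R < 1"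
    and int: "\<And>n. integrable lborel (\<lambda>z. u h z * (\<Phi> z * dbar (\<lambda>z. of_real (cut R (inverse (Suc n)) z)) z))"
  shows "(\<lambda>n. \<integral>z. u h z * (\<Phi> z * dbar (\<lambda>z. of_real (cut R (inverse (Suc n)) z)) z) \<partial>lborel) \<longlonglongrightarrow> 0"
proof -
  let ?S = "{a\<in>Z. cmod a \<le> R}"
  have fin: "finite ?S" by (rule finite_Z_cball[OF R])
  obtain B0 where B0: "B0 > 0" "\<And>a r z. r > 0 \<Longrightarrow> cmod (dbar (\<lambda>z. of_real (rstep a r z)) z) \<le> B0 / r * indicator (ball a r) z"
    by (rule dbar_rstep_le, rule that)
  have K: "K \<ge> 0" using \<Phi>[of 0] norm_ge_zero order_trans by blast
  have [measurable]: "u h \<in> borel_measurable borel" by (rule u_measurable[OF h(1)])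
  define N where "N n a = (\<integral>\<^sup>+z\<in>ball a (inverse (Suc n)). ennreal (cmod (u h z) * real (Suc n)) \<partial>lborel)" for n a
  let ?x = "\<lambda>n. \<integral>z. u h z * (\<Phi> z * dbar (\<lambda>z. of_real (cut R (inverse (Suc n)) z)) z) \<partial>lborel"
  have le: "ennreal (cmod (?x n)) \<le> ennreal (K * B0) * (\<Sum>a\<in>?S. N n a)" for n
  proof -
    let ?r = "inverse (real (Suc n))"
    have [measurable]: "ball a ?r \<in> sets borel" for a :: complex by simp
    have r: "?r > 0" by simp
    have "ennreal (cmod (?x n)) \<le> (\<integral>\<^sup>+z. ennreal (cmod (u h z * (\<Phi> z * dbar (\<lambda>z. of_real (cut R ?r z)) z))) \<partial>lborel)"
      by (rule integral_norm_bound_ennreal[OF int])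
    also have "\<dots> \<le> (\<integral>\<^sup>+z. ennreal (K * B0) * (\<Sum>a\<in>?S. ennreal (cmod (u h z) * real (Suc n)) * indicator (ball a ?r) z) \<partial>lborel)"
    proof (rule nn_integral_mono)
      fix z
      have "cmod (dbar (\<lambda>z. of_real (cut R ?r z)) z) \<le> (\<Sum>a\<in>?S. cmod (dbar (\<lambda>z. of_real (rstep a ?r z)) z))"
        unfolding cut_def by (rule spec[OF conjunct2[OF dbar_prod_bound[OF fin r]]])
      also have "\<dots> \<le> (\<Sum>a\<in>?S. B0 / ?r * indicator (ball a ?r) z)" by (intro sum_mono B0(2) r)
      finally have "cmod (u h z) * (cmod (\<Phi> z) * cmod (dbar (\<lambda>z. of_real (cut R ?r z)) z)) \<le>
          cmod (u h z) * (K * (\<Sum>a\<in>?S. B0 / ?r * indicator (ball a ?r) z))"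
        using \<Phi> K by (intro mult_left_mono mult_mono) auto
      also have "\<dots> = K * B0 * (\<Sum>a\<in>?S. cmod (u h z) * real (Suc n) * indicator (ball a ?r) z)"
        by (simp add: sum_distrib_left sum_distrib_right divide_inverse mult_ac del: of_nat_Suc)
      finally have "ennreal (cmod (u h z * (\<Phi> z * dbar (\<lambda>z. of_real (cut R ?r z)) z))) \<le>
         ennreal (K * B0 * (\<Sum>a\<in>?S. cmod (u h z) * real (Suc n) * indicator (ball a ?r) z))"
        unfolding norm_mult by (rule ennreal_leI)
      also have "\<dots> = ennreal (K * B0) * ennreal (\<Sum>a\<in>?S. cmod (u h z) * real (Suc n) * indicator (ball a ?r) z)"
        using K B0(1) by (intro ennreal_mult sum_nonneg) auto
      also have "ennreal (\<Sum>a\<in>?S. cmod (u h z) * real (Suc n) * indicator (ball a ?r) z) =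
          (\<Sum>a\<in>?S. ennreal (cmod (u h z) * real (Suc n) * indicator (ball a ?r) z))"
        by (rule sum_ennreal[symmetric]) simp
      also have "\<dots> = (\<Sum>a\<in>?S. ennreal (cmod (u h z) * real (Suc n)) * indicator (ball a ?r) z)"
        by (intro sum.cong refl) (simp add: indicator_def)
      finally show "ennreal (cmod (u h z * (\<Phi> z * dbar (\<lambda>z. of_real (cut R ?r z)) z))) \<le>
         ennreal (K * B0) * (\<Sum>a\<in>?S. ennreal (cmod (u h z) * real (Suc n)) * indicator (ball a ?r) z)" .
    qed
    also have "\<dots> = ennreal (K * B0) * (\<Sum>a\<in>?S. N n a)"
      unfolding N_def by (subst nn_integral_cmult, measurable, subst nn_integral_sum, measurable)
    finally show ?thesis .
  qed
  have "(\<lambda>n. ennreal (K * B0) * (\<Sum>a\<in>?S. N n a)) \<longlonglongrightarrow> ennreal (K * B0) * (\<Sum>a\<in>?S. 0)"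
  proof (intro ennreal_tendsto_cmult tendsto_sum)
    fix a assume "a \<in> ?S"
    then show "(\<lambda>n. N n a) \<longlonglongrightarrow> 0" unfolding N_def by (intro u_shrinking[OF h]) simp
  qed simp
  then have lim: "(\<lambda>n. ennreal (K * B0) * (\<Sum>a\<in>?S. N n a)) \<longlonglongrightarrow> 0" by simp
  have "(\<lambda>n. ennreal (cmod (?x n))) \<longlonglongrightarrow> 0"
    by (rule tendsto_sandwich[OF _ _ tendsto_const lim]) (simp, rule always_eventually, rule allI, rule le)
  then have "(\<lambda>n. cmod (?x n)) \<longlonglongrightarrow> 0"
    by (subst (asm) ennreal_tendsto_0_iff) auto
  then show ?thesis by (rule tendsto_norm_zero_cancel)
qed

text \<open>The equation is known for test functions cut off near \<open>Z\<close>. Letting the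
  cutoff radius tend to 0, the two main terms converge by dominated convergence, and the term with
  the differentiated cutoff disappears; so the poles of \<open>1 / \<Psi>\<close> leave no point
  masses in the equation.\<close>

lemma u_solves_test:
  assumes h: "h holomorphic_on unit_disk" "Bint p h < \<infinity>" "\<forall>a\<in>Z. h a = v a"
    and fin: "LpZ_int p Z (u h) < \<infinity>"
    and \<phi>: "smooth_on UNIV \<phi>" and R: "0 < R" "R < 1" and out: "\<And>z. z \<notin> cball 0 R \<Longrightarrow> \<phi> z = 0"
  shows "- (\<integral>z. u h z * dbar (\<lambda>w. of_real (1 - (cmod w)\<^sup>2) * \<phi> w) z \<partial>lborel) = (\<integral>z. f z * \<phi> z \<partial>lborel)"
proof -
  define \<Phi> where "\<Phi> = (\<lambda>w. of_real (1 - (cmod w)\<^sup>2) * \<phi> w)"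
  have s: "smooth_on UNIV \<Phi>" unfolding \<Phi>_def by (rule smooth_on_mult[OF open_UNIV smooth_on_sqnorm \<phi>])
  have out': "\<Phi> z = 0" if "z \<notin> cball 0 R" for z using out[OF that] by (simp add: \<Phi>_def)
  define c where "c n z = complex_of_real (cut R (inverse (real (Suc n))) z)" for n z
  have cs: "smooth_on UNIV (c n)" for n
    unfolding c_def[abs_def] cut_def using dbar_prod_bound[OF finite_Z_cball[OF R(2)]] by (rule conjunct1) simp
  have meas: "g \<in> borel_measurable borel" if "smooth_on UNIV g" for g
    by (rule borel_measurable_continuous_onI[OF smooth_on_continuous[OF that]])
  have [measurable]: "\<phi> \<in> borel_measurable borel" "\<Phi> \<in> borel_measurable borel" "c n \<in> borel_measurable borel"
    "dbar \<Phi> \<in> borel_measurable borel" "dbar (c n) \<in> borel_measurable borel" for n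
    using meas \<phi> s cs smooth_on_dbar[OF open_UNIV] by auto
  have c1: "cmod (c n z) \<le> 1" for n z using cut_bounds[of R "inverse (real (Suc n))" z] by (simp add: c_def)
  obtain K1 where K1: "K1 > 0" "\<And>z. z \<in> cball 0 R \<Longrightarrow> norm (\<phi> z) \<le> K1"
    by (rule continuous_bounded_cball[OF continuous_on_subset[OF smooth_on_continuous[OF \<phi>] subset_UNIV]], rule that)
  obtain K2 where K2: "K2 > 0" "\<And>z. z \<in> cball 0 R \<Longrightarrow> norm (\<Phi> z) \<le> K2"
    by (rule continuous_bounded_cball[OF continuous_on_subset[OF smooth_on_continuous[OF s] subset_UNIV]], rule that)
  have b1: "cmod (\<phi> z) \<le> K1" for z using K1 out by (cases "z \<in> cball 0 R") auto
  have b2: "cmod (\<Phi> z) \<le> K2" for z using K2 out' by (cases "z \<in> cball 0 R") auto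
  obtain K3 where b3: "\<And>z. cmod (dbar \<Phi> z) \<le> K3"
    by (rule smooth_compact_dbar_bounded[OF s, of 0 R], rule out', assumption) (rule that)
  have ui: "integrable lborel (u h)" by (rule u_integrable[OF h(1) fin])
  have fi: "integrable lborel f"
    by (rule Bochner_Integration.integrable_bound[OF F_integrable])
       (use kZ_nonneg in \<open>auto simp: F_def f_0 intro!: AE_I2 mult_le_cancel_left1[THEN iffD2]\<close>)
  have i1: "integrable lborel (\<lambda>z. u h z * (dbar \<Phi> z * c n z))" for n
    by (rule integrable_mult_bounded[OF ui, of _ "K3 * 1"])
       (measurable, simp only: norm_mult, rule mult_mono[OF b3 c1], use b3[of 0] norm_ge_zero order_trans in blast, simp)
  have i2: "integrable lborel (\<lambda>z. u h z * (\<Phi> z * dbar (c n) z))" for n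
  proof -
    have sm: "smooth_on UNIV (\<lambda>z. \<Phi> z * c n z)" by (rule smooth_on_mult[OF open_UNIV s cs])
    obtain K4 where K4: "\<And>z. cmod (dbar (\<lambda>z. \<Phi> z * c n z) z) \<le> K4"
      by (rule smooth_compact_dbar_bounded[OF sm, of 0 R], simp add: out') (rule that)
    have [measurable]: "dbar (\<lambda>z. \<Phi> z * c n z) \<in> borel_measurable borel"
      by (rule meas[OF smooth_on_dbar[OF open_UNIV sm]])
    \<comment> \<open>The integrability of this term is obtained as a difference by the product
      rule, since \<open>dbar\<close> of the compactly supported product is bounded.\<close>
    have "integrable lborel (\<lambda>z. u h z * dbar (\<lambda>z. \<Phi> z * c n z) z - u h z * (dbar \<Phi> z * c n z))"
      by (rule Bochner_Integration.integrable_diff[OF integrable_mult_bounded[OF ui _ K4] i1]) measurable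
    moreover have "dbar (\<lambda>z. \<Phi> z * c n z) z = dbar \<Phi> z * c n z + \<Phi> z * dbar (c n) z" for z
      by (rule dbar_mult; rule smooth_on_differentiable) (use s cs in auto)
    ultimately show ?thesis by (simp add: distrib_left)
  qed
  have AEZ: "AE z in lborel. z \<notin> Z"
    using Z_countable by (intro AE_not_in countable_imp_null_set_lborel)
  have c_lim: "(\<lambda>n. c n z) \<longlonglongrightarrow> 1" if "z \<notin> Z" for z
    using tendsto_of_real[OF cut_tendsto[OF R(2) that], where ?'a = complex] by (simp add: c_def)
  have L1: "(\<lambda>n. \<integral>z. u h z * (dbar \<Phi> z * c n z) \<partial>lborel) \<longlonglongrightarrow> (\<integral>z. u h z * dbar \<Phi> z \<partial>lborel)"
  proof (rule integral_dominated_convergence[where w="\<lambda>z. cmod (u h z) * K3"])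
    show "AE z in lborel. (\<lambda>n. u h z * (dbar \<Phi> z * c n z)) \<longlonglongrightarrow> u h z * dbar \<Phi> z"
      using AEZ
    proof eventually_elim
      case (elim z)
      have "(\<lambda>n. u h z * (dbar \<Phi> z * c n z)) \<longlonglongrightarrow> u h z * (dbar \<Phi> z * 1)"
        by (intro tendsto_mult tendsto_const c_lim elim)
      then show ?case by simp
    qed
    show "AE z in lborel. norm (u h z * (dbar \<Phi> z * c n z)) \<le> cmod (u h z) * K3" for n
    proof (rule AE_I2)
      fix z
      have "cmod (dbar \<Phi> z) * cmod (c n z) \<le> cmod (dbar \<Phi> z) * 1" by (rule mult_left_mono[OF c1]) simp
      then have "cmod (dbar \<Phi> z) * cmod (c n z) \<le> K3" using b3[of z] by simp
      then show "norm (u h z * (dbar \<Phi> z * c n z)) \<le> cmod (u h z) * K3"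
        unfolding norm_mult by (rule mult_left_mono) simp
    qed
    show "integrable lborel (\<lambda>z. cmod (u h z) * K3)" using ui by simp
  qed (use borel_measurable_integrable[OF ui] in measurable)
  have L2: "(\<lambda>n. \<integral>z. f z * (\<phi> z * c n z) \<partial>lborel) \<longlonglongrightarrow> (\<integral>z. f z * \<phi> z \<partial>lborel)"
  proof (rule integral_dominated_convergence[where w="\<lambda>z. cmod (f z) * K1"])
    show "AE z in lborel. (\<lambda>n. f z * (\<phi> z * c n z)) \<longlonglongrightarrow> f z * \<phi> z"
      using AEZ
    proof eventually_elim
      case (elim z)
      have "(\<lambda>n. f z * (\<phi> z * c n z)) \<longlonglongrightarrow> f z * (\<phi> z * 1)"
        by (intro tendsto_mult tendsto_const c_lim elim)
      then show ?case by simp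
    qed
    show "AE z in lborel. norm (f z * (\<phi> z * c n z)) \<le> cmod (f z) * K1" for n
    proof (rule AE_I2)
      fix z
      have "cmod (\<phi> z) * cmod (c n z) \<le> cmod (\<phi> z) * 1" by (rule mult_left_mono[OF c1]) simp
      then have "cmod (\<phi> z) * cmod (c n z) \<le> K1" using b1[of z] by simp
      then show "norm (f z * (\<phi> z * c n z)) \<le> cmod (f z) * K1"
        unfolding norm_mult by (rule mult_left_mono) simp
    qed
    show "integrable lborel (\<lambda>z. cmod (f z) * K1)" using fi by simp
  qed measurable
  have L3: "(\<lambda>n. \<integral>z. u h z * (\<Phi> z * dbar (c n) z) \<partial>lborel) \<longlonglongrightarrow> 0"
    unfolding c_def[abs_def] by (rule u_dbar_cut_tendsto_0[OF h b2 R(2) i2[unfolded c_def[abs_def]]])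
  have eq: "(\<integral>z. u h z * (dbar \<Phi> z * c n z) \<partial>lborel) + (\<integral>z. u h z * (\<Phi> z * dbar (c n) z) \<partial>lborel) =
      - (\<integral>z. f z * (\<phi> z * c n z) \<partial>lborel)" for n
  proof -
    have "(\<integral>z. u h z * (dbar \<Phi> z * c n z) \<partial>lborel) + (\<integral>z. u h z * (\<Phi> z * dbar (c n) z) \<partial>lborel) =
      (\<integral>z. u h z * (dbar \<Phi> z * c n z) + u h z * (\<Phi> z * dbar (c n) z) \<partial>lborel)"
      by (rule Bochner_Integration.integral_add[symmetric, OF i1 i2])
    also have "\<dots> = (\<integral>z. u h z * dbar (\<lambda>z. \<Phi> z * c n z) z \<partial>lborel)"
    proof (rule Bochner_Integration.integral_cong[OF refl])
      fix z
      have "dbar (\<lambda>z. \<Phi> z * c n z) z = dbar \<Phi> z * c n z + \<Phi> z * dbar (c n) z"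
        by (rule dbar_mult; rule smooth_on_differentiable) (use s cs in auto)
      then show "u h z * (dbar \<Phi> z * c n z) + u h z * (\<Phi> z * dbar (c n) z) = u h z * dbar (\<lambda>z. \<Phi> z * c n z) z"
        by (simp add: distrib_left)
    qed
    also have "\<dots> = - (\<integral>w. f w * (\<Phi> w * c n w / of_real (1 - (cmod w)\<^sup>2)) \<partial>lborel)"
      unfolding c_def by (rule integral_u_dbar_cut[OF s R out' _ h(1)]) simp_all
    also have "(\<lambda>w. f w * (\<Phi> w * c n w / of_real (1 - (cmod w)\<^sup>2))) = (\<lambda>w. f w * (\<phi> w * c n w))"
    proof
      fix w
      show "f w * (\<Phi> w * c n w / of_real (1 - (cmod w)\<^sup>2)) = f w * (\<phi> w * c n w)"
      proof (cases "w \<in> unit_disk")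
        case True
        then have "complex_of_real (1 - (cmod w)\<^sup>2) \<noteq> 0" by (intro of_real_one_minus_sq_neq_0) simp
        then show ?thesis by (simp add: \<Phi>_def del: of_real_diff)
      qed (simp add: f_0)
    qed
    finally show ?thesis .
  qed
  have "(\<lambda>n. - (\<integral>z. f z * (\<phi> z * c n z) \<partial>lborel)) \<longlonglongrightarrow> (\<integral>z. u h z * dbar \<Phi> z \<partial>lborel) + 0"
    unfolding eq[symmetric] by (rule tendsto_add[OF L1 L3])
  moreover have "(\<lambda>n. - (\<integral>z. f z * (\<phi> z * c n z) \<partial>lborel)) \<longlonglongrightarrow> - (\<integral>z. f z * \<phi> z \<partial>lborel)"
    by (rule tendsto_minus[OF L2])
  ultimately have "(\<integral>z. u h z * dbar \<Phi> z \<partial>lborel) + 0 = - (\<integral>z. f z * \<phi> z \<partial>lborel)" by (rule LIMSEQ_unique)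
  then show ?thesis unfolding \<Phi>_def by simp
qed

text \<open>Here \<open>f0\<close> is the given Lebesgue measurable right-hand side and f its Borel
  version, which the integrals in the equation do not distinguish. The bound is linear in I because
  the weighted sum of v on \<open>Z\<close>, and with it \<open>Bint p h\<close>, is.\<close>

theorem dbar_solution:
  assumes f0: "AE z in lborel. indicator unit_disk z *\<^sub>R f0 z = f z"
  shows "\<exists>w\<in>LpZ p Z. dbar_weighted_solves w f0 \<and>
    LpZ_int p Z w \<le> ennreal (2 * (30 / (lowc * \<kappa>)) powr p * 4 powr p *
      (Cs + (1 + 4 * pi * Cb) * (M * (6 powr p / (pi * \<kappa>\<^sup>2) * Cs))) * I)"
proof -
  obtain h where h: "h holomorphic_on unit_disk" "Bint p h \<le> ennreal (M * wsum p Z v)" "\<forall>a\<in>Z. h a = v a"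
    using interp[OF v_lpZ(1)] unfolding interp_by_def by auto
  have hfin: "Bint p h < \<infinity>" using h(2) by (rule le_less_trans) simp
  define D where "D = M * (6 powr p / (pi * \<kappa>\<^sup>2) * Cs)"
  have D: "D \<ge> 0" using M Cs by (simp add: D_def)
  have "Bint p h \<le> ennreal (D * I)"
  proof -
    have "M * wsum p Z v \<le> M * (6 powr p / (pi * \<kappa>\<^sup>2) * (Cs * I))"
      using M by (intro mult_left_mono v_lpZ(2)) auto
    also have "\<dots> = D * I" by (simp add: D_def)
    finally have "ennreal (M * wsum p Z v) \<le> ennreal (D * I)" by (rule ennreal_leI)
    with h(2) show ?thesis by (rule order_trans)
  qed
  then have "LpZ_int p Z (u h) \<le> ennreal (2 * B) * (ennreal (Cs * I) + ennreal (1 + 4 * pi * Cb) * ennreal (D * I))"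
    by (intro order_trans[OF LpZ_int_u[OF h(1) hfin h(3)]] mult_left_mono add_left_mono) auto
  also have "\<dots> = ennreal (2 * B * (Cs * I + (1 + 4 * pi * Cb) * (D * I)))"
  proof -
    have "ennreal (1 + 4 * pi * Cb) * ennreal (D * I) = ennreal ((1 + 4 * pi * Cb) * (D * I))"
      using Cb D I(1) by (intro ennreal_mult[symmetric]) auto
    moreover have "ennreal (Cs * I) + ennreal ((1 + 4 * pi * Cb) * (D * I)) = ennreal (Cs * I + (1 + 4 * pi * Cb) * (D * I))"
      using Cb Cs D I(1) by (intro ennreal_plus[symmetric]) auto
    moreover have "ennreal (2 * B) * ennreal (Cs * I + (1 + 4 * pi * Cb) * (D * I)) = ennreal (2 * B * (Cs * I + (1 + 4 * pi * Cb) * (D * I)))"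
      using B_pos Cb Cs D I(1) by (intro ennreal_mult[symmetric]) auto
    ultimately show ?thesis by (simp only:)
  qed
  also have "2 * B * (Cs * I + (1 + 4 * pi * Cb) * (D * I)) =
      2 * (30 / (lowc * \<kappa>)) powr p * 4 powr p * (Cs + (1 + 4 * pi * Cb) * D) * I"
    by (simp add: B_def A_def algebra_simps)
  finally have le: "LpZ_int p Z (u h) \<le> ennreal (2 * (30 / (lowc * \<kappa>)) powr p * 4 powr p * (Cs + (1 + 4 * pi * Cb) * D) * I)" .
  then have fin: "LpZ_int p Z (u h) < \<infinity>" by (rule le_less_trans) simp
  have um[measurable]: "u h \<in> borel_measurable borel" by (rule u_measurable[OF h(1)])
  have "(\<lambda>z. indicator unit_disk z *\<^sub>R u h z) \<in> borel_measurable lborel" by measurable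
  then have "set_borel_measurable lebesgue unit_disk (u h)"
    unfolding set_borel_measurable_def by (rule measurable_completion)
  then have mem: "u h \<in> LpZ p Z" using fin by (simp add: LpZ_def)
  have "dbar_weighted_solves (u h) f0"
    unfolding dbar_weighted_solves_def
  proof (intro allI impI)
    fix \<phi> assume t: "test_fun \<phi>"
    then have cpt: "compact (closure {z. \<phi> z \<noteq> 0})" "closure {z. \<phi> z \<noteq> 0} \<subseteq> unit_disk" by (auto simp: test_fun_def)
    obtain R where R: "0 < R" "R < 1" "closure {z. \<phi> z \<noteq> 0} \<subseteq> cball 0 R"
      by (rule compact_subset_unit_disk[OF cpt], rule that)
    have out: "\<phi> z = 0" if "z \<notin> cball 0 R" for z
      using that R(3) closure_subset[of "{z. \<phi> z \<noteq> 0}"] by auto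
    have s: "smooth_on UNIV \<phi>" using t by (intro smooth_fun_smooth_on) (simp add: test_fun_def)
    have s': "smooth_on UNIV (\<lambda>w. of_real (1 - (cmod w)\<^sup>2) * \<phi> w)"
      by (rule smooth_on_mult[OF open_UNIV smooth_on_sqnorm s])
    have [measurable]: "dbar (\<lambda>w. of_real (1 - (cmod w)\<^sup>2) * \<phi> w) \<in> borel_measurable borel" "\<phi> \<in> borel_measurable borel"
      using smooth_on_continuous[OF smooth_on_dbar[OF open_UNIV s']] smooth_on_continuous[OF s]
      by (auto intro: borel_measurable_continuous_onI)
    have "(LINT z:unit_disk|lebesgue. u h z * dbar (\<lambda>w. complex_of_real (1 - (cmod w)\<^sup>2) * \<phi> w) z) =
        (\<integral>z. u h z * dbar (\<lambda>w. of_real (1 - (cmod w)\<^sup>2) * \<phi> w) z \<partial>lborel)"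
      by (rule set_lebesgue_integral_borel) (measurable, auto simp: u_def indicator_def intro!: AE_I2)
    moreover have "(LINT z:unit_disk|lebesgue. f0 z * \<phi> z) = (\<integral>z. f z * \<phi> z \<partial>lborel)"
    proof (rule set_lebesgue_integral_borel)
      show "AE z in lborel. indicator unit_disk z *\<^sub>R (f0 z * \<phi> z) = f z * \<phi> z"
        using f0 by eventually_elim (metis mult_scaleR_left)
    qed measurable
    ultimately show "- (LINT z:unit_disk|lebesgue. u h z * dbar (\<lambda>w. complex_of_real (1 - (cmod w)\<^sup>2) * \<phi> w) z) =
        (LINT z:unit_disk|lebesgue. f0 z * \<phi> z)"
      using u_solves_test[OF h(1) hfin h(3) fin s R(1,2) out] by simp
  qed
  with mem le show ?thesis unfolding D_def by (intro bexI[of _ "u h"] conjI)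
qed

end

section \<open>Assembly of the two implications\<close>

theorem (in separated_seq) dbar_of_interpolating:
  assumes p: "p \<ge> 1" and int: "interpolating p Z"
  shows "\<exists>C::real. \<forall>f\<in>LpZ p Z. \<exists>u\<in>LpZ p Z. dbar_weighted_solves u f \<and> LpZ_norm p Z u \<le> C * LpZ_norm p Z f"
proof -
  obtain Cs where Cs: "Cs > 0" "kernel_bound p Cs" by (rule kernel_bound_exists[OF p])
  obtain \<Psi> where \<Psi>: "\<Psi> holomorphic_on unit_disk"
    "\<And>z. cmod z < 1 \<Longrightarrow> cmod (\<Psi> z) \<le> exp (kZ Z z)"
    "\<And>z a. cmod z < 1 \<Longrightarrow> a \<in> Z \<Longrightarrow> cmod (\<Psi> z) \<le> 2 * pseudo_hyp z a * exp (kZ Z z)"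
    "\<And>z. cmod z < 1 \<Longrightarrow> \<forall>b\<in>Z. z \<notin> hball \<kappa> b \<Longrightarrow> lowc * exp (kZ Z z) \<le> cmod (\<Psi> z)"
    "\<And>z a. a \<in> Z \<Longrightarrow> z \<in> hball \<kappa> a \<Longrightarrow> lowc * pseudo_hyp z a * exp (kZ Z z) \<le> cmod (\<Psi> z)"
    by (rule canonical_function, rule that)
  obtain Cb where Cb: "Cb > 0" "\<And>h \<zeta> r. h holomorphic_on unit_disk \<Longrightarrow> r > 0 \<Longrightarrow> ball \<zeta> r \<subseteq> unit_disk \<Longrightarrow>
      ennreal (cmod (h \<zeta>) powr p) \<le> ennreal (Cb / r\<^sup>2) * (\<integral>\<^sup>+z\<in>ball \<zeta> r. ennreal (cmod (h z) powr p) \<partial>lborel)"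
    by (rule bergman_local_bound[OF p], rule that)
  obtain M where M: "M > 0" "\<And>c. c \<in> lpZ p Z \<Longrightarrow> interp_by p Z (M * wsum p Z c) c"
    by (rule interpolating_uniform[OF p Z_disk Z_countable int], rule that)
  \<comment> \<open>Built from \<kappa>, p and the constants of the kernel, of the mean value
    inequality and of interpolation, all chosen before the right-hand side. It bounds p-th powers,
    hence the exponent 1/p in the witness.\<close>
  define K where "K = 2 * (30 / (lowc * \<kappa>)) powr p * 4 powr p *
      (Cs + (1 + 4 * pi * Cb) * (M * (6 powr p / (pi * \<kappa>\<^sup>2) * Cs)))"
  have K: "K \<ge> 0" using Cs(1) Cb(1) M(1) by (simp add: K_def)
  show ?thesis
  proof (intro exI[of _ "K powr (1 / p)"] ballI)
    fix f0 assume f0: "f0 \<in> LpZ p Z"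
    then have "(\<lambda>z. indicator unit_disk z *\<^sub>R f0 z) \<in> borel_measurable lebesgue"
      by (simp add: LpZ_def set_borel_measurable_def)
    then obtain fb where fb[measurable]: "fb \<in> borel_measurable borel" and fb_ae: "AE z in lborel. indicator unit_disk z *\<^sub>R f0 z = fb z"
      by (rule lebesgue_borel_version)
    define f where "f = (\<lambda>z. indicator unit_disk z *\<^sub>R fb z)"
    have [measurable]: "unit_disk \<in> sets borel" by simp
    have fm: "f \<in> borel_measurable borel" unfolding f_def by measurable
    have fz: "f z = 0" if "z \<notin> unit_disk" for z using that by (simp add: f_def)
    have f_ae: "AE z in lborel. indicator unit_disk z *\<^sub>R f0 z = f z"
      using fb_ae by eventually_elim (auto simp: f_def indicator_def)
    \<comment> \<open>Passing to a Borel version changes the function on a null set of the disk and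
      so preserves the weighted norm.\<close>
    have f_int: "LpZ_int p Z f = LpZ_int p Z f0"
      unfolding LpZ_int_eq
    proof (rule nn_integral_cong_AE)
      show "AE z in lborel. ennreal ((cmod (f z) * exp (kZ Z z)) powr p) * indicator unit_disk z =
          ennreal ((cmod (f0 z) * exp (kZ Z z)) powr p) * indicator unit_disk z"
        using f_ae by eventually_elim (auto simp: indicator_def split: if_splits)
    qed
    have ffin: "LpZ_int p Z f < \<infinity>" using f0 unfolding f_int by (simp add: LpZ_def)
    interpret dbar_data Z \<kappa> p \<Psi> f Cs Cb M
      by unfold_locales (fact p \<Psi> fm fz ffin Cs Cb M)+
    obtain w where w: "w \<in> LpZ p Z" "dbar_weighted_solves w f0" "LpZ_int p Z w \<le> ennreal (K * I)"
      using dbar_solution[OF f_ae] unfolding K_def[symmetric] by auto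
    have "enn2real (LpZ_int p Z w) \<le> K * I"
      using enn2real_mono[OF w(3)] K I(1) by simp
    then have "LpZ_norm p Z w \<le> (K * I) powr (1 / p)"
      unfolding LpZ_norm_def using p by (intro powr_mono2) auto
    also have "\<dots> = K powr (1 / p) * LpZ_norm p Z f0"
      using K I(1) by (simp add: powr_mult LpZ_norm_def I_def f_int)
    finally show "\<exists>u\<in>LpZ p Z. dbar_weighted_solves u f0 \<and> LpZ_norm p Z u \<le> K powr (1 / p) * LpZ_norm p Z f0"
      using w by (intro bexI[of _ w] conjI)
  qed
qed

theorem mainTheorem1:
  fixes p :: real and Z :: "complex set"
  assumes "1 \<le> p"
    and "Z \<subseteq> unit_disk" and "countable Z"
  shows "interpolating p Z \<longleftrightarrow>
    separated Z \<and>
    (\<exists>C::real. \<forall>f\<in>LpZ p Z. \<exists>u\<in>LpZ p Z.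
        dbar_weighted_solves u f \<and> LpZ_norm p Z u \<le> C * LpZ_norm p Z f)"
proof
  assume int: "interpolating p Z"
  have sep: "separated Z" by (rule interpolating_separated[OF assms int])
  obtain \<kappa> where k: "0 < \<kappa>" "\<kappa> \<le> 1/8"
    "\<And>a b. a \<in> Z \<Longrightarrow> b \<in> Z \<Longrightarrow> a \<noteq> b \<Longrightarrow> hball \<kappa> a \<inter> hball \<kappa> b = {}"
    by (rule separated_hball_disjoint[OF sep assms(2)], rule that)
  interpret separated_seq Z \<kappa> by unfold_locales (fact assms k)+
  show "separated Z \<and> (\<exists>C::real. \<forall>f\<in>LpZ p Z. \<exists>u\<in>LpZ p Z.
      dbar_weighted_solves u f \<and> LpZ_norm p Z u \<le> C * LpZ_norm p Z f)"
    using sep dbar_of_interpolating[OF assms(1) int] by (rule conjI)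
next
  assume R: "separated Z \<and> (\<exists>C::real. \<forall>f\<in>LpZ p Z. \<exists>u\<in>LpZ p Z.
      dbar_weighted_solves u f \<and> LpZ_norm p Z u \<le> C * LpZ_norm p Z f)"
  obtain \<kappa> where k: "0 < \<kappa>" "\<kappa> \<le> 1/8"
    "\<And>a b. a \<in> Z \<Longrightarrow> b \<in> Z \<Longrightarrow> a \<noteq> b \<Longrightarrow> hball \<kappa> a \<inter> hball \<kappa> b = {}"
    by (rule separated_hball_disjoint[OF conjunct1[OF R] assms(2)], rule that)
  interpret separated_seq Z \<kappa> by unfold_locales (fact assms k)+
  have solv: "\<exists>u\<in>LpZ p Z. dbar_weighted_solves u f" if "f \<in> LpZ p Z" for f
    using conjunct2[OF R] that by blast
  show "interpolating p Z"
    unfolding interpolating_def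
  proof (intro conjI ballI)
    show "f \<in> lpZ p Z" if "f \<in> bergman p" for f by (rule bergman_lpZ[OF assms(1) that])
    show "\<exists>f\<in>bergman p. \<forall>a\<in>Z. f a = c a" if "c \<in> lpZ p Z" for c
      by (rule interpolate_of_dbar[OF assms(1) solv that])
  qed
qed

end
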